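(* Let $M$ and $A$ be weight sequences satisfying $(M.1)$ and $(M.2)'$, and let $E$ be a TMIB of class $[M]-[A]$ satisfying condition (G). Then, for a given $f \in \mathcal{S}'^{[M]}_{[A]}(\mathbb{R}^d)$, we have $f * \varphi \in E$ for every $\varphi \in \mathcal{S}^{[M]}_{[A]}(\mathbb{R}^d)$ if and only if there exist $f_\alpha \in E$, $\alpha \in \mathbb{N}^d$, such that $f = \sum_{\alpha \in \mathbb{N}^d} f_\alpha^{(\alpha)}$ (convergence in $\mathcal{S}'^{[M]}_{[A]}$) and, for some $\ell>0$ in the Beurling case (for every $\ell>0$ in the Roumieu case), $\sup_{\alpha \in \mathbb{N}^d} \ell^{|\alpha|} M_\alpha \|f_\alpha\|_E < \infty$.
   Context: A weight sequence is a sequence $M=(M_p)_{p\in\mathbb{N}}$ of positive reals with $(M_p/M_0)^{1/p}\to\infty$. Conditions: $(M.1)$ $M_p^2\le M_{p-1}M_{p+1}$ for $p\ge1$; $(M.2)'$ $M_{p+1}\le C_0H^pM_p$ for some $C_0,H\ge1$. For $\alpha\in\mathbb{N}^d$ write $M_\alpha=M_{|\alpha|}$. The associated function is $\omega_M(t)=\sup_{p\in\mathbb{N}}\log(t^pM_0/M_p)$ for $t>0$, $\omega_M(0)=0$, extended radially to $\mathbb{R}^d$ by $\omega_M(x)=\omega_M(|x|)$. For $q,\ell>0$, $\mathcal{S}^{M,\ell}_{A,q}$ is the Banach space of $\varphi\in C^\infty(\mathbb{R}^d)$ with $\sup_{\alpha\in\mathbb{N}^d,x\in\mathbb{R}^d}|\varphi^{(\alpha)}(x)|e^{\omega_A(qx)}/(\ell^{|\alpha|}M_\alpha)<\infty$.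 The Gelfand–Shilov spaces are $\mathcal{S}^{(M)}_{(A)}=\varprojlim_{\ell\to0^+}\mathcal{S}^{M,\ell}_{A,1/\ell}$ (Beurling) and $\mathcal{S}^{\{M\}}_{\{A\}}=\varinjlim_{\ell\to\infty}\mathcal{S}^{M,\ell}_{A,1/\ell}$ (Roumieu); $[M]$, $[A]$ denotes either case, and statements in parentheses refer to the Roumieu case. $\mathcal{S}'^{[M]}_{[A]}$ is the strong dual (tempered ultradistributions). It is assumed $\mathcal{S}^{(M)}_{(A)}\neq\{0\}$. Operators: $T_xf(t)=f(t-x)$, $M_\xi f(t)=e^{2\pi i\xi\cdot t}f(t)$, $\check f(t)=f(-t)$, extended to $\mathcal{S}'^{[M]}_{[A]}$ by duality; for $f\in\mathcal{S}'^{[M]}_{[A]}$, $\psi\in\mathcal{S}^{[M]}_{[A]}$, $\langle f*\psi,\varphi\rangle=\langle f,\varphi*\check\psi\rangle$. A Banach space $E$ is a TMIB (translation-modulation invariant Banach space of ultradistributions) of class $[M]-[A]$ if: (a) $\mathcal{S}^{[M]}_{[A]}\hookrightarrow E\hookrightarrow\mathcal{S}'^{[M]}_{[A]}$ continuously and densely; (b) $T_x(E)\subseteq E$, $M_\xi(E)\subseteq E$ for all $x,\xi$; (c) there exist $q,C_{E,q}>0$ (for every $q>0$ there exists $C_{E,q}>0$) with $\omega_E(x):=\|T_x\|_{L(E)}\le C_{E,q}e^{\omega_A(qx)}$ and $\nu_E(\xi):=\|M_{-\xi}\|_{L(E)}\le C_{E,q}e^{\omega_M(q\xi)}$ for all $x,\xi\in\mathbb{R}^d$.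 Condition (G): for every $q_0>0$ there is $q_1>0$ (for every $q_1>0$ there is $q_0>0$) and $C>0$ such that $\nu_E(\xi)e^{\omega_M(q_0\xi)}\le Ce^{\omega_M(q_1\xi)}$ for all $\xi\in\mathbb{R}^d$. *)

theory Defs
  imports "HOL-Analysis.Analysis"
begin

text \<open>Test functions live on \<open>real^'n\<close> (so d = CARD('n)) with complex values.
  Ultradistributions are represented as complex functionals on all functions;
  only their values on the test space matter.\<close>

type_synonym 'n testfun = "real^'n \<Rightarrow> complex"
type_synonym 'n udist = "'n testfun \<Rightarrow> complex"

definition weight_seq :: "(nat \<Rightarrow> real) \<Rightarrow> bool" where
  "weight_seq M \<longleftrightarrow> (\<forall>p. M p > 0) \<and>
     filterlim (\<lambda>p. (M p / M 0) powr (1 / real p)) at_top sequentially"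

definition M1 :: "(nat \<Rightarrow> real) \<Rightarrow> bool" where
  "M1 M \<longleftrightarrow> (\<forall>p\<ge>1. (M p)\<^sup>2 \<le> M (p - 1) * M (p + 1))"

definition M2' :: "(nat \<Rightarrow> real) \<Rightarrow> bool" where
  "M2' M \<longleftrightarrow> (\<exists>C0 H. C0 \<ge> 1 \<and> H \<ge> 1 \<and> (\<forall>p. M (p + 1) \<le> C0 * H ^ p * M p))"

definition assoc_fun :: "(nat \<Rightarrow> real) \<Rightarrow> real \<Rightarrow> real" where
  "assoc_fun M t = (if t \<le> 0 then 0 else (SUP p. ln (t ^ p * M 0 / M p)))"

definition partial :: "'n::finite \<Rightarrow> 'n testfun \<Rightarrow> 'n testfun" where
  "partial i f = (\<lambda>x. frechet_derivative f (at x) (axis i 1))"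

fun pd :: "'n::finite list \<Rightarrow> 'n testfun \<Rightarrow> 'n testfun" where
  "pd [] f = f"
| "pd (i # is) f = partial i (pd is f)"

definition smooth :: "'n::finite testfun \<Rightarrow> bool" where
  "smooth f \<longleftrightarrow> (\<forall>is x. pd is f differentiable (at x))"

definition mlen :: "('n::finite \<Rightarrow> nat) \<Rightarrow> nat" where
  "mlen \<alpha> = (\<Sum>i\<in>UNIV. \<alpha> i)"

definition mderiv :: "('n::finite \<Rightarrow> nat) \<Rightarrow> 'n testfun \<Rightarrow> 'n testfun" where
  "mderiv \<alpha> f = pd (SOME is. \<forall>i. count_list is i = \<alpha> i) f"

definition gs_le :: "(nat \<Rightarrow> real) \<Rightarrow> (nat \<Rightarrow> real) \<Rightarrow> real \<Rightarrow> real \<Rightarrow> real \<Rightarrow> 'n::finite testfun \<Rightarrow> bool" where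
  "gs_le M A l q C \<phi> \<longleftrightarrow> (\<forall>\<alpha> x. cmod (mderiv \<alpha> \<phi> x) * exp (assoc_fun A (q * norm x))
       \<le> C * (l ^ mlen \<alpha> * M (mlen \<alpha>)))"

definition gs_space :: "(nat \<Rightarrow> real) \<Rightarrow> (nat \<Rightarrow> real) \<Rightarrow> real \<Rightarrow> real \<Rightarrow> 'n::finite testfun set" where
  "gs_space M A l q = {\<phi>. smooth \<phi> \<and> (\<exists>C. gs_le M A l q C \<phi>)}"

definition gs_norm :: "(nat \<Rightarrow> real) \<Rightarrow> (nat \<Rightarrow> real) \<Rightarrow> real \<Rightarrow> real \<Rightarrow> 'n::finite testfun \<Rightarrow> real" where
  "gs_norm M A l q \<phi> = (SUP (\<alpha>, x). cmod (mderiv \<alpha> \<phi> x) * exp (assoc_fun A (q * norm x))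
       / (l ^ mlen \<alpha> * M (mlen \<alpha>)))"

text \<open>The parameter \<open>beur\<close> selects the Beurling case (True) or the Roumieu case (False).\<close>
definition TS :: "bool \<Rightarrow> (nat \<Rightarrow> real) \<Rightarrow> (nat \<Rightarrow> real) \<Rightarrow> 'n::finite testfun set" where
  "TS beur M A = (if beur then {\<phi>. \<forall>l>0. \<phi> \<in> gs_space M A l (1/l)}
                  else {\<phi>. \<exists>l>0. \<phi> \<in> gs_space M A l (1/l)})"

definition TS_bounded :: "bool \<Rightarrow> (nat \<Rightarrow> real) \<Rightarrow> (nat \<Rightarrow> real) \<Rightarrow> 'n::finite testfun set \<Rightarrow> bool" where
  "TS_bounded beur M A B \<longleftrightarrow> B \<subseteq> TS beur M A \<and>
     (if beur then (\<forall>l>0. \<exists>C. \<forall>\<phi>\<in>B. gs_le M A l (1/l) C \<phi>)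
      else (\<exists>l>0. \<exists>C. \<forall>\<phi>\<in>B. \<phi> \<in> gs_space M A l (1/l) \<and> gs_le M A l (1/l) C \<phi>))"

definition UD :: "bool \<Rightarrow> (nat \<Rightarrow> real) \<Rightarrow> (nat \<Rightarrow> real) \<Rightarrow> 'n::finite udist set" where
  "UD beur M A = {T.
     (\<forall>\<phi>\<in>TS beur M A. \<forall>\<psi>\<in>TS beur M A. \<forall>a b. T (\<lambda>x. a * \<phi> x + b * \<psi> x) = a * T \<phi> + b * T \<psi>) \<and>
     (if beur then (\<exists>l>0. \<exists>C. \<forall>\<phi>\<in>TS beur M A. cmod (T \<phi>) \<le> C * gs_norm M A l (1/l) \<phi>)
      else (\<forall>l>0. \<exists>C. \<forall>\<phi>\<in>gs_space M A l (1/l). cmod (T \<phi>) \<le> C * gs_norm M A l (1/l) \<phi>))}"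

definition ud_eq :: "bool \<Rightarrow> (nat \<Rightarrow> real) \<Rightarrow> (nat \<Rightarrow> real) \<Rightarrow> 'n::finite udist \<Rightarrow> 'n udist \<Rightarrow> bool" where
  "ud_eq beur M A T U \<longleftrightarrow> (\<forall>\<phi>\<in>TS beur M A. T \<phi> = U \<phi>)"

text \<open>Unconditional convergence of \<open>\<Sum>\<^sub>\<alpha> g \<alpha>\<close> to f in the strong dual topology
  (uniform convergence on bounded sets, along the net of finite partial sums).\<close>
definition ud_sums :: "bool \<Rightarrow> (nat \<Rightarrow> real) \<Rightarrow> (nat \<Rightarrow> real) \<Rightarrow> ('i \<Rightarrow> 'n::finite udist) \<Rightarrow> 'n udist \<Rightarrow> bool" where
  "ud_sums beur M A g f \<longleftrightarrow> (\<forall>B. TS_bounded beur M A B \<longrightarrow> (\<forall>\<epsilon>>0.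
     eventually (\<lambda>F. \<forall>\<phi>\<in>B. cmod (f \<phi> - (\<Sum>\<alpha>\<in>F. g \<alpha> \<phi>)) \<le> \<epsilon>) (finite_subsets_at_top UNIV)))"

definition fun_ud :: "'n::finite testfun \<Rightarrow> 'n udist" where
  "fun_ud \<phi> = (\<lambda>g. integral\<^sup>L lborel (\<lambda>y. \<phi> y * g y))"

definition ud_deriv :: "('n::finite \<Rightarrow> nat) \<Rightarrow> 'n udist \<Rightarrow> 'n udist" where
  "ud_deriv \<alpha> T = (\<lambda>\<phi>. (-1) ^ mlen \<alpha> * T (mderiv \<alpha> \<phi>))"

definition transl :: "real^'n \<Rightarrow> 'n::finite testfun \<Rightarrow> 'n testfun" where
  "transl x \<phi> = (\<lambda>t. \<phi> (t - x))"

definition modul :: "real^'n \<Rightarrow> 'n::finite testfun \<Rightarrow> 'n testfun" where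
  "modul \<xi> \<phi> = (\<lambda>t. exp (2 * of_real pi * \<i> * of_real (\<xi> \<bullet> t)) * \<phi> t)"

definition ud_transl :: "real^'n \<Rightarrow> 'n::finite udist \<Rightarrow> 'n udist" where
  "ud_transl x T = (\<lambda>\<phi>. T (transl (-x) \<phi>))"

definition ud_modul :: "real^'n \<Rightarrow> 'n::finite udist \<Rightarrow> 'n udist" where
  "ud_modul \<xi> T = (\<lambda>\<phi>. T (modul \<xi> \<phi>))"

definition conv :: "'n::finite testfun \<Rightarrow> 'n testfun \<Rightarrow> 'n testfun" where
  "conv \<phi> \<psi> = (\<lambda>x. integral\<^sup>L lborel (\<lambda>y. \<phi> y * \<psi> (x - y)))"

definition reflect :: "'n::finite testfun \<Rightarrow> 'n testfun" where
  "reflect \<psi> = (\<lambda>t. \<psi> (-t))"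

definition ud_conv :: "'n::finite udist \<Rightarrow> 'n testfun \<Rightarrow> 'n udist" where
  "ud_conv T \<psi> = (\<lambda>\<phi>. T (conv \<phi> (reflect \<psi>)))"

text \<open>TMIB of class [M]-[A]: a Banach space E (type 'e) with an injective linear map
  \<open>\<iota>\<close> into the ultradistributions; all conditions (a)-(c).\<close>
definition TMIB :: "bool \<Rightarrow> (nat \<Rightarrow> real) \<Rightarrow> (nat \<Rightarrow> real) \<Rightarrow> ('e::banach \<Rightarrow> 'n::finite udist) \<Rightarrow> bool" where
  "TMIB beur M A \<iota> \<longleftrightarrow>
    \<comment> \<open>\<iota> maps into the dual, is linear and injective\<close>
    (\<forall>e. \<iota> e \<in> UD beur M A) \<and>
    (\<forall>e e'. ud_eq beur M A (\<iota> (e + e')) (\<lambda>\<phi>. \<iota> e \<phi> + \<iota> e' \<phi>)) \<and>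
    (\<forall>r e. ud_eq beur M A (\<iota> (r *\<^sub>R e)) (\<lambda>\<phi>. of_real r * \<iota> e \<phi>)) \<and>
    (\<forall>e e'. ud_eq beur M A (\<iota> e) (\<iota> e') \<longrightarrow> e = e') \<and>
    \<comment> \<open>E is a complex Banach space: closed under complex scalars, norm complex-homogeneous\<close>
    (\<forall>c e. \<exists>e'. ud_eq beur M A (\<iota> e') (\<lambda>\<phi>. c * \<iota> e \<phi>) \<and> norm e' = cmod c * norm e) \<and>
    \<comment> \<open>(a) S \<hookrightarrow> E continuously and densely\<close>
    (\<forall>\<phi>\<in>TS beur M A. \<exists>e. ud_eq beur M A (\<iota> e) (fun_ud \<phi>)) \<and>
    (if beur then (\<exists>l>0. \<exists>C. \<forall>\<phi>\<in>TS beur M A. \<forall>e. ud_eq beur M A (\<iota> e) (fun_ud \<phi>) \<longrightarrow>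
                     norm e \<le> C * gs_norm M A l (1/l) \<phi>)
     else (\<forall>l>0. \<exists>C. \<forall>\<phi>\<in>gs_space M A l (1/l). \<forall>e. ud_eq beur M A (\<iota> e) (fun_ud \<phi>) \<longrightarrow>
                     norm e \<le> C * gs_norm M A l (1/l) \<phi>)) \<and>
    (\<forall>e. \<forall>\<epsilon>>0. \<exists>\<phi>\<in>TS beur M A. \<exists>e'. ud_eq beur M A (\<iota> e') (fun_ud \<phi>) \<and> norm (e - e') < \<epsilon>) \<and>
    \<comment> \<open>(a) E \<hookrightarrow> S' continuously and densely (strong dual topology)\<close>
    (\<forall>B. TS_bounded beur M A B \<longrightarrow> (\<exists>C. \<forall>e. \<forall>\<phi>\<in>B. cmod (\<iota> e \<phi>) \<le> C * norm e)) \<and>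
    (\<forall>f\<in>UD beur M A. \<forall>B. TS_bounded beur M A B \<longrightarrow> (\<forall>\<epsilon>>0. \<exists>e. \<forall>\<phi>\<in>B. cmod (f \<phi> - \<iota> e \<phi>) < \<epsilon>)) \<and>
    \<comment> \<open>(b) translation and modulation invariance\<close>
    (\<forall>x e. \<exists>e'. ud_eq beur M A (\<iota> e') (ud_transl x (\<iota> e))) \<and>
    (\<forall>\<xi> e. \<exists>e'. ud_eq beur M A (\<iota> e') (ud_modul \<xi> (\<iota> e))) \<and>
    \<comment> \<open>(c) operator norm bounds \<open>\<omega>_E(x) \<le> C e^{\<omega>_A(qx)}\<close>, \<open>\<nu>_E(\<xi>) \<le> C e^{\<omega>_M(q\<xi>)}\<close>\<close>
    (let bnd = (\<lambda>q C. (\<forall>x e e'. ud_eq beur M A (\<iota> e') (ud_transl x (\<iota> e)) \<longrightarrow>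
                           norm e' \<le> C * exp (assoc_fun A (q * norm x)) * norm e) \<and>
                       (\<forall>\<xi> e e'. ud_eq beur M A (\<iota> e') (ud_modul (-\<xi>) (\<iota> e)) \<longrightarrow>
                           norm e' \<le> C * exp (assoc_fun M (q * norm \<xi>)) * norm e))
     in if beur then (\<exists>q>0. \<exists>C>0. bnd q C) else (\<forall>q>0. \<exists>C>0. bnd q C))"

text \<open>Condition (G), with \<open>\<nu>_E(\<xi>) = \<parallel>M_{-\<xi>}\<parallel>_{L(E)}\<close> written out as an operator norm bound.\<close>
definition cond_G :: "bool \<Rightarrow> (nat \<Rightarrow> real) \<Rightarrow> (nat \<Rightarrow> real) \<Rightarrow> ('e::banach \<Rightarrow> 'n::finite udist) \<Rightarrow> bool" where
  "cond_G beur M A \<iota> \<longleftrightarrow>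
    (let G = (\<lambda>q0 q1. \<exists>C. \<forall>\<xi> e e'. ud_eq beur M A (\<iota> e') (ud_modul (-\<xi>) (\<iota> e)) \<longrightarrow>
                 norm e' * exp (assoc_fun M (q0 * norm \<xi>)) \<le> C * exp (assoc_fun M (q1 * norm \<xi>)) * norm e)
     in if beur then (\<forall>q0>0. \<exists>q1>0. G q0 q1) else (\<forall>q1>0. \<exists>q0>0. G q0 q1))"

end

theory Submission
  imports Defs "HOL-Probability.Probability"
begin

text \<open>
  If \<open>f = \<Sum>\<^sub>\<alpha> \<partial>\<^sup>\<alpha> f\<^sub>\<alpha>\<close>, then \<open>f * \<phi> = \<Sum>\<^sub>\<alpha> f\<^sub>\<alpha> * \<partial>\<^sup>\<alpha> \<phi>\<close>. Every \<open>f\<^sub>\<alpha> * \<psi>\<close> is an integral of translates of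
  \<open>f\<^sub>\<alpha>\<close> in \<open>E\<close>, bounded by the norm of \<open>f\<^sub>\<alpha>\<close> times a weighted \<open>L\<^sup>1\<close> norm of \<open>\<psi>\<close>, so the series converges
  absolutely in \<open>E\<close>.

  Conversely, if all \<open>f * \<phi>\<close> are in \<open>E\<close>, a gliding hump argument bounds the norm of \<open>f * \<phi> * \<psi>\<close> in \<open>E\<close> by a
  seminorm of \<open>\<phi>\<close> times a weighted \<open>L\<^sup>1\<close> norm of \<open>\<psi>\<close>. Choose \<open>\<theta>\<close> and \<open>\<gamma>\<close> of Beurling type with
  \<open>(\<theta> * \<gamma>) 0 = 1\<close>. By Fourier inversion \<open>f\<close> is the integral over all frequencies \<open>\<xi>\<close> of \<open>f * M\<^sub>\<xi> \<theta> * M\<^sub>\<xi> \<gamma>\<close>,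
  whose norm grows at most like \<open>exp (\<omega>\<^sub>M (c \<bar>\<xi>\<bar>))\<close>. Cut frequency space into unit cubes. On a cube at
  distance \<open>r\<close> from the origin integrate by parts \<open>n\<close> times in the direction \<open>j\<close> of the largest coordinate,
  where \<open>n\<close> nearly attains the supremum defining \<open>\<omega>\<^sub>M (Q r)\<close>; dividing by the \<open>n\<close>-th power of the \<open>j\<close>-th
  frequency then compensates the growth and leaves a summable factor. The terms with \<open>q\<close> derivatives left
  outside contribute to \<open>f\<^sub>\<alpha>\<close> for \<open>\<alpha> = q e\<^sub>j\<close>. In the Roumieu case the parameter of the seminorms tends to
  infinity along the cubes, so slowly that the constants in the estimates stay below \<open>r\<close>.
\<close>

section \<open>Iterated partial derivatives\<close>

text \<open>The map sending \<open>\<phi>\<close> to f * \<open>\<phi>\<close> is not known to be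
  continuous, and the gliding hump proves a bound only for products
  \<open>conv \<phi> \<psi>\<close>: in an error term tail * psi the two factors can exchange roles,
  so that the tail enters through a weighted L^1 norm and psi through the norm of f * psi. This is
  why the unit is factored as \<open>conv \<theta> \<gamma>\<close>: the derivatives from the
  integrations by parts fall on \<open>\<gamma>\<close> or on the test function, while
  \<open>\<theta>\<close> carries the seminorm.

  Each cube needs two estimates. One, in the norm of E, measures the coefficients. The other
  controls the pairing with derivatives of high order q of test functions. Since (M.2)' compares
  only M_(p+1) with M_p, these derivatives, divided by mu^q M_q, need not stay bounded in a seminorm
  of the test space; only their pointwise decay is under control. So the second estimate acts on f
  itself and puts every derivative of the seminorm on \<open>\<theta>\<close>.

  Taking \<open>\<theta>\<close> and \<open>\<gamma>\<close> of Beurling type in both cases keeps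
  every seminorm parameter available, even when it varies from cube to cube.\<close>

lemma pd_append: "pd (is @ js) f = pd is (pd js f)"
  by (induction "is") auto

lemma smooth_pd: "smooth f \<Longrightarrow> smooth (pd is f)"
  unfolding smooth_def by (metis pd_append)

lemma smooth_partial: "smooth f \<Longrightarrow> smooth (partial i f)"
  using smooth_pd[of f "[i]"] by simp

lemma smooth_differentiable: "smooth f \<Longrightarrow> f differentiable (at x)"
  unfolding smooth_def by (metis pd.simps(1))

lemma smooth_has_derivative:
  fixes f :: "'n::finite testfun"
  assumes "smooth f"
  shows "(f has_derivative (\<lambda>h. \<Sum>i\<in>UNIV. (h $ i) *\<^sub>R partial i f x)) (at x)"
proof -
  have d: "(f has_derivative frechet_derivative f (at x)) (at x)"
    using smooth_differentiable[OF assms] by (simp add: frechet_derivative_works)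
  interpret bounded_linear "frechet_derivative f (at x)"
    using d by (rule has_derivative_bounded_linear)
  have "frechet_derivative f (at x) h = (\<Sum>i\<in>UNIV. (h $ i) *\<^sub>R partial i f x)" for h
  proof -
    have "h = (\<Sum>i\<in>UNIV. (h $ i) *\<^sub>R axis i 1)"
      by (simp add: vec_eq_iff axis_def if_distrib cong: if_cong)
    then have "frechet_derivative f (at x) h = frechet_derivative f (at x) (\<Sum>i\<in>UNIV. (h $ i) *\<^sub>R axis i 1)"
      by simp
    then show ?thesis by (simp add: sum scaleR partial_def)
  qed
  then show ?thesis using d by (metis (no_types, lifting) ext)
qed

lemma partialI:
  assumes "(f has_derivative f') (at x)"
  shows "partial i f x = f' (axis i 1)"
  using frechet_derivative_at[OF assms] by (simp add: partial_def)

lemma sum_axis_scaleR: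
  fixes v :: "'n::finite \<Rightarrow> complex"
  shows "(\<Sum>k\<in>UNIV. (axis i (1::real) $ k) *\<^sub>R v k) = v i"
  by (simp add: axis_def if_distrib[of "\<lambda>c. c *\<^sub>R _"] cong: if_cong)

lemma smooth_continuous_on: "smooth f \<Longrightarrow> continuous_on S f"
  by (meson continuous_at_imp_continuous_on differentiable_imp_continuous_within smooth_differentiable)

text \<open>A class of differentiable functions closed under \<open>partial\<close> contains only
  smooth functions. Affine substitutions, modulations, convolutions and series are all treated by
  choosing such a class.\<close>

lemma smooth_coinduct:
  assumes "P f" and "\<And>f x. P f \<Longrightarrow> f differentiable (at x)" and "\<And>f i. P f \<Longrightarrow> P (partial i f)"
  shows "smooth f"
proof -
  have "P (pd is f)" for "is"
    by (induction "is") (use assms in auto)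
  then show ?thesis using assms(2) by (auto simp: smooth_def)
qed

section \<open>Symmetry of mixed partial derivatives\<close>

lemma smooth_vector_derivative:
  fixes f :: "'n::finite testfun"
  assumes "smooth f"
  shows "((\<lambda>t. f (a + t *\<^sub>R axis i 1)) has_vector_derivative partial i f (a + t *\<^sub>R axis i 1)) (at t within S)"
proof -
  have "(f has_derivative (\<lambda>h. \<Sum>k\<in>UNIV. (h $ k) *\<^sub>R partial k f (a + t *\<^sub>R axis i 1))) (at (a + t *\<^sub>R axis i 1))"
    by (rule smooth_has_derivative[OF assms])
  moreover have "((\<lambda>t. a + t *\<^sub>R axis i 1) has_derivative (\<lambda>t. t *\<^sub>R axis i 1)) (at t within S)"
    by (auto intro!: derivative_eq_intros)
  ultimately have "((\<lambda>t. f (a + t *\<^sub>R axis i 1)) has_derivative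
     (\<lambda>h. \<Sum>k\<in>UNIV. ((h *\<^sub>R axis i 1) $ k) *\<^sub>R partial k f (a + t *\<^sub>R axis i 1))) (at t within S)"
    by (rule has_derivative_compose[rotated])
  moreover have "(\<lambda>h. \<Sum>k\<in>UNIV. ((h *\<^sub>R axis i (1::real)) $ k) *\<^sub>R partial k f (a + t *\<^sub>R axis i 1))
      = (\<lambda>h. h *\<^sub>R partial i f (a + t *\<^sub>R axis i 1))"
    by (auto simp: fun_eq_iff axis_def if_distrib[of "\<lambda>c. _ * c"] if_distrib[of "\<lambda>c. c *\<^sub>R _"] cong: if_cong)
  ultimately show ?thesis by (simp add: has_vector_derivative_def)
qed

text \<open>The second difference along two axes, divided by the square of the step, approximates the
  mixed derivative in either order.\<close>
lemma second_difference_bound: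
  fixes f :: "'n::finite testfun"
  assumes f: "smooth f" and e: "e > 0"
  obtains d where "d > 0" "\<And>s. 0 < s \<Longrightarrow> s < d \<Longrightarrow>
    norm (f (x + s *\<^sub>R axis i 1 + s *\<^sub>R axis j 1) - f (x + s *\<^sub>R axis i 1) - f (x + s *\<^sub>R axis j 1) + f x
      - (s * s) *\<^sub>R partial j (partial i f) x) \<le> e * (s * s)"
proof -
  define g where "g = partial i f"
  have g: "smooth g" using f by (simp add: g_def smooth_partial)
  define D where "D = (\<lambda>h::real^'n. \<Sum>k\<in>UNIV. (h $ k) *\<^sub>R partial k g x)"
  have D: "(g has_derivative D) (at x)" unfolding D_def by (rule smooth_has_derivative[OF g])
  interpret D: bounded_linear D using D by (rule has_derivative_bounded_linear)
  have Dj: "D (axis j 1) = partial j g x"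
    using partialI[OF D] by simp
  from D e have "\<exists>d>0. \<forall>y. norm (y - x) < d \<longrightarrow> norm (g y - g x - D (y - x)) \<le> (e / 3) * norm (y - x)"
    unfolding has_derivative_at_alt by (meson divide_pos_pos zero_less_numeral)
  then obtain d where d: "d > 0" "\<And>y. norm (y - x) < d \<Longrightarrow> norm (g y - g x - D (y - x)) \<le> (e / 3) * norm (y - x)"
    by blast
  show ?thesis
  proof (rule that[of "d / 2"])
    show "d / 2 > 0" using d by simp
    fix s :: real assume s: "0 < s" "s < d / 2"
    \<comment> \<open>\<open>h s - h 0\<close> is the whole quantity to be estimated, and the
      derivative of \<open>h\<close> compares two values of \<open>g\<close> near \<open>x\<close>
      with its linearisation there. The increments have length at most 2s and s, which explains the
      division of \<open>e\<close> by 3.\<close>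
    define h where "h = (\<lambda>t. f (x + s *\<^sub>R axis j 1 + t *\<^sub>R axis i 1) - f (x + t *\<^sub>R axis i 1) - t *\<^sub>R s *\<^sub>R partial j g x)"
    have hd: "(h has_derivative (\<lambda>u. u *\<^sub>R (g (x + s *\<^sub>R axis j 1 + t *\<^sub>R axis i 1) - g (x + t *\<^sub>R axis i 1) - s *\<^sub>R partial j g x)))
         (at t within {0..s})" for t
      using smooth_vector_derivative[OF f, of "x + s *\<^sub>R axis j 1" i t "{0..s}"] smooth_vector_derivative[OF f, of x i t "{0..s}"]
      unfolding h_def g_def has_vector_derivative_def
      by (auto intro!: derivative_eq_intros simp: algebra_simps)
    have bd: "norm (g (x + s *\<^sub>R axis j 1 + t *\<^sub>R axis i 1) - g (x + t *\<^sub>R axis i 1) - s *\<^sub>R partial j g x) \<le> e * s"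
      if t: "t \<in> {0..s}" for t
    proof -
      have 1: "norm (s *\<^sub>R axis j (1::real) + t *\<^sub>R axis i 1) \<le> 2 * s"
        by (rule order_trans[OF norm_triangle_ineq]) (use t in \<open>simp add: norm_axis_1\<close>)
      have 2: "norm (t *\<^sub>R axis i (1::real)) \<le> s" using t by (simp add: norm_axis_1)
      let ?a = "g (x + s *\<^sub>R axis j 1 + t *\<^sub>R axis i 1) - g x - D (s *\<^sub>R axis j 1 + t *\<^sub>R axis i 1)"
      let ?b = "g (x + t *\<^sub>R axis i 1) - g x - D (t *\<^sub>R axis i 1)"
      have "norm ?a \<le> (e / 3) * norm (s *\<^sub>R axis j (1::real) + t *\<^sub>R axis i 1)"
        using d(2)[of "x + s *\<^sub>R axis j 1 + t *\<^sub>R axis i 1"] 1 s by (simp add: add.assoc)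
      also have "\<dots> \<le> (e / 3) * (2 * s)" using 1 e by (intro mult_left_mono) auto
      finally have a: "norm ?a \<le> (e / 3) * (2 * s)" .
      have "norm ?b \<le> (e / 3) * norm (t *\<^sub>R axis i (1::real))"
        using d(2)[of "x + t *\<^sub>R axis i 1"] 2 s by simp
      also have "\<dots> \<le> (e / 3) * s" using 2 e by (intro mult_left_mono) auto
      finally have b: "norm ?b \<le> (e / 3) * s" .
      have "g (x + s *\<^sub>R axis j 1 + t *\<^sub>R axis i 1) - g (x + t *\<^sub>R axis i 1) - s *\<^sub>R partial j g x = ?a - ?b"
        by (simp add: D.add D.scaleR Dj)
      also have "norm \<dots> \<le> norm ?a + norm ?b" by (rule norm_triangle_ineq4)
      also have "\<dots> \<le> (e / 3) * (2 * s) + (e / 3) * s" using a b by (rule add_mono)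
      finally show ?thesis by (simp add: field_simps)
    qed
    have "norm (h s - h 0) \<le> (e * s) * norm (s - 0)"
    proof (rule differentiable_bound[OF _ hd])
      fix t assume "t \<in> {0..s}"
      then show "onorm (\<lambda>u. u *\<^sub>R (g (x + s *\<^sub>R axis j 1 + t *\<^sub>R axis i 1) - g (x + t *\<^sub>R axis i 1) - s *\<^sub>R partial j g x)) \<le> e * s"
        using bd[of t] by (intro onorm_le) (auto simp: mult.commute intro!: mult_left_mono)
    qed (use s in auto)
    moreover have "h s - h 0 = f (x + s *\<^sub>R axis i 1 + s *\<^sub>R axis j 1) - f (x + s *\<^sub>R axis i 1) - f (x + s *\<^sub>R axis j 1) + f x
      - (s * s) *\<^sub>R partial j (partial i f) x"
      by (simp add: h_def g_def algebra_simps)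
    ultimately show "norm (f (x + s *\<^sub>R axis i 1 + s *\<^sub>R axis j 1) - f (x + s *\<^sub>R axis i 1) - f (x + s *\<^sub>R axis j 1) + f x
      - (s * s) *\<^sub>R partial j (partial i f) x) \<le> e * (s * s)"
      using s by (simp add: mult.assoc)
  qed
qed

text \<open>The second difference \<open>?Q\<close> is symmetric in \<open>i\<close> and
  \<open>j\<close>, hence lies within (e/2) s^2 of s^2 times either mixed derivative; dividing by
  s^2 leaves \<open>e\<close>.\<close>

lemma partial_commute:
  fixes f :: "'n::finite testfun"
  assumes f: "smooth f"
  shows "partial i (partial j f) = partial j (partial i f)"
proof
  fix x
  have "norm (partial i (partial j f) x - partial j (partial i f) x) \<le> e" if e: "e > 0" for e
  proof -
    have e2: "e / 2 > 0" using e by simp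
    obtain d1 where d1: "d1 > 0" "\<And>s. 0 < s \<Longrightarrow> s < d1 \<Longrightarrow>
      norm (f (x + s *\<^sub>R axis i 1 + s *\<^sub>R axis j 1) - f (x + s *\<^sub>R axis i 1) - f (x + s *\<^sub>R axis j 1) + f x
      - (s * s) *\<^sub>R partial j (partial i f) x) \<le> (e/2) * (s * s)"
      using second_difference_bound[OF f e2, of x i j] by blast
    obtain d2 where d2: "d2 > 0" "\<And>s. 0 < s \<Longrightarrow> s < d2 \<Longrightarrow>
      norm (f (x + s *\<^sub>R axis j 1 + s *\<^sub>R axis i 1) - f (x + s *\<^sub>R axis j 1) - f (x + s *\<^sub>R axis i 1) + f x
      - (s * s) *\<^sub>R partial i (partial j f) x) \<le> (e/2) * (s * s)"
      using second_difference_bound[OF f e2, of x j i] by blast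
    define s where "s = min d1 d2 / 2"
    have s: "0 < s" "s < d1" "s < d2" using d1 d2 by (auto simp: s_def)
    let ?Q = "f (x + s *\<^sub>R axis i 1 + s *\<^sub>R axis j 1) - f (x + s *\<^sub>R axis i 1) - f (x + s *\<^sub>R axis j 1) + f x"
    have a: "norm (?Q - (s * s) *\<^sub>R partial j (partial i f) x) \<le> (e/2) * (s * s)" using d1(2)[OF s(1,2)] .
    have b: "norm (?Q - (s * s) *\<^sub>R partial i (partial j f) x) \<le> (e/2) * (s * s)"
      using d2(2)[OF s(1,3)] by (simp add: algebra_simps)
    have "(s * s) * norm (partial i (partial j f) x - partial j (partial i f) x)
       = norm ((s * s) *\<^sub>R (partial i (partial j f) x - partial j (partial i f) x))" by simp
    also have "\<dots> = norm ((?Q - (s * s) *\<^sub>R partial j (partial i f) x) - (?Q - (s * s) *\<^sub>R partial i (partial j f) x))"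
      by (rule arg_cong[where f = norm]) (simp add: algebra_simps)
    also have "\<dots> \<le> (e/2) * (s * s) + (e/2) * (s * s)"
      using a b norm_triangle_ineq4 by (meson add_mono order_trans)
    also have "\<dots> = (s * s) * e" by simp
    finally show ?thesis using s by simp
  qed
  then have "norm (partial i (partial j f) x - partial j (partial i f) x) \<le> 0"
    by (rule field_le_epsilon) simp
  then show "partial i (partial j f) x = partial j (partial i f) x" by simp
qed

section \<open>From multi-indices to lists of directions\<close>

lemma pd_Cons_move:
  assumes "smooth f" "i \<in> set is"
  shows "pd is f = pd (i # remove1 i is) f"
  using assms(2)
proof (induction "is")
  case (Cons a "is")
  show ?case
  proof (cases "a = i")
    case False
    with Cons have "pd is f = partial i (pd (remove1 i is) f)" by auto
    with False partial_commute[OF smooth_pd[OF assms(1)]] show ?thesis by simp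
  qed simp
qed simp

text \<open>\<open>mderiv\<close> differentiates along a list picked by \<open>SOME\<close>. By
  symmetry only the multiset of directions matters, so that choice can be replaced by any convenient
  list.\<close>

lemma pd_cong_mset:
  assumes "smooth f" "mset is = mset js"
  shows "pd is f = pd js f"
  using assms(2)
proof (induction "is" arbitrary: js)
  case (Cons a "is")
  then have "a \<in> set js" by (metis list.set_intros(1) mset_eq_setD)
  moreover have "mset is = mset (remove1 a js)" using Cons.prems by (metis mset_remove1 remove1.simps(2))
  ultimately show ?case using Cons.IH[of "remove1 a js"] pd_Cons_move[OF assms(1), of a js] by simp
qed simp

lemma exists_count_list: "\<exists>is. \<forall>i::'n::finite. count_list is i = \<alpha> i"
proof -
  have "finite (UNIV :: 'n set)" by simp
  define m where "m = Abs_multiset \<alpha>"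
  have "count m = \<alpha>" by (simp add: m_def)
  moreover obtain "is" where "mset is = m" by (metis ex_mset)
  ultimately show ?thesis by (metis count_mset)
qed

lemma mderiv_eq_pd:
  assumes "smooth f" "\<And>i. count_list is i = \<alpha> i"
  shows "mderiv \<alpha> f = pd is f"
proof -
  define js where "js = (SOME is. \<forall>i. count_list is i = \<alpha> i)"
  have "\<forall>i. count_list js i = \<alpha> i" unfolding js_def by (rule someI_ex) (rule exists_count_list)
  then have "mset js = mset is" using assms(2) by (metis count_mset multiset_eqI)
  then show ?thesis unfolding mderiv_def js_def[symmetric] by (rule pd_cong_mset[OF assms(1)])
qed

lemma length_eq_mlen: "length is = mlen (count_list is :: 'n::finite \<Rightarrow> nat)"
proof (induction "is")
  case (Cons a "is")
  have "mlen (count_list (a # is)) = (\<Sum>i\<in>UNIV. count_list is i + (if i = a then 1 else 0))"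
    unfolding mlen_def by (rule sum.cong) auto
  also have "\<dots> = mlen (count_list is) + 1"
    by (simp add: sum.distrib mlen_def)
  finally show ?case using Cons.IH by (metis Suc_eq_plus1 length_Cons)
qed (simp add: mlen_def)

lemma mderiv_list:
  obtains "is" where "length is = mlen \<alpha>" "\<And>f. smooth f \<Longrightarrow> mderiv \<alpha> f = pd is f"
proof -
  obtain "is" where i: "\<forall>i. count_list is i = \<alpha> i" using exists_count_list by blast
  then have "count_list is = \<alpha>" by auto
  then show ?thesis using that[of "is"] mderiv_eq_pd[of _ "is" \<alpha>] length_eq_mlen[of "is"] by auto
qed

text \<open>All seminorm estimates are carried out on lists of directions, where one more derivative
  is one more list element; every list realises a multi-index of the same order, and
  conversely.\<close>

lemma gs_le_iff_pd:
  assumes "smooth f"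
  shows "gs_le M A l q C f \<longleftrightarrow>
    (\<forall>is x. cmod (pd is f x) * exp (assoc_fun A (q * norm x)) \<le> C * (l ^ length is * M (length is)))"
proof
  assume g: "gs_le M A l q C f"
  show "\<forall>is x. cmod (pd is f x) * exp (assoc_fun A (q * norm x)) \<le> C * (l ^ length is * M (length is))"
  proof (intro allI)
    fix "is" x
    have "mderiv (count_list is) f = pd is f" by (rule mderiv_eq_pd[OF assms]) simp
    then show "cmod (pd is f x) * exp (assoc_fun A (q * norm x)) \<le> C * (l ^ length is * M (length is))"
      using g by (metis gs_le_def length_eq_mlen)
  qed
next
  assume h: "\<forall>is x. cmod (pd is f x) * exp (assoc_fun A (q * norm x)) \<le> C * (l ^ length is * M (length is))"
  show "gs_le M A l q C f" unfolding gs_le_def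
  proof (intro allI)
    fix \<alpha> x
    obtain "is" where "length is = mlen \<alpha>" "mderiv \<alpha> f = pd is f" using mderiv_list assms by metis
    then show "cmod (mderiv \<alpha> f x) * exp (assoc_fun A (q * norm x)) \<le> C * (l ^ mlen \<alpha> * M (mlen \<alpha>))"
      using h by metis
  qed
qed

subsection \<open>Linear operations and reflections\<close>

lemma partial_lincomb:
  assumes "smooth f" "smooth g"
  shows "partial i (\<lambda>x. a * f x + b * g x) = (\<lambda>x. a * partial i f x + b * partial i g x)"
proof
  fix x
  have "((\<lambda>x. a * f x + b * g x) has_derivative
     (\<lambda>h. a * (\<Sum>i\<in>UNIV. (h $ i) *\<^sub>R partial i f x) + b * (\<Sum>i\<in>UNIV. (h $ i) *\<^sub>R partial i g x))) (at x)"
    by (intro derivative_intros smooth_has_derivative assms)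
  from partialI[OF this, of i]
  show "partial i (\<lambda>x. a * f x + b * g x) x = a * partial i f x + b * partial i g x"
    by (simp add: sum_axis_scaleR)
qed

lemma pd_lincomb:
  assumes "smooth f" "smooth g"
  shows "pd is (\<lambda>x. a * f x + b * g x) = (\<lambda>x. a * pd is f x + b * pd is g x)"
  by (induction "is") (auto simp: partial_lincomb smooth_pd assms)

lemma smooth_lincomb:
  assumes "smooth f" "smooth g"
  shows "smooth (\<lambda>x. a * f x + b * g x)"
  unfolding smooth_def pd_lincomb[OF assms]
proof (intro allI)
  fix "is" x
  show "(\<lambda>x. a * pd is f x + b * pd is g x) differentiable (at x)"
    using assms unfolding smooth_def by (intro differentiable_add differentiable_mult) auto
qed

lemma pd_zero: "pd is (\<lambda>x. 0) = (\<lambda>x. 0)"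
proof -
  have p: "partial i (\<lambda>x. 0) = (\<lambda>x. 0)" for i :: 'a by (simp add: partial_def)
  show ?thesis by (induction "is") (auto simp: p)
qed

lemma smooth_zero: "smooth (\<lambda>x. 0)"
  by (simp add: smooth_def pd_zero)

lemma smooth_cmult: "smooth f \<Longrightarrow> smooth (\<lambda>x. a * f x)"
  using smooth_lincomb[of f f a 0] by simp

lemma pd_cmult: "smooth f \<Longrightarrow> pd is (\<lambda>x. a * f x) = (\<lambda>x. a * pd is f x)"
  using pd_lincomb[of f f "is" a 0] by simp

lemma partial_affine:
  assumes "smooth f"
  shows "partial i (\<lambda>x. f (c *\<^sub>R x + a)) = (\<lambda>x. of_real c * partial i f (c *\<^sub>R x + a))"
proof
  fix x
  have "(f has_derivative (\<lambda>h. \<Sum>k\<in>UNIV. (h $ k) *\<^sub>R partial k f (c *\<^sub>R x + a))) (at (c *\<^sub>R x + a))"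
    by (rule smooth_has_derivative[OF assms])
  moreover have "((\<lambda>x. c *\<^sub>R x + a) has_derivative (\<lambda>h. c *\<^sub>R h)) (at x)"
    by (auto intro!: derivative_eq_intros)
  ultimately have "((\<lambda>x. f (c *\<^sub>R x + a)) has_derivative
     (\<lambda>h. \<Sum>k\<in>UNIV. ((c *\<^sub>R h) $ k) *\<^sub>R partial k f (c *\<^sub>R x + a))) (at x)"
    by (rule has_derivative_compose[rotated])
  from partialI[OF this, of i]
  have "partial i (\<lambda>x. f (c *\<^sub>R x + a)) x = (\<Sum>k\<in>UNIV. ((c *\<^sub>R axis i 1) $ k) *\<^sub>R partial k f (c *\<^sub>R x + a))" .
  also have "\<dots> = c *\<^sub>R partial i f (c *\<^sub>R x + a)"
    by (simp add: axis_def if_distrib[of "\<lambda>u. _ * u"] if_distrib[of "\<lambda>c. c *\<^sub>R _"] cong: if_cong)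
  finally show "partial i (\<lambda>x. f (c *\<^sub>R x + a)) x = of_real c * partial i f (c *\<^sub>R x + a)"
    by (simp add: scaleR_conv_of_real)
qed

text \<open>Translations are the case \<open>c = 1\<close>, the reflection is \<open>c = -1\<close>;
  both are read off below.\<close>

lemma
  assumes "smooth f"
  shows smooth_affine: "smooth (\<lambda>x. f (c *\<^sub>R x + a))"
    and pd_affine: "pd is (\<lambda>x. f (c *\<^sub>R x + a)) = (\<lambda>x. of_real c ^ length is * pd is f (c *\<^sub>R x + a))"
proof -
  have D: "(\<lambda>x. f (c *\<^sub>R x + a)) differentiable (at x)" if "smooth f" for f :: "'a testfun" and x
    using differentiable_compose[of f "\<lambda>x. c *\<^sub>R x + a" x UNIV] smooth_differentiable[OF that] by auto
  show S: "smooth (\<lambda>x. f (c *\<^sub>R x + a))"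
  proof (rule smooth_coinduct[where P = "\<lambda>g. \<exists>f b. smooth f \<and> g = (\<lambda>x. b * f (c *\<^sub>R x + a))"])
    show "\<exists>fa b. smooth fa \<and> (\<lambda>x. f (c *\<^sub>R x + a)) = (\<lambda>x. b * fa (c *\<^sub>R x + a))"
      using assms by (intro exI[of _ f] exI[of _ 1]) auto
  next
    fix g :: "'a testfun" and x assume "\<exists>f b. smooth f \<and> g = (\<lambda>x. b * f (c *\<^sub>R x + a))"
    then show "g differentiable (at x)" using D by auto
  next
    fix g :: "'a testfun" and i assume "\<exists>f b. smooth f \<and> g = (\<lambda>x. b * f (c *\<^sub>R x + a))"
    then obtain f b where f: "smooth f" "g = (\<lambda>x. b * f (c *\<^sub>R x + a))" by blast
    have "partial i g = (\<lambda>x. of_real c * partial i (\<lambda>x. b * f x) (c *\<^sub>R x + a))"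
      unfolding f(2) using partial_affine[OF smooth_cmult[OF f(1), of b], of i c a] .
    then show "\<exists>f b. smooth f \<and> partial i g = (\<lambda>x. b * f (c *\<^sub>R x + a))"
      using smooth_partial[OF smooth_cmult[OF f(1), of b]] by metis
  qed
  show "pd is (\<lambda>x. f (c *\<^sub>R x + a)) = (\<lambda>x. of_real c ^ length is * pd is f (c *\<^sub>R x + a))"
  proof (induction "is")
    case (Cons i "is")
    have "pd (i # is) (\<lambda>x. f (c *\<^sub>R x + a)) = partial i (\<lambda>x. (\<lambda>y. of_real c ^ length is * pd is f y) (c *\<^sub>R x + a))"
      using Cons by simp
    also have "\<dots> = (\<lambda>x. of_real c * partial i (\<lambda>y. of_real c ^ length is * pd is f y) (c *\<^sub>R x + a))"
      by (rule partial_affine) (intro smooth_cmult smooth_pd assms)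
    also have "partial i (\<lambda>y. of_real c ^ length is * pd is f y) = (\<lambda>y. of_real c ^ length is * partial i (pd is f) y)"
      using pd_cmult[OF smooth_pd[OF assms], of "[i]" "of_real c ^ length is" "is"] by simp
    finally show ?case by (simp add: mult.assoc)
  qed simp
qed

lemma smooth_transl: "smooth f \<Longrightarrow> smooth (transl h f)"
  and pd_transl: "smooth f \<Longrightarrow> pd is (transl h f) = transl h (pd is f)"
  using smooth_affine[of f 1 "-h"] pd_affine[of f "is" 1 "-h"] by (auto simp: transl_def)

lemma smooth_reflect: "smooth f \<Longrightarrow> smooth (reflect f)"
  and pd_reflect: "smooth f \<Longrightarrow> pd is (reflect f) = (\<lambda>x. (-1) ^ length is * reflect (pd is f) x)"
  using smooth_affine[of f "-1" 0] pd_affine[of f "is" "-1" 0] by (auto simp: reflect_def)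

subsection \<open>Modulations\<close>

lemma has_derivative_exp_complex:
  fixes g :: "'a::real_normed_vector \<Rightarrow> complex"
  assumes "(g has_derivative g') (at x within S)"
  shows "((\<lambda>t. exp (g t)) has_derivative (\<lambda>h. g' h * exp (g x))) (at x within S)"
  using has_derivative_compose[OF assms has_field_derivative_imp_has_derivative[OF DERIV_exp]]
  by (simp add: mult.commute)

lemma partial_modul:
  fixes f :: "'n::finite testfun"
  assumes "smooth f"
  shows "partial i (modul \<xi> f) = modul \<xi> (\<lambda>x. (2 * of_real pi * \<i> * of_real (\<xi> $ i)) * f x + 1 * partial i f x)"
proof
  fix x
  let ?E = "\<lambda>t::real^'n. exp (2 * of_real pi * \<i> * of_real (\<xi> \<bullet> t))"
  have "((\<lambda>t. 2 * of_real pi * \<i> * of_real (\<xi> \<bullet> t)) has_derivative (\<lambda>h. 2 * of_real pi * \<i> * of_real (\<xi> \<bullet> h))) (at x)"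
    by (auto intro!: derivative_eq_intros)
  then have "(?E has_derivative (\<lambda>h. (2 * of_real pi * \<i> * of_real (\<xi> \<bullet> h)) * ?E x)) (at x)"
    by (rule has_derivative_exp_complex)
  then have "((\<lambda>t. ?E t * f t) has_derivative
     (\<lambda>h. ?E x * (\<Sum>i\<in>UNIV. (h $ i) *\<^sub>R partial i f x) + ((2 * of_real pi * \<i> * of_real (\<xi> \<bullet> h)) * ?E x) * f x)) (at x)"
    by (intro has_derivative_mult smooth_has_derivative assms)
  from partialI[OF this, of i]
  have "partial i (modul \<xi> f) x = ?E x * (\<Sum>k\<in>UNIV. (axis i 1 $ k) *\<^sub>R partial k f x)
     + ((2 * of_real pi * \<i> * of_real (\<xi> \<bullet> axis i 1)) * ?E x) * f x"
    by (simp add: modul_def)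
  also have "(\<Sum>k\<in>UNIV. (axis i 1 $ k) *\<^sub>R partial k f x) = partial i f x"
    by (rule sum_axis_scaleR)
  also have "\<xi> \<bullet> axis i 1 = \<xi> $ i" by (simp add: inner_axis)
  finally show "partial i (modul \<xi> f) x = modul \<xi> (\<lambda>x. (2 * of_real pi * \<i> * of_real (\<xi> $ i)) * f x + 1 * partial i f x) x"
    by (simp add: modul_def algebra_simps)
qed

lemma smooth_modul:
  fixes f :: "'n::finite testfun"
  assumes "smooth f" shows "smooth (modul \<xi> f)"
proof (rule smooth_coinduct[where P = "\<lambda>g. \<exists>f. smooth f \<and> g = modul \<xi> f"])
  fix g :: "'n testfun" and x assume "\<exists>f. smooth f \<and> g = modul \<xi> f"
  then obtain f where f: "smooth f" "g = modul \<xi> f" by blast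
  have "((\<lambda>t. 2 * of_real pi * \<i> * of_real (\<xi> \<bullet> t)) has_derivative (\<lambda>h. 2 * of_real pi * \<i> * of_real (\<xi> \<bullet> h))) (at x)"
    by (auto intro!: derivative_eq_intros)
  then have "(\<lambda>t. exp (2 * of_real pi * \<i> * of_real (\<xi> \<bullet> t))) differentiable (at x)"
    unfolding differentiable_def by (intro exI) (rule has_derivative_exp_complex)
  then show "g differentiable (at x)"
    unfolding f(2) modul_def using smooth_differentiable[OF f(1)] by (rule differentiable_mult)
next
  fix g :: "'n testfun" and i assume "\<exists>f. smooth f \<and> g = modul \<xi> f"
  then obtain f where f: "smooth f" "g = modul \<xi> f" by blast
  show "\<exists>f. smooth f \<and> partial i g = modul \<xi> f"
    unfolding f(2) partial_modul[OF f(1)]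
    by (intro exI conjI) (rule smooth_lincomb[OF f(1) smooth_partial[OF f(1)]], rule refl)
qed (use assms in auto)

lemma cmod_modul [simp]: "cmod (modul \<xi> f x) = cmod (f x)"
proof -
  have "2 * of_real pi * \<i> * of_real (\<xi> \<bullet> x) = \<i> * of_real (2 * pi * (\<xi> \<bullet> x))" by simp
  then show ?thesis unfolding modul_def norm_mult by (metis norm_exp_i_times mult_1)
qed

text \<open>With E the shift of the sequence \<open>a\<close>, this is (s + E)^n (s + E) = (s +
  E)^(n+1) evaluated at index 0, proved by Pascal's rule.\<close>

lemma binomial_shift_sum:
  fixes a :: "nat \<Rightarrow> real"
  shows "(\<Sum>j\<le>n. real (n choose j) * s ^ (n - j) * (s * a j + a (Suc j))) =
     (\<Sum>j\<le>Suc n. real (Suc n choose j) * s ^ (Suc n - j) * a j)"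
proof -
  have "(\<Sum>j\<le>Suc n. real (Suc n choose j) * s ^ (Suc n - j) * a j)
     = s ^ Suc n * a 0 + (\<Sum>j\<le>n. real (Suc n choose Suc j) * s ^ (n - j) * a (Suc j))"
    by (subst sum.atMost_Suc_shift) simp
  also have "(\<Sum>j\<le>n. real (Suc n choose Suc j) * s ^ (n - j) * a (Suc j)) =
     (\<Sum>j\<le>n. real (n choose j) * s ^ (n - j) * a (Suc j)) + (\<Sum>j\<le>n. real (n choose Suc j) * s ^ (n - j) * a (Suc j))"
    by (simp add: sum.distrib algebra_simps)
  also have "s ^ Suc n * a 0 + ((\<Sum>j\<le>n. real (n choose j) * s ^ (n - j) * a (Suc j)) + (\<Sum>j\<le>n. real (n choose Suc j) * s ^ (n - j) * a (Suc j)))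
     = (\<Sum>j\<le>n. real (n choose j) * s ^ (n - j) * a (Suc j)) + (s ^ Suc n * a 0 + (\<Sum>j\<le>n. real (n choose Suc j) * s ^ (n - j) * a (Suc j)))"
    by simp
  also have "s ^ Suc n * a 0 + (\<Sum>j\<le>n. real (n choose Suc j) * s ^ (n - j) * a (Suc j))
     = (\<Sum>j\<le>Suc n. real (n choose j) * s ^ (Suc n - j) * a j)"
    by (subst sum.atMost_Suc_shift) simp
  also have "\<dots> = (\<Sum>j\<le>n. real (n choose j) * s ^ (Suc n - j) * a j)" by simp
  also have "\<dots> = (\<Sum>j\<le>n. real (n choose j) * s ^ (n - j) * (s * a j))"
    by (rule sum.cong) (auto simp: Suc_diff_le)
  finally show ?thesis by (simp add: sum.distrib[symmetric] algebra_simps)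
qed

text \<open>Peeling off the innermost derivative replaces \<open>f\<close> by \<open>2\<pi>i\<xi>\<^sub>i f + \<partial>\<^sub>i f\<close>, hence the sequence
  \<open>a\<close> by \<open>s a\<^sub>j + a\<^sub>j\<^sub>+\<^sub>1\<close>.\<close>
lemma pd_modul_diff_bound:
  fixes f :: "'n::finite testfun"
  assumes "smooth f" and "\<And>is. cmod (pd is f x) \<le> a (length is)"
  shows "cmod (pd is (modul \<xi> f) x - modul \<xi> (pd is f) x) \<le>
     (\<Sum>j\<le>length is. real (length is choose j) * (2 * pi * norm \<xi>) ^ (length is - j) * a j) - a (length is)"
  using assms
proof (induction "is" arbitrary: f a rule: rev_induct)
  case Nil
  then show ?case by simp
next
  case (snoc i "is")
  define s where "s = 2 * pi * norm \<xi>"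
  define n where "n = length is"
  define c where "c = 2 * of_real pi * \<i> * of_real (\<xi> $ i)"
  define g where "g = (\<lambda>x. c * f x + 1 * partial i f x)"
  have c: "cmod c \<le> s" unfolding c_def s_def by (simp add: norm_mult component_le_norm_cart)
  have s: "s \<ge> 0" by (simp add: s_def)
  have sg: "smooth g" unfolding g_def by (intro smooth_lincomb smooth_partial snoc.prems)
  have pg: "pd js g = (\<lambda>x. c * pd js f x + 1 * pd (js @ [i]) f x)" for js
    unfolding g_def pd_append using snoc.prems(1) by (subst pd_lincomb) (auto simp: smooth_partial)
  have bg: "cmod (pd js g x) \<le> s * a (length js) + a (Suc (length js))" for js
  proof -
    have "cmod (pd js g x) \<le> cmod c * cmod (pd js f x) + cmod (pd (js @ [i]) f x)"
      unfolding pg by (metis mult_1 norm_mult norm_triangle_ineq)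
    also have "\<dots> \<le> s * a (length js) + a (Suc (length js))"
      using snoc.prems(2)[of js] snoc.prems(2)[of "js @ [i]"] c s by (intro add_mono mult_mono) auto
    finally show ?thesis .
  qed
  have eq: "pd (is @ [i]) (modul \<xi> f) = pd is (modul \<xi> g)"
    unfolding pd_append using partial_modul[OF snoc.prems(1), of i \<xi>] by (simp add: g_def c_def)
  have "cmod (pd is (modul \<xi> g) x - modul \<xi> (pd is g) x) \<le>
     (\<Sum>j\<le>n. real (n choose j) * s ^ (n - j) * (s * a j + a (Suc j))) - (s * a n + a (Suc n))"
    using snoc.IH[OF sg, of "\<lambda>j. s * a j + a (Suc j)"] bg by (simp add: s_def n_def)
  moreover have "modul \<xi> (pd is g) x - modul \<xi> (pd (is @ [i]) f) x = modul \<xi> (\<lambda>x. c * pd is f x) x"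
    by (simp add: pg modul_def algebra_simps)
  moreover have "cmod (modul \<xi> (\<lambda>x. c * pd is f x) x) \<le> s * a n"
    using c s snoc.prems(2)[of "is"] by (auto simp: norm_mult n_def intro!: mult_mono)
  moreover have "pd is (modul \<xi> g) x - modul \<xi> (pd (is @ [i]) f) x =
      (pd is (modul \<xi> g) x - modul \<xi> (pd is g) x) + (modul \<xi> (pd is g) x - modul \<xi> (pd (is @ [i]) f) x)" by simp
  ultimately have "cmod (pd is (modul \<xi> g) x - modul \<xi> (pd (is @ [i]) f) x) \<le>
     (\<Sum>j\<le>n. real (n choose j) * s ^ (n - j) * (s * a j + a (Suc j))) - a (Suc n)"
    by (smt (verit) norm_triangle_ineq)
  then show ?case unfolding eq binomial_shift_sum by (simp add: s_def n_def)
qed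

lemma pd_modul_bound:
  fixes f :: "'n::finite testfun"
  assumes "smooth f" and "\<And>is. cmod (pd is f x) \<le> a (length is)"
  shows "cmod (pd is (modul \<xi> f) x) \<le>
     (\<Sum>j\<le>length is. real (length is choose j) * (2 * pi * norm \<xi>) ^ (length is - j) * a j)"
proof -
  have "cmod (pd is (modul \<xi> f) x) \<le> cmod (pd is (modul \<xi> f) x - modul \<xi> (pd is f) x) + cmod (modul \<xi> (pd is f) x)"
    by (metis diff_add_cancel norm_triangle_ineq)
  also have "cmod (modul \<xi> (pd is f) x) \<le> a (length is)" using assms(2)[of "is"] by simp
  finally show ?thesis using pd_modul_diff_bound[OF assms, of "is" \<xi>] by simp
qed

section \<open>Weight sequences and associated functions\<close>

locale wseq =
  fixes M :: "nat \<Rightarrow> real"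
  assumes ws: "weight_seq M" and m1: "M1 M" and m2: "M2' M"
begin

lemma pos: "M p > 0"
  using ws by (simp add: weight_seq_def)

lemma nonneg [simp]: "M p \<ge> 0" "M p \<noteq> 0"
  using pos[of p] by auto

lemma eventually_power_le:
  assumes "t \<ge> 0"
  shows "eventually (\<lambda>p. t ^ p * M 0 / M p \<le> 1) sequentially"
proof -
  have "eventually (\<lambda>p. t \<le> (M p / M 0) powr (1 / real p)) sequentially"
    using ws unfolding weight_seq_def filterlim_at_top by blast
  moreover have "eventually (\<lambda>p. p \<ge> 1) sequentially" by (rule eventually_ge_at_top)
  ultimately show ?thesis
  proof eventually_elim
    case (elim p)
    have "t ^ p \<le> ((M p / M 0) powr (1 / real p)) ^ p"
      using elim assms by (intro power_mono) auto
    also have "\<dots> = M p / M 0" using elim pos[of p] pos[of 0]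
      by (simp add: powr_realpow[symmetric] powr_powr)
    finally show ?case using pos[of p] pos[of 0] by (simp add: field_simps)
  qed
qed

lemma bdd_assoc:
  assumes "t > 0"
  shows "bdd_above (range (\<lambda>p. ln (t ^ p * M 0 / M p)))"
proof -
  obtain P where P: "\<And>p. p \<ge> P \<Longrightarrow> t ^ p * M 0 / M p \<le> 1"
    using eventually_power_le[of t] assms unfolding eventually_sequentially by auto
  have "ln (t ^ p * M 0 / M p) \<le> Max (insert 0 ((\<lambda>p. ln (t ^ p * M 0 / M p)) ` {..P}))" for p
  proof (cases "p \<le> P")
    case False
    have "ln (t ^ p * M 0 / M p) \<le> 0" using P[of p] False assms pos by (simp add: ln_le_zero_iff)
    also have "0 \<le> Max (insert 0 ((\<lambda>p. ln (t ^ p * M 0 / M p)) ` {..P}))" by (intro Max_ge) auto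
    finally show ?thesis .
  qed (intro Max_ge, auto)
  then show ?thesis by (auto simp: bdd_above_def)
qed

lemma exp_assoc_ge:
  assumes "t \<ge> 0"
  shows "t ^ p * M 0 / M p \<le> exp (assoc_fun M t)"
proof (cases "t = 0")
  case True
  then show ?thesis by (cases p) (auto simp: assoc_fun_def)
next
  case False
  then have t: "t > 0" using assms by simp
  then have "ln (t ^ p * M 0 / M p) \<le> assoc_fun M t"
    unfolding assoc_fun_def using t cSUP_upper[OF UNIV_I bdd_assoc[OF t], of p] by simp
  then show ?thesis using t pos by (metis divide_pos_pos exp_le_cancel_iff exp_ln mult_pos_pos zero_less_power)
qed

lemma exp_assoc_le:
  assumes "t \<ge> 0" "K \<ge> 1" "\<And>p. t ^ p * M 0 / M p \<le> K"
  shows "exp (assoc_fun M t) \<le> K"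
proof (cases "t = 0")
  case False
  then have t: "t > 0" using assms by simp
  have "ln (t ^ p * M 0 / M p) \<le> ln K" for p
    using assms(2,3) t pos by (intro ln_mono) auto
  then have "assoc_fun M t \<le> ln K"
    unfolding assoc_fun_def using t by (auto intro: cSUP_least)
  then show ?thesis using assms(2) by (metis exp_le_cancel_iff exp_ln less_le_trans zero_less_one)
qed (use assms in \<open>simp add: assoc_fun_def\<close>)

lemma exp_assoc_ge_1: "t \<ge> 0 \<Longrightarrow> exp (assoc_fun M t) \<ge> 1"
  using exp_assoc_ge[of t 0] by simp

lemma assoc_mono:
  assumes "0 \<le> s" "s \<le> t"
  shows "assoc_fun M s \<le> assoc_fun M t"
proof -
  have "s ^ p * M 0 / M p \<le> exp (assoc_fun M t)" for p
  proof -
    have "s ^ p * M 0 / M p \<le> t ^ p * M 0 / M p"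
      using assms by (intro divide_right_mono mult_right_mono power_mono) auto
    then show ?thesis using exp_assoc_ge[of t p] assms by linarith
  qed
  then have "exp (assoc_fun M s) \<le> exp (assoc_fun M t)"
    using assms exp_assoc_ge_1[of t] by (intro exp_assoc_le) auto
  then show ?thesis by simp
qed

text \<open>If all terms stayed below half of \<open>exp (assoc_fun M t)\<close>, so would their
  supremum. The index obtained here later becomes the number of integrations by parts on a
  cube.\<close>

lemma assoc_attained:
  assumes "t \<ge> 0"
  obtains p where "exp (assoc_fun M t) \<le> 2 * (t ^ p * M 0 / M p)"
proof -
  have "\<exists>p. exp (assoc_fun M t) \<le> 2 * (t ^ p * M 0 / M p)"
  proof (rule ccontr)
    assume "\<not> ?thesis"
    then have *: "t ^ p * M 0 / M p < exp (assoc_fun M t) / 2" for p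
      by (metis less_divide_eq_numeral1(1) mult.commute not_le)
    have "1 < exp (assoc_fun M t) / 2" using *[of 0] by simp
    then have "exp (assoc_fun M t) \<le> exp (assoc_fun M t) / 2"
      using * assms by (intro exp_assoc_le) (auto intro: less_imp_le)
    then show False by simp
  qed
  then show ?thesis using that by blast
qed

lemma power_le_exp_assoc:
  assumes "s \<ge> 0" "l > 0"
  shows "s ^ n \<le> exp (assoc_fun M (s / l)) * l ^ n * M n / M 0"
  using exp_assoc_ge[of "s / l" n] assms pos[of n] pos[of 0]
  by (simp add: field_simps power_divide)

lemma log_convex: "M (Suc j) * M (j + k) \<le> M j * M (Suc (j + k))"
proof (induction k)
  case (Suc k)
  let ?n = "j + k"
  have "(M (Suc ?n))\<^sup>2 \<le> M ?n * M (Suc (Suc ?n))"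
    using m1 unfolding M1_def by (metis Suc_eq_plus1 diff_Suc_1 le_add2)
  then have "M (Suc j) * (M (Suc ?n))\<^sup>2 \<le> M (Suc j) * (M ?n * M (Suc (Suc ?n)))"
    by (intro mult_left_mono) auto
  also have "\<dots> = (M (Suc j) * M ?n) * M (Suc (Suc ?n))" by simp
  also have "\<dots> \<le> (M j * M (Suc ?n)) * M (Suc (Suc ?n))"
    using Suc by (intro mult_right_mono) auto
  finally have "(M (Suc j) * M (Suc ?n)) * M (Suc ?n) \<le> (M j * M (Suc (Suc ?n))) * M (Suc ?n)"
    by (simp add: power2_eq_square mult_ac)
  then show ?case using pos[of "Suc ?n"] by (simp add: mult_le_cancel_right)
qed simp

text \<open>By (M.1) the ratios M_(p+1)/M_p increase, so M_(j+k)/M_k grows in k from its value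
  M_j/M_0. It is used whenever derivatives are shared between two factors.\<close>

lemma mult_le: "M j * M k \<le> M 0 * M (j + k)"
proof (induction k)
  case (Suc k)
  have "(M j * M (Suc k)) * M k = (M j * M k) * M (Suc k)" by simp
  also have "\<dots> \<le> (M 0 * M (j + k)) * M (Suc k)" using Suc by (intro mult_right_mono) auto
  also have "\<dots> = M 0 * (M (Suc k) * M (k + j))" by (simp add: add.commute)
  also have "\<dots> \<le> M 0 * (M k * M (Suc (k + j)))" by (intro mult_left_mono log_convex) auto
  finally have "(M j * M (Suc k)) * M k \<le> (M 0 * M (j + Suc k)) * M k"
    by (simp add: mult_ac add.commute)
  then show ?case using pos[of k] by (simp add: mult_le_cancel_right)
qed (simp add: mult.commute)

lemma M_Suc:
  obtains C0 H where "C0 \<ge> 1" "H \<ge> 1" "\<And>p. M (Suc p) \<le> C0 * H ^ p * M p"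
  using m2 that unfolding M2'_def by (metis Suc_eq_plus1)

text \<open>Shifting the index p by one in the supremum that defines \<open>assoc_fun\<close> turns
  a factor t into a dilation by H, at the price (M.2)' allows. Iterating m times absorbs any power
  of 1 + t into a dilation.\<close>

lemma exp_assoc_absorb:
  "\<exists>K\<ge>1. \<exists>C>0. \<forall>t\<ge>0. (1 + t) ^ m * exp (assoc_fun M t) \<le> C * exp (assoc_fun M (K * t))"
proof (induction m)
  case 0
  show ?case by (rule exI[of _ 1], simp, rule exI[of _ 1], simp)
next
  case (Suc m)
  then obtain K C where K: "K \<ge> 1" "C > 0" "\<And>t. t \<ge> 0 \<Longrightarrow> (1 + t) ^ m * exp (assoc_fun M t) \<le> C * exp (assoc_fun M (K * t))"
    by blast
  obtain C0 H where H: "C0 \<ge> 1" "H \<ge> 1" "\<And>p. M (Suc p) \<le> C0 * H ^ p * M p" by (rule M_Suc) blast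
  have 1: "t * exp (assoc_fun M t) \<le> C0 * exp (assoc_fun M (H * t))" if t: "t \<ge> 0" for t
  proof (cases "t = 0")
    case False
    then have t0: "t > 0" using t by simp
    have "t ^ p * M 0 / M p \<le> (C0 * exp (assoc_fun M (H * t))) / t" for p
    proof -
      have "t ^ p * M 0 / M p * t \<le> C0 * (H * t) ^ Suc p * M 0 / M (Suc p)"
      proof -
        have "M (Suc p) * (t ^ Suc p * M 0) \<le> (C0 * H ^ p * M p) * (t ^ Suc p * M 0)"
          using H(3) t by (intro mult_right_mono) auto
        also have "\<dots> \<le> (C0 * H ^ Suc p * M p) * (t ^ Suc p * M 0)"
          using H t by (intro mult_right_mono mult_left_mono power_increasing) auto
        finally show ?thesis using pos[of p] pos[of "Suc p"] by (simp add: field_simps power_mult_distrib)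
      qed
      also have "\<dots> = C0 * ((H * t) ^ Suc p * M 0 / M (Suc p))" by simp
      also have "\<dots> \<le> C0 * exp (assoc_fun M (H * t))"
        using exp_assoc_ge[of "H * t" "Suc p"] H t by (intro mult_left_mono) auto
      finally show ?thesis using t0 by (simp add: field_simps)
    qed
    moreover have "(C0 * exp (assoc_fun M (H * t))) / t \<ge> 1"
    proof -
      have "C0 * exp (assoc_fun M (H * t)) / t \<ge> t ^ 0 * M 0 / M 0" by (rule calculation(1))
      then show ?thesis by simp
    qed
    ultimately have "exp (assoc_fun M t) \<le> (C0 * exp (assoc_fun M (H * t))) / t"
      using t by (intro exp_assoc_le) auto
    then show ?thesis using t0 by (simp add: field_simps)
  qed (use H in auto)
  have "(1 + t) ^ Suc m * exp (assoc_fun M t) \<le> (C * (1 + C0)) * exp (assoc_fun M ((H * K) * t))" if t: "t \<ge> 0" for t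
  proof -
    have Kt: "t \<le> K * t" using K t by (simp add: mult_le_cancel_right1)
    have HKt: "K * t \<le> H * (K * t)" using H K t by (metis Kt mult_le_cancel_right1 order.trans linorder_not_less)
    have "(1 + t) ^ Suc m * exp (assoc_fun M t) = (1 + t) * ((1 + t) ^ m * exp (assoc_fun M t))" by simp
    also have "\<dots> \<le> (1 + t) * (C * exp (assoc_fun M (K * t)))"
      using K(3)[OF t] t by (intro mult_left_mono) auto
    also have "\<dots> \<le> (1 + K * t) * (C * exp (assoc_fun M (K * t)))"
      using Kt K by (intro mult_right_mono) auto
    also have "\<dots> = C * (exp (assoc_fun M (K * t)) + K * t * exp (assoc_fun M (K * t)))" by (simp add: algebra_simps)
    also have "\<dots> \<le> C * (exp (assoc_fun M (H * (K * t))) + C0 * exp (assoc_fun M (H * (K * t))))"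
      using 1[of "K * t"] K t HKt by (intro mult_left_mono add_mono) (auto intro: assoc_mono)
    finally show ?thesis by (simp add: algebra_simps)
  qed
  moreover have "H * K \<ge> 1" using H K mult_mono[of 1 H 1 K] by simp
  moreover have "C * (1 + C0) > 0" using K H by simp
  ultimately show ?case by blast
qed

text \<open>Each power s^(n-j) is at most exp(omega_M(s/l)) l^(n-j) M_(n-j)/M_0, and M_(n-j) M_j is
  at most M_0 M_n. What remains is the sum of the binomial coefficients, which doubles
  \<open>l\<close>.\<close>

lemma binomial_weight_sum:
  assumes "s \<ge> 0" "l > 0"
  shows "(\<Sum>j\<le>n. real (n choose j) * s ^ (n - j) * (l ^ j * M j)) \<le> (2 * l) ^ n * M n * exp (assoc_fun M (s / l))"
proof -
  have "real (n choose j) * s ^ (n - j) * (l ^ j * M j) \<le> real (n choose j) * (l ^ n * M n * exp (assoc_fun M (s / l)))"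
    if "j \<le> n" for j
  proof -
    have "s ^ (n - j) * (l ^ j * M j) \<le> (exp (assoc_fun M (s / l)) * l ^ (n - j) * M (n - j) / M 0) * (l ^ j * M j)"
      using assms power_le_exp_assoc[of s l "n - j"] by (intro mult_right_mono) auto
    also have "\<dots> = exp (assoc_fun M (s / l)) * (l ^ (n - j) * l ^ j) * ((M (n - j) * M j) / M 0)" by simp
    also have "l ^ (n - j) * l ^ j = l ^ n" using that by (simp add: power_add[symmetric])
    also have "exp (assoc_fun M (s / l)) * l ^ n * ((M (n - j) * M j) / M 0) \<le> exp (assoc_fun M (s / l)) * l ^ n * M n"
      using mult_le[of "n - j" j] that pos[of 0] assms by (intro mult_left_mono) (auto simp: field_simps)
    finally have "s ^ (n - j) * (l ^ j * M j) \<le> exp (assoc_fun M (s / l)) * l ^ n * M n" .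
    from mult_left_mono[OF this, of "real (n choose j)"] show ?thesis by (simp add: mult_ac)
  qed
  then have "(\<Sum>j\<le>n. real (n choose j) * s ^ (n - j) * (l ^ j * M j)) \<le> (\<Sum>j\<le>n. real (n choose j) * (l ^ n * M n * exp (assoc_fun M (s / l))))"
    by (intro sum_mono) auto
  also have "\<dots> = real (\<Sum>j\<le>n. n choose j) * (l ^ n * M n * exp (assoc_fun M (s / l)))"
    by (simp add: sum_distrib_right)
  finally show ?thesis by (simp add: choose_row_sum power_mult_distrib mult_ac)
qed

end

definition wgt :: "(nat \<Rightarrow> real) \<Rightarrow> real \<Rightarrow> real^'n::finite \<Rightarrow> real" where
  "wgt A q x = exp (assoc_fun A (q * norm x))"

lemma wgt_pos [simp]: "wgt A q x > 0" "wgt A q x \<ge> 0" "wgt A q x \<noteq> 0"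
  by (auto simp: wgt_def)

lemma wgt_minus [simp]: "wgt A q (- x) = wgt A q x"
  by (simp add: wgt_def)

context wseq
begin

lemma wgt_ge_1: "q \<ge> 0 \<Longrightarrow> wgt M q x \<ge> 1"
  by (metis exp_assoc_ge_1 mult_nonneg_nonneg norm_ge_zero wgt_def)

lemma wgt_mono: "0 \<le> q \<Longrightarrow> q \<le> r \<Longrightarrow> wgt M q x \<le> wgt M r x"
  by (auto simp: wgt_def intro!: assoc_mono mult_right_mono)

text \<open>The norm of x + y is at most twice the larger of the two norms; the factor belonging to
  the smaller one is at least 1.\<close>

lemma wgt_add:
  assumes "q \<ge> 0"
  shows "wgt M q (x + y) \<le> wgt M (2 * q) x * wgt M (2 * q) y"
proof -
  have *: "wgt M q (x + y) \<le> wgt M (2 * q) z" if "norm (x + y) \<le> 2 * norm z" for z :: "real^'a"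
    using assms that by (auto simp: wgt_def mult.assoc intro!: assoc_mono mult_left_mono dest: mult_left_mono[OF _ assms])
  show ?thesis
  proof (cases "norm x \<le> norm y")
    case True
    then have "norm (x + y) \<le> 2 * norm y" using norm_triangle_ineq[of x y] by simp
    from *[OF this] show ?thesis using assms wgt_ge_1[of "2 * q" x]
      by (metis mult.commute mult_le_cancel_right1 order.trans wgt_pos(2) linorder_not_less mult_nonneg_nonneg zero_le_numeral)
  next
    case False
    then have "norm (x + y) \<le> 2 * norm x" using norm_triangle_ineq[of x y] by simp
    from *[OF this] show ?thesis using assms wgt_ge_1[of "2 * q" y]
      by (metis mult.commute mult_le_cancel_right1 order.trans wgt_pos(2) linorder_not_less mult_nonneg_nonneg zero_le_numeral)
  qed
qed

text \<open>The dilation \<open>K\<close> serves all \<open>q\<close> at once and only the constant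
  depends on \<open>q\<close>. This uniformity allows a single number \<open>domK\<close>
  later.\<close>

lemma wgt_absorb:
  "\<exists>K\<ge>1. \<forall>q>0. \<exists>C>0. \<forall>x::real^'n::finite. (1 + norm x) ^ m * wgt M q x \<le> C * wgt M (K * q) x"
proof -
  obtain K C where K: "K \<ge> 1" "C > 0" "\<And>t. t \<ge> 0 \<Longrightarrow> (1 + t) ^ m * exp (assoc_fun M t) \<le> C * exp (assoc_fun M (K * t))"
    using exp_assoc_absorb[of m] by blast
  have "\<exists>C>0. \<forall>x::real^'n. (1 + norm x) ^ m * wgt M q x \<le> C * wgt M (K * q) x" if q: "q > 0" for q
  proof -
    define c where "c = max 1 (1 / q)"
    \<comment> \<open>The choice of \<open>c\<close> makes 1 + |x| at most c (1 + q |x|), so that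
      the absorption at the point q |x| applies.\<close>
    have c: "c \<ge> 1" "c * q \<ge> 1" using q by (auto simp: c_def field_simps max_def)
    have "(1 + norm x) ^ m * wgt M q x \<le> (c ^ m * C) * wgt M (K * q) x" for x :: "real^'n"
    proof -
      have "1 + norm x \<le> c + (c * q) * norm x"
        using c by (intro add_mono) (auto simp: mult_le_cancel_right1)
      then have "1 + norm x \<le> c * (1 + q * norm x)" by (simp add: algebra_simps)
      then have "(1 + norm x) ^ m \<le> c ^ m * (1 + q * norm x) ^ m"
        using power_mono[of "1 + norm x" "c * (1 + q * norm x)" m] by (simp add: power_mult_distrib)
      then have "(1 + norm x) ^ m * wgt M q x \<le> (c ^ m * (1 + q * norm x) ^ m) * wgt M q x"
        by (intro mult_right_mono) auto
      also have "\<dots> = c ^ m * ((1 + q * norm x) ^ m * wgt M q x)" by simp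
      also have "\<dots> \<le> c ^ m * (C * wgt M (K * q) x)"
        using K(3)[of "q * norm x"] q c by (intro mult_left_mono) (auto simp: wgt_def mult.assoc)
      finally show ?thesis by simp
    qed
    moreover have "c ^ m * C > 0" using c K by simp
    ultimately show ?thesis by blast
  qed
  then show ?thesis using K(1) by blast
qed

lemma wgt_continuous_bound:
  assumes "q \<ge> 0" "norm x \<le> R"
  shows "wgt M q x \<le> exp (assoc_fun M (q * R))"
  using assms norm_ge_zero[of x] unfolding wgt_def
  by (simp add: assoc_mono mult_left_mono)

lemma inverse_wgt_le:
  assumes "q > 0"
  obtains C where "C > 0" "\<And>x::real^'n::finite. 1 / wgt M q x \<le> C / (1 + norm x) ^ m"
proof -
  obtain K where K: "K \<ge> 1" "\<And>q. q > 0 \<Longrightarrow> \<exists>C>0. \<forall>x::real^'n. (1 + norm x) ^ m * wgt M q x \<le> C * wgt M (K * q) x"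
    using wgt_absorb[of m] by blast
  then obtain C where C: "C > 0" "\<And>x::real^'n. (1 + norm x) ^ m * wgt M (q / K) x \<le> C * wgt M (K * (q / K)) x"
    using assms by (metis divide_pos_pos less_le_trans zero_less_one)
  have "1 / wgt M q x \<le> C / (1 + norm x) ^ m" for x :: "real^'n"
  proof -
    have p: "(1 + norm x) ^ m > 0" by (simp add: add_pos_nonneg)
    have "(1 + norm x) ^ m * 1 \<le> (1 + norm x) ^ m * wgt M (q / K) x"
      using wgt_ge_1[of "q / K" x] assms K(1) p by (intro mult_left_mono) auto
    also have "\<dots> \<le> C * wgt M q x" using C(2)[of x] K(1) by simp
    finally show ?thesis using p by (simp add: field_simps)
  qed
  then show ?thesis using that C(1) by blast
qed

lemma assoc_measurable [measurable]: "assoc_fun M \<in> borel_measurable borel"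
proof (rule borel_measurable_mono)
  show "mono (assoc_fun M)"
  proof (rule monoI)
    fix s t :: real assume "s \<le> t"
    then show "assoc_fun M s \<le> assoc_fun M t"
      using assoc_mono[of s t] assoc_mono[of 0 t] by (cases "s \<ge> 0"; cases "t \<ge> 0") (auto simp: assoc_fun_def)
  qed
qed

lemma wgt_measurable [measurable]: "wgt M q \<in> borel_measurable borel"
  unfolding wgt_def[abs_def] by measurable

end

section \<open>Integration on Euclidean space\<close>

text \<open>The square of 1 + |x| dominates 1 + x_b^2 for each coordinate. The product of these d
  bounds is a product of integrable functions of one variable, whence the exponent 2d used
  everywhere below.\<close>

lemma integrable_inverse_one_plus_norm:
  "integrable lborel (\<lambda>x::real^'n::finite. 1 / (1 + norm x) ^ (2 * CARD('n)))"
proof (rule integrableI_bounded)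
  show "(\<lambda>x::real^'n. 1 / (1 + norm x) ^ (2 * CARD('n))) \<in> borel_measurable lborel" by measurable
  have fin1: "(\<integral>\<^sup>+ t. ennreal (inverse (1 + t\<^sup>2)) \<partial>lborel) < \<infinity>"
  proof -
    have "set_integrable lborel (einterval (-\<infinity>) \<infinity>) (\<lambda>x. inverse (1 + x^2))"
      by (rule integrable_inverse_1_plus_square)
    then have "integrable lborel (\<lambda>x::real. inverse (1 + x^2))"
      by (simp add: set_integrable_def einterval_def)
    from integrableD(2)[OF this] show ?thesis by (simp add: less_top)
  qed
  have "(\<integral>\<^sup>+ x. ennreal (norm (1 / (1 + norm (x::real^'n)) ^ (2 * CARD('n)))) \<partial>lborel)
      \<le> (\<integral>\<^sup>+ x. (\<Prod>b\<in>(Basis :: (real^'n) set). ennreal (inverse (1 + (x \<bullet> b)\<^sup>2))) \<partial>lborel)"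
  proof (rule nn_integral_mono)
    fix x :: "real^'n"
    have "1 / (1 + norm x) ^ (2 * CARD('n)) = (\<Prod>b\<in>(Basis :: (real^'n) set). inverse ((1 + norm x)\<^sup>2))"
      by (simp add: power_mult divide_inverse power_inverse)
    also have "\<dots> \<le> (\<Prod>b\<in>(Basis :: (real^'n) set). inverse (1 + (x \<bullet> b)\<^sup>2))"
    proof (rule prod_mono)
      fix b :: "real^'n" assume b: "b \<in> Basis"
      have "\<bar>x \<bullet> b\<bar> \<le> norm x" using Basis_le_norm[OF b] by simp
      then have "(x \<bullet> b)\<^sup>2 \<le> (norm x)\<^sup>2" by (metis abs_le_square_iff abs_norm_cancel)
      then have "1 + (x \<bullet> b)\<^sup>2 \<le> (1 + norm x)\<^sup>2" using norm_ge_zero[of x] unfolding power2_sum one_power2 by linarith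
      moreover have "1 + (x \<bullet> b)\<^sup>2 > 0" by (simp add: add_pos_nonneg)
      ultimately show "0 \<le> inverse ((1 + norm x)\<^sup>2) \<and> inverse ((1 + norm x)\<^sup>2) \<le> inverse (1 + (x \<bullet> b)\<^sup>2)"
        by (auto intro: le_imp_inverse_le)
    qed
    finally have "1 / (1 + norm x) ^ (2 * CARD('n)) \<le> (\<Prod>b\<in>(Basis :: (real^'n) set). inverse (1 + (x \<bullet> b)\<^sup>2))" .
    then show "ennreal (norm (1 / (1 + norm x) ^ (2 * CARD('n)))) \<le> (\<Prod>b\<in>(Basis :: (real^'n) set). ennreal (inverse (1 + (x \<bullet> b)\<^sup>2)))"
      by (subst prod_ennreal) (auto intro!: ennreal_leI)
  qed
  also have "\<dots> = (\<Prod>b\<in>(Basis :: (real^'n) set). (\<integral>\<^sup>+ t. ennreal (inverse (1 + t\<^sup>2)) \<partial>lborel))"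
    by (rule nn_integral_lborel_prod) auto
  also have "\<dots> < \<infinity>" using fin1 by (simp add: power_less_top_ennreal)
  finally show "(\<integral>\<^sup>+ x. ennreal (norm (1 / (1 + norm (x::real^'n)) ^ (2 * CARD('n)))) \<partial>lborel) < \<infinity>" .
qed

section \<open>Affine changes of variables and Fubini's theorem\<close>

lemma
  fixes f :: "'a::euclidean_space \<Rightarrow> 'b::{banach, second_countable_topology}"
  assumes c: "c \<noteq> 0" and f: "integrable lborel f"
  shows integrable_lborel_affine: "integrable lborel (\<lambda>x. f (t + c *\<^sub>R x))"
    and integral_lborel_affine: "integral\<^sup>L lborel f = \<bar>c\<bar> ^ DIM('a) *\<^sub>R integral\<^sup>L lborel (\<lambda>x. f (t + c *\<^sub>R x))"
proof -
  have [measurable]: "f \<in> borel_measurable borel" using f by auto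
  have "integrable (density (distr lborel borel (\<lambda>x. t + c *\<^sub>R x)) (\<lambda>_. \<bar>c\<bar>^DIM('a))) f"
    using f lborel_affine[OF c, of t] by simp
  then have "integrable (distr lborel borel (\<lambda>x. t + c *\<^sub>R x)) (\<lambda>x. \<bar>c\<bar>^DIM('a) *\<^sub>R f x)"
    by (subst (asm) integrable_density) auto
  then have "integrable lborel (\<lambda>x. \<bar>c\<bar>^DIM('a) *\<^sub>R f (t + c *\<^sub>R x))"
    by (subst (asm) integrable_distr_eq) auto
  from integrable_scaleR_right[OF this, of "inverse (\<bar>c\<bar>^DIM('a))"]
  show 1: "integrable lborel (\<lambda>x. f (t + c *\<^sub>R x))" using c by simp
  have "integral\<^sup>L lborel f = integral\<^sup>L (density (distr lborel borel (\<lambda>x. t + c *\<^sub>R x)) (\<lambda>_. \<bar>c\<bar>^DIM('a))) f"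
    using lborel_affine[OF c, of t] by simp
  also have "\<dots> = integral\<^sup>L (distr lborel borel (\<lambda>x. t + c *\<^sub>R x)) (\<lambda>x. \<bar>c\<bar>^DIM('a) *\<^sub>R f x)"
    by (subst integral_density) auto
  also have "\<dots> = integral\<^sup>L lborel (\<lambda>x. \<bar>c\<bar>^DIM('a) *\<^sub>R f (t + c *\<^sub>R x))"
    by (subst integral_distr) auto
  finally show "integral\<^sup>L lborel f = \<bar>c\<bar> ^ DIM('a) *\<^sub>R integral\<^sup>L lborel (\<lambda>x. f (t + c *\<^sub>R x))"
    using 1 by simp
qed

lemma integrable_lborel_diff:
  fixes f :: "'a::euclidean_space \<Rightarrow> 'b::{banach, second_countable_topology}"
  assumes "integrable lborel f" shows "integrable lborel (\<lambda>y. f (x - y))"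
  using integrable_lborel_affine[of "-1" f x] assms by simp

lemma integrable_lborel_plus:
  fixes f :: "'a::euclidean_space \<Rightarrow> 'b::{banach, second_countable_topology}"
  assumes "integrable lborel f" shows "integrable lborel (\<lambda>y. f (x + y))"
  using integrable_lborel_affine[of 1 f x] assms by simp

lemma integral_lborel_plus:
  fixes f :: "'a::euclidean_space \<Rightarrow> 'b::{banach, second_countable_topology}"
  shows "integral\<^sup>L lborel (\<lambda>y. f (x + y)) = integral\<^sup>L lborel f"
proof (cases "integrable lborel f")
  case True
  then show ?thesis using integral_lborel_affine[of 1 f x] by simp
next
  case False
  then have "\<not> integrable lborel (\<lambda>y. f (x + y))"
    using integrable_lborel_plus[of "\<lambda>y. f (x + y)" "-x"] by auto
  with False show ?thesis by (simp add: not_integrable_integral_eq)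
qed

lemma integral_lborel_diff:
  fixes f :: "'a::euclidean_space \<Rightarrow> 'b::{banach, second_countable_topology}"
  shows "integral\<^sup>L lborel (\<lambda>y. f (x - y)) = integral\<^sup>L lborel f"
proof (cases "integrable lborel f")
  case True
  then show ?thesis using integral_lborel_affine[of "-1" f x] by simp
next
  case False
  then have "\<not> integrable lborel (\<lambda>y. f (x - y))"
    using integrable_lborel_diff[of "\<lambda>y. f (x - y)" x] by auto
  with False show ?thesis by (simp add: not_integrable_integral_eq)
qed

text \<open>The form in which Fubini's theorem is needed: two integrable functions of separate
  variables and a bounded kernel, which will be a translate of a test function or a
  character.\<close>

lemma
  fixes u :: "'a::euclidean_space \<Rightarrow> complex" and v :: "'b::euclidean_space \<Rightarrow> complex"
  assumes u: "integrable lborel u" and v: "integrable lborel v"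
    and b [measurable]: "b \<in> borel_measurable (lborel \<Otimes>\<^sub>M lborel)"
    and B: "\<And>x y. cmod (b (x, y)) \<le> B"
  shows Fubini_product_integrable: "integrable (lborel \<Otimes>\<^sub>M lborel) (\<lambda>(x, y). u x * v y * b (x, y))"
    and Fubini_product_swap: "(\<integral>y. (\<integral>x. u x * v y * b (x, y) \<partial>lborel) \<partial>lborel) = (\<integral>x. (\<integral>y. u x * v y * b (x, y) \<partial>lborel) \<partial>lborel)"
proof -
  have [measurable]: "u \<in> borel_measurable borel" "v \<in> borel_measurable borel" using u v by auto
  have B0: "B \<ge> 0" using B[of undefined undefined] norm_ge_zero order_trans by blast
  have bx: "integrable lborel (\<lambda>y. u x * v y * b (x, y))" for x
  proof (rule Bochner_Integration.integrable_bound)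
    show "integrable lborel (\<lambda>y. (cmod (u x) * B) * cmod (v y))" using v by auto
    show "AE y in lborel. norm (u x * v y * b (x, y)) \<le> norm ((cmod (u x) * B) * cmod (v y))"
    proof (intro AE_I2)
      fix y
      show "norm (u x * v y * b (x, y)) \<le> norm ((cmod (u x) * B) * cmod (v y))"
        using mult_left_mono[OF B[of x y], of "cmod (u x) * cmod (v y)"] B0 by (simp add: norm_mult mult_ac)
    qed
  qed measurable
  show I: "integrable (lborel \<Otimes>\<^sub>M lborel) (\<lambda>(x, y). u x * v y * b (x, y))"
  proof (rule lborel_pair.Fubini_integrable)
    show "integrable lborel (\<lambda>x. \<integral>y. norm (case (x, y) of (x, y) \<Rightarrow> u x * v y * b (x, y)) \<partial>lborel)"
    proof (rule Bochner_Integration.integrable_bound)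
      show "integrable lborel (\<lambda>x. cmod (u x) * (B * (\<integral>y. cmod (v y) \<partial>lborel)))" using u by auto
      show "AE x in lborel. norm (\<integral>y. norm (case (x, y) of (x, y) \<Rightarrow> u x * v y * b (x, y)) \<partial>lborel) \<le> norm (cmod (u x) * (B * (\<integral>y. cmod (v y) \<partial>lborel)))"
      proof (intro AE_I2)
        fix x
        have "(\<integral>y. cmod (u x * v y * b (x, y)) \<partial>lborel) \<le> (\<integral>y. (cmod (u x) * B) * cmod (v y) \<partial>lborel)"
        proof (rule integral_mono)
          show "integrable lborel (\<lambda>y. cmod (u x * v y * b (x, y)))" using bx[of x] by (rule integrable_norm)
          show "integrable lborel (\<lambda>y. (cmod (u x) * B) * cmod (v y))" using v by auto
          fix y
          show "cmod (u x * v y * b (x, y)) \<le> (cmod (u x) * B) * cmod (v y)"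
            using mult_left_mono[OF B[of x y], of "cmod (u x) * cmod (v y)"] by (simp add: norm_mult mult_ac)
        qed
        then show "norm (\<integral>y. norm (case (x, y) of (x, y) \<Rightarrow> u x * v y * b (x, y)) \<partial>lborel) \<le> norm (cmod (u x) * (B * (\<integral>y. cmod (v y) \<partial>lborel)))"
          using B0 by (simp add: mult_ac abs_mult integral_nonneg_AE)
      qed
    qed measurable
    show "AE x in lborel. integrable lborel (\<lambda>y. case (x, y) of (x, y) \<Rightarrow> u x * v y * b (x, y))" using bx by simp
  qed measurable
  show "(\<integral>y. (\<integral>x. u x * v y * b (x, y) \<partial>lborel) \<partial>lborel) = (\<integral>x. (\<integral>y. u x * v y * b (x, y) \<partial>lborel) \<partial>lborel)"
    by (rule lborel_pair.Fubini_integral) (use I in \<open>simp add: case_prod_beta'\<close>)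
qed

lemma integrable_mult_bounded:
  fixes f g :: "'a::euclidean_space \<Rightarrow> complex"
  assumes f: "integrable lborel f" and g: "g \<in> borel_measurable borel" "\<And>x. cmod (g x) \<le> B"
  shows "integrable lborel (\<lambda>x. f x * g x)"
proof (rule Bochner_Integration.integrable_bound)
  show "integrable lborel (\<lambda>x. B * cmod (f x))" using f by auto
  have "0 \<le> B" using g(2)[of 0] norm_ge_zero order_trans by blast
  then show "AE x in lborel. norm (f x * g x) \<le> norm (B * cmod (f x))"
    using mult_left_mono[OF g(2), of "cmod (f _)"] by (simp add: norm_mult mult_ac)
  show "(\<lambda>x. f x * g x) \<in> borel_measurable lborel" using f g(1) by measurable
qed

section \<open>Convolution\<close>

lemma conv_commute: "conv f g = conv g f"
proof
  fix x
  have "conv f g x = (\<integral>y. (\<lambda>y. f y * g (x - y)) (x - y) \<partial>lborel)"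
    unfolding conv_def by (rule integral_lborel_diff[symmetric])
  then show "conv f g x = conv g f x" by (simp add: conv_def mult.commute)
qed

lemma smooth_difference_bound:
  fixes g :: "'n::finite testfun"
  assumes g: "smooth g" and L: "\<And>i x. x \<in> closed_segment z (z + u) \<Longrightarrow> cmod (partial i g x) \<le> L"
  shows "cmod (g (z + u) - g z) \<le> real CARD('n) * L * norm u"
proof -
  have "cmod (g (z + u) - g z) \<le> (real CARD('n) * L) * norm ((z + u) - z)"
  proof (rule differentiable_bound[where f' = "\<lambda>x h. \<Sum>i\<in>UNIV. (h $ i) *\<^sub>R partial i g x"])
    show "convex (closed_segment z (z + u))" by simp
    fix x assume x: "x \<in> closed_segment z (z + u)"
    show "(g has_derivative (\<lambda>h. \<Sum>i\<in>UNIV. (h $ i) *\<^sub>R partial i g x)) (at x within closed_segment z (z + u))"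
      by (rule has_derivative_at_withinI[OF smooth_has_derivative[OF g]])
    show "onorm (\<lambda>h. \<Sum>i\<in>UNIV. (h $ i) *\<^sub>R partial i g x) \<le> real CARD('n) * L"
    proof (rule onorm_le)
      fix h :: "real^'n"
      have "norm (\<Sum>i\<in>UNIV. (h $ i) *\<^sub>R partial i g x) \<le> (\<Sum>i\<in>(UNIV::'n set). norm h * L)"
        using L[OF x] by (intro sum_norm_le) (auto intro!: mult_mono component_le_norm_cart)
      then show "norm (\<Sum>i\<in>UNIV. (h $ i) *\<^sub>R partial i g x) \<le> (real CARD('n) * L) * norm h" by (simp add: mult_ac)
    qed
  qed auto
  then show ?thesis by simp
qed

text \<open>The mean value inequality is applied to \<open>f\<close> minus its linear part at
  \<open>z\<close>, whose derivative is small by the same inequality for the partial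
  derivatives.\<close>

lemma bounded_second_derivative_remainder:
  fixes f :: "'n::finite testfun"
  assumes f: "smooth f" and K: "\<And>i j x. cmod (partial j (partial i f) x) \<le> K"
  shows "cmod (f (z + h) - f z - (\<Sum>i\<in>UNIV. (h $ i) *\<^sub>R partial i f z)) \<le> (real CARD('n))\<^sup>2 * K * (norm h)\<^sup>2"
proof -
  have K0: "K \<ge> 0" using K[of undefined undefined undefined] norm_ge_zero order_trans by blast
  define R where "R = (\<lambda>y. (1::complex) * f y + (-1) * (\<Sum>i\<in>UNIV. ((y - z) $ i) *\<^sub>R partial i f z))"
  define D where "D = (\<lambda>x (h::real^'n). (\<Sum>i\<in>UNIV. (h $ i) *\<^sub>R (partial i f x - partial i f z)))"
  have "cmod (R (z + h) - R z) \<le> (real CARD('n) * (real CARD('n) * K * norm h)) * norm ((z + h) - z)"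
  proof (rule differentiable_bound[where f' = D])
    show "convex (closed_segment z (z + h))" by simp
    fix x assume x: "x \<in> closed_segment z (z + h)"
    have "((\<lambda>y::real^'n. \<Sum>i\<in>UNIV. ((y - z) $ i) *\<^sub>R partial i f z) has_derivative (\<lambda>h. \<Sum>i\<in>UNIV. (h $ i) *\<^sub>R partial i f z)) (at x)"
      by (rule has_derivative_eq_rhs, (rule derivative_intros)+) (auto intro!: derivative_eq_intros bounded_linear.has_derivative[OF bounded_linear_vec_nth])
    then have "(R has_derivative (\<lambda>h. 1 * (\<Sum>i\<in>UNIV. (h $ i) *\<^sub>R partial i f x) + (-1) * (\<Sum>i\<in>UNIV. (h $ i) *\<^sub>R partial i f z))) (at x)"
      unfolding R_def by (intro has_derivative_add has_derivative_mult_right smooth_has_derivative[OF f])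
    then have "(R has_derivative D x) (at x)"
      by (simp add: D_def scaleR_diff_right sum_subtractf)
    then show "(R has_derivative D x) (at x within closed_segment z (z + h))" by (rule has_derivative_at_withinI)
    show "onorm (D x) \<le> real CARD('n) * (real CARD('n) * K * norm h)"
    proof (rule onorm_le)
      fix k :: "real^'n"
      have "cmod (partial i f x - partial i f z) \<le> real CARD('n) * K * norm h" for i
      proof -
        have "cmod (partial i f (z + (x - z)) - partial i f z) \<le> real CARD('n) * K * norm (x - z)"
          by (rule smooth_difference_bound[OF smooth_partial[OF f]]) (rule K)
        also have "\<dots> \<le> real CARD('n) * K * norm h"
          using segment_bound(1)[OF x] K0 by (intro mult_left_mono) auto
        finally show ?thesis by simp
      qed
      then have "norm (D x k) \<le> (\<Sum>i\<in>(UNIV::'n set). norm k * (real CARD('n) * K * norm h))"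
        unfolding D_def by (intro sum_norm_le) (auto intro!: mult_mono component_le_norm_cart)
      then show "norm (D x k) \<le> (real CARD('n) * (real CARD('n) * K * norm h)) * norm k" by (simp add: mult_ac)
    qed
  qed auto
  then show ?thesis by (simp add: R_def power2_eq_square algebra_simps)
qed

text \<open>The quadratic remainder of \<open>f\<close> is uniform in the base point, so it can be
  integrated against \<open>g\<close> and gives the derivative of the convolution at once. The class
  \<open>P\<close> is closed under \<open>partial\<close>, which turns one derivative into
  all.\<close>

lemma
  fixes f g :: "'n::finite testfun"
  assumes f: "smooth f" and K: "\<And>is. \<exists>K. \<forall>x. cmod (pd is f x) \<le> K" and g: "integrable lborel g"
  shows smooth_conv: "smooth (conv f g)" and pd_conv: "pd is (conv f g) = conv (pd is f) g"
proof -
  define P where "P = (\<lambda>f::'n testfun. smooth f \<and> (\<forall>is. \<exists>K. \<forall>x. cmod (pd is f x) \<le> K))"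
  have Pp: "P (partial i f)" if Pf: "P f" for f i
    unfolding P_def
  proof (intro conjI allI)
    show "smooth (partial i f)" using Pf by (simp add: P_def smooth_partial)
    fix "is"
    obtain K where "\<forall>x. cmod (pd (is @ [i]) f x) \<le> K" using Pf unfolding P_def by blast
    then show "\<exists>K. \<forall>x. cmod (pd is (partial i f) x) \<le> K" by (auto simp: pd_append)
  qed
  have der: "(conv f g has_derivative (\<lambda>h. \<Sum>i\<in>UNIV. (h $ i) *\<^sub>R conv (partial i f) g x)) (at x)" if "P f" for f x
  proof -
    have f: "smooth f" using that by (simp add: P_def)
    have bd: "\<exists>K. \<forall>x. cmod (pd is f x) \<le> K" for "is" using that by (simp add: P_def)
    have meas: "f \<in> borel_measurable borel" "partial i f \<in> borel_measurable borel" for i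
      using f smooth_continuous_on smooth_partial borel_measurable_continuous_onI by blast+
    have I: "integrable lborel (\<lambda>y. g y * k (x - y))" if k: "k \<in> borel_measurable borel" "\<exists>K. \<forall>x. cmod (k x) \<le> K" for k and x :: "real^'n"
    proof -
      obtain K where "\<And>x. cmod (k x) \<le> K" using k by blast
      then show ?thesis using k(1) by (intro integrable_mult_bounded[OF g, where B = K]) auto
    qed
    have If: "integrable lborel (\<lambda>y. g y * f (x - y))" for x
      using I[OF meas(1)] bd[of "[]"] by simp
    have Ip: "integrable lborel (\<lambda>y. g y * partial i f (x - y))" for x i
      using I[OF meas(2)] bd[of "[i]"] by simp
    have "\<exists>K. \<forall>i j x. cmod (partial j (partial i f) x) \<le> K"
    proof -
      have "\<forall>p::'n \<times> 'n. \<exists>K. \<forall>x. cmod (pd [snd p, fst p] f x) \<le> K" using bd by blast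
      then obtain KK where KK: "\<And>p x. cmod (pd [snd p, fst p] f x) \<le> KK p" by metis
      have "cmod (partial j (partial i f) x) \<le> Max (range KK)" for i j x
        using KK[of "(i, j)" x] by (auto intro: order_trans[OF _ Max_ge])
      then show ?thesis by blast
    qed
    then obtain K where K: "\<And>i j x. cmod (partial j (partial i f) x) \<le> K" by blast
    have K0: "K \<ge> 0" using K[of undefined undefined undefined] norm_ge_zero order_trans by blast
    define L where "L = (real CARD('n))\<^sup>2 * K * (\<integral>y. cmod (g y) \<partial>lborel)"
    have L0: "L \<ge> 0" unfolding L_def using K0 by (intro mult_nonneg_nonneg) (auto intro: integral_nonneg_AE)
    have main: "cmod (conv f g (x + h) - conv f g x - (\<Sum>i\<in>UNIV. (h $ i) *\<^sub>R conv (partial i f) g x)) \<le> L * (norm h)\<^sup>2" for h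
    proof -
      have "conv f g (x + h) - conv f g x - (\<Sum>i\<in>UNIV. (h $ i) *\<^sub>R conv (partial i f) g x)
         = (\<integral>y. g y * f (x + h - y) \<partial>lborel) - (\<integral>y. g y * f (x - y) \<partial>lborel)
           - (\<Sum>i\<in>UNIV. (h $ i) *\<^sub>R (\<integral>y. g y * partial i f (x - y) \<partial>lborel))"
        by (subst conv_commute, subst conv_commute, subst conv_commute) (simp add: conv_def)
      also have "\<dots> = (\<integral>y. g y * f (x + h - y) - g y * f (x - y) - (\<Sum>i\<in>UNIV. (h $ i) *\<^sub>R (g y * partial i f (x - y))) \<partial>lborel)"
        using If Ip by simp
      also have "\<dots> = (\<integral>y. g y * (f (x - y + h) - f (x - y) - (\<Sum>i\<in>UNIV. (h $ i) *\<^sub>R partial i f (x - y))) \<partial>lborel)"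
        by (rule Bochner_Integration.integral_cong) (auto simp: algebra_simps sum_distrib_left)
      also have "cmod \<dots> \<le> (\<integral>y. cmod (g y) * ((real CARD('n))\<^sup>2 * K * (norm h)\<^sup>2) \<partial>lborel)"
      proof (rule Bochner_Integration.integral_norm_bound_integral)
        show "integrable lborel (\<lambda>y. cmod (g y) * ((real CARD('n))\<^sup>2 * K * (norm h)\<^sup>2))" using g by auto
        have "integrable lborel (\<lambda>y. g y * f (x + h - y) - g y * f (x - y) - (\<Sum>i\<in>UNIV. (h $ i) *\<^sub>R (g y * partial i f (x - y))))"
          using If Ip by auto
        moreover have "(\<lambda>y. g y * (f (x - y + h) - f (x - y) - (\<Sum>i\<in>UNIV. (h $ i) *\<^sub>R partial i f (x - y)))) =
           (\<lambda>y. g y * f (x + h - y) - g y * f (x - y) - (\<Sum>i\<in>UNIV. (h $ i) *\<^sub>R (g y * partial i f (x - y))))"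
          by (auto simp: algebra_simps sum_distrib_left)
        ultimately show "integrable lborel (\<lambda>y. g y * (f (x - y + h) - f (x - y) - (\<Sum>i\<in>UNIV. (h $ i) *\<^sub>R partial i f (x - y))))" by simp
        fix y
        show "norm (g y * (f (x - y + h) - f (x - y) - (\<Sum>i\<in>UNIV. (h $ i) *\<^sub>R partial i f (x - y)))) \<le> cmod (g y) * ((real CARD('n))\<^sup>2 * K * (norm h)\<^sup>2)"
          unfolding norm_mult by (intro mult_left_mono bounded_second_derivative_remainder f K) auto
      qed
      also have "\<dots> = L * (norm h)\<^sup>2" using g by (simp add: L_def)
      finally show ?thesis .
    qed
    show ?thesis unfolding has_derivative_at_alt
    proof (intro conjI allI impI)
      show "bounded_linear (\<lambda>h. \<Sum>i\<in>UNIV. (h $ i) *\<^sub>R conv (partial i f) g x)"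
        by (intro bounded_linear_sum bounded_linear_scaleR_const bounded_linear_vec_nth)
      fix e :: real assume e: "e > 0"
      show "\<exists>d>0. \<forall>y. norm (y - x) < d \<longrightarrow> norm (conv f g y - conv f g x - (\<Sum>i\<in>UNIV. ((y - x) $ i) *\<^sub>R conv (partial i f) g x)) \<le> e * norm (y - x)"
      proof (intro exI[of _ "e / (L + 1)"] conjI allI impI)
        show "e / (L + 1) > 0" using e L0 by simp
        fix y assume y: "norm (y - x) < e / (L + 1)"
        have "norm (conv f g y - conv f g x - (\<Sum>i\<in>UNIV. ((y - x) $ i) *\<^sub>R conv (partial i f) g x)) \<le> L * (norm (y - x))\<^sup>2"
          using main[of "y - x"] by simp
        also have "\<dots> = (L * norm (y - x)) * norm (y - x)" by (simp add: power2_eq_square)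
        also have "L * norm (y - x) \<le> (L + 1) * norm (y - x)" by (simp add: algebra_simps)
        also have "\<dots> \<le> e" using y L0 by (simp add: field_simps)
        finally show "norm (conv f g y - conv f g x - (\<Sum>i\<in>UNIV. ((y - x) $ i) *\<^sub>R conv (partial i f) g x)) \<le> e * norm (y - x)"
          by (simp add: mult_right_mono)
      qed
    qed
  qed
  have pc: "partial i (conv f g) = conv (partial i f) g" if "P f" for f i
  proof
    fix x
    show "partial i (conv f g) x = conv (partial i f) g x"
      using partialI[OF der[OF that, of x], of i] by (simp add: sum_axis_scaleR)
  qed
  have Pf: "P f" using f K by (simp add: P_def)
  show "smooth (conv f g)"
  proof (rule smooth_coinduct[where P = "\<lambda>h. \<exists>f. P f \<and> h = conv f g"])
    show "\<exists>fa. P fa \<and> conv f g = conv fa g" using Pf by blast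
    show "h differentiable (at x)" if "\<exists>f. P f \<and> h = conv f g" for h x
      using that der unfolding differentiable_def by blast
    show "\<exists>f. P f \<and> partial i h = conv f g" if "\<exists>f. P f \<and> h = conv f g" for h i
      using that pc Pp by blast
  qed
  have Ppd: "P (pd is f)" for "is" by (induction "is") (use Pf Pp in auto)
  show "pd is (conv f g) = conv (pd is f) g"
    by (induction "is") (auto simp: pc[OF Ppd])
qed

section \<open>The test function spaces\<close>

lemma gs_le_pd:
  "gs_le M A l q C f \<Longrightarrow> smooth f \<Longrightarrow> cmod (pd is f x) * wgt A q x \<le> C * (l ^ length is * M (length is))"
  by (simp add: gs_le_iff_pd wgt_def)

lemma gs_leI:
  "smooth f \<Longrightarrow> (\<And>is x. cmod (pd is f x) * wgt A q x \<le> C * (l ^ length is * M (length is))) \<Longrightarrow> gs_le M A l q C f"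
  by (simp add: gs_le_iff_pd wgt_def)

lemma gs_le_pd_div:
  "gs_le M A l q C f \<Longrightarrow> smooth f \<Longrightarrow> cmod (pd is f x) \<le> C * (l ^ length is * M (length is)) / wgt A q x"
  using gs_le_pd[of M A l q C f "is" x] by (simp add: pos_le_divide_eq)

locale gs = M: wseq M + A: wseq A for M A :: "nat \<Rightarrow> real"
begin

lemma gs_le_nonneg:
  assumes "gs_le M A l q C f" shows "C \<ge> 0"
proof -
  define z :: "'a \<Rightarrow> nat" where "z = (\<lambda>_. 0)"
  have "mlen z = 0" by (simp add: mlen_def z_def)
  then have "cmod (mderiv z f undefined) * exp (assoc_fun A (q * norm (undefined::real^'a))) \<le> C * M 0"
    using assms unfolding gs_le_def by (metis mult_1 power_0)
  then have "0 \<le> C * M 0" by (meson exp_ge_zero mult_nonneg_nonneg norm_ge_zero order_trans)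
  then show ?thesis using M.pos[of 0] by (simp add: zero_le_mult_iff)
qed

lemma gs_le_mono:
  assumes g: "gs_le M A l q C f" and "0 < l" "l \<le> l'" "0 \<le> q'" "q' \<le> q" "C \<le> C'"
  shows "gs_le M A l' q' C' f"
  unfolding gs_le_def
proof (intro allI)
  fix \<alpha> x
  have C: "C \<ge> 0" using gs_le_nonneg[OF g] .
  have "cmod (mderiv \<alpha> f x) * exp (assoc_fun A (q' * norm x)) \<le> cmod (mderiv \<alpha> f x) * exp (assoc_fun A (q * norm x))"
    using assms by (intro mult_left_mono) (auto intro!: A.assoc_mono mult_right_mono)
  also have "\<dots> \<le> C * (l ^ mlen \<alpha> * M (mlen \<alpha>))" using g by (simp add: gs_le_def)
  also have "\<dots> \<le> C' * (l' ^ mlen \<alpha> * M (mlen \<alpha>))"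
    using assms C by (intro mult_mono power_mono) auto
  finally show "cmod (mderiv \<alpha> f x) * exp (assoc_fun A (q' * norm x)) \<le> C' * (l' ^ mlen \<alpha> * M (mlen \<alpha>))" .
qed

lemma gs_le_gs_norm:
  assumes "\<phi> \<in> gs_space M A l q" "l > 0"
  shows "gs_le M A l q (gs_norm M A l q \<phi>) \<phi>"
proof -
  let ?F = "\<lambda>(\<alpha>, x). cmod (mderiv \<alpha> \<phi> x) * exp (assoc_fun A (q * norm x)) / (l ^ mlen \<alpha> * M (mlen \<alpha>))"
  have p: "l ^ n * M n > 0" for n using assms M.pos by simp
  obtain C where "gs_le M A l q C \<phi>" using assms by (auto simp: gs_space_def)
  then have "\<forall>y. ?F y \<le> C" using p by (auto simp: gs_le_def divide_le_eq)
  then have "bdd_above (range ?F)" by (auto simp: bdd_above_def)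
  then have "?F (\<alpha>, x) \<le> gs_norm M A l q \<phi>" for \<alpha> x
    unfolding gs_norm_def by (rule cSUP_upper[OF UNIV_I])
  then show ?thesis using p by (simp add: gs_le_def divide_le_eq)
qed

lemma gs_norm_le:
  assumes "gs_le M A l q C \<phi>" "l > 0"
  shows "gs_norm M A l q \<phi> \<le> C"
proof -
  have p: "l ^ n * M n > 0" for n using assms M.pos by simp
  show ?thesis unfolding gs_norm_def
    using assms p by (intro cSUP_least) (auto simp: gs_le_def divide_le_eq)
qed

lemma TS_smooth: "\<phi> \<in> TS b M A \<Longrightarrow> smooth \<phi>"
  by (cases b) (auto simp: TS_def gs_space_def dest: spec[of _ 1])

text \<open>The spaces are indexed by the coupled pair (l, 1/l), but the step
  \<open>min l (1 / q)\<close> refines an arbitrary pair. Separate parameters are easier to follow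
  through operations that change only one of them.\<close>

lemma TS_True_gs_le:
  assumes "\<phi> \<in> TS True M A" "l > 0" "q > 0"
  obtains C where "C > 0" "gs_le M A l q C \<phi>"
proof -
  define l0 where "l0 = min l (1 / q)"
  have l0: "l0 > 0" "l0 \<le> l" "q \<le> 1 / l0" using assms by (auto simp: l0_def min_def field_simps)
  obtain C where C: "gs_le M A l0 (1 / l0) C \<phi>" using assms l0 by (auto simp: TS_def gs_space_def)
  have "gs_le M A l q (C + 1) \<phi>" by (rule gs_le_mono[OF C]) (use l0 assms in auto)
  moreover have "C + 1 > 0" using gs_le_nonneg[OF C] by simp
  ultimately show ?thesis using that by blast
qed

lemma TS_False_gs_le:
  assumes "\<phi> \<in> TS False M A"
  obtains l q C where "l > 0" "q > 0" "C > 0" "gs_le M A l q C \<phi>"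
proof -
  obtain l C where l: "l > 0" and C: "gs_le M A l (1 / l) C \<phi>" using assms by (auto simp: TS_def gs_space_def)
  have "gs_le M A l (1 / l) (C + 1) \<phi>" by (rule gs_le_mono[OF C]) (use l in auto)
  moreover have "C + 1 > 0" using gs_le_nonneg[OF C] by simp
  ultimately show ?thesis using that[of l "1 / l"] l by simp
qed

lemma gs_le_in_step:
  assumes "gs_le M A l q C \<phi>" "l > 0" "q > 0" "l \<le> l'" "1 / q \<le> l'"
  shows "gs_le M A l' (1 / l') C \<phi>"
  by (rule gs_le_mono[OF assms(1)]) (use assms in \<open>auto simp: field_simps\<close>)

text \<open>The same separation of \<open>l\<close> and \<open>q\<close> for bounded sets, with a
  minimum of steps in the Beurling case and a maximum in the Roumieu case. Boundedness of images
  then becomes a question about single seminorms.\<close>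

lemma TS_bounded_iff:
  "TS_bounded b M A B \<longleftrightarrow> (\<forall>\<phi>\<in>B. smooth \<phi>) \<and>
     (if b then \<forall>l>0. \<forall>q>0. \<exists>C>0. \<forall>\<phi>\<in>B. gs_le M A l q C \<phi>
      else \<exists>l>0. \<exists>q>0. \<exists>C>0. \<forall>\<phi>\<in>B. gs_le M A l q C \<phi>)" (is "_ = ?R")
proof
  assume L: "TS_bounded b M A B"
  have sm: "\<forall>\<phi>\<in>B. smooth \<phi>" using L TS_smooth by (auto simp: TS_bounded_def)
  show ?R
  proof (cases b)
    case True
    have "\<exists>C>0. \<forall>\<phi>\<in>B. gs_le M A l q C \<phi>" if "l > 0" "q > 0" for l q
    proof -
      define l0 where "l0 = min l (1 / q)"
      have l0: "l0 > 0" "l0 \<le> l" "q \<le> 1 / l0" using that by (auto simp: l0_def min_def field_simps)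
      obtain C where C: "\<forall>\<phi>\<in>B. gs_le M A l0 (1 / l0) C \<phi>" using L True l0 by (auto simp: TS_bounded_def)
      have "gs_le M A l q (\<bar>C\<bar> + 1) \<phi>" if "\<phi> \<in> B" for \<phi>
        by (rule gs_le_mono[OF C[rule_format, OF that]]) (use l0 \<open>q > 0\<close> in auto)
      then show ?thesis by (intro exI[of _ "\<bar>C\<bar> + 1"]) auto
    qed
    then show ?thesis using sm True by auto
  next
    case False
    then obtain l C where l: "l > 0" and C: "\<forall>\<phi>\<in>B. gs_le M A l (1 / l) C \<phi>"
      using L by (auto simp: TS_bounded_def)
    have "gs_le M A l (1/l) (\<bar>C\<bar> + 1) \<phi>" if "\<phi> \<in> B" for \<phi>
      by (rule gs_le_mono[OF C[rule_format, OF that]]) (use l in auto)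
    then have "\<exists>l>0. \<exists>q>0. \<exists>C>0. \<forall>\<phi>\<in>B. gs_le M A l q C \<phi>"
      using l by (intro exI[of _ l] conjI exI[of _ "1 / l"] exI[of _ "\<bar>C\<bar> + 1"]) auto
    then show ?thesis using sm False by simp
  qed
next
  assume R: ?R
  show "TS_bounded b M A B"
  proof (cases b)
    case True
    then have "\<exists>C. \<forall>\<phi>\<in>B. gs_le M A l (1 / l) C \<phi>" if "l > 0" for l
      using R that by (metis zero_less_divide_1_iff)
    moreover from this have "\<phi> \<in> TS True M A" if "\<phi> \<in> B" for \<phi>
      using R that unfolding TS_def gs_space_def by (simp, meson)
    ultimately show ?thesis using True by (auto simp: TS_bounded_def)
  next
    case False
    then obtain l q C where l: "l > 0" "q > 0" "C > 0" and C: "\<And>\<phi>. \<phi> \<in> B \<Longrightarrow> gs_le M A l q C \<phi>"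
      using R by auto
    define l0 where "l0 = max l (1 / q)"
    have l0: "l0 > 0" using l by (simp add: l0_def)
    have "gs_le M A l0 (1 / l0) C \<phi>" if "\<phi> \<in> B" for \<phi>
      by (rule gs_le_in_step[OF C[OF that] l(1,2)]) (auto simp: l0_def)
    then have *: "\<forall>\<phi>\<in>B. \<phi> \<in> gs_space M A l0 (1 / l0) \<and> gs_le M A l0 (1 / l0) C \<phi>"
      using R by (auto simp: gs_space_def)
    then have "B \<subseteq> TS False M A" using l0 by (auto simp: TS_def)
    then show ?thesis using False * l0 by (auto simp: TS_bounded_def)
  qed
qed

lemma TS_bounded_singleton: "TS_bounded b M A {\<phi>} \<longleftrightarrow> \<phi> \<in> TS b M A"
proof
  assume "\<phi> \<in> TS b M A"
  then show "TS_bounded b M A {\<phi>}"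
    unfolding TS_bounded_iff using TS_smooth[of \<phi> b] TS_True_gs_le[of \<phi>] TS_False_gs_le[of \<phi>]
    by (cases b; simp; metis)
qed (simp add: TS_bounded_def)

lemma TS_bounded_subset: "TS_bounded b M A B \<Longrightarrow> B' \<subseteq> B \<Longrightarrow> TS_bounded b M A B'"
  unfolding TS_bounded_iff by (cases b) (simp; meson subsetD)+

lemma TS_True_subset: "(TS True M A :: 'n::finite testfun set) \<subseteq> TS b M A"
proof
  fix \<phi> :: "'n testfun" assume 1: "\<phi> \<in> TS True M A"
  then have 2: "\<phi> \<in> gs_space M A 1 (1 / 1)" unfolding TS_def by (metis (mono_tags, lifting) mem_Collect_eq zero_less_one)
  show "\<phi> \<in> TS b M A"
  proof (cases b)
    case False
    have "\<exists>l>0. \<phi> \<in> gs_space M A l (1 / l)" by (rule exI[of _ 1]) (use 2 in simp)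
    then show ?thesis using False by (simp add: TS_def)
  qed (use 1 in simp)
qed

text \<open>In the Roumieu case the exponent of the weight may be assumed to be small, which leaves room
  for multipliers and convolutors of limited decay.\<close>
lemma TS_bounded_image:
  assumes B: "TS_bounded b M A B"
    and sm: "\<And>i \<phi>. i \<in> I \<Longrightarrow> \<phi> \<in> B \<Longrightarrow> smooth (F i \<phi>)"
    and "a > 0" "c > 0" "qm > 0"
    and F: "\<And>l q C. l > 0 \<Longrightarrow> q > 0 \<Longrightarrow> b \<or> q \<le> qm \<Longrightarrow> C > 0 \<Longrightarrow>
       \<exists>C'>0. \<forall>i\<in>I. \<forall>\<phi>\<in>B. gs_le M A l q C \<phi> \<longrightarrow> gs_le M A (a * l) (c * q) C' (F i \<phi>)"
  shows "TS_bounded b M A {F i \<phi> | i \<phi>. i \<in> I \<and> \<phi> \<in> B}"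
proof (cases b)
  case True
  have hB: "\<forall>l>0. \<forall>q>0. \<exists>C>0. \<forall>\<phi>\<in>B. gs_le M A l q C \<phi>"
    using B True by (simp add: TS_bounded_iff)
  have "\<exists>C>0. \<forall>i\<in>I. \<forall>\<phi>\<in>B. gs_le M A l q C (F i \<phi>)" if lq: "l > 0" "q > 0" for l q
  proof -
    obtain C where C: "C > 0" "\<forall>\<phi>\<in>B. gs_le M A (l / a) (q / c) C \<phi>"
      using hB[rule_format, of "l / a" "q / c"] lq assms by auto
    obtain C' where "C' > 0" "\<forall>i\<in>I. \<forall>\<phi>\<in>B. gs_le M A (l / a) (q / c) C \<phi> \<longrightarrow> gs_le M A (a * (l / a)) (c * (q / c)) C' (F i \<phi>)"
      using F[of "l / a" "q / c" C] lq assms True C(1) by auto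
    then show ?thesis using C assms by auto
  qed
  then have "\<forall>l>0. \<forall>q>0. \<exists>C>0. \<forall>\<psi>\<in>{F i \<phi> | i \<phi>. i \<in> I \<and> \<phi> \<in> B}. gs_le M A l q C \<psi>"
    by fast
  then show ?thesis unfolding TS_bounded_iff using sm True by auto
next
  case False
  then obtain l q C where C: "l > 0" "q > 0" "C > 0" "\<forall>\<phi>\<in>B. gs_le M A l q C \<phi>"
    using B unfolding TS_bounded_iff by auto
  define q' where "q' = min q qm"
  have q': "q' > 0" "q' \<le> qm" "q' \<le> q" using C assms by (auto simp: q'_def)
  have C2: "\<forall>\<phi>\<in>B. gs_le M A l q' C \<phi>" using C q' gs_le_mono[of l q C _ l q' C] by auto
  obtain C' where "C' > 0" "\<forall>i\<in>I. \<forall>\<phi>\<in>B. gs_le M A l q' C \<phi> \<longrightarrow> gs_le M A (a * l) (c * q') C' (F i \<phi>)"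
    using F[of l q' C] C q' by auto
  then have "\<exists>l>0. \<exists>q>0. \<exists>C>0. \<forall>\<psi>\<in>{F i \<phi> | i \<phi>. i \<in> I \<and> \<phi> \<in> B}. gs_le M A l q C \<psi>"
    using C C2 q' assms by (intro exI[of _ "a * l"] conjI exI[of _ "c * q'"] exI[of _ C']) auto
  then show ?thesis unfolding TS_bounded_iff using sm False by auto
qed

lemma TS_image:
  assumes "\<phi> \<in> TS b M A" "smooth (F \<phi>)" "a > 0" "c > 0" "qm > 0"
    and F: "\<And>l q C. l > 0 \<Longrightarrow> q > 0 \<Longrightarrow> b \<or> q \<le> qm \<Longrightarrow> C > 0 \<Longrightarrow> gs_le M A l q C \<phi> \<Longrightarrow> \<exists>C'>0. gs_le M A (a * l) (c * q) C' (F \<phi>)"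
  shows "F \<phi> \<in> TS b M A"
proof -
  have "TS_bounded b M A {(\<lambda>_. F) i \<psi> | i \<psi>. i \<in> {()} \<and> \<psi> \<in> {\<phi>}}"
  proof (rule TS_bounded_image[OF TS_bounded_singleton[THEN iffD2, OF assms(1)] _ assms(3-5)])
    fix l q C :: real assume *: "l > 0" "q > 0" "b \<or> q \<le> qm" "C > 0"
    show "\<exists>C'>0. \<forall>i\<in>{()}. \<forall>\<psi>\<in>{\<phi>}. gs_le M A l q C \<psi> \<longrightarrow> gs_le M A (a * l) (c * q) C' (F \<psi>)"
    proof (cases "gs_le M A l q C \<phi>")
      case True
      then show ?thesis using F[OF * True] by auto
    qed (auto intro: exI[of _ 1])
  qed (use assms in auto)
  then show ?thesis by (simp add: TS_bounded_singleton)
qed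

section \<open>Stability under linear combinations, translations, reflections, modulations and
  derivatives\<close>

lemma gs_le_lincomb:
  assumes "gs_le M A l q C f" "gs_le M A l q D g" "smooth f" "smooth g"
  shows "gs_le M A l q (cmod a * C + cmod b * D) (\<lambda>x. a * f x + b * g x)"
proof (rule gs_leI)
  fix "is" x
  have "cmod (a * pd is f x + b * pd is g x) * wgt A q x \<le> (cmod a * cmod (pd is f x) + cmod b * cmod (pd is g x)) * wgt A q x"
    by (intro mult_right_mono) (auto intro: order_trans[OF norm_triangle_ineq] simp: norm_mult)
  also have "\<dots> = cmod a * (cmod (pd is f x) * wgt A q x) + cmod b * (cmod (pd is g x) * wgt A q x)" by (simp add: algebra_simps)
  also have "\<dots> \<le> cmod a * (C * (l ^ length is * M (length is))) + cmod b * (D * (l ^ length is * M (length is)))"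
    using gs_le_pd[OF assms(1,3)] gs_le_pd[OF assms(2,4)] by (intro add_mono mult_left_mono) auto
  finally show "cmod (pd is (\<lambda>x. a * f x + b * g x) x) * wgt A q x \<le> (cmod a * C + cmod b * D) * (l ^ length is * M (length is))"
    by (simp add: pd_lincomb[OF assms(3,4)] algebra_simps)
qed (intro smooth_lincomb assms)

lemma TS_lincomb:
  assumes f: "f \<in> TS b M A" and g: "g \<in> TS b M A"
  shows "(\<lambda>x. a * f x + c * g x) \<in> TS b M A"
proof -
  have s: "smooth f" "smooth g" using f g TS_smooth by auto
  have Bf: "TS_bounded b M A {f}" and Bg: "TS_bounded b M A {g}" using f g by (auto simp: TS_bounded_singleton)
  have "TS_bounded b M A {(\<lambda>x. a * f x + c * g x)}"
  proof (cases b)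
    case True
    have "\<exists>C>0. gs_le M A l q C (\<lambda>x. a * f x + c * g x)" if lq: "l > 0" "q > 0" for l q
    proof -
      obtain C D where CD: "C > 0" "D > 0" "gs_le M A l q C f" "gs_le M A l q D g"
        using Bf Bg lq True unfolding TS_bounded_iff by simp blast
      have "gs_le M A l q (cmod a * C + cmod c * D + 1) (\<lambda>x. a * f x + c * g x)"
        by (rule gs_le_mono[OF gs_le_lincomb[OF CD(3,4) s]]) (use lq in auto)
      moreover have "cmod a * C + cmod c * D + 1 > 0" using CD by (simp add: add_nonneg_pos)
      ultimately show ?thesis by blast
    qed
    then show ?thesis unfolding TS_bounded_iff using True smooth_lincomb[OF s] by auto
  next
    case False
    obtain l1 q1 C where 1: "l1 > 0" "q1 > 0" "C > 0" "gs_le M A l1 q1 C f"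
      using Bf False unfolding TS_bounded_iff by auto
    obtain l2 q2 D where 2: "l2 > 0" "q2 > 0" "D > 0" "gs_le M A l2 q2 D g"
      using Bg False unfolding TS_bounded_iff by auto
    define l where "l = max l1 l2"
    define q where "q = min q1 q2"
    have lq: "l > 0" "q > 0" using 1 2 by (auto simp: l_def q_def)
    have 3: "gs_le M A l q C f" by (rule gs_le_mono[OF 1(4)]) (use 1 2 in \<open>auto simp: l_def q_def\<close>)
    have 4: "gs_le M A l q D g" by (rule gs_le_mono[OF 2(4)]) (use 1 2 in \<open>auto simp: l_def q_def\<close>)
    have "gs_le M A l q (cmod a * C + cmod c * D + 1) (\<lambda>x. a * f x + c * g x)"
      by (rule gs_le_mono[OF gs_le_lincomb[OF 3 4 s]]) (use lq in auto)
    moreover have "cmod a * C + cmod c * D + 1 > 0" using 1 2 by (simp add: add_nonneg_pos)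
    ultimately show ?thesis unfolding TS_bounded_iff using False smooth_lincomb[OF s] lq by auto
  qed
  then show ?thesis by (simp add: TS_bounded_singleton)
qed

lemma TS_cmult: "f \<in> TS b M A \<Longrightarrow> (\<lambda>x. a * f x) \<in> TS b M A"
  using TS_lincomb[of f b f a 0] by simp

lemma TS_add: "f \<in> TS b M A \<Longrightarrow> g \<in> TS b M A \<Longrightarrow> (\<lambda>x. f x + g x) \<in> TS b M A"
  using TS_lincomb[of f b g 1 1] by simp

lemma TS_zero: "(\<lambda>x. 0) \<in> TS b M A"
proof -
  have "gs_le M A l q 0 (\<lambda>x. 0)" for l q by (rule gs_leI[OF smooth_zero]) (simp add: pd_zero)
  then have "TS_bounded b M A {(\<lambda>x. 0)}"
    unfolding TS_bounded_iff using smooth_zero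
    by (cases b) (auto intro!: exI[of _ "1::real"] gs_leI simp: pd_zero)
  then show ?thesis by (simp add: TS_bounded_singleton)
qed

lemma TS_sum: "finite S \<Longrightarrow> (\<And>i. i \<in> S \<Longrightarrow> f i \<in> TS b M A) \<Longrightarrow> (\<lambda>x. \<Sum>i\<in>S. f i x) \<in> TS b M A"
proof (induction S rule: finite_induct)
  case (insert i S)
  then show ?case using TS_add[of "f i" b "\<lambda>x. \<Sum>i\<in>S. f i x"] by simp
qed (simp add: TS_zero)

lemma gs_le_transl:
  assumes f: "smooth f" "gs_le M A l q C f" and q: "q > 0" and l: "l > 0"
  shows "gs_le M A l (q / 2) (C * wgt A q h) (transl h f)"
proof (rule gs_leI[OF smooth_transl[OF f(1)]])
  fix "is" x
  have "cmod (pd is f (x - h)) * wgt A (q / 2) x \<le> cmod (pd is f (x - h)) * (wgt A q (x - h) * wgt A q h)"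
    using A.wgt_add[of "q / 2" "x - h" h] q by (intro mult_left_mono) auto
  also have "\<dots> = (cmod (pd is f (x - h)) * wgt A q (x - h)) * wgt A q h" by simp
  also have "\<dots> \<le> (C * (l ^ length is * M (length is))) * wgt A q h"
    using gs_le_pd[OF f(2,1)] by (intro mult_right_mono) auto
  finally show "cmod (pd is (transl h f) x) * wgt A (q / 2) x \<le> C * wgt A q h * (l ^ length is * M (length is))"
    by (simp add: pd_transl[OF f(1)]) (simp add: transl_def mult_ac)
qed

lemma TS_transl:
  assumes "f \<in> TS b M A" shows "transl h f \<in> TS b M A"
proof (rule TS_image[OF assms, where a = 1 and c = "1/2" and qm = 1])
  show "smooth (transl h f)" using assms TS_smooth smooth_transl by blast
  fix l q C :: real assume *: "l > 0" "q > 0" "C > 0" "gs_le M A l q C f"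
  then show "\<exists>C'>0. gs_le M A (1 * l) (1 / 2 * q) C' (transl h f)"
    using gs_le_transl[OF TS_smooth[OF assms] *(4,2,1), of h]
    by (intro exI[of _ "C * wgt A q h"]) auto
qed auto

lemma gs_le_reflect:
  assumes f: "smooth f" "gs_le M A l q C f"
  shows "gs_le M A l q C (reflect f)"
proof (rule gs_leI[OF smooth_reflect[OF f(1)]])
  fix "is" x
  show "cmod (pd is (reflect f) x) * wgt A q x \<le> C * (l ^ length is * M (length is))"
    using gs_le_pd[OF f(2,1), of "is" "- x"] by (simp add: pd_reflect[OF f(1)] norm_mult norm_power) (simp add: reflect_def)
qed

lemma TS_reflect:
  assumes "f \<in> TS b M A" shows "reflect f \<in> TS b M A"
proof (rule TS_image[OF assms, where a = 1 and c = 1 and qm = 1])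
  show "smooth (reflect f)" using assms TS_smooth smooth_reflect by blast
qed (use gs_le_reflect[OF TS_smooth[OF assms]] in auto)

text \<open>The Leibniz rule and \<open>binomial_weight_sum\<close> with s = 2 pi |xi|. A modulation
  doubles \<open>l\<close> and costs a factor exp(omega_M), the source of all growth in the
  frequency below.\<close>

lemma gs_le_modul:
  fixes f :: "'n::finite testfun"
  assumes f: "smooth f" "gs_le M A l q C f" and l: "l > 0"
  shows "gs_le M A (2 * l) q (C * exp (assoc_fun M (2 * pi * norm \<xi> / l))) (modul \<xi> f)"
proof (rule gs_leI[OF smooth_modul[OF f(1)]])
  fix "is" :: "'n list" and x
  let ?n = "length is" and ?s = "2 * pi * norm \<xi>"
  have C: "C \<ge> 0" using gs_le_nonneg[OF f(2)] .
  have "cmod (pd is (modul \<xi> f) x) \<le>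
     (\<Sum>j\<le>?n. real (?n choose j) * ?s ^ (?n - j) * (C * (l ^ j * M j) / wgt A q x))"
    by (rule pd_modul_bound[OF f(1) gs_le_pd_div[OF f(2,1)]])
  also have "\<dots> = (C / wgt A q x) * (\<Sum>j\<le>?n. real (?n choose j) * ?s ^ (?n - j) * (l ^ j * M j))"
    by (simp add: sum_distrib_left mult_ac)
  also have "\<dots> \<le> (C / wgt A q x) * ((2 * l) ^ ?n * M ?n * exp (assoc_fun M (?s / l)))"
    using M.binomial_weight_sum[of ?s l ?n] l C by (intro mult_left_mono) auto
  finally show "cmod (pd is (modul \<xi> f) x) * wgt A q x \<le> C * exp (assoc_fun M (2 * pi * norm \<xi> / l)) * ((2 * l) ^ ?n * M ?n)"
    by (simp add: pos_le_divide_eq mult_ac)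
qed

lemma TS_modul:
  assumes "f \<in> TS b M A" shows "modul \<xi> f \<in> TS b M A"
proof (rule TS_image[OF assms, where a = 2 and c = 1 and qm = 1])
  show "smooth (modul \<xi> f)" using assms TS_smooth smooth_modul by blast
  fix l q C :: real assume *: "l > 0" "q > 0" "C > 0" "gs_le M A l q C f"
  then show "\<exists>C'>0. gs_le M A (2 * l) (1 * q) C' (modul \<xi> f)"
    using gs_le_modul[OF TS_smooth[OF assms] *(4,1), of \<xi>]
    by (intro exI[of _ "C * exp (assoc_fun M (2 * pi * norm \<xi> / l))"]) auto
qed auto

text \<open>By (M.2)' one more derivative costs a dilation of \<open>l\<close> by H. The factor
  \<open>a\<close> is chosen before \<open>l\<close>, as required by
  \<open>TS_bounded_image\<close>.\<close>

lemma gs_le_partial: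
  "\<exists>a>0. \<forall>l>0. \<exists>K>0. \<forall>q C. \<forall>f::'n::finite testfun. \<forall>i. smooth f \<longrightarrow> gs_le M A l q C f \<longrightarrow> gs_le M A (a * l) q (K * C) (partial i f)"
proof -
  obtain C0 H where H: "C0 \<ge> 1" "H \<ge> 1" "\<And>p. M (Suc p) \<le> C0 * H ^ p * M p" using M.M_Suc by blast
  have "gs_le M A (H * l) q ((C0 * l) * C) (partial i f)" if l: "l > 0" and f: "smooth f" "gs_le M A l q C f" for l q C i and f :: "'n testfun"
  proof (rule gs_leI[OF smooth_partial[OF f(1)]])
    fix "is" x
    have C: "C \<ge> 0" using gs_le_nonneg[OF f(2)] .
    have "cmod (pd (is @ [i]) f x) * wgt A q x \<le> C * (l ^ Suc (length is) * M (Suc (length is)))"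
      using gs_le_pd[OF f(2,1), of "is @ [i]" x] by simp
    also have "\<dots> \<le> C * (l ^ Suc (length is) * (C0 * H ^ length is * M (length is)))"
      using C l H by (intro mult_left_mono) auto
    finally show "cmod (pd is (partial i f) x) * wgt A q x \<le> C0 * l * C * ((H * l) ^ length is * M (length is))"
      by (simp add: pd_append power_mult_distrib mult_ac)
  qed
  then have "\<forall>l>0. \<exists>K>0. \<forall>q C. \<forall>f::'n testfun. \<forall>i. smooth f \<longrightarrow> gs_le M A l q C f \<longrightarrow> gs_le M A (H * l) q (K * C) (partial i f)"
    using H by (metis less_le_trans mult_pos_pos zero_less_one)
  then show ?thesis using H(2) by (intro exI[of _ H]) auto
qed

lemma TS_bounded_partial:
  assumes "TS_bounded b M A B"
  shows "TS_bounded b M A (partial i ` B)"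
proof -
  obtain a where a: "a > 0" "\<And>l. l > 0 \<Longrightarrow> \<exists>K>0. \<forall>q C. \<forall>f::'a testfun. \<forall>i. smooth f \<longrightarrow> gs_le M A l q C f \<longrightarrow> gs_le M A (a * l) q (K * C) (partial i f)"
    using gs_le_partial by blast
  have sB: "smooth \<phi>" if "\<phi> \<in> B" for \<phi> using assms that by (simp add: TS_bounded_iff)
  have "TS_bounded b M A {(\<lambda>_. partial i) j \<phi> | j \<phi>. j \<in> {()} \<and> \<phi> \<in> B}"
  proof (rule TS_bounded_image[OF assms, where a = a and c = 1 and qm = 1])
    fix l q C :: real assume *: "l > 0" "q > 0" "C > 0"
    then obtain K where "K > 0" "\<forall>q C. \<forall>f::'a testfun. \<forall>i. smooth f \<longrightarrow> gs_le M A l q C f \<longrightarrow> gs_le M A (a * l) q (K * C) (partial i f)"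
      using a(2) by blast
    then show "\<exists>C'>0. \<forall>j\<in>{()}. \<forall>\<phi>\<in>B. gs_le M A l q C \<phi> \<longrightarrow> gs_le M A (a * l) (1 * q) C' (partial i \<phi>)"
      using * sB by (intro exI[of _ "K * C"]) auto
  next
    show "smooth (partial i \<phi>)" if "\<phi> \<in> B" for \<phi> using smooth_partial[OF sB[OF that]] .
  qed (use a in auto)
  moreover have "{(\<lambda>_. partial i) j \<phi> | j \<phi>. j \<in> {()} \<and> \<phi> \<in> B} = partial i ` B" by auto
  ultimately show ?thesis by simp
qed

lemma TS_bounded_pd: "TS_bounded b M A B \<Longrightarrow> TS_bounded b M A (pd is ` B)"
  by (induction "is") (simp_all add: image_comp[symmetric] comp_def TS_bounded_partial flip: image_image)

lemma TS_pd: "f \<in> TS b M A \<Longrightarrow> pd is f \<in> TS b M A"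
  using TS_bounded_pd[of b "{f}" "is"] by (simp add: TS_bounded_singleton)

lemma TS_partial: "f \<in> TS b M A \<Longrightarrow> partial i f \<in> TS b M A"
  using TS_pd[of f b "[i]"] by simp

subsection \<open>Decay, integrability and convolution\<close>

lemma TS_pd_decay:
  assumes "f \<in> TS b M A"
  obtains q C where "q > 0" "C > 0" "\<And>x. cmod (pd is f x) \<le> C / wgt A q x"
proof -
  have "\<exists>l q C. l > 0 \<and> q > 0 \<and> C > 0 \<and> gs_le M A l q C f"
    using assms TS_True_gs_le[of f 1 1] TS_False_gs_le[of f] by (cases b) (metis zero_less_one)+
  then obtain l q C where g: "l > 0" "q > 0" "C > 0" "gs_le M A l q C f" by blast
  have "C * (l ^ length is * M (length is)) > 0" using g M.pos by simp
  then show ?thesis using that[OF g(2)] gs_le_pd_div[OF g(4) TS_smooth[OF assms]] by blast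
qed

lemma TS_bound:
  assumes "f \<in> TS b M A"
  obtains K where "\<And>x. cmod (pd is f x) \<le> K"
proof -
  obtain q C where q: "q > 0" "C > 0" "\<And>x. cmod (pd is f x) \<le> C / wgt A q x" using TS_pd_decay[OF assms] by metis
  have "cmod (pd is f x) \<le> C" for x
    using q(3)[of x] A.wgt_ge_1[of q x] q(1,2) by (smt (verit) divide_le_eq_1 frac_le div_by_1)
  then show ?thesis using that by blast
qed

lemma wgt_decay_integrable:
  fixes f :: "'n::finite testfun"
  assumes f: "f \<in> borel_measurable borel" and q: "q > 0" and C: "\<And>x. cmod (f x) \<le> C / wgt A q x"
  shows "integrable lborel f"
proof -
  obtain D where D: "D > 0" "\<And>x::real^'n. 1 / wgt A q x \<le> D / (1 + norm x) ^ (2 * CARD('n))"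
    using A.inverse_wgt_le[OF q] by blast
  show ?thesis
  proof (rule Bochner_Integration.integrable_bound)
    show "integrable lborel (\<lambda>x::real^'n. (\<bar>C\<bar> * D) * (1 / (1 + norm x) ^ (2 * CARD('n))))"
      using integrable_inverse_one_plus_norm by (rule integrable_mult_right)
    show "AE x in lborel. norm (f x) \<le> norm ((\<bar>C\<bar> * D) * (1 / (1 + norm x) ^ (2 * CARD('n))))"
    proof (intro AE_I2)
      fix x :: "real^'n"
      have "norm (f x) \<le> \<bar>C\<bar> * (1 / wgt A q x)" using C[of x] by (simp add: divide_right_mono order_trans[OF C])
      also have "\<dots> \<le> \<bar>C\<bar> * (D / (1 + norm x) ^ (2 * CARD('n)))" using D by (intro mult_left_mono) auto
      finally show "norm (f x) \<le> norm ((\<bar>C\<bar> * D) * (1 / (1 + norm x) ^ (2 * CARD('n))))"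
        using D(1) by (simp add: abs_mult)
    qed
  qed (use f in simp)
qed

lemma TS_measurable: "f \<in> TS b M A \<Longrightarrow> f \<in> borel_measurable borel"
  using TS_smooth smooth_continuous_on borel_measurable_continuous_onI by blast

lemma TS_integrable:
  assumes "f \<in> TS b M A" shows "integrable lborel f"
proof -
  obtain q C where "q > 0" "\<And>x. cmod (pd [] f x) \<le> C / wgt A q x" using TS_pd_decay[OF assms] by metis
  then show ?thesis using wgt_decay_integrable[OF TS_measurable[OF assms], of q C] by simp
qed

lemma smooth_conv_TS: "f \<in> TS b M A \<Longrightarrow> integrable lborel g \<Longrightarrow> smooth (conv f g)"
  using TS_bound[of f b] by (intro smooth_conv TS_smooth) (assumption | metis)+

lemma pd_conv_TS: "f \<in> TS b M A \<Longrightarrow> integrable lborel g \<Longrightarrow> pd is (conv f g) = conv (pd is f) g"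
  using TS_bound[of f b] by (intro pd_conv TS_smooth) (assumption | metis)+

lemma pd_conv_TS2: "g \<in> TS b M A \<Longrightarrow> integrable lborel f \<Longrightarrow> pd is (conv f g) = conv f (pd is g)"
  by (metis pd_conv_TS conv_commute)

text \<open>The weight at x is at most the product of the doubled weights at x - y and y; the first
  is absorbed by the decay of \<open>f\<close>, the second by the weighted L^1 norm of
  \<open>g\<close>.\<close>

lemma conv_wgt_bound:
  fixes f g :: "'n::finite testfun"
  assumes f: "f \<in> borel_measurable borel" "\<And>x. cmod (f x) \<le> C / wgt A (2 * q) x" and C: "C \<ge> 0" and q: "q > 0"
    and g: "integrable lborel (\<lambda>y. cmod (g y) * wgt A (2 * q) y)" "(\<integral>y. cmod (g y) * wgt A (2 * q) y \<partial>lborel) \<le> D"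
    and gm: "g \<in> borel_measurable borel"
  shows "cmod (conv f g x) * wgt A q x \<le> C * D"
proof -
  have "cmod (conv f g x) * wgt A q x \<le> (\<integral>y. cmod (g y * f (x - y)) \<partial>lborel) * wgt A q x"
    by (subst conv_commute) (auto simp: conv_def intro!: mult_right_mono integral_norm_bound)
  also have "\<dots> = (\<integral>y. cmod (g y * f (x - y)) * wgt A q x \<partial>lborel)" by simp
  also have "\<dots> \<le> (\<integral>y. C * (cmod (g y) * wgt A (2 * q) y) \<partial>lborel)"
  proof (rule integral_mono_AE')
    show "integrable lborel (\<lambda>y. C * (cmod (g y) * wgt A (2 * q) y))" using g(1) by simp
    show "AE y in lborel. cmod (g y * f (x - y)) * wgt A q x \<le> C * (cmod (g y) * wgt A (2 * q) y)"
    proof (intro AE_I2)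
      fix y
      have "cmod (f (x - y)) * wgt A q x \<le> (C / wgt A (2 * q) (x - y)) * (wgt A (2 * q) (x - y) * wgt A (2 * q) y)"
        using f(2)[of "x - y"] A.wgt_add[of q "x - y" y] q C by (intro mult_mono) auto
      also have "\<dots> = C * wgt A (2 * q) y" by simp
      finally have "cmod (g y) * (cmod (f (x - y)) * wgt A q x) \<le> cmod (g y) * (C * wgt A (2 * q) y)"
        by (rule mult_left_mono) simp
      then show "cmod (g y * f (x - y)) * wgt A q x \<le> C * (cmod (g y) * wgt A (2 * q) y)"
        by (simp add: norm_mult mult_ac)
    qed
  qed (use C in auto)
  also have "\<dots> = C * (\<integral>y. cmod (g y) * wgt A (2 * q) y \<partial>lborel)" by simp
  also have "\<dots> \<le> C * D" using g(2) C by (rule mult_left_mono)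
  finally show ?thesis .
qed

lemma integrable_of_wgt:
  assumes gm: "g \<in> borel_measurable borel" and q: "q \<ge> 0" and g: "integrable lborel (\<lambda>y. cmod (g y) * wgt A q y)"
  shows "integrable lborel g"
proof (rule Bochner_Integration.integrable_bound[OF g])
  show "AE y in lborel. norm (g y) \<le> norm (cmod (g y) * wgt A q y)"
    using A.wgt_ge_1[OF q] by (auto simp: abs_mult mult_le_cancel_left1)
qed (use gm in simp)

text \<open>All derivatives fall on \<open>f\<close>, so \<open>g\<close> enters only through a
  weighted L^1 norm. The bound for the functional on a cube rests on this asymmetry.\<close>

lemma gs_le_conv:
  fixes f g :: "'n::finite testfun"
  assumes f: "f \<in> TS b M A" "gs_le M A l (2 * q) C f" and lq: "l > 0" "q > 0"
    and g: "integrable lborel (\<lambda>y. cmod (g y) * wgt A (2 * q) y)" "(\<integral>y. cmod (g y) * wgt A (2 * q) y \<partial>lborel) \<le> D"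
    and gm: "g \<in> borel_measurable borel"
  shows "gs_le M A l q (C * D) (conv f g)"
proof -
  have C: "C \<ge> 0" using gs_le_nonneg[OF f(2)] .
  have gi: "integrable lborel g" using integrable_of_wgt[OF gm _ g(1)] lq by simp
  show ?thesis
  proof (rule gs_leI[OF smooth_conv_TS[OF f(1) gi]])
    fix "is" x
    have "cmod (conv (pd is f) g x) * wgt A q x \<le> (C * (l ^ length is * M (length is))) * D"
      by (rule conv_wgt_bound[OF TS_measurable[OF TS_pd[OF f(1)]] gs_le_pd_div[OF f(2) TS_smooth[OF f(1)]]])
        (use C lq g gm in auto)
    then show "cmod (pd is (conv f g) x) * wgt A q x \<le> C * D * (l ^ length is * M (length is))"
      by (simp add: pd_conv_TS[OF f(1) gi] mult_ac)
  qed
qed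

section \<open>From decay to weighted integrability\<close>

lemma wgt_quotient_integrable:
  "\<exists>K\<ge>1. \<forall>q>0. integrable lborel (\<lambda>x::real^'n::finite. wgt A q x / wgt A (K * q) x)"
proof -
  obtain K where K: "K \<ge> 1" "\<And>q. q > 0 \<Longrightarrow> \<exists>C>0. \<forall>x::real^'n. (1 + norm x) ^ (2 * CARD('n)) * wgt A q x \<le> C * wgt A (K * q) x"
    using A.wgt_absorb[of "2 * CARD('n)"] by blast
  have "integrable lborel (\<lambda>x::real^'n. wgt A q x / wgt A (K * q) x)" if q0: "q > 0" for q
  proof -
    obtain C where C: "C > 0" "\<And>x::real^'n. (1 + norm x) ^ (2 * CARD('n)) * wgt A q x \<le> C * wgt A (K * q) x"
      using K(2)[OF q0] by blast
    show ?thesis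
    proof (rule Bochner_Integration.integrable_bound)
      show "integrable lborel (\<lambda>x::real^'n. C * (1 / (1 + norm x) ^ (2 * CARD('n))))"
        using integrable_inverse_one_plus_norm by (rule integrable_mult_right)
      show "AE x::real^'n in lborel. norm (wgt A q x / wgt A (K * q) x) \<le> norm (C * (1 / (1 + norm x) ^ (2 * CARD('n))))"
      proof (intro AE_I2)
        fix x :: "real^'n"
        have "(1 + norm x) ^ (2 * CARD('n)) > 0" by (simp add: add_pos_nonneg)
        then show "norm (wgt A q x / wgt A (K * q) x) \<le> norm (C * (1 / (1 + norm x) ^ (2 * CARD('n))))"
          using C(2)[of x] C(1) by (simp add: field_simps)
      qed
    qed simp
  qed
  then show ?thesis using K(1) by blast
qed

definition dom :: "'n::finite itself \<Rightarrow> real \<Rightarrow> real \<Rightarrow> bool" where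
  "dom _ q r \<longleftrightarrow> integrable lborel (\<lambda>x::real^'n. wgt A q x / wgt A r x)"

text \<open>A dilation factor depending on \<open>A\<close> and the dimension alone: decay with
  weight \<open>domK t * q\<close> implies integrability against the weight with parameter
  \<open>q\<close>.\<close>

definition domK :: "'n::finite itself \<Rightarrow> real" where
  "domK t = (SOME K. K \<ge> 1 \<and> (\<forall>q>0. dom t q (K * q)))"

lemma domK: "domK t \<ge> 1" "q > 0 \<Longrightarrow> dom (t :: 'n::finite itself) q (domK t * q)"
proof -
  have "\<exists>K. K \<ge> 1 \<and> (\<forall>q>0. dom t q (K * q))"
    using wgt_quotient_integrable[where 'n = 'n] by (auto simp: dom_def)
  then have "domK t \<ge> 1 \<and> (\<forall>q>0. dom t q (domK t * q))" unfolding domK_def by (rule someI_ex)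
  then show "domK t \<ge> 1" "q > 0 \<Longrightarrow> dom t q (domK t * q)" by auto
qed

lemma domD:
  assumes q: "q > 0" and r: "r \<ge> domK TYPE('n::finite) * q"
  shows "integrable lborel (\<lambda>x::real^'n. wgt A q x / wgt A r x)"
proof (rule Bochner_Integration.integrable_bound)
  show "integrable lborel (\<lambda>x::real^'n. wgt A q x / wgt A (domK TYPE('n) * q) x)"
    using domK(2)[OF q, of "TYPE('n)"] by (simp add: dom_def)
  have "domK TYPE('n) * q \<ge> 0" using q domK(1)[of "TYPE('n)"] by simp
  then show "AE x::real^'n in lborel. norm (wgt A q x / wgt A r x) \<le> norm (wgt A q x / wgt A (domK TYPE('n) * q) x)"
    using A.wgt_mono[OF _ r] by (intro AE_I2) (auto intro!: divide_left_mono)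
qed simp

lemma wgt_L1:
  fixes f :: "'n::finite testfun"
  assumes q: "q > 0" and r: "r \<ge> domK TYPE('n) * q" and fm: "f \<in> borel_measurable borel"
    and f: "\<And>x. cmod (f x) \<le> C / wgt A r x"
  shows "integrable lborel (\<lambda>y. cmod (f y) * wgt A q y)"
    and "(\<integral>y. cmod (f y) * wgt A q y \<partial>lborel) \<le> C * (\<integral>x. wgt A q x / wgt A r (x::real^'n) \<partial>lborel)"
proof -
  have *: "cmod (f x) * wgt A q x \<le> C * (wgt A q x / wgt A r x)" for x
    using mult_right_mono[OF f[of x], of "wgt A q x"] by simp
  have I: "integrable lborel (\<lambda>x. C * (wgt A q x / wgt A r (x::real^'n)))" by (rule integrable_mult_right[OF domD[OF q r]])
  show 1: "integrable lborel (\<lambda>y. cmod (f y) * wgt A q y)"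
  proof (rule Bochner_Integration.integrable_bound[OF I])
    show "AE x in lborel. norm (cmod (f x) * wgt A q x) \<le> norm (C * (wgt A q x / wgt A r x))"
      using order_trans[OF * abs_ge_self] by (intro AE_I2) (simp add: abs_mult)
  qed (use fm in measurable)
  have "(\<integral>y. cmod (f y) * wgt A q y \<partial>lborel) \<le> (\<integral>x. C * (wgt A q x / wgt A r (x::real^'n)) \<partial>lborel)"
    using Bochner_Integration.integral_mono[OF 1 I] * by blast
  then show "(\<integral>y. cmod (f y) * wgt A q y \<partial>lborel) \<le> C * (\<integral>x. wgt A q x / wgt A r (x::real^'n) \<partial>lborel)" by (simp only: integral_mult_right_zero)
qed

lemma TS_True_wgt_integrable:
  fixes f :: "'n::finite testfun"
  assumes "f \<in> TS True M A" "q > 0"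
  shows "integrable lborel (\<lambda>y. cmod (f y) * wgt A q y)"
proof -
  have r: "domK TYPE('n) * q > 0" using assms(2) domK(1)[of "TYPE('n)"] by simp
  obtain C where C: "C > 0" "gs_le M A 1 (domK TYPE('n) * q) C f" using TS_True_gs_le[OF assms(1) _ r, of 1] by auto
  show ?thesis
    by (rule wgt_L1(1)[OF assms(2) order.refl TS_measurable[OF assms(1)], where C = "C * M 0"])
      (use gs_le_pd_div[OF C(2) TS_smooth[OF assms(1)], of "[]"] in simp)
qed

lemma TS_False_wgt_integrable:
  fixes f :: "'n::finite testfun"
  assumes "f \<in> TS False M A"
  obtains q0 where "q0 > 0" "\<And>q. 0 < q \<Longrightarrow> q \<le> q0 \<Longrightarrow> integrable lborel (\<lambda>y. cmod (f y) * wgt A q y)"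
proof -
  obtain l r C where C: "l > 0" "r > 0" "C > 0" "gs_le M A l r C f" using TS_False_gs_le[OF assms] by blast
  have K: "domK TYPE('n) > 0" using domK(1)[of "TYPE('n)"] by simp
  have "integrable lborel (\<lambda>y. cmod (f y) * wgt A q y)" if q: "0 < q" "q \<le> r / domK TYPE('n)" for q
    by (rule wgt_L1(1)[OF q(1) _ TS_measurable[OF assms], where C = "C * M 0" and r = r])
      (use gs_le_pd_div[OF C(4) TS_smooth[OF assms], of "[]"] q K in \<open>auto simp: field_simps\<close>)
  then show ?thesis using that[of "r / domK TYPE('n)"] C K by simp
qed

lemma TS_wgt_integrable:
  fixes f :: "'n::finite testfun"
  assumes "f \<in> TS b M A"
  obtains q0 where "q0 > 0" "\<And>q. 0 < q \<Longrightarrow> b \<or> q \<le> q0 \<Longrightarrow> integrable lborel (\<lambda>y. cmod (f y) * wgt A q y)"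
proof (cases b)
  case True
  show ?thesis by (rule that[of 1]) (use True TS_True_wgt_integrable[of f] assms in auto)
next
  case False
  then have "f \<in> TS False M A" using assms by simp
  then obtain q0 where "q0 > 0" "\<And>q. 0 < q \<Longrightarrow> q \<le> q0 \<Longrightarrow> integrable lborel (\<lambda>y. cmod (f y) * wgt A q y)"
    using TS_False_wgt_integrable by blast
  then show ?thesis using that[of q0] False by simp
qed

lemma TS_conv:
  fixes f g :: "'n::finite testfun"
  assumes f: "f \<in> TS b M A" and g: "g \<in> TS b M A"
  shows "conv f g \<in> TS b M A"
proof -
  obtain q0 where q0: "q0 > 0" "\<And>q. 0 < q \<Longrightarrow> b \<or> q \<le> q0 \<Longrightarrow> integrable lborel (\<lambda>y. cmod (g y) * wgt A q y)"
    using TS_wgt_integrable[OF g] by blast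
  show ?thesis
  proof (rule TS_image[OF f, where F = "\<lambda>f. conv f g" and a = 1 and c = "1/2" and qm = q0])
    show "smooth (conv f g)" by (rule smooth_conv_TS[OF f TS_integrable[OF g]])
    fix l q C :: real assume *: "l > 0" "q > 0" "b \<or> q \<le> q0" "C > 0" "gs_le M A l q C f"
    let ?D = "(\<integral>y. cmod (g y) * wgt A q y \<partial>lborel)"
    have "gs_le M A l (q / 2) (C * (?D + 1)) (conv f g)"
      by (rule gs_le_conv[OF f]) (use * q0(2)[of q] TS_measurable[OF g] in auto)
    moreover have "?D \<ge> 0" by (intro integral_nonneg_AE) auto
    then have "C * (?D + 1) > 0" using *(4) by (intro mult_pos_pos) linarith+
    ultimately show "\<exists>C'>0. gs_le M A (1 * l) (1 / 2 * q) C' (conv f g)"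
      using * by (intro exI[of _ "C * (?D + 1)"]) auto
  qed (use q0 in auto)
qed

end

section \<open>Vector-valued integrals\<close>

lemma box_exhaustion_tendsto:
  fixes f :: "'a::euclidean_space \<Rightarrow> 'b::{banach, second_countable_topology}"
  assumes f: "integrable lborel f"
  shows "(\<lambda>n. LINT x:cbox (- (real n *\<^sub>R One)) (real n *\<^sub>R One)|lborel. f x) \<longlonglongrightarrow> integral\<^sup>L lborel f"
  unfolding set_lebesgue_integral_def
proof (rule integral_dominated_convergence[where w = "\<lambda>x. norm (f x)"])
  show "AE x in lborel. (\<lambda>n. indicat_real (cbox (- (real n *\<^sub>R One)) (real n *\<^sub>R One)) x *\<^sub>R f x) \<longlonglongrightarrow> f x"
  proof (intro AE_I2)
    fix x :: 'a
    obtain N :: nat where N: "norm x \<le> real N" using real_arch_simple by blast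
    have "indicat_real (cbox (- (real n *\<^sub>R One)) (real n *\<^sub>R One)) x *\<^sub>R f x = f x" if "n \<ge> N" for n
    proof -
      have "x \<in> cbox (- (real n *\<^sub>R One)) (real n *\<^sub>R One)"
      proof (simp add: mem_box, intro ballI)
        fix b :: 'a assume b: "b \<in> Basis"
        have "\<bar>x \<bullet> b\<bar> \<le> real n" using Basis_le_norm[OF b, of x] N that by simp
        then show "- real n \<le> x \<bullet> b \<and> x \<bullet> b \<le> real n" by auto
      qed
      then show ?thesis by simp
    qed
    then show "(\<lambda>n. indicat_real (cbox (- (real n *\<^sub>R One)) (real n *\<^sub>R One)) x *\<^sub>R f x) \<longlonglongrightarrow> f x"
      by (intro tendsto_eventually eventually_sequentiallyI[of N]) auto
  qed
qed (use f in \<open>auto simp: indicator_def\<close>)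

text \<open>The type \<open>'e\<close> carries no separability. Integrals of the continuous function
  over growing boxes are Cauchy, their differences being dominated by those for \<open>g\<close>.
  Recording the limit through bounded functionals is enough, because \<open>\<iota>\<close>
  separates the points of the space.\<close>

lemma banach_integral_exists:
  fixes F :: "'a::euclidean_space \<Rightarrow> 'e::banach"
  assumes F: "continuous_on UNIV F" and g: "integrable lborel g" and Fg: "\<And>y. norm (F y) \<le> g y"
  shows "\<exists>I. norm I \<le> integral\<^sup>L lborel g \<and>
    (\<forall>L :: 'e \<Rightarrow> complex. bounded_linear L \<longrightarrow> L I = (\<integral>y. L (F y) \<partial>lborel))"
proof -
  define B where "B = (\<lambda>n. cbox (- (real n *\<^sub>R One)) (real n *\<^sub>R One :: 'a))"
  define I where "I = (\<lambda>n. integral (B n) F)"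
  define J where "J = (\<lambda>n. integral (B n) g)"
  have Bmono: "B n \<subseteq> B m" if "n \<le> m" for n m
    using that unfolding B_def by (intro subset_box_imp) auto
  have Fi: "F integrable_on B n" for n
    unfolding B_def by (rule integrable_continuous) (rule continuous_on_subset[OF F], simp)
  have setg: "set_integrable lborel (B n) g" for n
    unfolding B_def set_integrable_def by (rule integrable_mult_indicator[OF _ g]) simp
  have gi: "g integrable_on B n" and Jn: "J n = (LINT x:B n|lborel. g x)" for n
    using set_borel_integral_eq_integral[OF setg[of n]] by (auto simp: J_def)
  have Jlim: "J \<longlonglongrightarrow> integral\<^sup>L lborel g"
    proof -
    have "J = (\<lambda>n. LINT x:cbox (- (real n *\<^sub>R One)) (real n *\<^sub>R One)|lborel. g x)"
      using Jn by (auto simp: B_def)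
    then show ?thesis using box_exhaustion_tendsto[OF g] by simp
  qed
  have diff: "norm (I m - I n) \<le> J m - J n" if nm: "n \<le> m" for n m
  proof -
    \<comment> \<open>Extending by zero from the smaller box turns the difference of two integrals
      into one integral over the larger box, to which the norm bound by \<open>g\<close>
      applies.\<close>
    let ?F = "\<lambda>x. if x \<in> B n then F x else 0" and ?g = "\<lambda>x. if x \<in> B n then g x else 0"
    have 1: "(?F has_integral I n) (B m)"
      using has_integral_restrict[OF Bmono[OF nm], of F "I n"] Fi[of n] by (simp add: I_def integrable_integral)
    have 2: "(?g has_integral J n) (B m)"
      using has_integral_restrict[OF Bmono[OF nm], of g "J n"] gi[of n] by (simp add: J_def integrable_integral)
    have 3: "((\<lambda>x. F x - ?F x) has_integral (I m - I n)) (B m)"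
      by (rule has_integral_diff[OF _ 1]) (simp add: I_def Fi integrable_integral)
    have 4: "((\<lambda>x. g x - ?g x) has_integral (J m - J n)) (B m)"
      by (rule has_integral_diff[OF _ 2]) (simp add: J_def gi integrable_integral)
    have "norm (integral (B m) (\<lambda>x. F x - ?F x)) \<le> integral (B m) (\<lambda>x. g x - ?g x)"
      using 3 4 Fg by (intro integral_norm_bound_integral) (auto simp: has_integral_iff)
    then show ?thesis using 3 4 by (simp add: has_integral_iff)
  qed
  have "Cauchy I"
  proof (rule metric_CauchyI)
    fix e :: real assume e: "e > 0"
    obtain N where N: "\<And>m n. m \<ge> N \<Longrightarrow> n \<ge> N \<Longrightarrow> dist (J m) (J n) < e"
      using metric_CauchyD[OF LIMSEQ_imp_Cauchy[OF Jlim] e] by blast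
    have "dist (I m) (I n) < e" if "m \<ge> N" "n \<ge> N" for m n
    proof (cases "n \<le> m")
      case True
      then show ?thesis using diff[OF True] N[OF that] by (simp add: dist_norm)
    next
      case False
      then show ?thesis using diff[of m n] N[OF that] by (simp add: dist_norm norm_minus_commute)
    qed
    then show "\<exists>M. \<forall>m\<ge>M. \<forall>n\<ge>M. dist (I m) (I n) < e" by blast
  qed
  then obtain I0 where I0: "I \<longlonglongrightarrow> I0" by (auto simp: convergent_eq_Cauchy[symmetric] convergent_def)
  have "norm (I n) \<le> J n" for n
    unfolding I_def J_def using Fi gi Fg by (intro integral_norm_bound_integral) auto
  then have "norm I0 \<le> integral\<^sup>L lborel g"
    by (intro LIMSEQ_le[OF tendsto_norm[OF I0] Jlim]) auto
  moreover have "L I0 = (\<integral>y. L (F y) \<partial>lborel)" if L: "bounded_linear L" for L :: "'e \<Rightarrow> complex"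
  proof -
    obtain K where K: "K > 0" "\<And>x. norm (L x) \<le> norm x * K" using bounded_linear.pos_bounded[OF L] by blast
    have cont: "continuous_on UNIV (\<lambda>y. L (F y))" by (rule bounded_linear.continuous_on[OF L F])
    have LF: "integrable lborel (\<lambda>y. L (F y))"
    proof (rule Bochner_Integration.integrable_bound)
      show "integrable lborel (\<lambda>y. K * g y)" using g by simp
      show "AE y in lborel. norm (L (F y)) \<le> norm (K * g y)"
      proof (intro AE_I2)
        fix y
        have "norm (L (F y)) \<le> norm (F y) * K" by (rule K(2))
        also have "\<dots> \<le> g y * K" using Fg K(1) by (intro mult_right_mono) auto
        finally show "norm (L (F y)) \<le> norm (K * g y)" by (simp add: mult.commute)
      qed
    qed (use borel_measurable_continuous_onI[OF cont] in simp)
    have "set_integrable lborel (B n) (\<lambda>y. L (F y))" for n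
      unfolding B_def set_integrable_def by (rule integrable_mult_indicator[OF _ LF]) simp
    from set_borel_integral_eq_integral(2)[OF this]
    have "(LINT x:B n|lborel. L (F x)) = L (I n)" for n
      using integral_linear[OF Fi[of n] L] by (simp add: I_def comp_def)
    then have "(\<lambda>n. L (I n)) \<longlonglongrightarrow> (\<integral>y. L (F y) \<partial>lborel)"
      using box_exhaustion_tendsto[OF LF] by (simp add: B_def)
    moreover have "(\<lambda>n. L (I n)) \<longlonglongrightarrow> L I0" by (rule bounded_linear.tendsto[OF L I0])
    ultimately show ?thesis by (rule LIMSEQ_unique[rotated])
  qed
  ultimately show ?thesis by blast
qed

section \<open>Convolution identities\<close>

lemma reflect_conv: "reflect (conv f g) = conv (reflect f) (reflect g)"
proof
  fix x
  have "(\<integral>y. f y * g (- x - y) \<partial>lborel) = (\<integral>y. (\<lambda>y. f y * g (- x - y)) (0 - y) \<partial>lborel)"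
    by (rule integral_lborel_diff[symmetric])
  then show "reflect (conv f g) x = conv (reflect f) (reflect g) x"
    by (simp add: reflect_def conv_def algebra_simps)
qed

lemma modul_conv: "modul \<xi> (conv f g) = conv (modul \<xi> f) (modul \<xi> g)"
proof
  fix x
  have "exp (2 * of_real pi * \<i> * of_real (\<xi> \<bullet> x)) * (f y * g (x - y)) =
     modul \<xi> f y * modul \<xi> g (x - y)" for y
    unfolding modul_def by (simp add: exp_add[symmetric] inner_diff_right algebra_simps)
  then show "modul \<xi> (conv f g) x = conv (modul \<xi> f) (modul \<xi> g) x"
    unfolding conv_def by (subst modul_def) (simp add: integral_mult_right_zero[symmetric])
qed

lemma conv_reflect_eq: "conv \<phi> (reflect \<psi>) x = (\<integral>t. \<phi> (x + t) * \<psi> t \<partial>lborel)"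
proof -
  have "(\<integral>y. \<phi> y * reflect \<psi> (x - y) \<partial>lborel) = (\<integral>t. (\<lambda>y. \<phi> y * reflect \<psi> (x - y)) (x + t) \<partial>lborel)"
    by (rule integral_lborel_plus[symmetric])
  then show ?thesis by (simp add: conv_def reflect_def)
qed

context gs
begin

lemma conv_assoc:
  fixes f g h :: "'n::finite testfun"
  assumes f: "f \<in> TS b M A" and g: "g \<in> TS b M A" and h: "h \<in> TS b M A"
  shows "conv (conv f g) h = conv f (conv g h)"
proof
  fix x
  have [measurable]: "f \<in> borel_measurable borel" "g \<in> borel_measurable borel" "h \<in> borel_measurable borel"
    using TS_measurable f g h by blast+
  obtain K where K: "\<And>x. cmod (pd [] g x) \<le> K" using TS_bound[OF g] by metis
  have hi: "integrable lborel (\<lambda>y. h (x - y))" by (rule integrable_lborel_diff[OF TS_integrable[OF h]])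
  have "conv (conv f g) h x = (\<integral>y. (\<integral>z. f z * h (x - y) * g (y - z) \<partial>lborel) \<partial>lborel)"
    unfolding conv_def by (rule Bochner_Integration.integral_cong[OF refl]) (subst integral_mult_left_zero[symmetric], simp add: mult_ac)
  also have "\<dots> = (\<integral>z. (\<integral>y. f z * h (x - y) * (\<lambda>(z, y). g (y - z)) (z, y) \<partial>lborel) \<partial>lborel)"
    using Fubini_product_swap[OF TS_integrable[OF f] hi, of "\<lambda>(z, y). g (y - z)" K] K by simp
  also have "\<dots> = (\<integral>z. f z * (\<integral>y. g (y - z) * h (x - y) \<partial>lborel) \<partial>lborel)"
    by (rule Bochner_Integration.integral_cong[OF refl]) (subst integral_mult_right_zero[symmetric], simp add: mult_ac)
  also have "\<dots> = (\<integral>z. f z * (\<integral>y. g y * h (x - z - y) \<partial>lborel) \<partial>lborel)"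
  proof (rule Bochner_Integration.integral_cong[OF refl])
    fix z
    show "f z * (\<integral>y. g (y - z) * h (x - y) \<partial>lborel) = f z * (\<integral>y. g y * h (x - z - y) \<partial>lborel)"
      using integral_lborel_plus[of "\<lambda>y. g (y - z) * h (x - y)" z] by (simp add: algebra_simps)
  qed
  finally show "conv (conv f g) h x = conv f (conv g h) x" by (simp add: conv_def)
qed

text \<open>Both are Fubini's theorem. The first identity, an average over translates of the test
  function, is what \<open>conv_in_E\<close> extends by density from embedded test functions to the
  whole space.\<close>

lemma fun_ud_conv_reflect:
  fixes u \<phi> \<psi> :: "'n::finite testfun"
  assumes u: "u \<in> TS b M A" and \<phi>: "\<phi> \<in> TS b M A" and \<psi>: "\<psi> \<in> TS b M A"
  shows "fun_ud u (conv \<phi> (reflect \<psi>)) = (\<integral>t. \<psi> t * fun_ud u (transl (- t) \<phi>) \<partial>lborel)"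
    and "fun_ud u (conv \<phi> (reflect \<psi>)) = fun_ud (conv u \<psi>) \<phi>"
proof -
  have [measurable]: "u \<in> borel_measurable borel" "\<phi> \<in> borel_measurable borel" "\<psi> \<in> borel_measurable borel"
    using TS_measurable u \<phi> \<psi> by blast+
  obtain K where K: "\<And>x. cmod (pd [] \<phi> x) \<le> K" using TS_bound[OF \<phi>] by metis
  obtain K' where K': "\<And>x. cmod (pd [] \<psi> x) \<le> K'" using TS_bound[OF \<psi>] by metis
  have "fun_ud u (conv \<phi> (reflect \<psi>)) = (\<integral>x. (\<integral>t. u x * \<psi> t * (\<lambda>(x, t). \<phi> (x + t)) (x, t) \<partial>lborel) \<partial>lborel)"
    unfolding fun_ud_def conv_reflect_eq
    by (rule Bochner_Integration.integral_cong[OF refl]) (subst integral_mult_right_zero[symmetric], simp add: mult_ac)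
  also have "\<dots> = (\<integral>t. (\<integral>x. u x * \<psi> t * \<phi> (x + t) \<partial>lborel) \<partial>lborel)"
    using Fubini_product_swap[OF TS_integrable[OF u] TS_integrable[OF \<psi>], of "\<lambda>(x, t). \<phi> (x + t)" K] K by simp
  also have "\<dots> = (\<integral>t. \<psi> t * fun_ud u (transl (- t) \<phi>) \<partial>lborel)"
    unfolding fun_ud_def transl_def
    by (rule Bochner_Integration.integral_cong[OF refl]) (subst integral_mult_right_zero[symmetric], simp add: mult_ac)
  finally show "fun_ud u (conv \<phi> (reflect \<psi>)) = (\<integral>t. \<psi> t * fun_ud u (transl (- t) \<phi>) \<partial>lborel)" .
  have "fun_ud u (conv \<phi> (reflect \<psi>)) = (\<integral>x. (\<integral>y. u x * \<phi> y * (\<lambda>(x, y). \<psi> (y - x)) (x, y) \<partial>lborel) \<partial>lborel)"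
    unfolding fun_ud_def conv_def reflect_def
    by (rule Bochner_Integration.integral_cong[OF refl]) (subst integral_mult_right_zero[symmetric], simp add: mult_ac)
  also have "\<dots> = (\<integral>y. (\<integral>x. u x * \<phi> y * \<psi> (y - x) \<partial>lborel) \<partial>lborel)"
    using Fubini_product_swap[OF TS_integrable[OF u] TS_integrable[OF \<phi>], of "\<lambda>(x, y). \<psi> (y - x)" K'] K' by simp
  also have "\<dots> = fun_ud (conv u \<psi>) \<phi>"
    unfolding fun_ud_def conv_def
    by (rule Bochner_Integration.integral_cong[OF refl]) (subst integral_mult_left_zero[symmetric], simp add: mult_ac)
  finally show "fun_ud u (conv \<phi> (reflect \<psi>)) = fun_ud (conv u \<psi>) \<phi>" .
qed

section \<open>Difference quotients of translations and modulations\<close>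

text \<open>Boundedness of these quotients says that a translation by h moves \<open>\<phi>\<close>
  by O(|h|) in every continuous seminorm. The mean value inequality costs one derivative, hence the
  dilation H of \<open>l\<close>, and moves the point by at most 1, hence the factor
  \<open>exp (assoc_fun A q)\<close>.\<close>

lemma TS_bounded_transl_quotients:
  fixes \<phi> :: "'n::finite testfun"
  assumes \<phi>: "\<phi> \<in> TS b M A"
  shows "TS_bounded b M A {(\<lambda>x. of_real (1 / norm h) * transl h \<phi> x + of_real (- 1 / norm h) * \<phi> x) | h. h \<noteq> 0 \<and> norm h \<le> 1}"
proof -
  have s: "smooth \<phi>" using \<phi> TS_smooth by blast
  obtain C0 H where H: "C0 \<ge> 1" "H \<ge> 1" "\<And>p. M (Suc p) \<le> C0 * H ^ p * M p" using M.M_Suc by blast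
  let ?F = "\<lambda>h f. (\<lambda>x. of_real (1 / norm h) * transl h f x + of_real (- 1 / norm h) * f x)"
  have "TS_bounded b M A {?F h f | h f. h \<in> {h. h \<noteq> 0 \<and> norm h \<le> 1} \<and> f \<in> {\<phi>}}"
  proof (rule TS_bounded_image[where a = H and c = "1/2" and qm = 1 and F = ?F])
    fix l q C :: real assume *: "l > 0" "q > 0" "C > 0"
    define C' where "C' = real CARD('n) * (C * l * C0 * exp (assoc_fun A q))"
    have C': "C' > 0" using * H by (auto simp: C'_def intro!: mult_pos_pos)
    have "gs_le M A (H * l) (1 / 2 * q) C' (?F h \<phi>)" if h: "h \<noteq> 0" "norm h \<le> 1" and g: "gs_le M A l q C \<phi>" for h
    proof (rule gs_leI)
      show "smooth (?F h \<phi>)" by (intro smooth_lincomb smooth_transl s)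
      fix "is" :: "'n list" and x :: "real^'n"
      let ?n = "length is"
      define B where "B = C * (l ^ Suc ?n * M (Suc ?n)) * exp (assoc_fun A q) / wgt A (q / 2) x"
      have "cmod (pd is \<phi> (x + (- h)) - pd is \<phi> x) \<le> real CARD('n) * B * norm (- h)"
      proof (rule smooth_difference_bound[OF smooth_pd[OF s]])
        fix i z assume z: "z \<in> closed_segment x (x + - h)"
        have nz: "norm (x - z) \<le> 1"
          using segment_bound(1)[OF z] h by (simp add: norm_minus_commute)
        have "wgt A (q / 2) x \<le> wgt A q z * wgt A q (x - z)"
          using A.wgt_add[of "q / 2" z "x - z"] * by simp
        also have "\<dots> \<le> wgt A q z * exp (assoc_fun A q)"
          using A.wgt_continuous_bound[of q "x - z" 1] nz * by (intro mult_left_mono) auto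
        finally have w: "wgt A (q / 2) x \<le> wgt A q z * exp (assoc_fun A q)" .
        have "cmod (partial i (pd is \<phi>) z) \<le> C * (l ^ Suc ?n * M (Suc ?n)) / wgt A q z"
          using gs_le_pd_div[OF g s, of "i # is" z] by simp
        also have "\<dots> \<le> B"
          unfolding B_def using w * by (simp add: field_simps mult_left_mono)
        finally show "cmod (partial i (pd is \<phi>) z) \<le> B" .
      qed
      then have 1: "cmod (pd is \<phi> (x - h) - pd is \<phi> x) \<le> real CARD('n) * B * norm h" by simp
      have "pd is (?F h \<phi>) x = of_real (1 / norm h) * (pd is \<phi> (x - h) - pd is \<phi> x)"
        by (simp only: pd_lincomb[OF smooth_transl[OF s] s] pd_transl[OF s]) (simp add: transl_def algebra_simps)
      then have "cmod (pd is (?F h \<phi>) x) = (1 / norm h) * cmod (pd is \<phi> (x - h) - pd is \<phi> x)"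
        by (simp add: norm_mult norm_divide)
      also have "\<dots> \<le> (1 / norm h) * (real CARD('n) * B * norm h)" using 1 by (intro mult_left_mono) auto
      also have "\<dots> = real CARD('n) * B" using h by simp
      finally have "cmod (pd is (?F h \<phi>) x) * wgt A (1 / 2 * q) x \<le> (real CARD('n) * B) * wgt A (1 / 2 * q) x"
        by (intro mult_right_mono) auto
      also have "\<dots> = real CARD('n) * (C * l ^ Suc ?n * exp (assoc_fun A q)) * M (Suc ?n)"
        by (simp add: B_def)
      also have "\<dots> \<le> real CARD('n) * (C * l ^ Suc ?n * exp (assoc_fun A q)) * (C0 * H ^ ?n * M ?n)"
        using H * by (intro mult_left_mono) auto
      finally show "cmod (pd is (?F h \<phi>) x) * wgt A (1 / 2 * q) x \<le> C' * ((H * l) ^ ?n * M ?n)"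
        by (simp add: C'_def power_mult_distrib mult_ac)
    qed
    then show "\<exists>C'>0. \<forall>h\<in>{h. h \<noteq> 0 \<and> norm h \<le> 1}. \<forall>f\<in>{\<phi>}. gs_le M A l q C f \<longrightarrow> gs_le M A (H * l) (1 / 2 * q) C' (?F h f)"
      using C' by (intro exI[of _ C']) auto
  next
    fix h f assume "f \<in> {\<phi>}"
    then have "f = \<phi>" by simp
    then show "smooth (?F h f)" by (simp only:) (intro smooth_lincomb smooth_transl s)
  qed (use H \<phi> in \<open>auto simp: TS_bounded_singleton\<close>)
  then show ?thesis by (rule TS_bounded_subset) auto
qed

lemma cmod_exp_minus_one: "cmod (exp (2 * of_real pi * \<i> * of_real t) - 1) \<le> 2 * pi * \<bar>t\<bar>"
proof -
  have "cmod (exp (\<i> * of_real (2 * pi * t)) - 1) \<le> \<bar>2 * pi * t\<bar>"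
    using iexp_approx1[of "2 * pi * t" 0] by simp
  then show ?thesis by (simp add: abs_mult mult_ac)
qed

text \<open>The commutator of derivatives with the modulation is O(|h|) by the Leibniz bound without
  its top term, and the character differs from 1 by at most 2 pi |h| |x|. The factor |x| is absorbed
  into the weight, which reduces \<open>q\<close> to \<open>q / K\<close>.\<close>

lemma TS_bounded_modul_quotients:
  fixes \<phi> :: "'n::finite testfun"
  assumes \<phi>: "\<phi> \<in> TS b M A"
  shows "TS_bounded b M A {(\<lambda>x. of_real (1 / norm h) * modul h \<phi> x + of_real (- 1 / norm h) * \<phi> x) | h. h \<noteq> 0 \<and> 2 * pi * norm h \<le> 1}"
proof -
  have s: "smooth \<phi>" using \<phi> TS_smooth by blast
  obtain K where K: "K \<ge> 1" "\<And>q. q > 0 \<Longrightarrow> \<exists>C>0. \<forall>x::real^'n. (1 + norm x) ^ 1 * wgt A q x \<le> C * wgt A (K * q) x"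
    using A.wgt_absorb[of 1] by blast
  let ?F = "\<lambda>h f. (\<lambda>x. of_real (1 / norm h) * modul h f x + of_real (- 1 / norm h) * f x)"
  have "TS_bounded b M A {?F h f | h f. h \<in> {h. h \<noteq> 0 \<and> 2 * pi * norm h \<le> 1} \<and> f \<in> {\<phi>}}"
  proof (rule TS_bounded_image[where a = 2 and c = "1/K" and qm = 1 and F = ?F])
    fix l q C :: real assume *: "l > 0" "q > 0" "C > 0"
    obtain D where D: "D > 0" "\<And>x::real^'n. (1 + norm x) * wgt A (q / K) x \<le> D * wgt A q x"
      using K(2)[of "q / K"] K(1) * by auto
    define C' where "C' = 2 * pi * (C * exp (assoc_fun M (1 / l)) * D + C * D)"
    have C': "C' > 0" using * D by (auto simp: C'_def intro!: mult_pos_pos add_pos_pos)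
    have "gs_le M A (2 * l) (1 / K * q) C' (?F h \<phi>)" if h: "h \<noteq> 0" "2 * pi * norm h \<le> 1" and g: "gs_le M A l q C \<phi>" for h
    proof (rule gs_leI)
      show "smooth (?F h \<phi>)" by (intro smooth_lincomb smooth_modul s)
      fix "is" :: "'n list" and x :: "real^'n"
      let ?n = "length is" and ?s = "2 * pi * norm h"
      let ?a = "\<lambda>j. C * (l ^ j * M j) / wgt A q x"
      have a0: "?a j \<ge> 0" for j using * by auto
      have "cmod (pd is (modul h \<phi>) x - modul h (pd is \<phi>) x) \<le>
         (\<Sum>j\<le>?n. real (?n choose j) * ?s ^ (?n - j) * ?a j) - ?a ?n"
        by (rule pd_modul_diff_bound[OF s gs_le_pd_div[OF g s]])
      \<comment> \<open>The subtracted term is the one with j = n, so every remaining term contains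
        a positive power of \<open>?s\<close>; as \<open>?s\<close> is at most 1, one factor
        \<open>?s\<close> can be kept and the others replaced by 1.\<close>
      also have "\<dots> = (\<Sum>j<?n. real (?n choose j) * ?s ^ (?n - j) * ?a j)"
        by (simp add: lessThan_Suc_atMost[symmetric])
      also have "\<dots> \<le> (\<Sum>j<?n. real (?n choose j) * (?s * 1 ^ (?n - j)) * ?a j)"
      proof (intro sum_mono mult_right_mono mult_left_mono)
        fix j assume "j \<in> {..<?n}"
        then have "?s ^ (?n - j) \<le> ?s ^ 1" using h by (intro power_decreasing) auto
        then show "?s ^ (?n - j) \<le> ?s * 1 ^ (?n - j)" by simp
      qed (use a0 in auto)
      also have "\<dots> \<le> (\<Sum>j\<le>?n. real (?n choose j) * (?s * 1 ^ (?n - j)) * ?a j)"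
        by (intro sum_mono2 mult_nonneg_nonneg a0) auto
      also have "\<dots> = (?s * C / wgt A q x) * (\<Sum>j\<le>?n. real (?n choose j) * 1 ^ (?n - j) * (l ^ j * M j))"
        by (simp add: sum_distrib_left mult_ac)
      also have "\<dots> \<le> (?s * C / wgt A q x) * ((2 * l) ^ ?n * M ?n * exp (assoc_fun M (1 / l)))"
        using M.binomial_weight_sum[of 1 l ?n] * by (intro mult_left_mono) auto
      finally have 1: "cmod (pd is (modul h \<phi>) x - modul h (pd is \<phi>) x) \<le> norm h * (2 * pi * C * exp (assoc_fun M (1 / l)) / wgt A q x * ((2 * l) ^ ?n * M ?n))"
        by (simp add: mult_ac)
      have "modul h (pd is \<phi>) x - pd is \<phi> x = (exp (2 * of_real pi * \<i> * of_real (h \<bullet> x)) - 1) * pd is \<phi> x"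
        by (simp add: modul_def algebra_simps)
      then have "cmod (modul h (pd is \<phi>) x - pd is \<phi> x) = cmod (exp (2 * of_real pi * \<i> * of_real (h \<bullet> x)) - 1) * cmod (pd is \<phi> x)"
        by (simp add: norm_mult)
      also have "\<dots> \<le> (2 * pi * (norm h * norm x)) * (C * (l ^ ?n * M ?n) / wgt A q x)"
      proof (intro mult_mono gs_le_pd_div[OF g s])
        show "cmod (exp (2 * of_real pi * \<i> * of_real (h \<bullet> x)) - 1) \<le> 2 * pi * (norm h * norm x)"
          by (rule order_trans[OF cmod_exp_minus_one]) (simp add: Cauchy_Schwarz_ineq2)
      qed auto
      also have "\<dots> \<le> norm h * (2 * pi * C * norm x / wgt A q x * ((2 * l) ^ ?n * M ?n))"
      proof -
        have "l ^ ?n * M ?n \<le> (2 * l) ^ ?n * M ?n" using * by (intro mult_right_mono power_mono) auto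
        then have "(2 * pi * C * norm h * norm x / wgt A q x) * (l ^ ?n * M ?n) \<le> (2 * pi * C * norm h * norm x / wgt A q x) * ((2 * l) ^ ?n * M ?n)"
          using * by (intro mult_left_mono) auto
        then show ?thesis by (simp add: mult_ac)
      qed
      finally have 2: "cmod (modul h (pd is \<phi>) x - pd is \<phi> x) \<le> norm h * (2 * pi * C * norm x / wgt A q x * ((2 * l) ^ ?n * M ?n))" .
      let ?L = "(2 * l) ^ ?n * M ?n"
      have L0: "?L \<ge> 0" using * by simp
      have "cmod (pd is (modul h \<phi>) x - pd is \<phi> x) \<le> cmod (pd is (modul h \<phi>) x - modul h (pd is \<phi>) x) + cmod (modul h (pd is \<phi>) x - pd is \<phi> x)"
        by (rule order_trans[OF _ norm_triangle_ineq]) simp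
      then have "cmod (pd is (modul h \<phi>) x - pd is \<phi> x) \<le> norm h * ((2 * pi * C * exp (assoc_fun M (1 / l)) / wgt A q x + 2 * pi * C * norm x / wgt A q x) * ?L)"
        using 1 2 by (simp add: algebra_simps)
      moreover have "pd is (?F h \<phi>) x = of_real (1 / norm h) * (pd is (modul h \<phi>) x - pd is \<phi> x)"
        by (simp only: pd_lincomb[OF smooth_modul[OF s] s]) (simp add: algebra_simps)
      then have "cmod (pd is (?F h \<phi>) x) = (1 / norm h) * cmod (pd is (modul h \<phi>) x - pd is \<phi> x)"
        by (simp add: norm_mult norm_divide)
      ultimately have "cmod (pd is (?F h \<phi>) x) \<le> (2 * pi * C * exp (assoc_fun M (1 / l)) / wgt A q x + 2 * pi * C * norm x / wgt A q x) * ?L"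
        using h by (simp add: divide_le_eq mult.commute)
      then have "cmod (pd is (?F h \<phi>) x) * wgt A (1 / K * q) x \<le> ((2 * pi * C * exp (assoc_fun M (1 / l)) / wgt A q x + 2 * pi * C * norm x / wgt A q x) * ?L) * wgt A (1 / K * q) x"
        by (intro mult_right_mono) auto
      also have "\<dots> = (2 * pi * C * exp (assoc_fun M (1 / l)) * (wgt A (q / K) x / wgt A q x) + 2 * pi * C * (norm x * wgt A (q / K) x / wgt A q x)) * ?L"
        by (simp add: algebra_simps add_divide_distrib)
      also have "\<dots> \<le> (2 * pi * C * exp (assoc_fun M (1 / l)) * D + 2 * pi * C * D) * ?L"
      proof (intro mult_right_mono[OF _ L0] add_mono mult_left_mono)
        have "wgt A (q / K) x \<le> (1 + norm x) * wgt A (q / K) x"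
          using mult_right_mono[of 1 "1 + norm x" "wgt A (q / K) x"] by simp
        from order_trans[OF this D(2)] show "wgt A (q / K) x / wgt A q x \<le> D" by (simp add: divide_le_eq)
        have "norm x * wgt A (q / K) x \<le> (1 + norm x) * wgt A (q / K) x" by (simp add: mult_right_mono)
        from order_trans[OF this D(2)] show "norm x * wgt A (q / K) x / wgt A q x \<le> D" by (simp add: divide_le_eq)
      qed (use * in auto)
      finally show "cmod (pd is (?F h \<phi>) x) * wgt A (1 / K * q) x \<le> C' * ?L"
        by (simp add: C'_def algebra_simps)
    qed
    then show "\<exists>C'>0. \<forall>h\<in>{h. h \<noteq> 0 \<and> 2 * pi * norm h \<le> 1}. \<forall>f\<in>{\<phi>}. gs_le M A l q C f \<longrightarrow> gs_le M A (2 * l) (1 / K * q) C' (?F h f)"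
      using C' by (intro exI[of _ C']) auto
  next
    fix h f assume "f \<in> {\<phi>}"
    then have "f = \<phi>" by simp
    then show "smooth (?F h f)" by (simp only:) (intro smooth_lincomb smooth_modul s)
  qed (use K \<phi> in \<open>auto simp: TS_bounded_singleton\<close>)
  then show ?thesis by (rule TS_bounded_subset) auto
qed

end

section \<open>Translation-modulation invariant Banach spaces\<close>

lemma transl_transl: "transl a (transl b \<phi>) = transl (a + b) \<phi>"
  by (simp add: transl_def algebra_simps)

lemma conv_cmult_right: "conv f (\<lambda>x. c * g x) = (\<lambda>x. c * conv f g x)"
  by (simp add: conv_def fun_eq_iff mult.left_commute flip: integral_mult_right_zero)

context gs
begin

lemma UD_lin: "T \<in> UD b M A \<Longrightarrow> \<phi> \<in> TS b M A \<Longrightarrow> \<psi> \<in> TS b M A \<Longrightarrow> T (\<lambda>x. c * \<phi> x + d * \<psi> x) = c * T \<phi> + d * T \<psi>"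
  by (simp add: UD_def)

lemma UD_cmult: "T \<in> UD b M A \<Longrightarrow> \<phi> \<in> TS b M A \<Longrightarrow> T (\<lambda>x. c * \<phi> x) = c * T \<phi>"
  using UD_lin[of T b \<phi> \<phi> c 0] by simp

lemma UD_sum:
  assumes "T \<in> UD b M A" "finite S" "\<And>i. i \<in> S \<Longrightarrow> \<phi> i \<in> TS b M A"
  shows "T (\<lambda>x. \<Sum>i\<in>S. c i * \<phi> i x) = (\<Sum>i\<in>S. c i * T (\<phi> i))"
  using assms(2,3)
proof (induction S rule: finite_induct)
  case empty
  then show ?case using UD_cmult[OF assms(1) TS_zero, of 0] by simp
next
  case (insert i S)
  have "(\<lambda>x. \<Sum>j\<in>S. c j * \<phi> j x) \<in> TS b M A" using insert by (intro TS_sum TS_cmult) auto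
  then show ?case using insert UD_lin[OF assms(1), of "\<phi> i" "\<lambda>x. \<Sum>j\<in>S. c j * \<phi> j x" "c i" 1] by simp
qed

text \<open>Any admissible constant \<open>D\<close> dominates \<open>gs_norm\<close>, so continuity
  can be used with explicit bounds instead of a supremum. Enlarging \<open>C\<close> to
  \<open>\<bar>C\<bar> + 1\<close> makes the inequality monotone in the seminorm.\<close>

lemma UD_bound:
  fixes T :: "'n::finite udist"
  assumes T: "T \<in> UD b M A"
  shows "if b then \<exists>l>0. \<exists>C>0. \<forall>\<phi>\<in>TS b M A. \<forall>D. gs_le M A l (1/l) D \<phi> \<longrightarrow> cmod (T \<phi>) \<le> C * D
         else \<forall>l>0. \<exists>C>0. \<forall>\<phi>\<in>TS b M A. \<forall>D. gs_le M A l (1/l) D \<phi> \<longrightarrow> cmod (T \<phi>) \<le> C * D"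
proof -
  have *: "cmod (T \<phi>) \<le> (\<bar>C\<bar> + 1) * D"
    if "cmod (T \<phi>) \<le> C * gs_norm M A l (1/l) \<phi>" "gs_le M A l (1/l) D \<phi>" "l > 0" "\<phi> \<in> TS b M A" for C l D and \<phi> :: "'n testfun"
  proof -
    have sp: "\<phi> \<in> gs_space M A l (1/l)" using that TS_smooth by (auto simp: gs_space_def)
    have n0: "gs_norm M A l (1/l) \<phi> \<ge> 0" using gs_le_nonneg[OF gs_le_gs_norm[OF sp that(3)]] .
    have "C * gs_norm M A l (1/l) \<phi> \<le> (\<bar>C\<bar> + 1) * gs_norm M A l (1/l) \<phi>" using n0 by (intro mult_right_mono) auto
    also have "\<dots> \<le> (\<bar>C\<bar> + 1) * D" using gs_norm_le[OF that(2,3)] by (intro mult_left_mono) auto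
    finally show ?thesis using that(1) by linarith
  qed
  show ?thesis
  proof (cases b)
    case True
    then obtain l C where l: "l > 0" "\<forall>\<phi>\<in>TS b M A. cmod (T \<phi>) \<le> C * gs_norm M A l (1/l) \<phi>"
      using T by (auto simp: UD_def)
    then have "\<forall>\<phi>\<in>TS b M A. \<forall>D. gs_le M A l (1/l) D \<phi> \<longrightarrow> cmod (T \<phi>) \<le> (\<bar>C\<bar> + 1) * D"
      using * by blast
    moreover have "\<bar>C\<bar> + 1 > 0" by simp
    ultimately show ?thesis using True l(1) by (simp, blast)
  next
    case False
    have "\<exists>C>0. \<forall>\<phi>\<in>TS b M A. \<forall>D. gs_le M A l (1/l) D \<phi> \<longrightarrow> cmod (T \<phi>) \<le> C * D" if l: "l > 0" for l
    proof -
      obtain C where C: "\<forall>\<phi>\<in>gs_space M A l (1/l). cmod (T \<phi>) \<le> C * gs_norm M A l (1/l) \<phi>"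
        using T False l by (auto simp: UD_def)
      have "cmod (T \<phi>) \<le> (\<bar>C\<bar> + 1) * D" if h: "\<phi> \<in> TS b M A" "gs_le M A l (1/l) D \<phi>" for \<phi> D
      proof (rule *[OF _ h(2) l h(1)])
        show "cmod (T \<phi>) \<le> C * gs_norm M A l (1/l) \<phi>"
          using C h TS_smooth by (auto simp: gs_space_def)
      qed
      moreover have "\<bar>C\<bar> + 1 > 0" by simp
      ultimately show ?thesis by blast
    qed
    then show ?thesis using False by simp
  qed
qed

lemma fun_ud_linear:
  assumes u: "u \<in> TS b M A" and "\<phi> \<in> TS b M A" "\<psi> \<in> TS b M A"
  shows "fun_ud u (\<lambda>x. c * \<phi> x + d * \<psi> x) = c * fun_ud u \<phi> + d * fun_ud u \<psi>"
proof -
  obtain K where K: "\<And>x. cmod (pd [] u x) \<le> K" using TS_bound[OF u] by metis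
  have "integrable lborel (\<lambda>x. \<phi> x * u x)" "integrable lborel (\<lambda>x. \<psi> x * u x)"
    using assms K TS_measurable[OF u] TS_integrable by (auto intro!: integrable_mult_bounded)
  then have "(\<integral>x. c * (\<phi> x * u x) + d * (\<psi> x * u x) \<partial>lborel) = c * fun_ud u \<phi> + d * fun_ud u \<psi>"
    by (simp add: fun_ud_def mult.commute)
  then show ?thesis by (simp add: fun_ud_def algebra_simps)
qed

end

text \<open>A finite set of multi-indices lies in a box, where the sum factors into one geometric
  sum below 2 for each coordinate.\<close>

lemma summable_on_power_mlen:
  "(\<lambda>\<alpha>::'n::finite \<Rightarrow> nat. (1/2::real) ^ mlen \<alpha>) summable_on UNIV"
proof (rule nonneg_bdd_above_summable_on)
  have "(\<Sum>\<alpha>\<in>F. (1/2::real) ^ mlen \<alpha>) \<le> 2 ^ CARD('n)" if F: "finite F" for F :: "('n \<Rightarrow> nat) set"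
  proof -
    define N where "N = Max (insert 0 ((\<lambda>(\<alpha>, i). \<alpha> i) ` (F \<times> UNIV)))"
    have "\<alpha> i \<le> N" if "\<alpha> \<in> F" for \<alpha> i
      unfolding N_def using F that by (intro Max_ge) (auto intro!: image_eqI[of _ _ "(\<alpha>, i)"])
    then have "F \<subseteq> PiE UNIV (\<lambda>_. {..N})" by auto
    then have "(\<Sum>\<alpha>\<in>F. (1/2::real) ^ mlen \<alpha>) \<le> (\<Sum>\<alpha>\<in>PiE (UNIV::'n set) (\<lambda>_. {..N}). (1/2) ^ mlen \<alpha>)"
      by (intro sum_mono2) (auto intro: finite_PiE)
    also have "\<dots> = (\<Sum>\<alpha>\<in>PiE UNIV (\<lambda>_::'n. {..N}). \<Prod>i\<in>UNIV. (1/2) ^ \<alpha> i)"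
      by (simp add: mlen_def power_sum)
    also have "\<dots> = (\<Prod>i\<in>(UNIV::'n set). \<Sum>m\<in>{..N}. (1/2) ^ m)"
      by (rule prod_sum_PiE[symmetric]) auto
    also have "\<dots> \<le> (\<Prod>i\<in>(UNIV::'n set). 2)"
    proof (rule prod_mono)
      have "(\<Sum>m\<in>{..N}. (1/2::real) ^ m) = 2 - (1/2) ^ N"
        by (induction N) auto
      then have "(\<Sum>m\<in>{..N}. (1/2::real) ^ m) \<le> 2" by simp
      then show "0 \<le> (\<Sum>m\<in>{..N}. (1/2::real) ^ m) \<and> (\<Sum>m\<in>{..N}. (1/2::real) ^ m) \<le> 2"
        by (auto intro: sum_nonneg)
    qed
    finally show ?thesis by simp
  qed
  then show "bdd_above (sum (\<lambda>\<alpha>::'n \<Rightarrow> nat. (1/2::real) ^ mlen \<alpha>) ` {F. F \<subseteq> UNIV \<and> finite F})"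
    by (auto simp: bdd_above_def)
qed auto

locale tmib = gs M A for M A :: "nat \<Rightarrow> real" +
  fixes beur :: bool and \<iota> :: "'e::banach \<Rightarrow> 'n::finite udist"
  assumes TMIB: "TMIB beur M A \<iota>"
begin

abbreviation T :: "'n testfun set" where "T \<equiv> TS beur M A"

lemmas TMIB_props = TMIB[unfolded TMIB_def Let_def ud_eq_def]

lemma iota_UD: "\<iota> e \<in> UD beur M A"
  using TMIB_props[THEN conjunct1] by blast

lemma iota_add: "\<phi> \<in> T \<Longrightarrow> \<iota> (e + e') \<phi> = \<iota> e \<phi> + \<iota> e' \<phi>"
  using TMIB_props[THEN conjunct2, THEN conjunct1] by blast

lemma iota_scaleR: "\<phi> \<in> T \<Longrightarrow> \<iota> (r *\<^sub>R e) \<phi> = of_real r * \<iota> e \<phi>"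
  using TMIB_props[THEN conjunct2, THEN conjunct2, THEN conjunct1] by blast

lemma iota_inj: "(\<And>\<phi>. \<phi> \<in> T \<Longrightarrow> \<iota> e \<phi> = \<iota> e' \<phi>) \<Longrightarrow> e = e'"
  using TMIB_props[THEN conjunct2, THEN conjunct2, THEN conjunct2, THEN conjunct1] by blast

lemmas TMIB_props_from_5 = TMIB_props[THEN conjunct2, THEN conjunct2, THEN conjunct2, THEN conjunct2]
lemmas TMIB_props_from_9 = TMIB_props_from_5[THEN conjunct2, THEN conjunct2, THEN conjunct2, THEN conjunct2]

lemma ex_cs: "\<exists>e'. (\<forall>\<phi>\<in>T. \<iota> e' \<phi> = c * \<iota> e \<phi>) \<and> norm e' = cmod c * norm e"
  using TMIB_props_from_5[THEN conjunct1] by blast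

lemma ex_emb: "\<phi> \<in> T \<Longrightarrow> \<exists>e. \<forall>\<psi>\<in>T. \<iota> e \<psi> = fun_ud \<phi> \<psi>"
  using TMIB_props_from_5[THEN conjunct2, THEN conjunct1] by blast

lemma TMIB_emb_bound: "if beur then (\<exists>l>0. \<exists>C. \<forall>\<phi>\<in>T. \<forall>e. (\<forall>\<psi>\<in>T. \<iota> e \<psi> = fun_ud \<phi> \<psi>) \<longrightarrow> norm e \<le> C * gs_norm M A l (1/l) \<phi>)
     else (\<forall>l>0. \<exists>C. \<forall>\<phi>\<in>gs_space M A l (1/l). \<forall>e. (\<forall>\<psi>\<in>T. \<iota> e \<psi> = fun_ud \<phi> \<psi>) \<longrightarrow> norm e \<le> C * gs_norm M A l (1/l) \<phi>)"
  using TMIB_props_from_5[THEN conjunct2, THEN conjunct2, THEN conjunct1] .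

lemma TMIB_emb_dense: "\<epsilon> > 0 \<Longrightarrow> \<exists>\<phi>\<in>T. \<exists>e'. (\<forall>\<psi>\<in>T. \<iota> e' \<psi> = fun_ud \<phi> \<psi>) \<and> norm (e - e') < \<epsilon>"
  using TMIB_props_from_5[THEN conjunct2, THEN conjunct2, THEN conjunct2, THEN conjunct1] by blast

lemma iota_bounded: "TS_bounded beur M A B \<Longrightarrow> \<exists>C. \<forall>e. \<forall>\<phi>\<in>B. cmod (\<iota> e \<phi>) \<le> C * norm e"
  using TMIB_props_from_9[THEN conjunct1] by blast

lemma UD_dense: "f \<in> UD beur M A \<Longrightarrow> TS_bounded beur M A B \<Longrightarrow> \<epsilon> > 0 \<Longrightarrow> \<exists>e. \<forall>\<phi>\<in>B. cmod (f \<phi> - \<iota> e \<phi>) < \<epsilon>"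
  using TMIB_props_from_9[THEN conjunct2, THEN conjunct1] by blast

lemma ex_tr: "\<exists>e'. \<forall>\<phi>\<in>T. \<iota> e' \<phi> = \<iota> e (transl (- x) \<phi>)"
  using TMIB_props_from_9[THEN conjunct2, THEN conjunct2, THEN conjunct1] unfolding ud_transl_def by blast

lemma TMIB_transl_bound: "if beur then \<exists>q>0. \<exists>C>0. \<forall>x e e'. (\<forall>\<phi>\<in>T. \<iota> e' \<phi> = \<iota> e (transl (- x) \<phi>)) \<longrightarrow> norm e' \<le> C * wgt A q x * norm e
   else \<forall>q>0. \<exists>C>0. \<forall>x e e'. (\<forall>\<phi>\<in>T. \<iota> e' \<phi> = \<iota> e (transl (- x) \<phi>)) \<longrightarrow> norm e' \<le> C * wgt A q x * norm e"
  using TMIB_props_from_9[THEN conjunct2, THEN conjunct2, THEN conjunct2, THEN conjunct2]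
  unfolding ud_transl_def wgt_def by (cases beur) (simp_all, blast+)

section \<open>Representatives, complex scalars and embedded test functions\<close>

definition inE :: "'n udist \<Rightarrow> bool" where "inE u \<longleftrightarrow> (\<exists>e. \<forall>\<phi>\<in>T. \<iota> e \<phi> = u \<phi>)"
definition rp :: "'n udist \<Rightarrow> 'e" where "rp u = (SOME e. \<forall>\<phi>\<in>T. \<iota> e \<phi> = u \<phi>)"

lemma rp: "inE u \<Longrightarrow> \<phi> \<in> T \<Longrightarrow> \<iota> (rp u) \<phi> = u \<phi>"
  unfolding inE_def rp_def by (drule someI_ex) blast

lemma rp_eqI: "(\<And>\<phi>. \<phi> \<in> T \<Longrightarrow> \<iota> e \<phi> = u \<phi>) \<Longrightarrow> inE u \<and> rp u = e"
  by (metis inE_def iota_inj rp)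

lemma inE_iota [simp]: "inE (\<iota> e)" "rp (\<iota> e) = e"
  using rp_eqI[of e "\<iota> e"] by auto

lemma rp_cong: "(\<And>\<phi>. \<phi> \<in> T \<Longrightarrow> u \<phi> = v \<phi>) \<Longrightarrow> rp u = rp v \<and> inE u = inE v"
proof -
  assume "\<And>\<phi>. \<phi> \<in> T \<Longrightarrow> u \<phi> = v \<phi>"
  then have "(\<lambda>e. \<forall>\<phi>\<in>T. \<iota> e \<phi> = u \<phi>) = (\<lambda>e. \<forall>\<phi>\<in>T. \<iota> e \<phi> = v \<phi>)" by auto
  then show ?thesis by (simp add: rp_def inE_def)
qed

text \<open>The type of the Banach space carries only real scalars; complex ones are recovered through \<open>\<iota>\<close>.\<close>
definition cs :: "complex \<Rightarrow> 'e \<Rightarrow> 'e" where "cs c e = rp (\<lambda>\<phi>. c * \<iota> e \<phi>)"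

lemma cs: "\<phi> \<in> T \<Longrightarrow> \<iota> (cs c e) \<phi> = c * \<iota> e \<phi>" and norm_cs: "norm (cs c e) = cmod c * norm e"
proof -
  obtain e' where e': "\<forall>\<phi>\<in>T. \<iota> e' \<phi> = c * \<iota> e \<phi>" "norm e' = cmod c * norm e" using ex_cs by blast
  then have "cs c e = e'" unfolding cs_def using rp_eqI[of e' "\<lambda>\<phi>. c * \<iota> e \<phi>"] by simp
  then show "\<phi> \<in> T \<Longrightarrow> \<iota> (cs c e) \<phi> = c * \<iota> e \<phi>" "norm (cs c e) = cmod c * norm e" using e' by auto
qed

text \<open>Reduces continuity of complex scalar multiplication to real scalars and the bounded
  real-linear map \<open>cs \<i>\<close>.\<close>

lemma cs_eq: "cs c e = Re c *\<^sub>R e + Im c *\<^sub>R cs \<i> e"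
  by (rule iota_inj) (simp add: cs iota_add iota_scaleR complex_eq_iff algebra_simps flip: complex_eq)

lemma iota_minus: "\<phi> \<in> T \<Longrightarrow> \<iota> (e - e') \<phi> = \<iota> e \<phi> - \<iota> e' \<phi>"
  using iota_add[of \<phi> e "(-1) *\<^sub>R e'"] iota_scaleR[of \<phi> "-1" e'] by simp

lemma bounded_linear_iota:
  assumes "\<phi> \<in> T" shows "bounded_linear (\<lambda>e. \<iota> e \<phi>)"
proof -
  obtain C where C: "\<And>e. cmod (\<iota> e \<phi>) \<le> C * norm e"
    using iota_bounded[of "{\<phi>}"] assms by (auto simp: TS_bounded_singleton)
  show ?thesis
    by (rule bounded_linear_intro[where K = C])
      (use C assms in \<open>auto simp: iota_add iota_scaleR scaleR_conv_of_real mult.commute\<close>)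
qed

definition emb :: "'n testfun \<Rightarrow> 'e" where "emb \<phi> = rp (fun_ud \<phi>)"

lemma inE_fun_ud: "\<phi> \<in> T \<Longrightarrow> inE (fun_ud \<phi>)"
  using ex_emb by (simp add: inE_def)

lemma emb: "\<phi> \<in> T \<Longrightarrow> \<psi> \<in> T \<Longrightarrow> \<iota> (emb \<phi>) \<psi> = fun_ud \<phi> \<psi>"
  using rp[OF inE_fun_ud] by (simp add: emb_def)

lemma emb_dense:
  assumes "\<epsilon> > 0" obtains \<phi> where "\<phi> \<in> T" "norm (e - emb \<phi>) < \<epsilon>"
proof -
  obtain \<phi> e' where *: "\<phi> \<in> T" "\<forall>\<psi>\<in>T. \<iota> e' \<psi> = fun_ud \<phi> \<psi>" "norm (e - e') < \<epsilon>"
    using TMIB_emb_dense[OF assms, of e] by blast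
  have "emb \<phi> = e'" unfolding emb_def using rp_eqI[of e' "fun_ud \<phi>"] * by simp
  then show ?thesis using that * by blast
qed

lemma emb_bounded:
  assumes B: "TS_bounded beur M A B"
  obtains C where "C \<ge> 0" "\<And>\<phi>. \<phi> \<in> B \<Longrightarrow> norm (emb \<phi>) \<le> C"
proof -
  have BT: "B \<subseteq> T" using B by (simp add: TS_bounded_def)
  have key: "norm (emb \<phi>) \<le> \<bar>C\<bar> * D"
    if "norm (emb \<phi>) \<le> C * gs_norm M A l (1/l) \<phi>" "gs_le M A l (1/l) D \<phi>" "l > 0" "\<phi> \<in> B" for C l D \<phi>
  proof -
    have sp: "\<phi> \<in> gs_space M A l (1/l)" using that BT TS_smooth[of \<phi> beur] by (auto simp: gs_space_def)
    have n0: "gs_norm M A l (1/l) \<phi> \<ge> 0" using gs_le_nonneg[OF gs_le_gs_norm[OF sp that(3)]] .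
    have "C * gs_norm M A l (1/l) \<phi> \<le> \<bar>C\<bar> * gs_norm M A l (1/l) \<phi>" using n0 by (intro mult_right_mono) auto
    also have "\<dots> \<le> \<bar>C\<bar> * D" using gs_norm_le[OF that(2,3)] by (intro mult_left_mono) auto
    finally show ?thesis using that(1) by linarith
  qed
  have "\<exists>C. \<forall>\<phi>\<in>B. norm (emb \<phi>) \<le> C"
  proof (cases beur)
    case True
    then obtain l C where l: "l > 0" "\<forall>\<phi>\<in>T. \<forall>e. (\<forall>\<psi>\<in>T. \<iota> e \<psi> = fun_ud \<phi> \<psi>) \<longrightarrow> norm e \<le> C * gs_norm M A l (1/l) \<phi>"
      using TMIB_emb_bound by auto
    obtain D where "\<forall>\<phi>\<in>B. gs_le M A l (1/l) D \<phi>" using B l True by (auto simp: TS_bounded_def)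
    then have "norm (emb \<phi>) \<le> \<bar>C\<bar> * D" if "\<phi> \<in> B" for \<phi>
      using key[of \<phi> C l D] l emb BT that by blast
    then show ?thesis by blast
  next
    case False
    then obtain l D where l: "l > 0" "\<forall>\<phi>\<in>B. \<phi> \<in> gs_space M A l (1/l) \<and> gs_le M A l (1/l) D \<phi>"
      using B by (auto simp: TS_bounded_def)
    obtain C where "\<forall>\<phi>\<in>gs_space M A l (1/l). \<forall>e. (\<forall>\<psi>\<in>T. \<iota> e \<psi> = fun_ud \<phi> \<psi>) \<longrightarrow> norm e \<le> C * gs_norm M A l (1/l) \<phi>"
      using TMIB_emb_bound False l by auto
    then have "norm (emb \<phi>) \<le> \<bar>C\<bar> * D" if "\<phi> \<in> B" for \<phi>
      using key[of \<phi> C l D] l emb BT that by blast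
    then show ?thesis by blast
  qed
  then obtain C where C: "\<forall>\<phi>\<in>B. norm (emb \<phi>) \<le> C" by blast
  have "norm (emb \<phi>) \<le> max C 0" if "\<phi> \<in> B" for \<phi> using C that by auto
  then show ?thesis using that[of "max C 0"] by simp
qed

lemma emb_lincomb:
  assumes "\<phi> \<in> T" "\<psi> \<in> T"
  shows "emb (\<lambda>x. a * \<phi> x + b * \<psi> x) = cs a (emb \<phi>) + cs b (emb \<psi>)"
proof (rule iota_inj)
  fix \<eta> assume \<eta>: "\<eta> \<in> T"
  have "fun_ud (\<lambda>x. a * \<phi> x + b * \<psi> x) \<eta> = a * fun_ud \<phi> \<eta> + b * fun_ud \<psi> \<eta>"
    using fun_ud_linear[OF \<eta> assms, of a b] by (simp add: fun_ud_def mult.commute)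
  then show "\<iota> (emb (\<lambda>x. a * \<phi> x + b * \<psi> x)) \<eta> = \<iota> (cs a (emb \<phi>) + cs b (emb \<psi>)) \<eta>"
    by (simp add: emb TS_lincomb assms \<eta> iota_add cs)
qed

section \<open>Translations on the Banach space\<close>

definition tr :: "real^'n \<Rightarrow> 'e \<Rightarrow> 'e" where "tr x e = rp (ud_transl x (\<iota> e))"

lemma tr: "\<phi> \<in> T \<Longrightarrow> \<iota> (tr x e) \<phi> = \<iota> e (transl (- x) \<phi>)"
proof -
  have "inE (ud_transl x (\<iota> e))" using ex_tr by (simp add: inE_def ud_transl_def)
  then show "\<phi> \<in> T \<Longrightarrow> \<iota> (tr x e) \<phi> = \<iota> e (transl (- x) \<phi>)"
    using rp by (simp add: tr_def ud_transl_def)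
qed

definition tb :: "real \<Rightarrow> real \<Rightarrow> bool" where
  "tb q C \<longleftrightarrow> q > 0 \<and> C > 0 \<and> (\<forall>x e. norm (tr x e) \<le> C * wgt A q x * norm e)"

lemma tb_ex: "if beur then \<exists>q>0. \<exists>C>0. tb q C else \<forall>q>0. \<exists>C>0. tb q C"
proof -
  have *: "tb q C" if "q > 0" "C > 0" "\<forall>x e e'. (\<forall>\<phi>\<in>T. \<iota> e' \<phi> = \<iota> e (transl (- x) \<phi>)) \<longrightarrow> norm e' \<le> C * wgt A q x * norm e" for q C
    unfolding tb_def using that tr by simp
  show ?thesis
  proof (cases beur)
    case True
    then obtain q C where "q > 0" "C > 0" "\<forall>x e e'. (\<forall>\<phi>\<in>T. \<iota> e' \<phi> = \<iota> e (transl (- x) \<phi>)) \<longrightarrow> norm e' \<le> C * wgt A q x * norm e"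
      using TMIB_transl_bound by auto
    from *[OF this] show ?thesis using True \<open>q > 0\<close> \<open>C > 0\<close> by auto
  next
    case False
    have "\<exists>C>0. tb q C" if q: "q > 0" for q
    proof -
      obtain C where "C > 0" "\<forall>x e e'. (\<forall>\<phi>\<in>T. \<iota> e' \<phi> = \<iota> e (transl (- x) \<phi>)) \<longrightarrow> norm e' \<le> C * wgt A q x * norm e"
        using TMIB_transl_bound False q by auto
      from *[OF q this] \<open>C > 0\<close> show ?thesis by blast
    qed
    then show ?thesis using False by simp
  qed
qed

lemma tb_ex_le:
  assumes "qm > 0" obtains q C where "tb q C" "beur \<or> q \<le> qm"
proof (cases beur)
  case True
  then show ?thesis using tb_ex that by auto
next
  case False
  then obtain C where "tb qm C" using tb_ex assms by auto
  then show ?thesis using that by blast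
qed

lemma tr_linear: "tr x (e - e') = tr x e - tr x e'"
  by (rule iota_inj) (simp add: tr iota_minus TS_transl)

lemma tr_emb: "\<phi> \<in> T \<Longrightarrow> tr x (emb \<phi>) = emb (transl x \<phi>)"
proof (rule iota_inj)
  fix \<psi> assume *: "\<phi> \<in> T" "\<psi> \<in> T"
  have "fun_ud \<phi> (transl (- x) \<psi>) = (\<integral>y. (\<lambda>y. \<phi> (y - x) * \<psi> y) (x + y) \<partial>lborel)"
    by (simp add: fun_ud_def transl_def add.commute)
  also have "\<dots> = fun_ud (transl x \<phi>) \<psi>"
    by (subst integral_lborel_plus) (simp add: fun_ud_def transl_def)
  finally show "\<iota> (tr x (emb \<phi>)) \<psi> = \<iota> (emb (transl x \<phi>)) \<psi>"
    using * by (simp add: tr emb TS_transl)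
qed

lemma tr_tr: "tr x (tr y e) = tr (x + y) e"
  by (rule iota_inj) (simp add: tr TS_transl transl_transl add.commute)

text \<open>On embedded test functions continuity at 0 follows from the bounded difference
  quotients. Density and the bound on the operator norms for |h| at most 1 extend it to all
  elements, and the group law moves it to other points.\<close>

lemma continuous_tr: "continuous_on UNIV (\<lambda>y. tr y e)"
proof -
  obtain q C where tb: "tb q C" by (rule tb_ex_le[of 1]) auto
  have tbb: "\<And>x e. norm (tr x e) \<le> C * wgt A q x * norm e" and C: "C > 0" "q > 0" using tb by (auto simp: tb_def)
  have emb_cont: "(\<lambda>h. tr h (emb \<phi>)) \<midarrow>0\<rightarrow> emb \<phi>" if \<phi>: "\<phi> \<in> T" for \<phi>
  proof -
    obtain K where K: "K \<ge> 0" "\<And>\<psi>. \<psi> \<in> {(\<lambda>x. of_real (1 / norm h) * transl h \<phi> x + of_real (- 1 / norm h) * \<phi> x) | h. h \<noteq> 0 \<and> norm h \<le> 1} \<Longrightarrow> norm (emb \<psi>) \<le> K"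
      using emb_bounded[OF TS_bounded_transl_quotients[OF \<phi>]] by blast
    have "norm (tr h (emb \<phi>) - emb \<phi>) \<le> K * norm h" if h: "h \<noteq> 0" "norm h \<le> 1" for h
    proof -
      have "emb (\<lambda>x. of_real (1 / norm h) * transl h \<phi> x + of_real (- 1 / norm h) * \<phi> x) = (1 / norm h) *\<^sub>R (tr h (emb \<phi>) - emb \<phi>)"
        unfolding emb_lincomb[OF TS_transl[OF \<phi>] \<phi>] tr_emb[OF \<phi>]
        by (rule iota_inj) (simp add: iota_add iota_minus cs iota_scaleR algebra_simps)
      moreover have "norm (emb (\<lambda>x. of_real (1 / norm h) * transl h \<phi> x + of_real (- 1 / norm h) * \<phi> x)) \<le> K"
        by (rule K(2)) (use h in blast)
      ultimately have "norm ((1 / norm h) *\<^sub>R (tr h (emb \<phi>) - emb \<phi>)) \<le> K" by metis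
      then have "(1 / norm h) * norm (tr h (emb \<phi>) - emb \<phi>) \<le> K" by simp
      then show ?thesis using h by (simp add: divide_le_eq)
    qed
    then have "\<forall>\<^sub>F h in at 0. norm (tr h (emb \<phi>) - emb \<phi>) \<le> K * norm h"
      unfolding eventually_at by (intro exI[of _ 1]) auto
    moreover have "((\<lambda>h::real^'n. K * norm h) \<longlongrightarrow> 0) (at 0)"
      by (rule tendsto_eq_intros tendsto_norm_zero tendsto_ident_at | simp)+
    ultimately have "((\<lambda>h. tr h (emb \<phi>) - emb \<phi>) \<longlongrightarrow> 0) (at 0)"
      by (rule Lim_null_comparison)
    then show ?thesis by (simp add: LIM_zero_iff)
  qed
  have "(\<lambda>h. tr h e) \<midarrow>0\<rightarrow> e"
  proof (rule tendstoI)
    fix \<epsilon> :: real assume \<epsilon>: "\<epsilon> > 0"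
    define L where "L = C * exp (assoc_fun A (q * 1))"
    have L: "L > 0" using C by (simp add: L_def)
    define \<delta> where "\<delta> = \<epsilon> / (3 * (L + 1))"
    have \<delta>: "\<delta> > 0" using \<epsilon> L by (simp add: \<delta>_def)
    obtain \<phi> where \<phi>: "\<phi> \<in> T" "norm (e - emb \<phi>) < \<delta>" using emb_dense[OF \<delta>] by blast
    have "\<forall>\<^sub>F h in at 0. dist (tr h (emb \<phi>)) (emb \<phi>) < \<epsilon> / 3"
      using tendstoD[OF emb_cont[OF \<phi>(1)], of "\<epsilon> / 3"] \<epsilon> by simp
    moreover have "\<forall>\<^sub>F h::real^'n in at 0. norm h \<le> 1"
      unfolding eventually_at by (intro exI[of _ 1]) auto
    ultimately show "\<forall>\<^sub>F h in at 0. dist (tr h e) e < \<epsilon>"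
    proof eventually_elim
      case (elim h)
      have "norm (tr h (e - emb \<phi>)) \<le> L * norm (e - emb \<phi>)"
        by (rule order_trans[OF tbb])
          (use C A.wgt_continuous_bound[of q h 1] elim in \<open>auto simp: L_def intro!: mult_right_mono mult_left_mono\<close>)
      also have "\<dots> \<le> (L + 1) * \<delta>" using \<phi>(2) L \<delta> by (intro mult_mono) auto
      also have "\<dots> = \<epsilon> / 3" using L unfolding \<delta>_def by (simp add: field_simps)
      finally have 1: "norm (tr h (e - emb \<phi>)) \<le> \<epsilon> / 3" .
      have "\<delta> \<le> \<epsilon> / 3" unfolding \<delta>_def using L \<epsilon> by (intro divide_left_mono) auto
      then have 2: "norm (emb \<phi> - e) < \<epsilon> / 3" using \<phi>(2) by (simp add: norm_minus_commute)
      have "norm (tr h e - e) = norm (tr h (e - emb \<phi>) + (tr h (emb \<phi>) - emb \<phi>) + (emb \<phi> - e))" by (simp add: tr_linear)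
      also have "\<dots> \<le> norm (tr h (e - emb \<phi>)) + norm (tr h (emb \<phi>) - emb \<phi>) + norm (emb \<phi> - e)"
        by (meson add_mono norm_triangle_ineq order.refl order_trans)
      also have "\<dots> < \<epsilon>" using 1 2 elim(1) by (simp add: dist_norm)
      finally show ?case by (simp add: dist_norm)
    qed
  qed
  then have lim0: "(\<lambda>h. tr h e - e) \<midarrow>0\<rightarrow> 0" by (simp add: LIM_zero_iff)
  have "isCont (\<lambda>y. tr y e) x" for x
    unfolding isCont_iff
  proof -
    have "(\<lambda>h. (C * wgt A q x) * norm (tr h e - e)) \<midarrow>0\<rightarrow> 0"
      by (rule tendsto_mult_right_zero[OF tendsto_norm_zero[OF lim0]])
    moreover have "norm (tr (x + h) e - tr x e) \<le> (C * wgt A q x) * norm (tr h e - e)" for h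
      using tbb[of x "tr h e - e"] by (simp add: tr_linear tr_tr)
    then have "\<forall>\<^sub>F h in at 0. norm (tr (x + h) e - tr x e) \<le> (C * wgt A q x) * norm (tr h e - e)"
      by (intro always_eventually allI)
    ultimately have "(\<lambda>h. tr (x + h) e - tr x e) \<midarrow>0\<rightarrow> 0" by (rule Lim_null_comparison[rotated])
    then show "(\<lambda>h. tr (x + h) e) \<midarrow>0\<rightarrow> tr x e" by (simp add: LIM_zero_iff)
  qed
  then show ?thesis by (simp add: continuous_at_imp_continuous_on)
qed

lemma continuous_cs:
  assumes "continuous_on S c" "continuous_on S g"
  shows "continuous_on S (\<lambda>y. cs (c y) (g y))"
proof -
  have "continuous_on S (\<lambda>y. cs \<i> (g y))"
  proof -
    have "bounded_linear (cs \<i>)"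
    proof (rule bounded_linear_intro[where K = 1])
      show "cs \<i> (x + y) = cs \<i> x + cs \<i> y" for x y by (rule iota_inj) (simp add: iota_add cs algebra_simps)
      show "cs \<i> (r *\<^sub>R x) = r *\<^sub>R cs \<i> x" for r x by (rule iota_inj) (simp add: iota_scaleR cs)
    qed (simp add: norm_cs)
    then show ?thesis using assms(2) by (rule bounded_linear.continuous_on)
  qed
  then show ?thesis using assms
    by (subst cs_eq[abs_def]) (intro continuous_intros)
qed

text \<open>The candidate is the integral of \<open>cs (\<psi> y) (tr y e)\<close>, which converges
  because the translations are bounded by the weight. It agrees with the convolution on embedded
  test functions by Fubini, and both sides depend continuously on the element.\<close>

theorem conv_in_E:
  assumes \<psi>: "\<psi> \<in> T" and tb: "tb q C" and int: "integrable lborel (\<lambda>y. cmod (\<psi> y) * wgt A q y)" and u: "inE u"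
  shows "inE (ud_conv u \<psi>) \<and> norm (rp (ud_conv u \<psi>)) \<le> C * (\<integral>y. cmod (\<psi> y) * wgt A q y \<partial>lborel) * norm (rp u)"
proof -
  have tbb: "\<And>x e. norm (tr x e) \<le> C * wgt A q x * norm e" and C: "C > 0" "q > 0" using tb by (auto simp: tb_def)
  have bound: "norm (cs (\<psi> y) (tr y e)) \<le> (C * norm e) * (cmod (\<psi> y) * wgt A q y)" for y e
    using mult_left_mono[OF tbb[of y e], of "cmod (\<psi> y)"] by (simp add: norm_cs mult_ac)
  have cont: "continuous_on UNIV (\<lambda>y. cs (\<psi> y) (tr y e))" for e
    by (intro continuous_cs continuous_tr smooth_continuous_on TS_smooth[OF \<psi>])
  have gi: "integrable lborel (\<lambda>y. (C * norm e) * (cmod (\<psi> y) * wgt A q y))" for e :: 'e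
    using int by (rule integrable_mult_right)
  have "\<forall>e. \<exists>I. norm I \<le> (\<integral>y. (C * norm e) * (cmod (\<psi> y) * wgt A q y) \<partial>lborel) \<and>
    (\<forall>L :: 'e \<Rightarrow> complex. bounded_linear L \<longrightarrow> L I = (\<integral>y. L (cs (\<psi> y) (tr y e)) \<partial>lborel))"
    by (intro allI banach_integral_exists[OF cont gi bound])
  from choice[OF this] obtain I where I: "\<And>e. norm (I e) \<le> (\<integral>y. (C * norm e) * (cmod (\<psi> y) * wgt A q y) \<partial>lborel)"
    "\<And>e L. bounded_linear (L :: 'e \<Rightarrow> complex) \<Longrightarrow> L (I e) = (\<integral>y. L (cs (\<psi> y) (tr y e)) \<partial>lborel)" by blast
  have nI: "norm (I e) \<le> C * (\<integral>y. cmod (\<psi> y) * wgt A q y \<partial>lborel) * norm e" for e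
    using I(1)[of e] by (simp add: mult_ac)
  have iI: "\<iota> (I e) \<phi> = (\<integral>y. \<psi> y * \<iota> e (transl (- y) \<phi>) \<partial>lborel)" if "\<phi> \<in> T" for e \<phi>
    using I(2)[OF bounded_linear_iota[OF that], of e] that by (simp add: cs tr)
  \<comment> \<open>The values of \<open>I\<close> come from a choice, so additivity is recovered by
    testing with \<open>\<iota>\<close>; this needs each of the scalar integrals to
    converge.\<close>
  have lin: "I (e - e') = I e - I e'" for e e'
  proof (rule iota_inj)
    fix \<phi> assume \<phi>: "\<phi> \<in> T"
    obtain K where K: "K > 0" "\<And>x. norm (\<iota> x \<phi>) \<le> norm x * K" using bounded_linear.pos_bounded[OF bounded_linear_iota[OF \<phi>]] by blast
    have "integrable lborel (\<lambda>y. \<psi> y * \<iota> e (transl (- y) \<phi>))" for e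
    proof (rule Bochner_Integration.integrable_bound)
      show "integrable lborel (\<lambda>y. K * ((C * norm e) * (cmod (\<psi> y) * wgt A q y)))" using gi by simp
      have eq: "\<psi> y * \<iota> e (transl (- y) \<phi>) = \<iota> (cs (\<psi> y) (tr y e)) \<phi>" for y using \<phi> by (simp add: cs tr)
      have "continuous_on UNIV (\<lambda>y. \<iota> (cs (\<psi> y) (tr y e)) \<phi>)"
        by (rule bounded_linear.continuous_on[OF bounded_linear_iota[OF \<phi>] cont])
      then show "(\<lambda>y. \<psi> y * \<iota> e (transl (- y) \<phi>)) \<in> borel_measurable lborel"
        unfolding eq using borel_measurable_continuous_onI by simp
      show "AE y in lborel. norm (\<psi> y * \<iota> e (transl (- y) \<phi>)) \<le> norm (K * ((C * norm e) * (cmod (\<psi> y) * wgt A q y)))"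
        unfolding eq
      proof (intro AE_I2)
        fix y
        have "norm (\<iota> (cs (\<psi> y) (tr y e)) \<phi>) \<le> norm (cs (\<psi> y) (tr y e)) * K" by (rule K(2))
        also have "\<dots> \<le> (C * norm e) * (cmod (\<psi> y) * wgt A q y) * K" using bound K(1) by (intro mult_right_mono) auto
        finally show "norm (\<iota> (cs (\<psi> y) (tr y e)) \<phi>) \<le> norm (K * ((C * norm e) * (cmod (\<psi> y) * wgt A q y)))"
          using K(1) C(1) by (simp add: mult_ac abs_mult)
      qed
    qed
    then show "\<iota> (I (e - e')) \<phi> = \<iota> (I e - I e') \<phi>"
      using \<phi> by (simp add: iI iota_minus TS_transl right_diff_distrib)
  qed
  have main: "\<iota> (I e) \<phi> = \<iota> e (conv \<phi> (reflect \<psi>))" if \<phi>: "\<phi> \<in> T" for e \<phi>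
  proof -
    have cT: "conv \<phi> (reflect \<psi>) \<in> T" using \<phi> \<psi> TS_conv TS_reflect by blast
    obtain K1 where K1: "K1 > 0" "\<And>x. norm (\<iota> x \<phi>) \<le> norm x * K1" using bounded_linear.pos_bounded[OF bounded_linear_iota[OF \<phi>]] by blast
    obtain K2 where K2: "K2 > 0" "\<And>x. norm (\<iota> x (conv \<phi> (reflect \<psi>))) \<le> norm x * K2" using bounded_linear.pos_bounded[OF bounded_linear_iota[OF cT]] by blast
    let ?J = "C * (\<integral>y. cmod (\<psi> y) * wgt A q y \<partial>lborel)"
    have J: "?J \<ge> 0" using C by (auto intro!: mult_nonneg_nonneg integral_nonneg_AE)
    have "cmod (\<iota> (I e) \<phi> - \<iota> e (conv \<phi> (reflect \<psi>))) \<le> \<epsilon>" if \<epsilon>: "\<epsilon> > 0" for \<epsilon>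
    proof -
      \<comment> \<open>Both errors are multiples of the distance to the approximating test
        function, with constants \<open>?J * K1\<close> and \<open>K2\<close>.\<close>
      define \<delta> where "\<delta> = \<epsilon> / (?J * K1 + K2)"
      have p: "?J * K1 + K2 > 0" using J K1 K2 by (simp add: add_nonneg_pos)
      then have \<delta>: "\<delta> > 0" using \<epsilon> by (simp add: \<delta>_def)
      obtain \<eta> where \<eta>: "\<eta> \<in> T" "norm (e - emb \<eta>) < \<delta>" using emb_dense[OF \<delta>] by blast
      have "\<iota> (I (emb \<eta>)) \<phi> = \<iota> (emb \<eta>) (conv \<phi> (reflect \<psi>))"
        using fun_ud_conv_reflect(1)[OF \<eta>(1) \<phi> \<psi>] \<phi> cT \<eta> by (simp add: iI emb TS_transl)
      then have "\<iota> (I e) \<phi> - \<iota> e (conv \<phi> (reflect \<psi>)) = \<iota> (I (e - emb \<eta>)) \<phi> - \<iota> (e - emb \<eta>) (conv \<phi> (reflect \<psi>))"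
        using \<phi> cT by (simp add: lin iota_minus)
      then have "cmod (\<iota> (I e) \<phi> - \<iota> e (conv \<phi> (reflect \<psi>))) \<le> norm (I (e - emb \<eta>)) * K1 + norm (e - emb \<eta>) * K2"
        using K1(2)[of "I (e - emb \<eta>)"] K2(2)[of "e - emb \<eta>"] norm_triangle_ineq4[of "\<iota> (I (e - emb \<eta>)) \<phi>" "\<iota> (e - emb \<eta>) (conv \<phi> (reflect \<psi>))"]
        by simp
      also have "\<dots> \<le> (?J * norm (e - emb \<eta>)) * K1 + norm (e - emb \<eta>) * K2"
        using nI[of "e - emb \<eta>"] K1 K2(1) by (intro add_mono mult_right_mono) auto
      also have "\<dots> = (?J * K1 + K2) * norm (e - emb \<eta>)" by (simp add: algebra_simps)
      also have "\<dots> \<le> (?J * K1 + K2) * \<delta>" using \<eta>(2) p by (intro mult_left_mono) auto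
      also have "\<dots> = \<epsilon>" using p by (simp add: \<delta>_def)
      finally show ?thesis .
    qed
    then have "cmod (\<iota> (I e) \<phi> - \<iota> e (conv \<phi> (reflect \<psi>))) \<le> 0" by (rule field_le_epsilon) simp
    then show ?thesis by simp
  qed
  have "inE (ud_conv u \<psi>) \<and> rp (ud_conv u \<psi>) = I (rp u)"
  proof (rule rp_eqI)
    fix \<phi> assume \<phi>: "\<phi> \<in> T"
    have cT: "conv \<phi> (reflect \<psi>) \<in> T" using \<phi> \<psi> TS_conv TS_reflect by blast
    show "\<iota> (I (rp u)) \<phi> = ud_conv u \<psi> \<phi>" using main[OF \<phi>] rp[OF u cT] by (simp add: ud_conv_def)
  qed
  then show ?thesis using nI[of "rp u"] by simp
qed

end

section \<open>Sums of derivatives are mapped into the space by convolution\<close>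

context tmib
begin

lemma ud_sums_has_sum:
  assumes "ud_sums beur M A g f" "\<phi> \<in> T"
  shows "((\<lambda>\<alpha>. g \<alpha> \<phi>) has_sum f \<phi>) UNIV"
  unfolding has_sum_def
proof (rule tendstoI)
  fix \<epsilon> :: real assume "\<epsilon> > 0"
  then have "eventually (\<lambda>F. \<forall>\<psi>\<in>{\<phi>}. cmod (f \<psi> - (\<Sum>\<alpha>\<in>F. g \<alpha> \<psi>)) \<le> \<epsilon> / 2) (finite_subsets_at_top UNIV)"
    using assms(1)[unfolded ud_sums_def, rule_format, of "{\<phi>}" "\<epsilon> / 2"] assms(2) by (simp add: TS_bounded_singleton)
  then show "\<forall>\<^sub>F F in finite_subsets_at_top UNIV. dist (\<Sum>\<alpha>\<in>F. g \<alpha> \<phi>) (f \<phi>) < \<epsilon>"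
    by eventually_elim (use \<open>\<epsilon> > 0\<close> in \<open>simp add: dist_norm norm_minus_commute\<close>)
qed

text \<open>The sign in the distributional derivative cancels the sign from differentiating a
  reflected function, so the derivatives land on \<open>\<phi>\<close> without sign.\<close>

lemma ud_deriv_conv:
  assumes u: "u \<in> UD beur M A" and \<phi>: "\<phi> \<in> T" and \<psi>: "\<psi> \<in> T"
  shows "ud_deriv \<alpha> u (conv \<psi> (reflect \<phi>)) = ud_conv u (mderiv \<alpha> \<phi>) \<psi>"
proof -
  obtain "is" where i: "length is = mlen \<alpha>" "\<And>f :: 'n testfun. smooth f \<Longrightarrow> mderiv \<alpha> f = pd is f"
    using mderiv_list by blast
  have r: "reflect \<phi> \<in> T" using \<phi> by (rule TS_reflect)
  have "mderiv \<alpha> (conv \<psi> (reflect \<phi>)) = pd is (conv \<psi> (reflect \<phi>))"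
    using i(2) TS_smooth[OF TS_conv[OF \<psi> r]] by blast
  also have "\<dots> = conv \<psi> (pd is (reflect \<phi>))" by (rule pd_conv_TS2[OF r TS_integrable[OF \<psi>]])
  also have "\<dots> = (\<lambda>x. (-1) ^ length is * conv \<psi> (reflect (pd is \<phi>)) x)"
    by (simp only: pd_reflect[OF TS_smooth[OF \<phi>]] conv_cmult_right)
  finally have "u (mderiv \<alpha> (conv \<psi> (reflect \<phi>))) = (-1) ^ length is * u (conv \<psi> (reflect (pd is \<phi>)))"
    using UD_cmult[OF u TS_conv[OF \<psi> TS_reflect[OF TS_pd[OF \<phi>, of "is"]]]] by simp
  then show ?thesis
    using i(2)[OF TS_smooth[OF \<phi>]] by (simp add: ud_deriv_def ud_conv_def i(1) flip: power_mult_distrib mult.assoc)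
qed

lemma mderiv_gs_le:
  assumes "gs_le M A l q C \<phi>"
  shows "cmod (mderiv \<alpha> \<phi> x) \<le> (C * (l ^ mlen \<alpha> * M (mlen \<alpha>))) / wgt A q x"
  using assms by (simp add: gs_le_def wgt_def pos_le_divide_eq)

lemma mderiv_TS: "\<phi> \<in> T \<Longrightarrow> mderiv \<alpha> \<phi> \<in> T"
  by (metis TS_pd TS_smooth mderiv_list)

theorem inE_conv_of_ud_sums:
  fixes fa :: "('n \<Rightarrow> nat) \<Rightarrow> 'e"
  assumes f: "f \<in> UD beur M A"
    and sums: "ud_sums beur M A (\<lambda>\<alpha>. ud_deriv \<alpha> (\<iota> (fa \<alpha>))) f"
    and fa: "if beur then (\<exists>l>0. \<exists>C. \<forall>\<alpha>. l ^ mlen \<alpha> * M (mlen \<alpha>) * norm (fa \<alpha>) \<le> C)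
             else (\<forall>l>0. \<exists>C. \<forall>\<alpha>. l ^ mlen \<alpha> * M (mlen \<alpha>) * norm (fa \<alpha>) \<le> C)"
    and \<phi>: "\<phi> \<in> T"
  shows "inE (ud_conv f \<phi>)"
proof -
  let ?K = "domK TYPE('n)"
  have K: "?K \<ge> 1" by (rule domK)
  \<comment> \<open>The factor 2 in \<open>2 * l\<close> yields (1/2)^|alpha| for summability over
    all multi-indices. In the Beurling case the coefficients and the translations fix
    \<open>l\<close> and \<open>q\<close>, and \<open>\<phi>\<close> adapts; in the Roumieu case
    \<open>\<phi>\<close> fixes them, and coefficients and translations adapt.\<close>
  have "\<exists>q Cq l C D. tb q Cq \<and> l > 0 \<and> gs_le M A l (?K * q) D \<phi> \<and> D \<ge> 0 \<and>
      (\<forall>\<alpha>. (2 * l) ^ mlen \<alpha> * M (mlen \<alpha>) * norm (fa \<alpha>) \<le> C)"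
  proof (cases beur)
    case True
    then obtain q Cq where tb: "tb q Cq" using tb_ex by auto
    obtain l C where l: "l > 0" "\<forall>\<alpha>. l ^ mlen \<alpha> * M (mlen \<alpha>) * norm (fa \<alpha>) \<le> C" using fa True by auto
    have "?K * q > 0" using tb K by (simp add: tb_def)
    then obtain D where "D > 0" "gs_le M A (l / 2) (?K * q) D \<phi>"
      using TS_True_gs_le[of \<phi> "l / 2" "?K * q"] \<phi> True l by auto
    then show ?thesis using tb l by (intro exI[of _ q] exI[of _ Cq] exI[of _ "l / 2"] exI[of _ C] exI[of _ D]) auto
  next
    case False
    then have "\<phi> \<in> TS False M A" using \<phi> by simp
    then obtain l r D where l: "l > 0" "r > 0" "D > 0" "gs_le M A l r D \<phi>" by (rule TS_False_gs_le)
    have "r / ?K > 0" using l K by simp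
    then obtain Cq where tb: "tb (r / ?K) Cq" using tb_ex False by auto
    have "2 * l > 0" using l by simp
    have fa': "\<forall>l>0. \<exists>C. \<forall>\<alpha>. l ^ mlen \<alpha> * M (mlen \<alpha>) * norm (fa \<alpha>) \<le> C" using fa False by simp
    then obtain C where "\<forall>\<alpha>. (2 * l) ^ mlen \<alpha> * M (mlen \<alpha>) * norm (fa \<alpha>) \<le> C" using fa'[rule_format, OF \<open>2 * l > 0\<close>] by blast
    then show ?thesis using tb l K
      by (intro exI[of _ "r / ?K"] exI[of _ Cq] exI[of _ l] exI[of _ C] exI[of _ D]) auto
  qed
  then obtain q Cq l C D where tb: "tb q Cq" and l: "l > 0" and D: "gs_le M A l (?K * q) D \<phi>" "D \<ge> 0"
    and C: "\<And>\<alpha>. (2 * l) ^ mlen \<alpha> * M (mlen \<alpha>) * norm (fa \<alpha>) \<le> C" by blast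
  have q: "q > 0" "Cq > 0" using tb by (auto simp: tb_def)
  define J where "J = (\<integral>x. wgt A q x / wgt A (?K * q) (x::real^'n) \<partial>lborel)"
  have J: "J \<ge> 0" unfolding J_def by (intro integral_nonneg_AE) auto
  define X where "X = (\<lambda>\<alpha>. rp (ud_conv (\<iota> (fa \<alpha>)) (mderiv \<alpha> \<phi>)))"
  have X: "inE (ud_conv (\<iota> (fa \<alpha>)) (mderiv \<alpha> \<phi>))" "norm (X \<alpha>) \<le> (Cq * D * J * C) * (1/2) ^ mlen \<alpha>" for \<alpha>
  proof -
    have dT: "mderiv \<alpha> \<phi> \<in> T" using \<phi> by (rule mderiv_TS)
    have int: "integrable lborel (\<lambda>y. cmod (mderiv \<alpha> \<phi> y) * wgt A q y)"
      and le: "(\<integral>y. cmod (mderiv \<alpha> \<phi> y) * wgt A q y \<partial>lborel) \<le> (D * (l ^ mlen \<alpha> * M (mlen \<alpha>))) * J"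
      unfolding J_def
      by (rule wgt_L1[OF q(1) order.refl TS_measurable[OF dT] mderiv_gs_le[OF D(1)]])+
    from conv_in_E[OF dT tb int inE_iota(1)]
    show "inE (ud_conv (\<iota> (fa \<alpha>)) (mderiv \<alpha> \<phi>))" by blast
    have "norm (X \<alpha>) \<le> Cq * (\<integral>y. cmod (mderiv \<alpha> \<phi> y) * wgt A q y \<partial>lborel) * norm (fa \<alpha>)"
      using conv_in_E[OF dT tb int inE_iota(1), of "fa \<alpha>"] by (simp add: X_def)
    also have "\<dots> \<le> Cq * ((D * (l ^ mlen \<alpha> * M (mlen \<alpha>))) * J) * norm (fa \<alpha>)"
      using le q by (intro mult_right_mono mult_left_mono) auto
    also have "\<dots> = (Cq * D * J * (1/2) ^ mlen \<alpha>) * ((2 * l) ^ mlen \<alpha> * M (mlen \<alpha>) * norm (fa \<alpha>))"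
      by (simp add: power_mult_distrib power_one_over)
    also have "\<dots> \<le> (Cq * D * J * (1/2) ^ mlen \<alpha>) * C"
      using C q D J by (intro mult_left_mono) auto
    finally show "norm (X \<alpha>) \<le> (Cq * D * J * C) * (1/2) ^ mlen \<alpha>" by (simp add: mult_ac)
  qed
  have "(\<lambda>\<alpha>. (Cq * D * J * C) * (1/2) ^ mlen \<alpha>) summable_on (UNIV :: ('n \<Rightarrow> nat) set)"
    by (rule summable_on_cmult_right[OF summable_on_power_mlen])
  then have "(\<lambda>\<alpha>. norm (X \<alpha>)) summable_on UNIV"
    by (rule summable_on_comparison_test) (use X in auto)
  then have Xs: "X summable_on UNIV" by (rule abs_summable_summable)
  have "\<iota> (infsum X UNIV) \<psi> = ud_conv f \<phi> \<psi>" if \<psi>: "\<psi> \<in> T" for \<psi>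
  proof -
    have cT: "conv \<psi> (reflect \<phi>) \<in> T" using \<phi> \<psi> TS_conv TS_reflect by blast
    have "((\<lambda>\<alpha>. ud_deriv \<alpha> (\<iota> (fa \<alpha>)) (conv \<psi> (reflect \<phi>))) has_sum f (conv \<psi> (reflect \<phi>))) UNIV"
      by (rule ud_sums_has_sum[OF sums cT])
    moreover have "ud_deriv \<alpha> (\<iota> (fa \<alpha>)) (conv \<psi> (reflect \<phi>)) = \<iota> (X \<alpha>) \<psi>" for \<alpha>
      using ud_deriv_conv[OF iota_UD \<phi> \<psi>] rp[OF X(1) \<psi>] by (simp add: X_def)
    moreover have "((\<lambda>\<alpha>. \<iota> (X \<alpha>) \<psi>) has_sum \<iota> (infsum X UNIV) \<psi>) UNIV"
      using has_sum_bounded_linear[OF bounded_linear_iota[OF \<psi>] has_sum_infsum[OF Xs]] by (simp add: comp_def)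
    ultimately show ?thesis using has_sum_unique by (fastforce simp: ud_conv_def)
  qed
  then show ?thesis unfolding inE_def by blast
qed

end

section \<open>A uniform boundedness principle\<close>

text \<open>With bounds for each derivative uniform in n and x, the tails of the differentiated
  series are uniformly small, so it may be differentiated term by term. The class \<open>P\<close>
  of such sequences is closed under \<open>partial\<close>.\<close>

lemma
  fixes u :: "nat \<Rightarrow> 'n::finite testfun" and b :: "nat \<Rightarrow> real"
  assumes u: "\<And>n. smooth (u n)" and K: "\<And>is. \<exists>K. \<forall>n x. cmod (pd is (u n) x) \<le> K"
    and b: "summable b" "\<And>n. b n \<ge> 0"
  shows smooth_suminf: "smooth (\<lambda>x. \<Sum>n. of_real (b n) * u n x)"
    and pd_suminf: "pd is (\<lambda>x. \<Sum>n. of_real (b n) * u n x) = (\<lambda>x. \<Sum>n. of_real (b n) * pd is (u n) x)"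
    and summable_suminf: "summable (\<lambda>n. of_real (b n) * u n x)"
proof -
  define P where "P = (\<lambda>u::nat \<Rightarrow> 'n testfun. (\<forall>n. smooth (u n)) \<and> (\<forall>is. \<exists>K. \<forall>n x. cmod (pd is (u n) x) \<le> K))"
  have Pp: "P (\<lambda>n. partial i (u n))" if Pu: "P u" for u i
    unfolding P_def
  proof (intro conjI allI)
    show "smooth (partial i (u n))" for n using Pu by (simp add: P_def smooth_partial)
    fix "is"
    obtain K where "\<forall>n x. cmod (pd (is @ [i]) (u n) x) \<le> K" using Pu unfolding P_def by blast
    then show "\<exists>K. \<forall>n x. cmod (pd is (partial i (u n)) x) \<le> K" by (auto simp: pd_append)
  qed
  have sm: "summable (\<lambda>n. cmod (of_real (b n) * u n x))" if Pu: "P u" for u and x :: "real^'n"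
  proof -
    obtain K where K: "\<And>n x. cmod (pd [] (u n) x) \<le> K" using Pu unfolding P_def by blast
    have "cmod (of_real (b n) * u n x) \<le> b n * K" for n
      using mult_left_mono[OF K[of n x] b(2)] b(2) by (simp add: norm_mult)
    then show ?thesis by (intro summable_comparison_test[OF _ summable_mult2[OF b(1)]]) auto
  qed
  let ?S = "\<lambda>u::nat \<Rightarrow> 'n testfun. (\<lambda>x. \<Sum>n. of_real (b n) * u n x)"
  have der: "(?S u has_derivative (\<lambda>h. \<Sum>i\<in>UNIV. (h $ i) *\<^sub>R ?S (\<lambda>n. partial i (u n)) x)) (at x)" if Pu: "P u" for u x
  proof -
    have "\<forall>i. \<exists>K. \<forall>n x. cmod (partial i (u n) x) \<le> K"
    proof
      fix i
      show "\<exists>K. \<forall>n x. cmod (partial i (u n) x) \<le> K" using Pu unfolding P_def by (metis pd.simps)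
    qed
    then obtain KK where KK: "\<And>i n x. cmod (partial i (u n) x) \<le> KK i" by metis
    define K where "K = Max (range KK)"
    have K: "cmod (partial i (u n) x) \<le> K" for i n x
      unfolding K_def by (rule order_trans[OF KK]) simp
    have K0: "K \<ge> 0" using K norm_ge_zero order_trans by blast
    have "\<exists>g. \<forall>x\<in>UNIV. (\<lambda>n. of_real (b n) * u n x) sums g x \<and> (g has_derivative (\<lambda>h. \<Sum>i\<in>UNIV. (h $ i) *\<^sub>R ?S (\<lambda>n. partial i (u n)) x)) (at x within UNIV)"
    proof (rule has_derivative_series)
      show "convex (UNIV :: (real^'n) set)" by simp
      show "((\<lambda>x. of_real (b n) * u n x) has_derivative (\<lambda>h. of_real (b n) * (\<Sum>i\<in>UNIV. (h $ i) *\<^sub>R partial i (u n) x))) (at x within UNIV)" for n x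
        using Pu by (intro has_derivative_mult_right smooth_has_derivative) (simp add: P_def)
      show "(\<lambda>n. of_real (b n) * u n 0) sums ?S u 0"
        using summable_norm_cancel[OF sm[OF Pu]] by (rule summable_sums)
      fix e :: real assume e: "e > 0"
      define c where "c = e / (real CARD('n) * (K + 1))"
      have cpos: "c > 0" using e K0 by (simp add: c_def)
      have "(\<lambda>n. suminf b - (\<Sum>i<n. b i)) \<longlonglongrightarrow> suminf b - suminf b"
        by (intro tendsto_diff tendsto_const summable_LIMSEQ b(1))
      then have "\<forall>\<^sub>F n in sequentially. dist (suminf b - (\<Sum>i<n. b i)) 0 < c"
        using cpos by (intro tendstoD) auto
      then show "\<forall>\<^sub>F n in sequentially. \<forall>x\<in>UNIV. \<forall>h. norm ((\<Sum>k<n. of_real (b k) * (\<Sum>i\<in>UNIV. (h $ i) *\<^sub>R partial i (u k) x)) - (\<Sum>i\<in>UNIV. (h $ i) *\<^sub>R ?S (\<lambda>n. partial i (u n)) x)) \<le> e * norm h"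
      proof eventually_elim
        case (elim n)
        have tail: "norm ((\<Sum>k<n. of_real (b k) * partial i (u k) x) - ?S (\<lambda>n. partial i (u n)) x) \<le> c * K" for i x
        proof -
          have s: "summable (\<lambda>k. cmod (of_real (b k) * partial i (u k) x))" by (rule sm[OF Pp[OF Pu]])
          have "(\<Sum>k<n. of_real (b k) * partial i (u k) x) - ?S (\<lambda>n. partial i (u n)) x = - (\<Sum>k. of_real (b (k + n)) * partial i (u (k + n)) x)"
            using suminf_split_initial_segment[OF summable_norm_cancel[OF s], of n] by simp
          also have "norm \<dots> \<le> (\<Sum>k. cmod (of_real (b (k + n)) * partial i (u (k + n)) x))"
            unfolding norm_minus_cancel by (rule summable_norm) (rule summable_ignore_initial_segment[OF s])
          also have "\<dots> \<le> (\<Sum>k. b (k + n) * K)"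
          proof (rule suminf_le)
            show "cmod (of_real (b (k + n)) * partial i (u (k + n)) x) \<le> b (k + n) * K" for k
              using mult_left_mono[OF K[of i "k + n" x] b(2)[of "k + n"]] b(2) by (simp add: norm_mult)
          qed (use summable_ignore_initial_segment[OF s] summable_mult2[OF summable_ignore_initial_segment[OF b(1)]] in auto)
          also have "\<dots> = (\<Sum>k. b (k + n)) * K" by (rule suminf_mult2[symmetric]) (rule summable_ignore_initial_segment[OF b(1)])
          also have "(\<Sum>k. b (k + n)) = suminf b - (\<Sum>i<n. b i)"
            using suminf_split_initial_segment[OF b(1), of n] by simp
          also have "(suminf b - (\<Sum>i<n. b i)) * K \<le> c * K"
            using elim K0 by (intro mult_right_mono) (auto simp: dist_norm)
          finally show ?thesis .
        qed
        show ?case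
        proof (intro ballI allI)
          fix x h :: "real^'n"
          have "(\<Sum>k<n. of_real (b k) * (\<Sum>i\<in>UNIV. (h $ i) *\<^sub>R partial i (u k) x)) - (\<Sum>i\<in>UNIV. (h $ i) *\<^sub>R ?S (\<lambda>n. partial i (u n)) x)
             = (\<Sum>i\<in>UNIV. (h $ i) *\<^sub>R ((\<Sum>k<n. of_real (b k) * partial i (u k) x) - ?S (\<lambda>n. partial i (u n)) x))"
            by (simp add: scaleR_diff_right sum_subtractf sum_distrib_left scaleR_sum_right sum.swap[of _ _ UNIV])
          also have "norm \<dots> \<le> (\<Sum>i\<in>(UNIV::'n set). norm h * (c * K))"
          proof (rule sum_norm_le)
            fix i
            show "norm ((h $ i) *\<^sub>R ((\<Sum>k<n. of_real (b k) * partial i (u k) x) - ?S (\<lambda>n. partial i (u n)) x)) \<le> norm h * (c * K)"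
              unfolding norm_scaleR using tail by (intro mult_mono) (auto intro: component_le_norm_cart)
          qed
          also have "\<dots> = (real CARD('n) * (c * K)) * norm h" by simp
          also have "\<dots> \<le> e * norm h"
          proof (rule mult_right_mono)
            have "real CARD('n) * (c * K) \<le> real CARD('n) * (c * (K + 1))" using cpos by (intro mult_left_mono) auto
            also have "\<dots> = e" using K0 by (simp add: c_def)
            finally show "real CARD('n) * (c * K) \<le> e" .
          qed simp
          finally show "norm ((\<Sum>k<n. of_real (b k) * (\<Sum>i\<in>UNIV. (h $ i) *\<^sub>R partial i (u k) x)) - (\<Sum>i\<in>UNIV. (h $ i) *\<^sub>R ?S (\<lambda>n. partial i (u n)) x)) \<le> e * norm h" .
        qed
      qed
    qed auto
    then obtain g where g: "\<And>x. (\<lambda>n. of_real (b n) * u n x) sums g x"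
      "\<And>x. (g has_derivative (\<lambda>h. \<Sum>i\<in>UNIV. (h $ i) *\<^sub>R ?S (\<lambda>n. partial i (u n)) x)) (at x)" by auto
    have "g = ?S u" using g(1) by (auto simp: sums_iff)
    then show ?thesis using g(2) by simp
  qed
  have pc: "partial i (?S u) = ?S (\<lambda>n. partial i (u n))" if "P u" for u i
    using partialI[OF der[OF that], of i] by (auto simp: sum_axis_scaleR)
  have Pu: "P u" using u K by (simp add: P_def)
  show "smooth (?S u)"
  proof (rule smooth_coinduct[where P = "\<lambda>h. \<exists>u. P u \<and> h = ?S u"])
    show "\<exists>ua. P ua \<and> ?S u = ?S ua" using Pu by blast
    show "h differentiable (at x)" if "\<exists>u. P u \<and> h = ?S u" for h x
      using that der unfolding differentiable_def by blast
    show "\<exists>u. P u \<and> partial i h = ?S u" if "\<exists>u. P u \<and> h = ?S u" for h i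
      using that pc Pp by blast
  qed
  have Ppd: "P (\<lambda>n. pd is (u n))" for "is" by (induction "is") (use Pu Pp in auto)
  show "pd is (?S u) = ?S (\<lambda>n. pd is (u n))"
    by (induction "is") (auto simp: pc[OF Ppd])
  show "summable (\<lambda>n. of_real (b n) * u n x)" using summable_norm_cancel[OF sm[OF Pu]] .
qed

context gs
begin

text \<open>The part of completeness that the gliding hump needs: a bounded sequence with summable
  nonnegative weights has its sum in the space.\<close>

lemma TS_suminf:
  fixes u :: "nat \<Rightarrow> 'n::finite testfun" and b :: "nat \<Rightarrow> real"
  assumes B: "TS_bounded be M A (range u)" and b: "summable b" "\<And>n. b n \<ge> 0"
  shows "(\<lambda>x. \<Sum>n. of_real (b n) * u n x) \<in> TS be M A"
    and "summable (\<lambda>n. of_real (b n) * u n x)"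
proof -
  have s: "smooth (u n)" for n using B by (simp add: TS_bounded_iff)
  have gsK: "\<exists>K. \<forall>n x. cmod (pd is (u n) x) \<le> K" for "is"
  proof -
    have "\<exists>l q C. l > 0 \<and> q > 0 \<and> C > 0 \<and> (\<forall>n. gs_le M A l q C (u n))"
      using B unfolding TS_bounded_iff by (cases be) (auto, metis zero_less_one)
    then obtain l q C where g: "l > 0" "q > 0" "C > 0" "\<And>n. gs_le M A l q C (u n)" by blast
    have "cmod (pd is (u n) x) \<le> C * (l ^ length is * M (length is))" for n x
    proof -
      have "cmod (pd is (u n) x) * 1 \<le> cmod (pd is (u n) x) * wgt A q x"
        using A.wgt_ge_1[of q x] g by (intro mult_left_mono) auto
      then show ?thesis using gs_le_pd[OF g(4)[of n] s, of "is" x] by simp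
    qed
    then show ?thesis by blast
  qed
  note su = smooth_suminf[OF s gsK b] pd_suminf[OF s gsK b] summable_suminf[OF s gsK b]
  show "summable (\<lambda>n. of_real (b n) * u n x)" by (rule su(3))
  have g: "gs_le M A l q (C * suminf b) (\<lambda>x. \<Sum>n. of_real (b n) * u n x)"
    if uC: "\<And>n. gs_le M A l q C (u n)" for l q C
  proof (rule gs_leI[OF su(1)])
    fix "is" :: "'n list" and x
    let ?L = "l ^ length is * M (length is)"
    have le: "cmod (of_real (b n) * pd is (u n) x) \<le> b n * (C * ?L / wgt A q x)" for n
      using mult_left_mono[OF gs_le_pd_div[OF uC[of n] s, of "is" x] b(2)[of n]] b(2)[of n] by (simp add: norm_mult)
    have sb: "summable (\<lambda>n. b n * (C * ?L / wgt A q x))" by (rule summable_mult2[OF b(1)])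
    have sn: "summable (\<lambda>n. cmod (of_real (b n) * pd is (u n) x))"
      by (rule summable_comparison_test[OF _ sb]) (use le in auto)
    have "cmod (\<Sum>n. of_real (b n) * pd is (u n) x) \<le> (\<Sum>n. cmod (of_real (b n) * pd is (u n) x))"
      by (rule summable_norm[OF sn])
    also have "\<dots> \<le> (\<Sum>n. b n * (C * ?L / wgt A q x))" by (rule suminf_le[OF le sn sb])
    also have "\<dots> = suminf b * (C * ?L / wgt A q x)" by (rule suminf_mult2[OF b(1), symmetric])
    finally show "cmod (pd is (\<lambda>x. \<Sum>n. of_real (b n) * u n x) x) * wgt A q x \<le> C * suminf b * ?L"
      unfolding su(2) by (simp add: pos_le_divide_eq mult_ac)
  qed
  have "suminf b \<ge> 0" by (rule suminf_nonneg[OF b])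
  then have pos: "C * suminf b + 1 > 0" if "C > 0" for C using that by (simp add: add_nonneg_pos)
  have g': "gs_le M A l q (C * suminf b + 1) (\<lambda>x. \<Sum>n. of_real (b n) * u n x)"
    if "\<And>n. gs_le M A l q C (u n)" "l > 0" "q > 0" for l q C
    by (rule gs_le_mono[OF g[OF that(1)]]) (use that in auto)
  have "TS_bounded be M A {(\<lambda>x. \<Sum>n. of_real (b n) * u n x)}"
  proof (cases be)
    case True
    have "\<exists>C>0. gs_le M A l q C (\<lambda>x. \<Sum>n. of_real (b n) * u n x)" if lq: "l > 0" "q > 0" for l q
    proof -
      obtain C where "C > 0" "\<forall>n. gs_le M A l q C (u n)" using B True lq unfolding TS_bounded_iff by simp blast
      then show ?thesis using g' pos lq by blast
    qed
    then show ?thesis unfolding TS_bounded_iff using True su(1) by auto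
  next
    case False
    obtain l q C where "l > 0" "q > 0" "C > 0" "\<forall>n. gs_le M A l q C (u n)" using B False unfolding TS_bounded_iff by auto
    then show ?thesis unfolding TS_bounded_iff using False su(1) g' pos by (simp, meson)
  qed
  then show "(\<lambda>x. \<Sum>n. of_real (b n) * u n x) \<in> TS be M A" by (simp add: TS_bounded_singleton)
qed

lemma conv_lincomb_left:
  fixes f g h :: "'n::finite testfun"
  assumes "f \<in> TS b M A" "g \<in> TS b M A" "h \<in> TS b M A"
  shows "conv (\<lambda>x. a * f x + c * g x) h = (\<lambda>x. a * conv f h x + c * conv g h x)"
proof
  fix x
  obtain K where K: "\<And>x. cmod (pd [] h x) \<le> K" using TS_bound[OF assms(3)] by metis
  have m: "(\<lambda>y. h (x - y)) \<in> borel_measurable borel" using TS_measurable[OF assms(3)] by measurable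
  have "integrable lborel (\<lambda>y. f y * h (x - y))" "integrable lborel (\<lambda>y. g y * h (x - y))"
    using K by (auto intro!: integrable_mult_bounded[OF TS_integrable m] assms)
  then have "(\<integral>y. a * (f y * h (x - y)) + c * (g y * h (x - y)) \<partial>lborel) = a * conv f h x + c * conv g h x"
    by (simp add: conv_def)
  then show "conv (\<lambda>x. a * f x + c * g x) h x = a * conv f h x + c * conv g h x"
    by (simp add: conv_def algebra_simps)
qed

lemma conv_lincomb_right:
  fixes f g h :: "'n::finite testfun"
  assumes "f \<in> TS b M A" "g \<in> TS b M A" "h \<in> TS b M A"
  shows "conv h (\<lambda>x. a * f x + c * g x) = (\<lambda>x. a * conv h f x + c * conv h g x)"
  using conv_lincomb_left[OF assms, of a c] by (metis (no_types, lifting) conv_commute ext)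

end

section \<open>The operator \<open>R\<close> of convolution with the given ultradistribution\<close>

locale tmib_conv = tmib M A beur \<iota> for M A :: "nat \<Rightarrow> real" and beur and \<iota> :: "'e::banach \<Rightarrow> 'n::finite udist" +
  fixes f :: "'n udist"
  assumes fUD: "f \<in> UD beur M A" and fE: "\<phi> \<in> T \<Longrightarrow> inE (ud_conv f \<phi>)"
begin

definition R :: "'n testfun \<Rightarrow> 'e" where "R \<phi> = rp (ud_conv f \<phi>)"

lemma iota_R: "\<phi> \<in> T \<Longrightarrow> \<psi> \<in> T \<Longrightarrow> \<iota> (R \<phi>) \<psi> = f (conv \<psi> (reflect \<phi>))"
  using rp[OF fE] by (simp add: R_def ud_conv_def)

lemma TST_T: "\<phi> \<in> TS True M A \<Longrightarrow> \<phi> \<in> T"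
  using TS_True_subset by blast

lemma R_lincomb:
  assumes "\<phi> \<in> T" "\<psi> \<in> T"
  shows "R (\<lambda>x. a * \<phi> x + b * \<psi> x) = cs a (R \<phi>) + cs b (R \<psi>)"
proof (rule iota_inj)
  fix \<eta> assume \<eta>: "\<eta> \<in> T"
  have r: "reflect (\<lambda>x. a * \<phi> x + b * \<psi> x) = (\<lambda>x. a * reflect \<phi> x + b * reflect \<psi> x)" by (simp add: reflect_def)
  show "\<iota> (R (\<lambda>x. a * \<phi> x + b * \<psi> x)) \<eta> = \<iota> (cs a (R \<phi>) + cs b (R \<psi>)) \<eta>"
    using \<eta> assms
    by (simp add: iota_R TS_lincomb iota_add cs r conv_lincomb_right[of "reflect \<phi>" beur "reflect \<psi>" \<eta>] TS_reflect UD_lin[OF fUD] TS_conv)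
qed

lemma norm_R_add:
  assumes "\<phi> \<in> T" "\<psi> \<in> T"
  shows "norm (R (\<lambda>x. \<phi> x + \<psi> x)) \<le> norm (R \<phi>) + norm (R \<psi>)"
  using R_lincomb[OF assms, of 1 1] norm_triangle_ineq[of "cs 1 (R \<phi>)" "cs 1 (R \<psi>)"] by (simp add: norm_cs)

lemma norm_R_diff:
  assumes "\<phi> \<in> T" "\<psi> \<in> T"
  shows "norm (R \<phi> - R \<psi>) = norm (R (\<lambda>x. 1 * \<phi> x + (-1) * \<psi> x))"
proof -
  have "R (\<lambda>x. 1 * \<phi> x + (-1) * \<psi> x) = R \<phi> - R \<psi>"
    unfolding R_lincomb[OF assms] by (rule iota_inj) (simp add: iota_add iota_minus cs)
  then show ?thesis by simp
qed

lemma norm_R_cmult: "\<phi> \<in> T \<Longrightarrow> norm (R (\<lambda>x. a * \<phi> x)) = cmod a * norm (R \<phi>)"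
proof -
  assume \<phi>: "\<phi> \<in> T"
  have "R (\<lambda>x. a * \<phi> x) = cs a (R \<phi>)"
  proof (rule iota_inj)
    fix \<eta> assume \<eta>: "\<eta> \<in> T"
    have r: "reflect (\<lambda>x. a * \<phi> x) = (\<lambda>x. a * reflect \<phi> x)" by (simp add: reflect_def)
    show "\<iota> (R (\<lambda>x. a * \<phi> x)) \<eta> = \<iota> (cs a (R \<phi>)) \<eta>"
      using \<eta> \<phi> by (simp add: iota_R TS_cmult cs r conv_cmult_right TS_reflect UD_cmult[OF fUD] TS_conv)
  qed
  then show ?thesis by (simp add: norm_cs)
qed

text \<open>By associativity f * (\<open>\<phi>\<close> * \<open>\<psi>\<close>) is the convolution
  of f * \<open>\<phi>\<close>, already in the space, with \<open>\<psi>\<close>, so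
  \<open>conv_in_E\<close> applies. For fixed \<open>\<phi>\<close> this is continuity in
  \<open>\<psi>\<close>.\<close>

lemma norm_R_conv:
  assumes \<phi>: "\<phi> \<in> T" and \<psi>: "\<psi> \<in> T" and tb: "tb q C" and int: "integrable lborel (\<lambda>y. cmod (\<psi> y) * wgt A q y)"
  shows "norm (R (conv \<phi> \<psi>)) \<le> C * (\<integral>y. cmod (\<psi> y) * wgt A q y \<partial>lborel) * norm (R \<phi>)"
proof -
  have "rp (ud_conv (ud_conv f \<phi>) \<psi>) = R (conv \<phi> \<psi>)"
    unfolding R_def
  proof (rule rp_cong[THEN conjunct1])
    fix \<eta> assume \<eta>: "\<eta> \<in> T"
    show "ud_conv (ud_conv f \<phi>) \<psi> \<eta> = ud_conv f (conv \<phi> \<psi>) \<eta>"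
      using conv_assoc[OF \<eta> TS_reflect[OF \<psi>] TS_reflect[OF \<phi>]]
      by (simp add: ud_conv_def reflect_conv conv_commute[of "reflect \<phi>" "reflect \<psi>"])
  qed
  then show ?thesis using conv_in_E[OF \<psi> tb int fE[OF \<phi>]] by (simp add: R_def)
qed

text \<open>If every bound failed, a sum of \<open>b n\<close> times \<open>\<phi> n\<close> could
  be built, with \<open>\<psi> n\<close> detecting its n-th term: earlier terms are compensated by
  the choice of \<open>\<phi> n\<close> and \<open>\<psi> n\<close>, later ones by small
  coefficients. Then the norm of R(sum * \<open>\<psi> n\<close>) is at least n, while
  \<open>norm_R_conv\<close> keeps it bounded. In the Beurling case \<open>l n\<close> tends to 0 to
  make the sum converge in all seminorms; in the Roumieu case one fixed \<open>l\<close>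
  suffices.\<close>

lemma gliding_hump:
  fixes l :: "nat \<Rightarrow> real"
  assumes tb: "tb q Cq" and l: "\<And>n. l n > 0" "\<And>n. domK TYPE('n) * q \<le> 1 / l n"
    and lb: "if beur then l \<longlonglongrightarrow> 0 else \<forall>n. l n = l 0"
  shows "\<exists>n K. \<forall>\<phi>\<in>TS True M A. \<forall>\<psi>\<in>TS True M A. gs_le M A (l n) (1 / l n) 1 \<phi> \<longrightarrow>
      (\<integral>y. cmod (\<psi> y) * wgt A q y \<partial>lborel) \<le> 1 \<longrightarrow> norm (R (conv \<phi> \<psi>)) \<le> K"
proof (rule ccontr)
  assume "\<not> ?thesis"
  then have neg: "\<exists>\<phi>\<in>TS True M A. \<exists>\<psi>\<in>TS True M A. gs_le M A (l n) (1 / l n) 1 \<phi> \<and>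
      (\<integral>y. cmod (\<psi> y) * wgt A q y \<partial>lborel) \<le> 1 \<and> norm (R (conv \<phi> \<psi>)) > K" for n K
    by (meson not_le)
  have q: "q > 0" "Cq > 0" using tb by (auto simp: tb_def)
  define r where "r = domK TYPE('n) * q"
  have r: "r > 0" using q domK(1)[of "TYPE('n)"] by (simp add: r_def)
  \<comment> \<open>A bound for the weighted L^1 norm of any function dominated by
    \<open>M 0 / wgt A r x\<close>, as all the chosen \<open>\<phi> n\<close> will be.\<close>
  define a where "a = M 0 * (\<integral>x. wgt A q x / wgt A r (x::real^'n) \<partial>lborel)"
  have a0: "a \<ge> 0" unfolding a_def by (intro mult_nonneg_nonneg integral_nonneg_AE) auto
  let ?N = "\<lambda>\<phi>. norm (R \<phi>)"
  \<comment> \<open>A stage consists of the partial sum \<open>S\<close> of earlier terms, the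
    coefficient \<open>b\<close>, and a pair beating \<open>S\<close> by the margin n + 1. In
    \<open>Q\<close> the last clause makes the sum of all later terms, convolved with
    \<open>\<psi>\<close>, contribute at most 1; the 2 comes from the halving of the
    coefficients.\<close>
  define P where "P = (\<lambda>n (S, b, \<phi>, \<psi>). S \<in> TS True M A \<and> (n = 0 \<longrightarrow> S = (\<lambda>x. 0)) \<and> b > 0 \<and> \<phi> \<in> TS True M A \<and> \<psi> \<in> TS True M A
     \<and> gs_le M A (l n) (1 / l n) 1 \<phi> \<and> (\<integral>y. cmod (\<psi> y) * wgt A q y \<partial>lborel) \<le> 1 \<and> b * ?N (conv \<phi> \<psi>) \<ge> real n + 1 + Cq * ?N S)"
  define Q where "Q = (\<lambda>(n::nat) (S, b, \<phi>, \<psi>) (S' :: 'n testfun, b'::real, \<phi>'::'n testfun, \<psi>'::'n testfun). S' = (\<lambda>x. S x + of_real b * \<phi> x) \<and> b' \<le> b / 2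
     \<and> 2 * a * Cq * ?N \<psi> * b' \<le> 1)"
  have step: "\<exists>\<phi> \<psi>. P n (S, b, \<phi>, \<psi>)" if "S \<in> TS True M A" "n = 0 \<longrightarrow> S = (\<lambda>x. 0)" "b > 0" for n S b
  proof -
    obtain \<phi> \<psi> where "\<phi> \<in> TS True M A" "\<psi> \<in> TS True M A" "gs_le M A (l n) (1 / l n) 1 \<phi>"
      "(\<integral>y. cmod (\<psi> y) * wgt A q y \<partial>lborel) \<le> 1" "?N (conv \<phi> \<psi>) > (real n + 1 + Cq * ?N S) / b"
      using neg by blast
    then have "P n (S, b, \<phi>, \<psi>)" using that by (simp add: P_def divide_less_eq mult.commute less_imp_le)
    then show ?thesis by blast
  qed
  have "\<exists>s. \<forall>n. P n (s n) \<and> Q n (s n) (s (Suc n))"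
  proof (rule dependent_nat_choice)
    show "\<exists>x. P 0 x" using step[of "\<lambda>x. 0" 0 1] TS_zero[of True] by auto
    fix x n assume Px: "P n x"
    obtain S b \<phi> \<psi> where x: "x = (S, b, \<phi>, \<psi>)" by (cases x) auto
    define b' where "b' = min (b / 2) (1 / (2 * a * Cq * ?N \<psi> + 1))"
    have nn: "2 * a * Cq * ?N \<psi> \<ge> 0" using a0 q by simp
    have b: "b > 0" "S \<in> TS True M A" "\<phi> \<in> TS True M A" using Px by (auto simp: P_def x)
    have b': "b' > 0" "b' \<le> b / 2" using b nn by (auto simp: b'_def add_nonneg_pos)
    have "2 * a * Cq * ?N \<psi> * b' \<le> 2 * a * Cq * ?N \<psi> * (1 / (2 * a * Cq * ?N \<psi> + 1))"
      using nn by (intro mult_left_mono) (auto simp: b'_def)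
    also have "\<dots> \<le> 1" using nn by (simp add: divide_le_eq add_nonneg_pos)
    finally have b'3: "2 * a * Cq * ?N \<psi> * b' \<le> 1" .
    define S' where "S' = (\<lambda>x. S x + of_real b * \<phi> x)"
    have "S' \<in> TS True M A" unfolding S'_def using TS_lincomb[OF b(2,3), of 1 "of_real b"] by simp
    then obtain \<phi>' \<psi>' where "P (Suc n) (S', b', \<phi>', \<psi>')" using step[of S' "Suc n" b'] b' by auto
    moreover have "Q n x (S', b', \<phi>', \<psi>')" using b' b'3 by (simp add: Q_def x S'_def)
    ultimately show "\<exists>y. P (Suc n) y \<and> Q n x y" by blast
  qed
  then obtain s where s: "\<And>n. P n (s n)" "\<And>n. Q n (s n) (s (Suc n))" by blast
  define S b \<phi> \<psi> where "S = (\<lambda>n. fst (s n))" and "b = (\<lambda>n. fst (snd (s n)))"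
    and "\<phi> = (\<lambda>n. fst (snd (snd (s n))))" and "\<psi> = (\<lambda>n. snd (snd (snd (s n))))"
  have sn: "s n = (S n, b n, \<phi> n, \<psi> n)" for n by (simp add: S_def b_def \<phi>_def \<psi>_def)
  have P: "S n \<in> TS True M A" "b n > 0" "\<phi> n \<in> TS True M A" "\<psi> n \<in> TS True M A" "gs_le M A (l n) (1 / l n) 1 (\<phi> n)"
    "(\<integral>y. cmod (\<psi> n y) * wgt A q y \<partial>lborel) \<le> 1" "b n * ?N (conv (\<phi> n) (\<psi> n)) \<ge> real n + 1 + Cq * ?N (S n)" for n
    using s(1)[of n] by (auto simp: P_def sn)
  have S0: "S 0 = (\<lambda>x. 0)" using s(1)[of 0] by (simp add: P_def sn)
  have Q: "S (Suc n) = (\<lambda>x. S n x + of_real (b n) * \<phi> n x)" "b (Suc n) \<le> b n / 2" "2 * a * Cq * ?N (\<psi> n) * b (Suc n) \<le> 1" for n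
    using s(2)[of n] by (auto simp: Q_def sn)
  have bgeo: "b (k + n) \<le> b n * (1/2) ^ k" for k n
  proof (induction k)
    case (Suc k)
    then show ?case using Q(2)[of "k + n"] by simp
  qed simp
  have geo: "summable (\<lambda>k. b n * (1/2::real) ^ k)" "(\<Sum>k. b n * (1/2::real) ^ k) = 2 * b n" for n
    using suminf_geometric[of "1/2::real"] by (auto intro!: summable_mult summable_geometric simp: suminf_mult)
  have bsum: "summable (\<lambda>k. b (k + n))" for n
    by (rule summable_comparison_test[OF _ geo(1)[of n]]) (use bgeo P(2) in \<open>auto simp: less_imp_le\<close>)
  have ble: "(\<Sum>k. b (k + n)) \<le> 2 * b n" for n
    using suminf_le[OF bgeo bsum geo(1)] geo(2) by simp
  have \<phi>sm: "smooth (\<phi> k)" for k by (rule TS_smooth[OF P(3)])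
  \<comment> \<open>In the Beurling case a given seminorm controls \<open>\<phi> k\<close> by 1 as
    soon as \<open>l k\<close> is small enough; the finitely many earlier functions are bounded one
    by one.\<close>
  have Bd: "TS_bounded beur M A (range (\<lambda>k. \<phi> (k + n)))" for n
  proof (cases beur)
    case True
    have "\<exists>C>0. \<forall>k. gs_le M A l' q' C (\<phi> k)" if lq: "l' > 0" "q' > 0" for l' q'
    proof -
      define \<epsilon> where "\<epsilon> = min l' (1 / q')"
      have \<epsilon>: "\<epsilon> > 0" "\<epsilon> \<le> l'" "q' \<le> 1 / \<epsilon>" using lq by (auto simp: \<epsilon>_def min_def field_simps)
      have "eventually (\<lambda>n. l n < \<epsilon>) sequentially" using lb True \<epsilon> by (auto intro: order_tendstoD)
      then obtain N where N: "\<And>n. n \<ge> N \<Longrightarrow> l n < \<epsilon>" by (auto simp: eventually_sequentially)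
      have "\<exists>C>0. gs_le M A l' q' C (\<phi> k)" for k using TS_True_gs_le[OF P(3) lq] by metis
      then obtain C where C: "\<And>k. C k > 0" "\<And>k. gs_le M A l' q' (C k) (\<phi> k)" by metis
      define D where "D = 1 + (\<Sum>k<N. C k)"
      have D: "D \<ge> 1" using sum_nonneg[of "{..<N}" C] C(1) by (simp add: D_def less_imp_le)
      have "gs_le M A l' q' D (\<phi> k)" for k
      proof (cases "k < N")
        case True
        then have "C k \<le> D" unfolding D_def using C(1) member_le_sum[of k "{..<N}" C] by (simp add: less_imp_le)
        then show ?thesis by (intro gs_le_mono[OF C(2)]) (use lq in auto)
      next
        case False
        then have "l k < \<epsilon>" using N by simp
        moreover from this have "1 / \<epsilon> \<le> 1 / l k" using l(1)[of k] by (intro divide_left_mono) auto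
        ultimately show ?thesis using \<epsilon> l(1)[of k] lq D by (intro gs_le_mono[OF P(5)]) auto
      qed
      then show ?thesis using D by (intro exI[of _ D]) auto
    qed
    then have "\<forall>l'>0. \<forall>q'>0. \<exists>C>0. \<forall>\<phi>'\<in>range (\<lambda>k. \<phi> (k + n)). gs_le M A l' q' C \<phi>'"
      by (metis (no_types, lifting) imageE)
    then show ?thesis unfolding TS_bounded_iff using True \<phi>sm by auto
  next
    case False
    then have "l k = l 0" for k using lb by auto
    then have "gs_le M A (l 0) (1 / l 0) 1 (\<phi> k)" for k using P(5)[of k] by metis
    then have "\<exists>l'>0. \<exists>q'>0. \<exists>C>0. \<forall>\<phi>'\<in>range (\<lambda>k. \<phi> (k + n)). gs_le M A l' q' C \<phi>'"
    proof -
      assume "\<And>k. gs_le M A (l 0) (1 / l 0) 1 (\<phi> k)"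
      then have "0 < l 0 \<and> 0 < 1 / l 0 \<and> (0::real) < 1 \<and> (\<forall>\<phi>'\<in>range (\<lambda>k. \<phi> (k + n)). gs_le M A (l 0) (1 / l 0) 1 \<phi>')"
        using l(1)[of 0] by auto
      then show ?thesis by blast
    qed
    then show ?thesis unfolding TS_bounded_iff using False \<phi>sm by auto
  qed
  have \<phi>bd: "cmod (\<phi> k x) \<le> M 0 / wgt A r x" for k x
  proof -
    have "gs_le M A (l k) r 1 (\<phi> k)" by (rule gs_le_mono[OF P(5)]) (use l r in \<open>auto simp: r_def\<close>)
    from gs_le_pd_div[OF this TS_smooth[OF P(3)], of "[]" x] show ?thesis by simp
  qed
  define tl where "tl = (\<lambda>n x. \<Sum>k. of_real (b (k + n)) * \<phi> (k + n) x)"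
  have tlT: "tl n \<in> T" for n
    unfolding tl_def using TS_suminf(1)[OF Bd bsum] P(2) by (simp add: less_imp_le)
  have tls: "summable (\<lambda>k. of_real (b (k + n)) * \<phi> (k + n) x)" for n x
    using TS_suminf(2)[OF Bd bsum] P(2) by (simp add: less_imp_le)
  have tl_bd: "cmod (tl n x) \<le> (2 * b n * M 0) / wgt A r x" for n x
  proof -
    have le: "cmod (of_real (b (k + n)) * \<phi> (k + n) x) \<le> b (k + n) * (M 0 / wgt A r x)" for k
      using mult_left_mono[OF \<phi>bd[of "k + n" x], of "b (k + n)"] P(2)[of "k + n"] by (simp add: norm_mult)
    have s1: "summable (\<lambda>k. b (k + n) * (M 0 / wgt A r x))" by (rule summable_mult2[OF bsum])
    have s2: "summable (\<lambda>k. cmod (of_real (b (k + n)) * \<phi> (k + n) x))"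
      by (rule summable_comparison_test[OF _ s1]) (use le in auto)
    have "cmod (tl n x) \<le> (\<Sum>k. cmod (of_real (b (k + n)) * \<phi> (k + n) x))"
      unfolding tl_def by (rule summable_norm[OF s2])
    also have "\<dots> \<le> (\<Sum>k. b (k + n) * (M 0 / wgt A r x))" by (rule suminf_le[OF le s2 s1])
    also have "\<dots> = (\<Sum>k. b (k + n)) * (M 0 / wgt A r x)" by (rule suminf_mult2[OF bsum, symmetric])
    also have "\<dots> \<le> (2 * b n) * (M 0 / wgt A r x)" using ble by (intro mult_right_mono) auto
    finally show ?thesis by simp
  qed
  have split: "tl 0 x = S n x + tl n x" for n x
  proof (induction n)
    case (Suc n)
    have "tl n x = of_real (b n) * \<phi> n x + tl (Suc n) x"
      unfolding tl_def using suminf_split_head[OF tls[of n x]] by (simp add: algebra_simps)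
    then show ?case using Suc by (simp add: Q(1) algebra_simps)
  qed (simp add: S0)
  have "real n \<le> Cq * ?N (tl 0)" for n
  proof -
    have \<psi>T: "\<psi> n \<in> T" and \<phi>T: "\<phi> n \<in> T" and ST: "S n \<in> T" using P TST_T by auto
    have \<psi>i: "integrable lborel (\<lambda>y. cmod (\<psi> n y) * wgt A q y)" by (rule TS_True_wgt_integrable[OF P(4) q(1)])
    have bound: "?N (conv \<eta> (\<psi> n)) \<le> Cq * ?N \<eta>" if "\<eta> \<in> T" for \<eta>
    proof -
      have "?N (conv \<eta> (\<psi> n)) \<le> Cq * (\<integral>y. cmod (\<psi> n y) * wgt A q y \<partial>lborel) * ?N \<eta>"
        by (rule norm_R_conv[OF that \<psi>T tb \<psi>i])
      also have "\<dots> \<le> Cq * 1 * ?N \<eta>" using P(6)[of n] q by (intro mult_right_mono mult_left_mono) auto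
      finally show ?thesis by simp
    qed
    have tlint: "integrable lborel (\<lambda>y. cmod (tl (Suc n) y) * wgt A q y)"
      and tlle: "(\<integral>y. cmod (tl (Suc n) y) * wgt A q y \<partial>lborel) \<le> (2 * b (Suc n) * M 0) * (\<integral>x. wgt A q x / wgt A r (x::real^'n) \<partial>lborel)"
      by (rule wgt_L1[OF q(1) _ TS_measurable[OF tlT] tl_bd], simp add: r_def)+
    \<comment> \<open>Here the factors exchange roles: the tail is treated as the convolving
      function, and the norm of R(\<open>\<psi> n\<close>), known when \<open>b (Suc n)\<close> was
      chosen, as the constant.\<close>
    have "?N (conv (tl (Suc n)) (\<psi> n)) \<le> Cq * (\<integral>y. cmod (tl (Suc n) y) * wgt A q y \<partial>lborel) * ?N (\<psi> n)"
      using norm_R_conv[OF \<psi>T tlT tb tlint] by (simp add: conv_commute)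
    also have "\<dots> \<le> Cq * (2 * b (Suc n) * a) * ?N (\<psi> n)"
      using tlle q by (intro mult_right_mono mult_left_mono) (auto simp: a_def mult_ac)
    also have "\<dots> \<le> 1" using Q(3)[of n] by (simp add: mult_ac)
    finally have t1: "?N (conv (tl (Suc n)) (\<psi> n)) \<le> 1" .
    have rest: "(\<lambda>x. 1 * S n x + 1 * tl (Suc n) x) \<in> T" by (rule TS_lincomb[OF ST tlT])
    have "(\<lambda>x. of_real (b n) * \<phi> n x) = (\<lambda>x. 1 * tl 0 x + (-1) * (1 * S n x + 1 * tl (Suc n) x))"
      using split[of _ "Suc n"] by (simp add: Q(1) fun_eq_iff)
    then have "conv (\<lambda>x. of_real (b n) * \<phi> n x) (\<psi> n) = (\<lambda>x. 1 * conv (tl 0) (\<psi> n) x + (-1) * conv (\<lambda>x. 1 * S n x + 1 * tl (Suc n) x) (\<psi> n) x)"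
      using conv_lincomb_left[OF tlT[of 0] rest \<psi>T, of 1 "-1"] by metis
    moreover have "conv (\<lambda>x. of_real (b n) * \<phi> n x) (\<psi> n) = (\<lambda>x. of_real (b n) * conv (\<phi> n) (\<psi> n) x)"
      by (metis conv_cmult_right conv_commute)
    ultimately have "b n * ?N (conv (\<phi> n) (\<psi> n)) = ?N (\<lambda>x. 1 * conv (tl 0) (\<psi> n) x + (-1) * conv (\<lambda>x. 1 * S n x + 1 * tl (Suc n) x) (\<psi> n) x)"
      using norm_R_cmult[OF TS_conv[OF \<phi>T \<psi>T], of "of_real (b n)"] P(2)[of n] by simp
    also have "\<dots> \<le> ?N (conv (tl 0) (\<psi> n)) + ?N (conv (\<lambda>x. 1 * S n x + 1 * tl (Suc n) x) (\<psi> n))"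
      unfolding norm_R_diff[OF TS_conv[OF tlT \<psi>T] TS_conv[OF rest \<psi>T], symmetric] by (rule norm_triangle_ineq4)
    also have "?N (conv (\<lambda>x. 1 * S n x + 1 * tl (Suc n) x) (\<psi> n)) \<le> ?N (conv (S n) (\<psi> n)) + ?N (conv (tl (Suc n)) (\<psi> n))"
      using norm_R_add[OF TS_conv[OF ST \<psi>T] TS_conv[OF tlT \<psi>T]] conv_lincomb_left[OF ST tlT \<psi>T, of 1 1] by simp
    also have "?N (conv (tl 0) (\<psi> n)) + (?N (conv (S n) (\<psi> n)) + ?N (conv (tl (Suc n)) (\<psi> n))) \<le> Cq * ?N (tl 0) + (Cq * ?N (S n) + 1)"
      using bound[OF tlT] bound[OF ST] t1 by (intro add_mono) auto
    finally show ?thesis using P(7)[of n] by simp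
  qed
  then show False using reals_Archimedean2[of "Cq * ?N (tl 0)"] by (metis not_le)
qed

text \<open>The single parameter \<open>l\<close> governs both the seminorm of \<open>\<phi>\<close>
  and the weight 1/l for \<open>\<psi>\<close>. Functions of Beurling type have finite values for
  both, whatever \<open>l\<close> is.\<close>

definition ubd :: "real \<Rightarrow> bool" where
  "ubd l \<longleftrightarrow> (\<exists>C>0. \<forall>\<phi>\<in>TS True M A. \<forall>\<psi>\<in>TS True M A. \<forall>P>0. \<forall>D>0. gs_le M A l (1 / l) P \<phi> \<longrightarrow>
      (\<integral>y. cmod (\<psi> y) * wgt A (1 / l) y \<partial>lborel) \<le> D \<longrightarrow> norm (R (conv \<phi> \<psi>)) \<le> C * P * D)"

theorem uniform_bound:
  "if beur then \<exists>l0>0. \<forall>l>0. l \<le> l0 \<longrightarrow> ubd l else \<forall>l>0. ubd l"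
proof -
  have K1: "domK TYPE('n) \<ge> 1" by (rule domK)
  \<comment> \<open>Dividing by \<open>P\<close> and \<open>D\<close> gives the normalised form of
    the hump lemma. Passing to a smaller \<open>l'\<close> strengthens the assumptions on both
    functions.\<close>
  have main: "ubd l'" if tb: "tb q Cq" and l': "0 < l'" "l' \<le> l" "domK TYPE('n) * q \<le> 1 / l"
    and K: "\<forall>\<phi>\<in>TS True M A. \<forall>\<psi>\<in>TS True M A. gs_le M A l (1 / l) 1 \<phi> \<longrightarrow>
      (\<integral>y. cmod (\<psi> y) * wgt A q y \<partial>lborel) \<le> 1 \<longrightarrow> norm (R (conv \<phi> \<psi>)) \<le> K" for q Cq l l' K
  proof -
    have q: "q > 0" using tb by (simp add: tb_def)
    have lpos: "l > 0" using l' by simp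
    have ql: "q \<le> 1 / l'"
    proof -
      have "q \<le> domK TYPE('n) * q" using K1 q by simp
      also have "\<dots> \<le> 1 / l" using l' by simp
      also have "\<dots> \<le> 1 / l'" using l' by (intro divide_left_mono) auto
      finally show ?thesis .
    qed
    have "norm (R (conv \<phi> \<psi>)) \<le> (\<bar>K\<bar> + 1) * P * D"
      if h: "\<phi> \<in> TS True M A" "\<psi> \<in> TS True M A" "P > 0" "D > 0" "gs_le M A l' (1 / l') P \<phi>" "(\<integral>y. cmod (\<psi> y) * wgt A (1 / l') y \<partial>lborel) \<le> D" for \<phi> \<psi> P D
    proof -
      define \<phi>' \<psi>' where "\<phi>' = (\<lambda>x. of_real (1 / P) * \<phi> x)" and "\<psi>' = (\<lambda>x. of_real (1 / D) * \<psi> x)"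
      have T': "\<phi>' \<in> TS True M A" "\<psi>' \<in> TS True M A" unfolding \<phi>'_def \<psi>'_def using TS_cmult[OF h(1)] TS_cmult[OF h(2)] by blast+
      have "gs_le M A l' (1 / l') (cmod (of_real (1 / P)) * P + cmod 0 * P) (\<lambda>x. of_real (1 / P) * \<phi> x + 0 * \<phi> x)"
        using h TS_smooth by (intro gs_le_lincomb) auto
      then have "gs_le M A l' (1 / l') 1 \<phi>'" using h by (simp add: \<phi>'_def norm_divide)
      then have 1: "gs_le M A l (1 / l) 1 \<phi>'"
        by (rule gs_le_mono) (use l' in \<open>auto intro!: divide_left_mono\<close>)
      have i1: "integrable lborel (\<lambda>y. cmod (\<psi> y) * wgt A (1 / l') y)" by (rule TS_True_wgt_integrable[OF h(2)]) (use l' in simp)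
      have i2: "integrable lborel (\<lambda>y. cmod (\<psi> y) * wgt A q y)" by (rule TS_True_wgt_integrable[OF h(2) q])
      have "(\<integral>y. cmod (\<psi> y) * wgt A q y \<partial>lborel) \<le> (\<integral>y. cmod (\<psi> y) * wgt A (1 / l') y \<partial>lborel)"
        using A.wgt_mono[OF _ ql] q by (intro integral_mono_AE[OF i2 i1] AE_I2 mult_left_mono) auto
      then have le: "(\<integral>y. cmod (\<psi> y) * wgt A q y \<partial>lborel) \<le> D" using h(6) by linarith
      have "(\<integral>y. cmod (\<psi>' y) * wgt A q y \<partial>lborel) = (\<integral>y. (1 / D) * (cmod (\<psi> y) * wgt A q y) \<partial>lborel)"
        using h(4) by (simp add: \<psi>'_def norm_mult norm_divide)
      also have "\<dots> = (1 / D) * (\<integral>y. cmod (\<psi> y) * wgt A q y \<partial>lborel)" by (rule integral_mult_right_zero)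
      also have "\<dots> \<le> 1" using le h(4) by (simp add: divide_le_eq)
      finally have 2: "(\<integral>y. cmod (\<psi>' y) * wgt A q y \<partial>lborel) \<le> 1" .
      have 3: "norm (R (conv \<phi>' \<psi>')) \<le> K" using K T' 1 2 by blast
      have "conv \<phi>' \<psi>' = (\<lambda>x. of_real (1 / (P * D)) * conv \<phi> \<psi> x)"
        unfolding \<phi>'_def \<psi>'_def conv_cmult_right by (subst conv_commute, subst conv_cmult_right, subst conv_commute) (simp add: mult_ac)
      then have "norm (R (conv \<phi>' \<psi>')) = (1 / (P * D)) * norm (R (conv \<phi> \<psi>))"
        using norm_R_cmult[OF TST_T[OF TS_conv[OF h(1,2)]], of "of_real (1 / (P * D))"] h by (simp add: norm_divide norm_mult)
      with 3 have "norm (R (conv \<phi> \<psi>)) \<le> K * (P * D)" using h by (simp add: divide_le_eq)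
      also have "\<dots> \<le> (\<bar>K\<bar> + 1) * (P * D)" using h by (intro mult_right_mono) auto
      finally show ?thesis by (simp add: mult_ac)
    qed
    then show ?thesis unfolding ubd_def by (intro exI[of _ "\<bar>K\<bar> + 1"]) auto
  qed
  show ?thesis
  proof (cases beur)
    case True
    then obtain q Cq where tb: "tb q Cq" using tb_ex by auto
    have q: "domK TYPE('n) * q > 0" using tb K1 by (simp add: tb_def)
    \<comment> \<open>Tends to 0 and starts at the largest value that \<open>gliding_hump\<close>
      admits for this \<open>q\<close>.\<close>
    define l where "l = (\<lambda>n. (1 / (domK TYPE('n) * q)) * (1 / real (Suc n)))"
    have lim: "l \<longlonglongrightarrow> 0" unfolding l_def by (rule tendsto_mult_right_zero[OF lim_1_over_n[THEN LIMSEQ_Suc]])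
    have lpos: "l n > 0" for n using q by (simp add: l_def)
    have lle: "domK TYPE('n) * q \<le> 1 / l n" for n using q by (simp add: l_def mult_le_cancel_left1)
    obtain n K where "\<forall>\<phi>\<in>TS True M A. \<forall>\<psi>\<in>TS True M A. gs_le M A (l n) (1 / l n) 1 \<phi> \<longrightarrow>
      (\<integral>y. cmod (\<psi> y) * wgt A q y \<partial>lborel) \<le> 1 \<longrightarrow> norm (R (conv \<phi> \<psi>)) \<le> K"
      using gliding_hump[of q Cq l, OF tb lpos lle] lim True by (simp only: if_True) blast
    from main[OF tb _ _ lle this] show ?thesis using True lpos[of n] by auto
  next
    case False
    have "ubd l" if l: "l > 0" for l
    proof -
      define q where "q = 1 / (domK TYPE('n) * l)"
      have q: "q > 0" "domK TYPE('n) * q = 1 / l" using l K1 by (auto simp: q_def)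
      then obtain Cq where tb: "tb q Cq" using tb_ex False by auto
      obtain n K where "\<forall>\<phi>\<in>TS True M A. \<forall>\<psi>\<in>TS True M A. gs_le M A l (1 / l) 1 \<phi> \<longrightarrow>
        (\<integral>y. cmod (\<psi> y) * wgt A q y \<partial>lborel) \<le> 1 \<longrightarrow> norm (R (conv \<phi> \<psi>)) \<le> K"
        using gliding_hump[OF tb, of "\<lambda>_. l"] l q False by auto
      from main[OF tb l order.refl _ this] q show ?thesis by simp
    qed
    then show ?thesis using False by simp
  qed
qed

end

section \<open>Fourier inversion\<close>

lemma
  fixes f :: "'a::euclidean_space \<Rightarrow> real \<Rightarrow> complex"
  assumes f: "\<And>b. b \<in> Basis \<Longrightarrow> integrable lborel (f b)"
  shows integrable_lborel_prod: "integrable lborel (\<lambda>x::'a. \<Prod>b\<in>Basis. f b (x \<bullet> b))"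
    and integral_lborel_prod: "(\<integral>x. (\<Prod>b\<in>Basis. f b ((x::'a) \<bullet> b)) \<partial>lborel) = (\<Prod>b\<in>Basis. \<integral>x. f b x \<partial>lborel)"
proof -
  interpret product_sigma_finite "\<lambda>_::'a. lborel :: real measure" by standard
  have [measurable]: "\<And>b. b \<in> Basis \<Longrightarrow> f b \<in> borel_measurable borel" using f by auto
  have m: "(\<lambda>g. \<Sum>b\<in>Basis. g b *\<^sub>R b) \<in> measurable (\<Pi>\<^sub>M b\<in>(Basis::'a set). lborel) borel" by measurable
  have m2: "(\<lambda>x::'a. \<Prod>b\<in>Basis. f b (x \<bullet> b)) \<in> borel_measurable borel" by measurable
  have i: "(\<Prod>b\<in>Basis. f b ((\<Sum>b\<in>Basis. g b *\<^sub>R b) \<bullet> b)) = (\<Prod>b\<in>Basis. f b (g b))" for g :: "'a \<Rightarrow> real"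
    by (rule prod.cong) (auto simp: inner_sum_left_Basis)
  have I: "integrable (\<Pi>\<^sub>M b\<in>(Basis::'a set). lborel) (\<lambda>g. \<Prod>b\<in>Basis. f b (g b))"
    by (rule product_integrable_prod) (use f in auto)
  show "integrable lborel (\<lambda>x::'a. \<Prod>b\<in>Basis. f b (x \<bullet> b))"
    by (subst lborel_eq) (simp add: integrable_distr_eq[OF m m2] i I)
  have "(\<integral>x. (\<Prod>b\<in>Basis. f b ((x::'a) \<bullet> b)) \<partial>lborel) = (\<integral>x. (\<Prod>b\<in>Basis. f b (x b)) \<partial>(\<Pi>\<^sub>M b\<in>(Basis::'a set). lborel))"
    by (subst lborel_eq) (simp add: integral_distr[OF m m2] i)
  then show "(\<integral>x. (\<Prod>b\<in>Basis. f b ((x::'a) \<bullet> b)) \<partial>lborel) = (\<Prod>b\<in>Basis. \<integral>x. f b x \<partial>lborel)"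
    using product_integral_prod[of "Basis::'a set" f] f by simp
qed

text \<open>The integral is the characteristic function of the standard normal distribution, up to
  its normalising constant.\<close>

lemma
  shows integrable_gaussian_iexp: "integrable lborel (\<lambda>x::real. of_real (exp (- x\<^sup>2 / 2)) * iexp (t * x))"
    and integral_gaussian_iexp: "(\<integral>x. of_real (exp (- (x::real)\<^sup>2 / 2)) * iexp (t * x) \<partial>lborel) = of_real (sqrt (2 * pi) * exp (- t\<^sup>2 / 2))"
proof -
  have e: "of_real (exp (- x\<^sup>2 / 2)) * iexp (t * x) = of_real (sqrt (2 * pi)) * (std_normal_density x *\<^sub>R iexp (t * x))" for x :: real
    by (simp add: std_normal_density_def scaleR_conv_of_real field_simps)
  have "integrable std_normal_distribution (\<lambda>x. iexp (t * x))"
  proof -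
    interpret real_distribution std_normal_distribution by (rule real_dist_normal_dist)
    show ?thesis by (rule integrable_const_bound[where B = 1]) auto
  qed
  then have I: "integrable lborel (\<lambda>x. std_normal_density x *\<^sub>R iexp (t * x))"
    by (subst (asm) integrable_density) auto
  show "integrable lborel (\<lambda>x::real. of_real (exp (- x\<^sup>2 / 2)) * iexp (t * x))"
    unfolding e using I by (rule integrable_mult_right)
  have "(\<integral>x. std_normal_density x *\<^sub>R iexp (t * x) \<partial>lborel) = char std_normal_distribution t"
    unfolding char_def by (subst integral_density) auto
  also have "\<dots> = of_real (exp (- t\<^sup>2 / 2))" by (simp add: char_std_normal_distribution)
  finally show "(\<integral>x. of_real (exp (- (x::real)\<^sup>2 / 2)) * iexp (t * x) \<partial>lborel) = of_real (sqrt (2 * pi) * exp (- t\<^sup>2 / 2))"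
    unfolding e integral_mult_right_zero by simp
qed

text \<open>This is exp(-|x|^2/2), written as a product over \<open>Basis\<close> so that its
  integrals factor.\<close>

definition gauss :: "'a::euclidean_space \<Rightarrow> real" where
  "gauss x = (\<Prod>b\<in>Basis. exp (- (x \<bullet> b)\<^sup>2 / 2))"

lemma gauss_0 [simp]: "gauss 0 = 1"
  by (simp add: gauss_def)

lemma gauss_nonneg: "0 \<le> gauss x" and gauss_le_1: "gauss x \<le> 1"
  unfolding gauss_def by (auto intro!: prod_nonneg prod_le_1)

lemma continuous_gauss: "continuous_on S gauss"
  unfolding gauss_def by (intro continuous_intros) simp

lemma gauss_measurable [measurable]: "gauss \<in> borel_measurable borel"
  using continuous_gauss by (rule borel_measurable_continuous_onI)

lemma
  fixes t :: "'a::euclidean_space"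
  shows integrable_gauss_iexp: "integrable lborel (\<lambda>x::'a. of_real (gauss x) * iexp (t \<bullet> x))"
    and integral_gauss_iexp: "(\<integral>x. of_real (gauss (x::'a)) * iexp (t \<bullet> x) \<partial>lborel) = of_real (sqrt (2 * pi) ^ DIM('a) * gauss t)"
proof -
  have e: "of_real (gauss x) * iexp (t \<bullet> x) = (\<Prod>b\<in>Basis. of_real (exp (- (x \<bullet> b)\<^sup>2 / 2)) * iexp ((t \<bullet> b) * (x \<bullet> b)))" for x :: 'a
  proof -
    have "iexp (t \<bullet> x) = (\<Prod>b\<in>Basis. iexp ((t \<bullet> b) * (x \<bullet> b)))"
      by (subst euclidean_inner) (simp add: exp_sum[symmetric] sum_distrib_left)
    then show ?thesis by (simp add: gauss_def prod.distrib)
  qed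
  show "integrable lborel (\<lambda>x::'a. of_real (gauss x) * iexp (t \<bullet> x))"
    unfolding e by (rule integrable_lborel_prod) (rule integrable_gaussian_iexp)
  show "(\<integral>x. of_real (gauss (x::'a)) * iexp (t \<bullet> x) \<partial>lborel) = of_real (sqrt (2 * pi) ^ DIM('a) * gauss t)"
    unfolding e
    by (subst integral_lborel_prod, rule integrable_gaussian_iexp)
      (simp only: integral_gaussian_iexp, simp add: prod.distrib gauss_def)
qed

lemma integrable_gauss: "integrable lborel (gauss :: 'a::euclidean_space \<Rightarrow> real)"
proof -
  have "integrable lborel (\<lambda>x::'a. complex_of_real (gauss x))" using integrable_gauss_iexp[of "0::'a"] by simp
  from integrable_norm[OF this] show ?thesis by (simp add: gauss_nonneg)
qed

lemma integral_gauss: "(\<integral>x. of_real (gauss (x::'a::euclidean_space)) \<partial>lborel) = complex_of_real (sqrt (2 * pi) ^ DIM('a))"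
  using integral_gauss_iexp[of "0::'a"] by simp

text \<open>Gaussian summation: \<open>F\<close> is damped by
  \<open>gauss (\<epsilon> n *\<^sub>R \<xi>)\<close> and the integrals are exchanged, so that the
  inner one becomes a Gaussian concentrating at 0. Both sides converge by dominated
  convergence.\<close>

lemma Fourier_inversion_at_0:
  fixes \<Phi> :: "'a::euclidean_space \<Rightarrow> complex"
  assumes c: "continuous_on UNIV \<Phi>" and B: "\<And>x. cmod (\<Phi> x) \<le> B" and i: "integrable lborel \<Phi>"
  defines "F \<equiv> \<lambda>\<xi>. \<integral>t. \<Phi> t * iexp (2 * pi * (\<xi> \<bullet> t)) \<partial>lborel"
  assumes Fi: "integrable lborel F"
  shows "(\<integral>\<xi>. F \<xi> \<partial>lborel) = \<Phi> 0"
proof -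
  define \<epsilon> where "\<epsilon> = (\<lambda>n. 1 / real (Suc n))"
  have \<epsilon>: "\<epsilon> n > 0" for n by (simp add: \<epsilon>_def)
  have \<epsilon>0: "\<epsilon> \<longlonglongrightarrow> 0" unfolding \<epsilon>_def by (rule lim_1_over_n[THEN LIMSEQ_Suc])
  have [measurable]: "\<Phi> \<in> borel_measurable borel" "F \<in> borel_measurable borel" using i Fi by auto
  define d where "d = DIM('a)"
  have lim1: "(\<lambda>n. \<integral>\<xi>. of_real (gauss (\<epsilon> n *\<^sub>R \<xi>)) * F \<xi> \<partial>lborel) \<longlonglongrightarrow> (\<integral>\<xi>. F \<xi> \<partial>lborel)"
  proof (rule integral_dominated_convergence[where w = "\<lambda>\<xi>. cmod (F \<xi>)"])
    show "AE \<xi> in lborel. (\<lambda>n. of_real (gauss (\<epsilon> n *\<^sub>R \<xi>)) * F \<xi>) \<longlonglongrightarrow> F \<xi>"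
    proof (intro AE_I2)
      fix \<xi> :: 'a
      have "(\<lambda>n. \<epsilon> n *\<^sub>R \<xi>) \<longlonglongrightarrow> 0 *\<^sub>R \<xi>" by (intro tendsto_intros \<epsilon>0)
      then have "(\<lambda>n. gauss (\<epsilon> n *\<^sub>R \<xi>)) \<longlonglongrightarrow> gauss (0::'a)"
        using continuous_on_tendsto_compose[OF continuous_gauss[of UNIV], of "\<lambda>n. \<epsilon> n *\<^sub>R \<xi>" 0 sequentially] by simp
      then have "(\<lambda>n. of_real (gauss (\<epsilon> n *\<^sub>R \<xi>)) * F \<xi>) \<longlonglongrightarrow> of_real (gauss (0::'a)) * F \<xi>" by (intro tendsto_intros)
      then show "(\<lambda>n. of_real (gauss (\<epsilon> n *\<^sub>R \<xi>)) * F \<xi>) \<longlonglongrightarrow> F \<xi>" by simp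
    qed
    show "AE \<xi> in lborel. norm (of_real (gauss (\<epsilon> n *\<^sub>R \<xi>)) * F \<xi>) \<le> cmod (F \<xi>)" for n
      by (intro AE_I2) (simp add: norm_mult abs_of_nonneg mult_left_le_one_le gauss_le_1 gauss_nonneg)
  qed (use Fi in auto)
  have eq: "(\<integral>\<xi>. of_real (gauss (\<epsilon> n *\<^sub>R \<xi>)) * F \<xi> \<partial>lborel)
      = of_real (sqrt (2 * pi) ^ d / (2 * pi) ^ d) * (\<integral>s. of_real (gauss s) * \<Phi> ((\<epsilon> n / (2 * pi)) *\<^sub>R s) \<partial>lborel)" for n
  proof -
    let ?e = "\<epsilon> n"
    have gi: "integrable lborel (\<lambda>\<xi>::'a. complex_of_real (gauss (?e *\<^sub>R \<xi>)))"
      using integrable_lborel_affine[of ?e "\<lambda>x::'a. complex_of_real (gauss x)" 0] \<epsilon>[of n] integrable_gauss by auto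
    have "(\<integral>\<xi>. of_real (gauss (?e *\<^sub>R \<xi>)) * F \<xi> \<partial>lborel) = (\<integral>\<xi>. (\<integral>t. \<Phi> t * of_real (gauss (?e *\<^sub>R \<xi>)) * iexp (2 * pi * (\<xi> \<bullet> t)) \<partial>lborel) \<partial>lborel)"
      unfolding F_def by (rule Bochner_Integration.integral_cong[OF refl]) (subst integral_mult_right_zero[symmetric], simp add: mult_ac)
    also have "\<dots> = (\<integral>t. (\<integral>\<xi>. \<Phi> t * of_real (gauss (?e *\<^sub>R \<xi>)) * iexp (2 * pi * (\<xi> \<bullet> t)) \<partial>lborel) \<partial>lborel)"
      using Fubini_product_swap[OF i gi, of "\<lambda>(t, \<xi>). iexp (2 * pi * (\<xi> \<bullet> t))" 1] by simp
    also have "\<dots> = (\<integral>t. \<Phi> t * (of_real (sqrt (2 * pi) ^ d / ?e ^ d) * of_real (gauss ((2 * pi / ?e) *\<^sub>R t))) \<partial>lborel)"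
    proof (rule Bochner_Integration.integral_cong[OF refl])
      fix t :: 'a
      let ?h = "\<lambda>\<eta>::'a. of_real (gauss \<eta>) * iexp (((2 * pi / ?e) *\<^sub>R t) \<bullet> \<eta>)"
      have "(\<integral>\<eta>. ?h \<eta> \<partial>lborel) = \<bar>?e\<bar> ^ DIM('a) *\<^sub>R (\<integral>\<xi>. ?h (0 + ?e *\<^sub>R \<xi>) \<partial>lborel)"
        by (rule integral_lborel_affine) (use \<epsilon>[of n] integrable_gauss_iexp[of "(2 * pi / ?e) *\<^sub>R t"] in auto)
      then have "(\<integral>\<xi>. ?h (?e *\<^sub>R \<xi>) \<partial>lborel) = of_real (sqrt (2 * pi) ^ d * gauss ((2 * pi / ?e) *\<^sub>R t)) / of_real (?e ^ d)"
        using \<epsilon>[of n] unfolding integral_gauss_iexp by (simp add: d_def scaleR_conv_of_real field_simps)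
      then have 1: "(\<integral>\<xi>. ?h (?e *\<^sub>R \<xi>) \<partial>lborel) = of_real (sqrt (2 * pi) ^ d / ?e ^ d) * of_real (gauss ((2 * pi / ?e) *\<^sub>R t))"
        by simp
      have 2: "of_real (gauss (?e *\<^sub>R \<xi>)) * iexp (2 * pi * (\<xi> \<bullet> t)) = ?h (?e *\<^sub>R \<xi>)" for \<xi>
        using \<epsilon>[of n] by (simp add: inner_commute mult.assoc)
      have "(\<integral>\<xi>. of_real (gauss (?e *\<^sub>R \<xi>)) * iexp (2 * pi * (\<xi> \<bullet> t)) \<partial>lborel) = of_real (sqrt (2 * pi) ^ d / ?e ^ d) * of_real (gauss ((2 * pi / ?e) *\<^sub>R t))"
        unfolding 2 by (rule 1)
      then show "(\<integral>\<xi>. \<Phi> t * of_real (gauss (?e *\<^sub>R \<xi>)) * iexp (2 * pi * (\<xi> \<bullet> t)) \<partial>lborel) = \<Phi> t * (of_real (sqrt (2 * pi) ^ d / ?e ^ d) * of_real (gauss ((2 * pi / ?e) *\<^sub>R t)))"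
        by (simp only: mult.assoc integral_mult_right_zero)
    qed
    also have "\<dots> = of_real (sqrt (2 * pi) ^ d / ?e ^ d) * (\<integral>t. of_real (gauss ((2 * pi / ?e) *\<^sub>R t)) * \<Phi> t \<partial>lborel)"
      by (simp only: integral_mult_right_zero[symmetric]) (simp add: mult_ac)
    \<comment> \<open>The substitution t = (eps / 2 pi) s removes the small parameter from the
      Gaussian and moves it into \<open>\<Phi>\<close>.\<close>
    also have "(\<integral>t. of_real (gauss ((2 * pi / ?e) *\<^sub>R t)) * \<Phi> t \<partial>lborel)
       = \<bar>?e / (2 * pi)\<bar> ^ DIM('a) *\<^sub>R (\<integral>s. (\<lambda>t. of_real (gauss ((2 * pi / ?e) *\<^sub>R t)) * \<Phi> t) (0 + (?e / (2 * pi)) *\<^sub>R s) \<partial>lborel)"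
    proof (rule integral_lborel_affine)
      have "integrable lborel (\<lambda>t. \<Phi> t * of_real (gauss ((2 * pi / ?e) *\<^sub>R t)))"
        by (rule integrable_mult_bounded[OF i, where B = 1]) (auto simp: gauss_nonneg gauss_le_1)
      then show "integrable lborel (\<lambda>t. of_real (gauss ((2 * pi / ?e) *\<^sub>R t)) * \<Phi> t)" by (simp add: mult.commute)
    qed (use \<epsilon>[of n] in auto)
    finally show ?thesis using \<epsilon>[of n]
      by (simp add: d_def scaleR_conv_of_real power_divide power_mult_distrib)
  qed
  have lim2: "(\<lambda>n. \<integral>s. of_real (gauss s) * \<Phi> ((\<epsilon> n / (2 * pi)) *\<^sub>R s) \<partial>lborel) \<longlonglongrightarrow> (\<integral>s. of_real (gauss (s::'a)) * \<Phi> 0 \<partial>lborel)"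
  proof (rule integral_dominated_convergence[where w = "\<lambda>s. B * gauss s"])
    show "integrable lborel (\<lambda>s::'a. B * gauss s)" by (simp add: integrable_gauss)
    show "AE s in lborel. (\<lambda>n. of_real (gauss s) * \<Phi> ((\<epsilon> n / (2 * pi)) *\<^sub>R s)) \<longlonglongrightarrow> of_real (gauss s) * \<Phi> 0"
    proof (intro AE_I2)
      fix s :: 'a
      have "(\<lambda>n. (\<epsilon> n / (2 * pi)) *\<^sub>R s) \<longlonglongrightarrow> (0 / (2 * pi)) *\<^sub>R s" by (intro tendsto_intros \<epsilon>0) simp
      then have "(\<lambda>n. \<Phi> ((\<epsilon> n / (2 * pi)) *\<^sub>R s)) \<longlonglongrightarrow> \<Phi> 0"
        using continuous_on_tendsto_compose[OF c, of "\<lambda>n. (\<epsilon> n / (2 * pi)) *\<^sub>R s" 0 sequentially] by simp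
      then show "(\<lambda>n. of_real (gauss s) * \<Phi> ((\<epsilon> n / (2 * pi)) *\<^sub>R s)) \<longlonglongrightarrow> of_real (gauss s) * \<Phi> 0" by (intro tendsto_intros)
    qed
    show "AE s in lborel. norm (of_real (gauss s) * \<Phi> ((\<epsilon> n / (2 * pi)) *\<^sub>R s)) \<le> B * gauss s" for n
    proof (intro AE_I2)
      fix s :: 'a
      show "norm (of_real (gauss s) * \<Phi> ((\<epsilon> n / (2 * pi)) *\<^sub>R s)) \<le> B * gauss s"
        using mult_right_mono[OF B[of "(\<epsilon> n / (2 * pi)) *\<^sub>R s"] gauss_nonneg[of s]] gauss_nonneg[of s] by (simp add: norm_mult mult.commute)
    qed
  qed measurable
  have "(\<integral>s. of_real (gauss (s::'a)) * \<Phi> 0 \<partial>lborel) = of_real (sqrt (2 * pi) ^ d) * \<Phi> 0"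
    unfolding integral_mult_left_zero integral_gauss d_def ..
  with lim2 have "(\<lambda>n. of_real (sqrt (2 * pi) ^ d / (2 * pi) ^ d) * (\<integral>s. of_real (gauss s) * \<Phi> ((\<epsilon> n / (2 * pi)) *\<^sub>R s) \<partial>lborel))
      \<longlonglongrightarrow> of_real (sqrt (2 * pi) ^ d / (2 * pi) ^ d) * (of_real (sqrt (2 * pi) ^ d) * \<Phi> 0)"
    by (intro tendsto_mult_left) (simp only:)
  moreover have "of_real (sqrt (2 * pi) ^ d / (2 * pi) ^ d) * (of_real (sqrt (2 * pi) ^ d) * \<Phi> 0) = \<Phi> 0"
  proof -
    have "sqrt (2 * pi) ^ d * sqrt (2 * pi) ^ d = (sqrt (2 * pi) * sqrt (2 * pi)) ^ d"
      by (rule power_mult_distrib[symmetric])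
    then have c: "sqrt (2 * pi) ^ d / (2 * pi) ^ d * sqrt (2 * pi) ^ d = 1" by simp
    have "of_real (sqrt (2 * pi) ^ d / (2 * pi) ^ d) * (of_real (sqrt (2 * pi) ^ d) * \<Phi> 0)
        = of_real (sqrt (2 * pi) ^ d / (2 * pi) ^ d * sqrt (2 * pi) ^ d) * \<Phi> 0"
      by (simp only: of_real_mult mult.assoc)
    then show ?thesis unfolding c by simp
  qed
  ultimately show ?thesis using LIMSEQ_unique[OF lim1[unfolded eq]] by simp
qed

section \<open>Reconstruction of ultradistributions from modulated convolutions\<close>

text \<open>Multiplication by \<open>c\<close> acts as minus the sum of the two commuting shifts of
  the double sequence, so c^n is given by the binomial formula.\<close>

lemma binomial_recurrence:
  fixes a :: "nat \<Rightarrow> nat \<Rightarrow> complex"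
  assumes "\<And>p k. c * a p k = - (a (Suc p) k + a p (Suc k))"
  shows "c ^ n * a 0 0 = (-1) ^ n * (\<Sum>k\<le>n. of_nat (n choose k) * a (n - k) k)"
proof (induction n)
  case (Suc n)
  have "c ^ Suc n * a 0 0 = (-1) ^ n * (\<Sum>k\<le>n. of_nat (n choose k) * (c * a (n - k) k))"
    using Suc by (simp add: sum_distrib_left mult_ac)
  also have "\<dots> = (-1) ^ Suc n * ((\<Sum>k\<le>n. of_nat (n choose k) * a (Suc (n - k)) k) + (\<Sum>k\<le>n. of_nat (n choose k) * a (n - k) (Suc k)))"
    unfolding assms by (simp add: sum_distrib_left sum.distrib[symmetric] sum_negf[symmetric] algebra_simps)
  also have "(\<Sum>k\<le>n. of_nat (n choose k) * a (Suc (n - k)) k) = (\<Sum>k\<le>Suc n. of_nat (n choose k) * a (Suc n - k) k)"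
    by (simp add: Suc_diff_le)
  also have "\<dots> = a (Suc n) 0 + (\<Sum>k\<le>n. of_nat (n choose Suc k) * a (n - k) (Suc k))"
    by (subst sum.atMost_Suc_shift) simp
  also have "a (Suc n) 0 + (\<Sum>k\<le>n. of_nat (n choose Suc k) * a (n - k) (Suc k)) + (\<Sum>k\<le>n. of_nat (n choose k) * a (n - k) (Suc k))
      = (\<Sum>k\<le>Suc n. of_nat (Suc n choose k) * a (Suc n - k) k)"
    by (simp only: sum.atMost_Suc_shift) (simp add: sum.distrib[symmetric] algebra_simps)
  finally show ?case .
qed simp

context gs
begin

lemma reflect_modul_integrable_wgt: "(\<integral>y. cmod (reflect (modul \<xi> g) y) * wgt A q y \<partial>lborel) = (\<integral>y. cmod (g y) * wgt A q y \<partial>lborel)"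
  and integrable_reflect_modul_wgt: "integrable lborel (\<lambda>y. cmod (g y) * wgt A q y) \<Longrightarrow> integrable lborel (\<lambda>y. cmod (reflect (modul \<xi> g) y) * wgt A q y)"
  using integral_lborel_diff[of "\<lambda>y. cmod (g y) * wgt A q y" 0] integrable_lborel_diff[of "\<lambda>y. cmod (g y) * wgt A q y" 0]
  by (simp_all add: reflect_def)

text \<open>All derivatives fall on \<open>\<phi>\<close>, and the weighted L^1 norm of a modulated
  function does not depend on the frequency.\<close>

lemma TS_bounded_conv_modul:
  fixes \<phi> \<eta> :: "'n::finite testfun"
  assumes \<phi>: "\<phi> \<in> TS b M A" and \<eta>: "\<eta> \<in> TS True M A"
  shows "TS_bounded b M A {conv \<phi> (reflect (modul \<xi> \<eta>)) | \<xi>. True}"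
proof -
  have r: "reflect (modul \<xi> \<eta>) \<in> TS True M A" for \<xi> using \<eta> by (intro TS_reflect TS_modul)
  have "TS_bounded b M A {(\<lambda>\<xi> \<phi>. conv \<phi> (reflect (modul \<xi> \<eta>))) \<xi> \<phi>' | \<xi> \<phi>'. \<xi> \<in> UNIV \<and> \<phi>' \<in> {\<phi>}}"
  proof (rule TS_bounded_image[where a = 1 and c = "1/2" and qm = 1])
    fix l q C :: real assume *: "l > 0" "q > 0" "C > 0"
    let ?D = "(\<integral>y. cmod (\<eta> y) * wgt A q y \<partial>lborel)"
    have D: "?D \<ge> 0" by (intro integral_nonneg_AE) auto
    have "gs_le M A l (q / 2) (C * (?D + 1)) (conv \<phi> (reflect (modul \<xi> \<eta>)))" if "gs_le M A l q C \<phi>" for \<xi>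
      by (rule gs_le_conv[OF \<phi>])
        (use that * integrable_reflect_modul_wgt[OF TS_True_wgt_integrable[OF \<eta> *(2)]] TS_measurable[OF r] in \<open>auto simp: reflect_modul_integrable_wgt\<close>)
    moreover have "C * (?D + 1) > 0" using * D by (intro mult_pos_pos) linarith+
    ultimately show "\<exists>C'>0. \<forall>\<xi>\<in>UNIV. \<forall>\<phi>'\<in>{\<phi>}. gs_le M A l q C \<phi>' \<longrightarrow> gs_le M A (1 * l) (1 / 2 * q) C' (conv \<phi>' (reflect (modul \<xi> \<eta>)))"
      by (intro exI[of _ "C * (?D + 1)"]) auto
  qed (use \<phi> r TS_smooth[OF TS_conv[OF \<phi>]] TS_True_subset in \<open>auto simp: TS_bounded_singleton intro!: smooth_conv_TS TS_integrable\<close>)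
  then show ?thesis by (rule TS_bounded_subset) auto
qed

lemma TS_bounded_Un:
  assumes "TS_bounded b M A B1" "TS_bounded b M A B2"
  shows "TS_bounded b M A (B1 \<union> B2)"
proof (cases b)
  case True
  have "\<exists>C>0. \<forall>\<phi>\<in>B1 \<union> B2. gs_le M A l q C \<phi>" if lq: "l > 0" "q > 0" for l q
  proof -
    obtain C1 C2 where C: "C1 > 0" "C2 > 0" "\<forall>\<phi>\<in>B1. gs_le M A l q C1 \<phi>" "\<forall>\<phi>\<in>B2. gs_le M A l q C2 \<phi>"
      using assms True lq unfolding TS_bounded_iff by simp blast
    have "gs_le M A l q (C1 + C2) \<phi>" if "\<phi> \<in> B1 \<union> B2" for \<phi>
      using that C lq gs_le_mono[of l q C1 \<phi> l q "C1 + C2"] gs_le_mono[of l q C2 \<phi> l q "C1 + C2"] by auto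
    then show ?thesis using C by (intro exI[of _ "C1 + C2"]) auto
  qed
  then show ?thesis using assms True unfolding TS_bounded_iff by auto
next
  case False
  obtain l1 q1 C1 where 1: "l1 > 0" "q1 > 0" "C1 > 0" "\<forall>\<phi>\<in>B1. gs_le M A l1 q1 C1 \<phi>"
    using assms(1) False unfolding TS_bounded_iff by auto
  obtain l2 q2 C2 where 2: "l2 > 0" "q2 > 0" "C2 > 0" "\<forall>\<phi>\<in>B2. gs_le M A l2 q2 C2 \<phi>"
    using assms(2) False unfolding TS_bounded_iff by auto
  have "gs_le M A (l1 + l2) (min q1 q2) (C1 + C2) \<phi>" if "\<phi> \<in> B1 \<union> B2" for \<phi>
    using that 1 2 gs_le_mono[of l1 q1 C1 \<phi> "l1 + l2" "min q1 q2" "C1 + C2"] gs_le_mono[of l2 q2 C2 \<phi> "l1 + l2" "min q1 q2" "C1 + C2"] by auto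
  moreover have "l1 + l2 > 0" "min q1 q2 > 0" "C1 + C2 > 0" using 1 2 by auto
  ultimately have "\<exists>l>0. \<exists>q>0. \<exists>C>0. \<forall>\<phi>\<in>B1 \<union> B2. gs_le M A l q C \<phi>" by blast
  then show ?thesis using assms False unfolding TS_bounded_iff by auto
qed

lemma TS_bounded_empty: "TS_bounded b M A {}"
  unfolding TS_bounded_iff by (cases b) (auto intro: exI[of _ "1::real"])

lemma TS_bounded_UN: "finite I \<Longrightarrow> (\<And>i. i \<in> I \<Longrightarrow> TS_bounded b M A (B i)) \<Longrightarrow> TS_bounded b M A (\<Union>i\<in>I. B i)"
  by (induction I rule: finite_induct) (auto simp: TS_bounded_empty intro: TS_bounded_Un)

text \<open>A derivative of the convolution may be put on either factor. On the modulated one it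
  produces the frequency factor plus the modulation of the derivative; solving for the former gives
  the recurrence of \<open>binomial_recurrence\<close>.\<close>

lemma integration_by_parts_modul:
  fixes \<phi> \<eta> :: "'n::finite testfun" and j :: 'n and \<xi> :: "real^'n"
  assumes \<phi>: "\<phi> \<in> TS b M A" and \<eta>: "\<eta> \<in> TS True M A"
  defines "a \<equiv> \<lambda>p k. conv (pd (replicate p j) \<phi>) (reflect (modul \<xi> (pd (replicate k j) \<eta>)))"
  shows "(2 * of_real pi * \<i> * of_real (\<xi> $ j)) ^ n * a 0 0 x = (-1) ^ n * (\<Sum>k\<le>n. of_nat (n choose k) * a (n - k) k x)"
proof (rule binomial_recurrence[where a = "\<lambda>p k. a p k x"])
  fix p k
  let ?c = "2 * of_real pi * \<i> * of_real (\<xi> $ j)"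
  define \<phi>' where "\<phi>' = pd (replicate p j) \<phi>"
  define \<eta>' where "\<eta>' = pd (replicate k j) \<eta>"
  have \<phi>': "\<phi>' \<in> TS b M A" and \<eta>': "\<eta>' \<in> TS True M A" using \<phi> \<eta> by (auto simp: \<phi>'_def \<eta>'_def intro: TS_pd)
  have s: "smooth \<eta>'" using \<eta>' TS_smooth by blast
  have mT: "modul \<xi> \<eta>' \<in> TS True M A" using \<eta>' by (rule TS_modul)
  have r: "reflect (modul \<xi> \<eta>') \<in> TS True M A" using mT by (rule TS_reflect)
  have "conv (partial j \<phi>') (reflect (modul \<xi> \<eta>')) = partial j (conv \<phi>' (reflect (modul \<xi> \<eta>')))"
    using pd_conv_TS[OF \<phi>' TS_integrable[OF r], of "[j]"] by simp
  also have "\<dots> = conv \<phi>' (partial j (reflect (modul \<xi> \<eta>')))"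
    using pd_conv_TS2[OF r TS_integrable[OF \<phi>'], of "[j]"] by simp
  also have "partial j (reflect (modul \<xi> \<eta>')) = (\<lambda>x. (-1) * reflect (partial j (modul \<xi> \<eta>')) x)"
    using pd_reflect[OF TS_smooth[OF mT], of "[j]"] by simp
  also have "partial j (modul \<xi> \<eta>') = (\<lambda>x. ?c * modul \<xi> \<eta>' x + 1 * modul \<xi> (partial j \<eta>') x)"
    unfolding partial_modul[OF s] by (simp add: modul_def algebra_simps)
  also have "(\<lambda>x. (-1) * reflect (\<lambda>x. ?c * modul \<xi> \<eta>' x + 1 * modul \<xi> (partial j \<eta>') x) x)
     = (\<lambda>x. (- ?c) * reflect (modul \<xi> \<eta>') x + (-1) * reflect (modul \<xi> (partial j \<eta>')) x)"
    by (simp add: reflect_def)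
  also have "conv \<phi>' \<dots> = (\<lambda>x. (- ?c) * conv \<phi>' (reflect (modul \<xi> \<eta>')) x + (-1) * conv \<phi>' (reflect (modul \<xi> (partial j \<eta>'))) x)"
    by (rule conv_lincomb_right[OF subsetD[OF TS_True_subset r] subsetD[OF TS_True_subset TS_reflect[OF TS_modul[OF TS_partial[OF \<eta>']]]] \<phi>'])
  finally have "conv (partial j \<phi>') (reflect (modul \<xi> \<eta>')) x = - ?c * conv \<phi>' (reflect (modul \<xi> \<eta>')) x - conv \<phi>' (reflect (modul \<xi> (partial j \<eta>'))) x"
    by simp
  then show "?c * a p k x = - (a (Suc p) k x + a p (Suc k) x)"
    by (simp add: a_def \<phi>'_def \<eta>'_def algebra_simps)
qed

text \<open>The largest coordinate controls the norm up to the factor d; when all coordinates are at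
  most 1, the trivial bound is enough.\<close>

lemma polynomial_decay:
  fixes \<xi> :: "real^'n::finite"
  assumes 0: "0 \<le> v" "v \<le> \<epsilon>" and j: "\<And>j. (2 * pi * \<bar>\<xi> $ j\<bar>) ^ n * v \<le> \<epsilon>"
  shows "v \<le> \<epsilon> * (real CARD('n) + 1) ^ n / (1 + norm \<xi>) ^ n"
proof -
  have "(1 + norm \<xi>) ^ n * v \<le> \<epsilon> * (real CARD('n) + 1) ^ n"
  proof (cases "\<forall>j. \<bar>\<xi> $ j\<bar> \<le> 1")
    case True
    have "norm \<xi> \<le> (\<Sum>j\<in>UNIV. \<bar>\<xi> $ j\<bar>)" by (rule norm_le_l1_cart)
    also have "\<dots> \<le> (\<Sum>j\<in>(UNIV::'n set). 1)" using True by (intro sum_mono) auto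
    finally have "1 + norm \<xi> \<le> real CARD('n) + 1" by simp
    then have "(1 + norm \<xi>) ^ n * v \<le> (real CARD('n) + 1) ^ n * \<epsilon>" using 0 by (intro mult_mono power_mono) auto
    then show ?thesis by (simp add: mult.commute)
  next
    case False
    define m where "m = Max (range (\<lambda>j. \<bar>\<xi> $ j\<bar>))"
    have "m \<in> range (\<lambda>j. \<bar>\<xi> $ j\<bar>)" unfolding m_def by (rule Max_in) auto
    then obtain j0 where j0: "m = \<bar>\<xi> $ j0\<bar>" by blast
    have mm: "\<bar>\<xi> $ j\<bar> \<le> m" for j unfolding m_def by (rule Max_ge) auto
    have m1: "m \<ge> 1" using False mm by (meson linear order_trans)
    have "norm \<xi> \<le> (\<Sum>j\<in>UNIV. \<bar>\<xi> $ j\<bar>)" by (rule norm_le_l1_cart)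
    also have "\<dots> \<le> (\<Sum>j\<in>(UNIV::'n set). m)" using mm by (intro sum_mono) auto
    finally have "1 + norm \<xi> \<le> (real CARD('n) + 1) * m" using m1 by (simp add: algebra_simps)
    also have "\<dots> \<le> (real CARD('n) + 1) * (2 * pi * m)"
      using m1 pi_gt3 by (intro mult_left_mono) (auto simp: mult_le_cancel_right1)
    finally have "(1 + norm \<xi>) ^ n * v \<le> ((real CARD('n) + 1) * (2 * pi * m)) ^ n * v"
      using 0 by (intro mult_right_mono power_mono) auto
    also have "\<dots> = (real CARD('n) + 1) ^ n * ((2 * pi * \<bar>\<xi> $ j0\<bar>) ^ n * v)" by (simp add: j0 power_mult_distrib)
    also have "\<dots> \<le> (real CARD('n) + 1) ^ n * \<epsilon>" using j by (intro mult_left_mono) auto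
    finally show ?thesis by (simp add: mult.commute)
  qed
  moreover have "(1 + norm \<xi>) ^ n > 0" by (simp add: add_pos_nonneg)
  ultimately show ?thesis by (simp add: pos_le_divide_eq mult.commute)
qed

end

context tmib
begin

definition lin_on_T :: "'n udist \<Rightarrow> bool" where
  "lin_on_T g \<longleftrightarrow> (\<forall>\<phi>\<in>T. \<forall>\<psi>\<in>T. \<forall>a b. g (\<lambda>x. a * \<phi> x + b * \<psi> x) = a * g \<phi> + b * g \<psi>)"

lemma lin_on_T_sum:
  assumes "lin_on_T g" "finite S" "\<And>i. i \<in> S \<Longrightarrow> \<phi> i \<in> T"
  shows "g (\<lambda>x. \<Sum>i\<in>S. c i * \<phi> i x) = (\<Sum>i\<in>S. c i * g (\<phi> i))"
  using assms(2,3)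
proof (induction S rule: finite_induct)
  case empty
  have "g (\<lambda>x. 0 * (0::complex) + 0 * 0) = 0 * g (\<lambda>x. 0) + 0 * g (\<lambda>x. 0)"
    by (rule assms(1)[unfolded lin_on_T_def, rule_format, OF TS_zero TS_zero])
  then show ?case by simp
next
  case (insert i S)
  have "(\<lambda>x. \<Sum>j\<in>S. c j * \<phi> j x) \<in> T" using insert by (intro TS_sum TS_cmult) auto
  then have "g (\<lambda>x. c i * \<phi> i x + 1 * (\<Sum>j\<in>S. c j * \<phi> j x)) = c i * g (\<phi> i) + 1 * g (\<lambda>x. \<Sum>j\<in>S. c j * \<phi> j x)"
    using insert.prems by (intro assms(1)[unfolded lin_on_T_def, rule_format]) auto
  then show ?case using insert by simp
qed

text \<open>Integration by parts n times in each direction. Stated for merely linear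
  \<open>g\<close>, it covers embedded test functions as well as the difference between f and such
  an approximation, whose small \<open>\<epsilon>\<close> then multiplies a fixed integrable
  function.\<close>

lemma conv_modul_decay:
  assumes g: "lin_on_T g" and \<phi>: "\<phi> \<in> T" and \<eta>: "\<eta> \<in> TS True M A"
    and \<epsilon>: "\<And>j p k \<xi>. p \<le> n \<Longrightarrow> k \<le> n \<Longrightarrow> cmod (g (conv (pd (replicate p j) \<phi>) (reflect (modul \<xi> (pd (replicate k j) \<eta>))))) \<le> \<epsilon>"
  shows "cmod (g (conv \<phi> (reflect (modul \<xi> \<eta>)))) \<le> (2 ^ n * \<epsilon>) * (real CARD('n) + 1) ^ n / (1 + norm \<xi>) ^ n"
proof (rule polynomial_decay)
  have e0: "\<epsilon> \<ge> 0" using \<epsilon>[of 0 0] norm_ge_zero order_trans by blast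
  have "cmod (g (conv \<phi> (reflect (modul \<xi> \<eta>)))) \<le> \<epsilon>" using \<epsilon>[of 0 0] by simp
  also have "\<dots> \<le> 2 ^ n * \<epsilon>" using e0 by (simp add: mult_le_cancel_right1)
  finally show "cmod (g (conv \<phi> (reflect (modul \<xi> \<eta>)))) \<le> 2 ^ n * \<epsilon>" .
  fix j
  let ?c = "2 * of_real pi * \<i> * of_real (\<xi> $ j) :: complex"
  let ?a = "\<lambda>p k. conv (pd (replicate p j) \<phi>) (reflect (modul \<xi> (pd (replicate k j) \<eta>)))"
  have aT: "?a p k \<in> T" for p k
    using \<phi> \<eta> by (intro TS_conv TS_reflect TS_modul TS_pd) (auto intro: subsetD[OF TS_True_subset])
  have a00: "conv \<phi> (reflect (modul \<xi> \<eta>)) \<in> T" using aT[of 0 0] by simp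
  have "(\<lambda>x. \<Sum>i\<in>{()}. ?c ^ n * ?a 0 0 x) = (\<lambda>x. \<Sum>k\<le>n. ((-1) ^ n * of_nat (n choose k)) * ?a (n - k) k x)"
    using integration_by_parts_modul[OF \<phi> \<eta>, of \<xi> j n] by (auto simp: sum_distrib_left mult.assoc)
  then have "g (\<lambda>x. \<Sum>i\<in>{()}. ?c ^ n * ?a 0 0 x) = g (\<lambda>x. \<Sum>k\<le>n. ((-1) ^ n * of_nat (n choose k)) * ?a (n - k) k x)" by simp
  then have "?c ^ n * g (?a 0 0) = (\<Sum>k\<le>n. ((-1) ^ n * of_nat (n choose k)) * g (?a (n - k) k))"
    using lin_on_T_sum[OF g, of "{()}" "\<lambda>_. ?a 0 0" "\<lambda>_. ?c ^ n"] lin_on_T_sum[OF g, of "{..n}" "\<lambda>k. ?a (n - k) k" "\<lambda>k. (-1) ^ n * of_nat (n choose k)"] aT a00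
    by simp
  then have "cmod (?c ^ n * g (?a 0 0)) \<le> (\<Sum>k\<le>n. real (n choose k) * \<epsilon>)"
    by (simp only:) (rule sum_norm_le, use \<epsilon> in \<open>auto simp: norm_mult norm_power intro!: mult_left_mono\<close>)
  also have "\<dots> = 2 ^ n * \<epsilon>" by (simp add: sum_distrib_right[symmetric] choose_row_sum flip: of_nat_sum)
  finally show "(2 * pi * \<bar>\<xi> $ j\<bar>) ^ n * cmod (g (conv \<phi> (reflect (modul \<xi> \<eta>)))) \<le> 2 ^ n * \<epsilon>"
    by (simp add: norm_mult norm_power)
qed simp

text \<open>Combines the two density statements of the definition, test functions in the Banach
  space and the Banach space in the dual, on one bounded set.\<close>

lemma UD_approx:
  assumes f: "f \<in> UD beur M A" and B: "TS_bounded beur M A B" and \<epsilon>: "\<epsilon> > 0"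
  obtains u where "u \<in> T" "\<And>\<psi>. \<psi> \<in> B \<Longrightarrow> cmod (f \<psi> - fun_ud u \<psi>) \<le> \<epsilon>"
proof -
  obtain e where e: "\<And>\<psi>. \<psi> \<in> B \<Longrightarrow> cmod (f \<psi> - \<iota> e \<psi>) < \<epsilon> / 2" using UD_dense[OF f B, of "\<epsilon> / 2"] \<epsilon> by auto
  obtain C where C: "\<And>e \<psi>. \<psi> \<in> B \<Longrightarrow> cmod (\<iota> e \<psi>) \<le> C * norm e" using iota_bounded[OF B] by blast
  define \<delta> where "\<delta> = \<epsilon> / (2 * (\<bar>C\<bar> + 1))"
  have \<delta>: "\<delta> > 0" using \<epsilon> by (simp add: \<delta>_def)
  obtain u where u: "u \<in> T" "norm (e - emb u) < \<delta>" using emb_dense[OF \<delta>] by blast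
  have BT: "B \<subseteq> T" using B by (simp add: TS_bounded_def)
  have "cmod (f \<psi> - fun_ud u \<psi>) \<le> \<epsilon>" if \<psi>: "\<psi> \<in> B" for \<psi>
  proof -
    have \<psi>T: "\<psi> \<in> T" using \<psi> BT by blast
    have "cmod (\<iota> (e - emb u) \<psi>) \<le> C * norm (e - emb u)" by (rule C[OF \<psi>])
    also have "\<dots> \<le> (\<bar>C\<bar> + 1) * norm (e - emb u)" by (intro mult_right_mono) auto
    also have "\<dots> \<le> (\<bar>C\<bar> + 1) * \<delta>" using u(2) by (intro mult_left_mono) auto
    also have "\<dots> = \<epsilon> / 2" unfolding \<delta>_def by (simp add: field_simps)
    finally have 1: "cmod (\<iota> e \<psi> - fun_ud u \<psi>) \<le> \<epsilon> / 2" using \<psi>T u(1) by (simp add: iota_minus emb)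
    have "f \<psi> - fun_ud u \<psi> = (f \<psi> - \<iota> e \<psi>) + (\<iota> e \<psi> - fun_ud u \<psi>)" by simp
    then have "cmod (f \<psi> - fun_ud u \<psi>) \<le> cmod (f \<psi> - \<iota> e \<psi>) + cmod (\<iota> e \<psi> - fun_ud u \<psi>)" by (metis norm_triangle_ineq)
    then show ?thesis using e[OF \<psi>] 1 by simp
  qed
  then show ?thesis using that u(1) by blast
qed

lemma modul_iexp: "modul \<xi> g t = g t * iexp (2 * pi * (\<xi> \<bullet> t))"
  by (simp add: modul_def mult_ac)

text \<open>For a test function u in place of f, the integrand is the Fourier transform of t |->
  \<open>\<eta> t\<close> * <u, \<open>transl (- t) \<phi>\<close>>, so this is inversion at 0. The
  general case follows by approximation uniform on one bounded set, with the error dominated by an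
  integrable function.\<close>

theorem reconstruction:
  assumes f: "f \<in> UD beur M A" and \<phi>: "\<phi> \<in> T" and \<eta>: "\<eta> \<in> TS True M A"
  shows "integrable lborel (\<lambda>\<xi>. f (conv \<phi> (reflect (modul \<xi> \<eta>))))"
    and "(\<integral>\<xi>. f (conv \<phi> (reflect (modul \<xi> \<eta>))) \<partial>lborel) = \<eta> 0 * f \<phi>"
proof -
  let ?\<psi> = "\<lambda>\<xi>. conv \<phi> (reflect (modul \<xi> \<eta>))"
  define N where "N = 2 * CARD('n)"
  \<comment> \<open>Besides \<open>\<phi>\<close>, the set collects everything that N integrations
    by parts produce, over all directions and all frequencies; approximation on this one set gives
    decay of the error of order N = 2d.\<close>
  define B where "B = {\<phi>} \<union> (\<Union>(j, p, k)\<in>UNIV \<times> {..N} \<times> {..N}. {conv (pd (replicate p j) \<phi>) (reflect (modul \<xi> (pd (replicate k j) \<eta>))) | \<xi>. True})"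
  have \<eta>T: "\<eta> \<in> T" using \<eta> TS_True_subset by blast
  have B: "TS_bounded beur M A B"
    unfolding B_def
  proof (intro TS_bounded_Un TS_bounded_UN)
    show "TS_bounded beur M A (case jpk of (j, p, k) \<Rightarrow> {conv (pd (replicate p j) \<phi>) (reflect (modul \<xi> (pd (replicate k j) \<eta>))) | \<xi>. True})" for jpk
      by (cases jpk) (simp only: prod.case, rule TS_bounded_conv_modul[OF TS_pd[OF \<phi>] TS_pd[OF \<eta>]])
  qed (use \<phi> in \<open>auto simp: TS_bounded_singleton\<close>)
  define W where "W = (\<lambda>\<xi>::real^'n. 2 ^ N * (real CARD('n) + 1) ^ N * (1 / (1 + norm \<xi>) ^ N))"
  have Wi: "integrable lborel W" unfolding W_def N_def using integrable_inverse_one_plus_norm by (rule integrable_mult_right)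
  have W0: "W \<xi> \<ge> 0" for \<xi> by (simp add: W_def)
  have decay: "cmod (g (?\<psi> \<xi>)) \<le> \<epsilon> * W \<xi>" if g: "lin_on_T g" and e: "\<And>\<psi>. \<psi> \<in> B \<Longrightarrow> cmod (g \<psi>) \<le> \<epsilon>" for g \<epsilon> \<xi>
  proof -
    have "cmod (g (?\<psi> \<xi>)) \<le> (2 ^ N * \<epsilon>) * (real CARD('n) + 1) ^ N / (1 + norm \<xi>) ^ N"
      by (rule conv_modul_decay[OF g \<phi> \<eta>]) (rule e, auto simp: B_def)
    then show ?thesis by (simp add: W_def mult_ac)
  qed
  have fun_ud: "integrable lborel (\<lambda>\<xi>. fun_ud u (?\<psi> \<xi>)) \<and> (\<integral>\<xi>. fun_ud u (?\<psi> \<xi>) \<partial>lborel) = \<eta> 0 * fun_ud u \<phi>" if u: "u \<in> T" for u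
  proof -
    define \<Phi> where "\<Phi> = (\<lambda>t. \<eta> t * fun_ud u (transl (- t) \<phi>))"
    have F: "fun_ud u (?\<psi> \<xi>) = (\<integral>t. \<Phi> t * iexp (2 * pi * (\<xi> \<bullet> t)) \<partial>lborel)" for \<xi>
      using fun_ud_conv_reflect(1)[OF u \<phi> TS_modul[OF \<eta>T, of \<xi>]] by (simp add: modul_iexp \<Phi>_def mult_ac)
    have "fun_ud u (transl (- t) \<phi>) = conv \<phi> (reflect u) t" for t
      unfolding conv_reflect_eq fun_ud_def transl_def by (simp add: mult.commute add.commute)
    then have \<Phi>eq: "\<Phi> = (\<lambda>t. \<eta> t * conv \<phi> (reflect u) t)" by (simp add: \<Phi>_def)
    have cT: "conv \<phi> (reflect u) \<in> T" using \<phi> u by (intro TS_conv TS_reflect)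
    obtain K1 where K1: "\<And>x. cmod (pd [] (conv \<phi> (reflect u)) x) \<le> K1" using TS_bound[OF cT] by metis
    obtain K2 where K2: "\<And>x. cmod (pd [] \<eta> x) \<le> K2" using TS_bound[OF \<eta>] by metis
    have c: "continuous_on UNIV \<Phi>" unfolding \<Phi>eq
      using smooth_continuous_on[OF TS_smooth[OF \<eta>]] smooth_continuous_on[OF TS_smooth[OF cT]] by (intro continuous_intros)
    have b: "cmod (\<Phi> x) \<le> K2 * K1" for x
      unfolding \<Phi>eq norm_mult using K1[of x] K2[of x] by (intro mult_mono) (auto intro: order_trans[OF norm_ge_zero])
    have i: "integrable lborel \<Phi>" unfolding \<Phi>eq
      by (rule integrable_mult_bounded[OF TS_integrable[OF \<eta>] TS_measurable[OF cT], where B = K1]) (use K1 in auto)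
    obtain C where C: "\<And>e \<psi>. \<psi> \<in> B \<Longrightarrow> cmod (\<iota> e \<psi>) \<le> C * norm e" using iota_bounded[OF B] by blast
    have "\<phi> \<in> B" by (simp add: B_def)
    have BT: "B \<subseteq> T" using B by (simp add: TS_bounded_def)
    have "cmod (fun_ud u (?\<psi> \<xi>)) \<le> (C * norm (emb u)) * W \<xi>" for \<xi>
    proof (rule decay)
      show "lin_on_T (fun_ud u)" using fun_ud_linear[OF u] by (simp add: lin_on_T_def)
      show "cmod (fun_ud u \<psi>) \<le> C * norm (emb u)" if "\<psi> \<in> B" for \<psi>
        using C[OF that, of "emb u"] emb[OF u, of \<psi>] BT that by auto
    qed
    then have bd: "cmod (\<integral>t. \<Phi> t * iexp (2 * pi * (\<xi> \<bullet> t)) \<partial>lborel) \<le> (C * norm (emb u)) * W \<xi>" for \<xi> by (simp add: F)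
    have [measurable]: "\<Phi> \<in> borel_measurable borel" using c by (rule borel_measurable_continuous_onI)
    have Fi: "integrable lborel (\<lambda>\<xi>. \<integral>t. \<Phi> t * iexp (2 * pi * (\<xi> \<bullet> t)) \<partial>lborel)"
    proof (rule Bochner_Integration.integrable_bound)
      show "integrable lborel (\<lambda>\<xi>. (C * norm (emb u)) * W \<xi>)" using Wi by (rule integrable_mult_right)
      show "AE \<xi> in lborel. norm (\<integral>t. \<Phi> t * iexp (2 * pi * (\<xi> \<bullet> t)) \<partial>lborel) \<le> norm ((C * norm (emb u)) * W \<xi>)"
        using order_trans[OF bd abs_ge_self] by (intro AE_I2) (simp only: real_norm_def)
    qed measurable
    show ?thesis using Fourier_inversion_at_0[OF c b i Fi] Fi
      by (simp add: F \<Phi>_def transl_def)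
  qed
  have "\<exists>u\<in>T. \<forall>\<psi>\<in>B. cmod (f \<psi> - fun_ud u \<psi>) \<le> 1 / real (Suc n)" for n
    using UD_approx[OF f B, of "1 / real (Suc n)"] by (metis of_nat_0_less_iff zero_less_Suc zero_less_divide_1_iff)
  then obtain u where u: "\<And>n. u n \<in> T" "\<And>n \<psi>. \<psi> \<in> B \<Longrightarrow> cmod (f \<psi> - fun_ud (u n) \<psi>) \<le> 1 / real (Suc n)" by metis
  have diff: "cmod (f (?\<psi> \<xi>) - fun_ud (u n) (?\<psi> \<xi>)) \<le> 1 / real (Suc n) * W \<xi>" for n \<xi>
    by (rule decay[of "\<lambda>\<psi>. f \<psi> - fun_ud (u n) \<psi>"])
      (use u UD_lin[OF f] fun_ud_linear[OF u(1)[of n]] in \<open>auto simp: lin_on_T_def algebra_simps\<close>)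
  have lim0: "(\<lambda>n. 1 / real (Suc n) * w) \<longlonglongrightarrow> 0" for w
    by (rule tendsto_mult_left_zero[OF lim_1_over_n[THEN LIMSEQ_Suc]])
  have lim: "(\<lambda>n. fun_ud (u n) (?\<psi> \<xi>)) \<longlonglongrightarrow> f (?\<psi> \<xi>)" for \<xi>
  proof -
    have "(\<lambda>n. fun_ud (u n) (?\<psi> \<xi>) - f (?\<psi> \<xi>)) \<longlonglongrightarrow> 0"
      by (rule Lim_null_comparison[OF _ lim0[of "W \<xi>"]]) (use diff in \<open>simp add: norm_minus_commute\<close>)
    then show ?thesis by (simp add: LIM_zero_iff)
  qed
  have meas: "(\<lambda>\<xi>. f (?\<psi> \<xi>)) \<in> borel_measurable lborel"
    by (rule borel_measurable_LIMSEQ_metric[OF _ lim]) (use fun_ud[OF u(1)] borel_measurable_integrable in blast)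
  have Ii: "integrable lborel (\<lambda>\<xi>. f (?\<psi> \<xi>))" and Ilim: "(\<lambda>n. \<integral>\<xi>. fun_ud (u n) (?\<psi> \<xi>) \<partial>lborel) \<longlonglongrightarrow> (\<integral>\<xi>. f (?\<psi> \<xi>) \<partial>lborel)"
  proof -
    let ?w = "\<lambda>\<xi>. cmod (fun_ud (u 0) (?\<psi> \<xi>)) + 2 * W \<xi>"
    have wi: "integrable lborel ?w" using fun_ud[OF u(1)] Wi by auto
    have fb: "cmod (f (?\<psi> \<xi>)) \<le> cmod (fun_ud (u 0) (?\<psi> \<xi>)) + W \<xi>" for \<xi>
      using diff[of \<xi> 0] norm_triangle_sub[of "f (?\<psi> \<xi>)" "fun_ud (u 0) (?\<psi> \<xi>)"] by simp
    show "integrable lborel (\<lambda>\<xi>. f (?\<psi> \<xi>))"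
      by (rule Bochner_Integration.integrable_bound[OF wi meas])
        (use order_trans[OF fb] W0 in \<open>intro AE_I2, auto intro!: order_trans[OF fb] simp: abs_of_nonneg\<close>)
    show "(\<lambda>n. \<integral>\<xi>. fun_ud (u n) (?\<psi> \<xi>) \<partial>lborel) \<longlonglongrightarrow> (\<integral>\<xi>. f (?\<psi> \<xi>) \<partial>lborel)"
    proof (rule integral_dominated_convergence[OF meas _ wi])
      show "AE \<xi> in lborel. (\<lambda>n. fun_ud (u n) (?\<psi> \<xi>)) \<longlonglongrightarrow> f (?\<psi> \<xi>)" using lim by simp
      show "AE \<xi> in lborel. norm (fun_ud (u n) (?\<psi> \<xi>)) \<le> ?w \<xi>" for n
      proof (intro AE_I2)
        fix \<xi>
        have "1 / real (Suc n) * W \<xi> \<le> 1 * W \<xi>" using W0 by (intro mult_right_mono) auto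
        then have "cmod (f (?\<psi> \<xi>) - fun_ud (u n) (?\<psi> \<xi>)) \<le> W \<xi>" using diff[of \<xi> n] by linarith
        then show "norm (fun_ud (u n) (?\<psi> \<xi>)) \<le> ?w \<xi>"
          using fb[of \<xi>] norm_triangle_sub[of "fun_ud (u n) (?\<psi> \<xi>)" "f (?\<psi> \<xi>)"] by (simp add: norm_minus_commute)
      qed
    qed (use fun_ud[OF u(1)] borel_measurable_integrable in blast)
  qed
  show "integrable lborel (\<lambda>\<xi>. f (?\<psi> \<xi>))" by (rule Ii)
  have "(\<lambda>n. fun_ud (u n) \<phi> - f \<phi>) \<longlonglongrightarrow> 0"
  proof (rule Lim_null_comparison[OF _ lim0[of 1]])
    show "\<forall>\<^sub>F n in sequentially. norm (fun_ud (u n) \<phi> - f \<phi>) \<le> 1 / real (Suc n) * 1"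
      using u(2)[of \<phi>] by (simp add: B_def norm_minus_commute)
  qed
  then have "(\<lambda>n. fun_ud (u n) \<phi>) \<longlonglongrightarrow> f \<phi>" by (simp add: LIM_zero_iff)
  then have "(\<lambda>n. \<eta> 0 * fun_ud (u n) \<phi>) \<longlonglongrightarrow> \<eta> 0 * f \<phi>" by (intro tendsto_intros)
  then show "(\<integral>\<xi>. f (?\<psi> \<xi>) \<partial>lborel) = \<eta> 0 * f \<phi>"
    using Ilim fun_ud[OF u(1)] by (simp add: LIMSEQ_unique)
qed

end

section \<open>A partition of frequency space into unit cubes\<close>

text \<open>Enumerates the integer points, so that sums over cubes become series indexed by
  \<open>nat\<close>.\<close>

definition corner :: "nat \<Rightarrow> 'n::finite \<Rightarrow> int" where
  "corner = from_nat_into UNIV"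

definition cube :: "nat \<Rightarrow> (real^'n::finite) set" where
  "cube m = cbox (\<chi> i. of_int (corner m i)) (\<chi> i. of_int (corner m i) + 1)"

text \<open>Half-open cubes give an exact partition, whereas the closed ones are compact and suit
  integrals of continuous vector-valued functions. They differ by null sets.\<close>

definition hcube :: "nat \<Rightarrow> (real^'n::finite) set" where
  "hcube m = {x. \<forall>i. \<lfloor>x $ i\<rfloor> = corner m i}"

lemma bij_corner: "bij (corner :: nat \<Rightarrow> 'n::finite \<Rightarrow> int)"
proof -
  have "inj (\<lambda>z::int. (\<lambda>_::'n. z))" by (auto intro!: injI dest: fun_cong)
  then have "infinite (UNIV :: ('n \<Rightarrow> int) set)"
    by (meson finite_imageD finite_subset infinite_UNIV_int subset_UNIV)
  then show ?thesis unfolding corner_def by (intro bij_betw_from_nat_into) auto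
qed

lemma hcube_disjoint: "x \<in> hcube m \<Longrightarrow> x \<in> hcube m' \<Longrightarrow> m = m'"
  by (rule injD[OF bij_is_inj[OF bij_corner]]) (auto simp: hcube_def fun_eq_iff)

lemma hcube_cover: "\<exists>m. x \<in> hcube m"
proof -
  obtain m where "corner m = (\<lambda>i. \<lfloor>x $ i\<rfloor>)" using bij_is_surj[OF bij_corner] by (metis surjD)
  then have "x \<in> hcube m" by (simp add: hcube_def)
  then show ?thesis by blast
qed

lemma hcube_measurable [measurable]: "hcube m \<in> sets borel"
  unfolding hcube_def by measurable

lemma mem_cube: "x \<in> cube m \<longleftrightarrow> (\<forall>i. of_int (corner m i) \<le> x $ i \<and> x $ i \<le> of_int (corner m i) + 1)"
  by (simp add: cube_def mem_box_cart)

lemma AE_hcube_cube: "AE x::real^'n::finite in lborel. x \<in> hcube m \<longleftrightarrow> x \<in> cube m"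
proof -
  let ?a = "(\<chi> i. of_int (corner m i)) :: real^'n" and ?b = "(\<chi> i. of_int (corner m i) + 1) :: real^'n"
  have "cbox ?a ?b - box ?a ?b \<in> null_sets lborel"
    using negligible_frontier_interval[of ?a ?b] negligible_iff_null_sets[of "cbox ?a ?b - box ?a ?b"]
    by (simp add: null_sets_completion_iff)
  then have "AE x in lborel. x \<notin> cbox ?a ?b - box ?a ?b" by (rule AE_not_in)
  then show ?thesis
  proof eventually_elim
    case (elim x)
    have "x \<in> hcube m" if "x \<in> box ?a ?b"
      unfolding hcube_def
    proof (intro CollectI allI)
      fix i
      show "\<lfloor>x $ i\<rfloor> = corner m i" using that by (intro floor_unique) (auto simp: mem_box_cart less_imp_le)
    qed
    moreover have "x \<in> cube m" if h: "x \<in> hcube m"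
    proof -
      have "of_int (corner m i) \<le> x $ i \<and> x $ i \<le> of_int (corner m i) + 1" for i
      proof -
        have "\<lfloor>x $ i\<rfloor> = corner m i" using h by (simp add: hcube_def)
        then show ?thesis using of_int_floor_le[of "x $ i"] real_of_int_floor_add_one_ge[of "x $ i"] by simp
      qed
      then show ?thesis by (simp add: mem_cube)
    qed
    ultimately show ?case using elim by (auto simp: cube_def)
  qed
qed

lemma sums_cubes:
  fixes I :: "real^'n::finite \<Rightarrow> 'b::euclidean_space"
  assumes I: "integrable lborel I"
  shows "(\<lambda>m. integral (cube m) I) sums (integral\<^sup>L lborel I)"
proof -
  have [measurable]: "I \<in> borel_measurable borel" using I by auto
  have eq: "integral (cube m) I = (\<integral>x. indicator (hcube m) x *\<^sub>R I x \<partial>lborel)" for m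
  proof -
    have "set_integrable lborel (cube m) I"
      unfolding set_integrable_def by (rule integrable_mult_indicator[OF _ I]) (simp add: cube_def)
    from set_borel_integral_eq_integral(2)[OF this]
    have "integral (cube m) I = (\<integral>x. indicator (cube m) x *\<^sub>R I x \<partial>lborel)"
      by (simp add: set_lebesgue_integral_def)
    also have "\<dots> = (\<integral>x. indicator (hcube m) x *\<^sub>R I x \<partial>lborel)"
    proof (rule integral_cong_AE)
      show "AE x in lborel. indicat_real (cube m) x *\<^sub>R I x = indicat_real (hcube m) x *\<^sub>R I x"
        using AE_hcube_cube[of m] by eventually_elim (auto simp: indicator_def)
    qed (auto simp: cube_def)
    finally show ?thesis .
  qed
  have "(\<lambda>n. \<integral>x. (\<Sum>m<n. indicator (hcube m) x) *\<^sub>R I x \<partial>lborel) \<longlonglongrightarrow> (\<integral>x. I x \<partial>lborel)"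
  proof (rule integral_dominated_convergence[where w = "\<lambda>x. norm (I x)"])
    have s: "(\<Sum>m<n. indicat_real (hcube m) x) = (if m0 < n then 1 else 0)" if "x \<in> hcube m0" for x m0 n
    proof -
      have "indicat_real (hcube m) x = (if m = m0 then 1 else 0)" for m
        using that hcube_disjoint by (auto simp: indicator_def)
      then show ?thesis by simp
    qed
    show "AE x in lborel. (\<lambda>n. (\<Sum>m<n. indicat_real (hcube m) x) *\<^sub>R I x) \<longlonglongrightarrow> I x"
    proof (intro AE_I2)
      fix x :: "real^'n"
      obtain m0 where "x \<in> hcube m0" using hcube_cover by blast
      then show "(\<lambda>n. (\<Sum>m<n. indicat_real (hcube m) x) *\<^sub>R I x) \<longlonglongrightarrow> I x"
        by (intro tendsto_eventually eventually_sequentiallyI[of "Suc m0"]) (simp add: s)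
    qed
    show "AE x in lborel. norm ((\<Sum>m<n. indicat_real (hcube m) x) *\<^sub>R I x) \<le> norm (I x)" for n
    proof (intro AE_I2)
      fix x :: "real^'n"
      obtain m0 where "x \<in> hcube m0" using hcube_cover by blast
      then show "norm ((\<Sum>m<n. indicat_real (hcube m) x) *\<^sub>R I x) \<le> norm (I x)" by (simp add: s)
    qed
  qed (use I in auto)
  moreover have "(\<integral>x. (\<Sum>m<n. indicator (hcube m) x) *\<^sub>R I x \<partial>lborel) = (\<Sum>m<n. integral (cube m) I)" for n
  proof -
    have "integrable lborel (\<lambda>x. indicat_real (hcube m) x *\<^sub>R I x)" for m
      by (rule integrable_mult_indicator[OF _ I]) simp
    then show ?thesis unfolding eq scaleR_sum_left by (subst Bochner_Integration.integral_sum) auto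
  qed
  ultimately show ?thesis by (simp add: sums_def)
qed

section \<open>Size and dominant direction of a cube\<close>

definition dirn :: "nat \<Rightarrow> 'n::finite" where
  "dirn m = (SOME j. \<forall>i::'n. \<bar>corner m i\<bar> \<le> \<bar>corner m j\<bar>)"

definition maxc :: "'n::finite itself \<Rightarrow> nat \<Rightarrow> real" where
  "maxc _ m = of_int \<bar>corner m (dirn m :: 'n)\<bar>"

text \<open>A lower bound for the dominant coordinate on cubes with \<open>maxc t m\<close> at least
  2, where maxc - 1 is at least maxc/2. The remaining cubes, where that coordinate may vanish, get
  radius 1.\<close>

definition rad :: "'n::finite itself \<Rightarrow> nat \<Rightarrow> real" where
  "rad t m = max 1 (maxc t m / 2)"

lemma corner_le_maxc: "of_int \<bar>corner m (i :: 'n::finite)\<bar> \<le> maxc TYPE('n) m"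
proof -
  have "\<exists>j. \<forall>i::'n. \<bar>corner m i\<bar> \<le> \<bar>corner m (j::'n)\<bar>"
  proof -
    have "Max (range (\<lambda>i::'n. \<bar>corner m i\<bar>)) \<in> range (\<lambda>i::'n. \<bar>corner m i\<bar>)" by (rule Max_in) auto
    then obtain j :: 'n where "Max (range (\<lambda>i::'n. \<bar>corner m i\<bar>)) = \<bar>corner m j\<bar>" by blast
    then show ?thesis by (metis (no_types, lifting) Max_ge finite_imageI finite_class.finite_UNIV rangeI)
  qed
  then have "\<forall>i::'n. \<bar>corner m i\<bar> \<le> \<bar>corner m (dirn m :: 'n)\<bar>" unfolding dirn_def by (rule someI_ex)
  then show ?thesis by (simp add: maxc_def del: of_int_abs)
qed

lemma rad_ge_1: "rad t m \<ge> 1" by (simp add: rad_def)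

lemma cube_norm_le:
  assumes "\<xi> \<in> cube m"
  shows "norm (\<xi> :: real^'n::finite) \<le> 3 * real CARD('n) * rad TYPE('n) m"
proof -
  have "norm \<xi> \<le> (\<Sum>j\<in>UNIV. \<bar>\<xi> $ j\<bar>)" by (rule norm_le_l1_cart)
  also have "\<dots> \<le> (\<Sum>j\<in>(UNIV::'n set). 3 * rad TYPE('n) m)"
  proof (rule sum_mono)
    fix j
    have "of_int (corner m j) \<le> \<xi> $ j" "\<xi> $ j \<le> of_int (corner m j) + 1" using assms by (auto simp: mem_cube)
    then have "\<bar>\<xi> $ j\<bar> \<le> \<bar>of_int (corner m j)\<bar> + 1" by linarith
    also have "\<dots> \<le> maxc TYPE('n) m + 1" using corner_le_maxc[of m j] by simp
    also have "\<dots> \<le> 3 * rad TYPE('n) m" by (simp add: rad_def)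
    finally show "\<bar>\<xi> $ j\<bar> \<le> 3 * rad TYPE('n) m" .
  qed
  finally show ?thesis by (simp add: mult_ac)
qed

lemma cube_component_ge:
  assumes "\<xi> \<in> cube m" "maxc TYPE('n::finite) m > 1"
  shows "\<bar>\<xi> $ (dirn m :: 'n)\<bar> \<ge> rad TYPE('n) m"
proof -
  have "2 \<le> \<bar>corner m (dirn m :: 'n)\<bar>" using assms(2) by (simp add: maxc_def del: of_int_abs)
  then have "maxc TYPE('n) m \<ge> 2" unfolding maxc_def by linarith
  moreover have "of_int (corner m (dirn m :: 'n)) \<le> \<xi> $ dirn m" "\<xi> $ dirn m \<le> of_int (corner m (dirn m :: 'n)) + 1"
    using assms by (auto simp: mem_cube)
  then have "\<bar>\<xi> $ dirn m\<bar> \<ge> maxc TYPE('n) m - 1" unfolding maxc_def by linarith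
  ultimately show ?thesis by (simp add: rad_def)
qed

lemma content_cube: "measure lborel (cube m :: (real^'n::finite) set) = 1"
proof -
  have "(cube m :: (real^'n) set) \<noteq> {}" using mem_cube[of "\<chi> i. of_int (corner m i)" m] by auto
  then show ?thesis unfolding cube_def by (subst content_cbox_cart) auto
qed

lemma integrable_on_cube_const: "(\<lambda>_. c::real) integrable_on cube m" "integral (cube m) (\<lambda>_. c) = c"
  using content_cube[of m] unfolding cube_def by (auto simp: integrable_const)

text \<open>On a unit cube 1 + |xi| is at most 4d times the radius, so each term is at most a
  constant times the integral of (1 + |xi|)^(-2d) over that cube.\<close>

lemma summable_rad: "summable (\<lambda>m. 1 / rad TYPE('n::finite) m ^ (2 * CARD('n)))"
proof -
  let ?N = "2 * CARD('n)"
  let ?W = "\<lambda>\<xi>::real^'n. 1 / (1 + norm \<xi>) ^ ?N"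
  define c where "c = (4 * real CARD('n)) ^ ?N"
  have card1: "real CARD('n) \<ge> 1" by (simp add: Suc_leI)
  have sW: "summable (\<lambda>m. integral (cube m) ?W)"
    using sums_cubes[OF integrable_inverse_one_plus_norm] by (rule sums_summable)
  have le: "1 / rad TYPE('n) m ^ ?N \<le> c * integral (cube m) ?W" for m
  proof -
    have W: "1 / rad TYPE('n) m ^ ?N / c \<le> ?W \<xi>" if "\<xi> \<in> cube m" for \<xi>
    proof -
      have "1 + norm \<xi> \<le> rad TYPE('n) m + 3 * real CARD('n) * rad TYPE('n) m"
        using cube_norm_le[OF that] rad_ge_1[of "TYPE('n)" m] by simp
      also have "\<dots> \<le> (4 * real CARD('n)) * rad TYPE('n) m"
        using mult_right_mono[OF card1, of "rad TYPE('n) m"] rad_ge_1[of "TYPE('n)" m] by simp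
      finally have "(1 + norm \<xi>) ^ ?N \<le> c * rad TYPE('n) m ^ ?N"
        unfolding c_def power_mult_distrib[symmetric] by (intro power_mono) auto
      moreover have "(1 + norm \<xi>) ^ ?N > 0" by (simp add: add_pos_nonneg)
      ultimately have "1 / (c * rad TYPE('n) m ^ ?N) \<le> ?W \<xi>" by (intro divide_left_mono mult_pos_pos) (auto simp: c_def rad_def)
      then show ?thesis by (simp add: mult.commute)
    qed
    have "1 / rad TYPE('n) m ^ ?N / c = integral (cube m) (\<lambda>_::real^'n. 1 / rad TYPE('n) m ^ ?N / c)"
      by (simp only: integrable_on_cube_const)
    also have "\<dots> \<le> integral (cube m) ?W"
    proof (rule integral_le[OF integrable_on_cube_const(1)])
      show "?W integrable_on cube m"
        unfolding cube_def by (intro integrable_continuous continuous_intros) (auto simp: add_nonneg_eq_0_iff)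
    qed (use W in auto)
    finally have "1 / rad TYPE('n) m ^ ?N / c \<le> integral (cube m) ?W" .
    moreover have "c > 0" by (simp add: c_def)
    ultimately have "c * (1 / rad TYPE('n) m ^ ?N / c) \<le> c * integral (cube m) ?W" by (intro mult_left_mono) auto
    then show ?thesis using \<open>c > 0\<close> by simp
  qed
  show ?thesis
    by (rule summable_comparison_test[OF _ summable_mult[OF sW, of c]]) (use le in \<open>auto simp: rad_def\<close>)
qed

lemma finite_rad_le: "finite {m. rad TYPE('n::finite) m \<le> R}"
proof -
  let ?N = "2 * CARD('n)"
  have "(\<lambda>m. 1 / rad TYPE('n) m ^ ?N) \<longlonglongrightarrow> 0" by (rule summable_LIMSEQ_zero[OF summable_rad])
  moreover have "1 / (\<bar>R\<bar> + 1) ^ ?N > 0" by simp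
  ultimately have "eventually (\<lambda>m. 1 / rad TYPE('n) m ^ ?N < 1 / (\<bar>R\<bar> + 1) ^ ?N) sequentially"
    by (rule order_tendstoD)
  then obtain m0 where m0: "\<And>m. m \<ge> m0 \<Longrightarrow> 1 / rad TYPE('n) m ^ ?N < 1 / (\<bar>R\<bar> + 1) ^ ?N"
    by (auto simp: eventually_sequentially)
  have "{m. rad TYPE('n) m \<le> R} \<subseteq> {..<m0}"
  proof
    fix m assume "m \<in> {m. rad TYPE('n) m \<le> R}"
    then have r: "rad TYPE('n) m \<le> \<bar>R\<bar> + 1" by simp
    have "rad TYPE('n) m > 0" using rad_ge_1[of "TYPE('n)" m] by linarith
    then have "1 / (\<bar>R\<bar> + 1) ^ ?N \<le> 1 / rad TYPE('n) m ^ ?N"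
      using r by (intro divide_left_mono power_mono mult_pos_pos zero_less_power) auto
    then show "m \<in> {..<m0}" using m0[of m] by (meson lessThan_iff not_le not_less)
  qed
  then show ?thesis by (rule finite_subset) simp
qed

text \<open>\<open>\<nu> m\<close> is the largest N with \<open>D N\<close> at most
  \<open>r m\<close>. As \<open>D\<close> dominates both the identity and \<open>C\<close>, such N
  are finite in number and \<open>C (\<nu> m)\<close> stays below the radius; as \<open>r\<close>
  tends to infinity, so does \<open>\<nu>\<close>.\<close>

lemma slow_choice:
  fixes C :: "nat \<Rightarrow> real" and r :: "nat \<Rightarrow> real"
  assumes r1: "\<And>m. r m \<ge> 1" and fin: "\<And>R. finite {m. r m \<le> R}"
  obtains \<nu> \<kappa> where "\<kappa> > 0" "\<And>m. C (\<nu> m) \<le> \<kappa> * r m" "\<And>L. finite {m. \<nu> m < (L::nat)}"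
proof -
  define D where "D = (\<lambda>N. real N + (\<Sum>i\<le>N. \<bar>C i\<bar>))"
  have CD: "C N \<le> D N" for N
  proof -
    have "\<bar>C N\<bar> \<le> (\<Sum>i\<le>N. \<bar>C i\<bar>)" by (rule member_le_sum) auto
    then show ?thesis by (simp add: D_def)
  qed
  have ND: "real N \<le> D N" for N by (simp add: D_def sum_nonneg)
  have finD: "finite {N. D N \<le> R}" for R
    by (rule finite_subset[of _ "{..nat \<lceil>R\<rceil>}"]) (use ND in \<open>auto, smt (verit) nat_ceiling_le_eq ceiling_le of_nat_le_iff le_nat_iff real_nat_ceiling_ge\<close>)
  \<comment> \<open>The default 0 is used where no N qualifies; the constant \<open>C 0\<close> is
    then paid for by \<open>\<kappa>\<close>.\<close>
  define \<nu> where "\<nu> = (\<lambda>m. Max (insert 0 {N. D N \<le> r m}))"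
  have \<nu>: "\<nu> m = 0 \<or> D (\<nu> m) \<le> r m" for m
  proof -
    have "\<nu> m \<in> insert 0 {N. D N \<le> r m}" unfolding \<nu>_def by (rule Max_in) (use finD in auto)
    then show ?thesis by auto
  qed
  have "C (\<nu> m) \<le> (\<bar>C 0\<bar> + 1) * r m" for m
  proof -
    have 1: "1 * r m \<le> (\<bar>C 0\<bar> + 1) * r m" using r1[of m] by (intro mult_right_mono) auto
    have 2: "(\<bar>C 0\<bar> + 1) * 1 \<le> (\<bar>C 0\<bar> + 1) * r m" using r1[of m] by (intro mult_left_mono) auto
    show ?thesis using \<nu>[of m] CD[of "\<nu> m"] 1 2 by auto
  qed
  moreover have "finite {m. \<nu> m < L}" for L
  proof (rule finite_subset[OF _ fin[of "D L"]])
    show "{m. \<nu> m < L} \<subseteq> {m. r m \<le> D L}"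
    proof (intro subsetI CollectI)
      fix m assume m: "m \<in> {m. \<nu> m < L}"
      show "r m \<le> D L"
      proof (rule ccontr)
        assume "\<not> r m \<le> D L"
        then have "L \<in> insert 0 {N. D N \<le> r m}" by simp
        then have "L \<le> \<nu> m" unfolding \<nu>_def by (intro Max_ge) (use finD in auto)
        then show False using m by simp
      qed
    qed
  qed
  ultimately show ?thesis using that[of "\<bar>C 0\<bar> + 1" \<nu>] by simp
qed

context gs
begin

text \<open>The numbers \<open>conv \<theta> (reflect (modul \<xi> \<theta>)) 0\<close> are the
  values of the Fourier transform of the square of \<open>\<theta>\<close>. If all were zero,
  inversion would give \<open>\<theta> 0 = 0\<close>.\<close>

lemma exists_factorized_unit:
  assumes "\<exists>\<phi>::'n::finite testfun \<in> TS True M A. \<phi> \<noteq> (\<lambda>_. 0)"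
  obtains \<theta> \<gamma> :: "'n::finite testfun" where "\<theta> \<in> TS True M A" "\<gamma> \<in> TS True M A" "conv \<theta> \<gamma> 0 = 1"
proof -
  obtain \<phi> :: "'n testfun" and x0 where \<phi>: "\<phi> \<in> TS True M A" "\<phi> x0 \<noteq> 0" using assms by (auto simp: fun_eq_iff)
  define \<theta> where "\<theta> = transl (- x0) \<phi>"
  have \<theta>: "\<theta> \<in> TS True M A" "\<theta> 0 \<noteq> 0"
    unfolding \<theta>_def using TS_transl[OF \<phi>(1), of "- x0"] \<phi>(2) by (simp, simp add: transl_def)
  have "\<exists>\<xi>. conv \<theta> (reflect (modul \<xi> \<theta>)) 0 \<noteq> 0"
  proof (rule ccontr)
    assume "\<not> ?thesis"
    then have z: "(\<integral>t. (\<theta> t * \<theta> t) * iexp (2 * pi * (\<xi> \<bullet> t)) \<partial>lborel) = 0" for \<xi>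
      unfolding conv_reflect_eq by (simp add: modul_def mult_ac)
    obtain K where K: "\<And>x. cmod (pd [] \<theta> x) \<le> K" using TS_bound[OF \<theta>(1)] by metis
    have "(\<integral>\<xi>. (\<integral>t. (\<theta> t * \<theta> t) * iexp (2 * pi * (\<xi> \<bullet> t)) \<partial>lborel) \<partial>lborel) = \<theta> 0 * \<theta> 0"
    proof (rule Fourier_inversion_at_0)
      show "continuous_on UNIV (\<lambda>t. \<theta> t * \<theta> t)"
        by (intro continuous_intros smooth_continuous_on TS_smooth[OF \<theta>(1)])
      show "cmod (\<theta> t * \<theta> t) \<le> K * K" for t
        unfolding norm_mult using K[of t] by (intro mult_mono) (auto intro: order_trans[OF norm_ge_zero])
      show "integrable lborel (\<lambda>t. \<theta> t * \<theta> t)"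
        by (rule integrable_mult_bounded[OF TS_integrable[OF \<theta>(1)] TS_measurable[OF \<theta>(1)], where B = K]) (use K in auto)
      show "integrable lborel (\<lambda>\<xi>. \<integral>t. (\<theta> t * \<theta> t) * iexp (2 * pi * (\<xi> \<bullet> t)) \<partial>lborel)"
        unfolding z by simp
    qed
    then show False unfolding z using \<theta>(2) by simp
  qed
  then obtain \<xi> where \<xi>: "conv \<theta> (reflect (modul \<xi> \<theta>)) 0 \<noteq> 0" by blast
  define \<gamma> where "\<gamma> = (\<lambda>x. (1 / conv \<theta> (reflect (modul \<xi> \<theta>)) 0) * reflect (modul \<xi> \<theta>) x)"
  have "\<gamma> \<in> TS True M A" unfolding \<gamma>_def by (intro TS_cmult TS_reflect TS_modul \<theta>)
  moreover have "conv \<theta> \<gamma> 0 = 1" unfolding \<gamma>_def conv_cmult_right using \<xi> by simp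
  ultimately show ?thesis using that \<theta>(1) by blast
qed

end

section \<open>The structure theorem\<close>

context tmib_conv
begin

lemma exists_ubd:
  obtains l C where "l > 0" "C > 0" "\<And>\<phi> \<psi> P D. \<phi> \<in> TS True M A \<Longrightarrow> \<psi> \<in> TS True M A \<Longrightarrow> P > 0 \<Longrightarrow> D > 0 \<Longrightarrow> gs_le M A l (1 / l) P \<phi> \<Longrightarrow>
      (\<integral>y. cmod (\<psi> y) * wgt A (1 / l) y \<partial>lborel) \<le> D \<Longrightarrow> norm (R (conv \<phi> \<psi>)) \<le> C * P * D"
proof -
  obtain l0 :: real where "l0 > 0" "ubd l0"
  proof (cases beur)
    case True
    with uniform_bound have "\<exists>l0>0. \<forall>l>0. l \<le> l0 \<longrightarrow> ubd l" by (simp only: if_True)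
    then obtain l0 where l0: "l0 > 0" "\<forall>l>0. l \<le> l0 \<longrightarrow> ubd l" by (elim exE conjE)
    from l0(2)[rule_format, OF l0(1) order_refl] show ?thesis using \<open>\<And>l0. l0 > 0 \<Longrightarrow> ubd l0 \<Longrightarrow> thesis\<close> l0(1) by simp
  next
    case False
    with uniform_bound have "\<forall>l>0. ubd l" by (simp only: if_False)
    from this[rule_format, of 1] show ?thesis using \<open>\<And>l0. l0 > 0 \<Longrightarrow> ubd l0 \<Longrightarrow> thesis\<close>[of 1] by simp
  qed
  from this(2)[unfolded ubd_def] obtain C where "C > 0" and S: "\<forall>\<phi>\<in>TS True M A. \<forall>\<psi>\<in>TS True M A. \<forall>P>0. \<forall>D>0. gs_le M A l0 (1 / l0) P \<phi> \<longrightarrow>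
      (\<integral>y. cmod (\<psi> y) * wgt A (1 / l0) y \<partial>lborel) \<le> D \<longrightarrow> norm (R (conv \<phi> \<psi>)) \<le> C * P * D"
    by (elim exE conjE)
  show ?thesis by (rule that[OF \<open>l0 > 0\<close> \<open>C > 0\<close> S[rule_format]])
qed

lemma modul_diff_eq:
  assumes "h \<noteq> 0"
  shows "modul (\<eta> + h) g = (\<lambda>x. 1 * modul \<eta> g x + of_real (norm h) * modul \<eta> (\<lambda>x. of_real (1 / norm h) * modul h g x + of_real (- 1 / norm h) * g x) x)"
proof
  fix x
  have "exp (2 * of_real pi * \<i> * of_real ((\<eta> + h) \<bullet> x)) = exp (2 * of_real pi * \<i> * of_real (\<eta> \<bullet> x)) * exp (2 * of_real pi * \<i> * of_real (h \<bullet> x))"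
    by (simp add: inner_add_left algebra_simps flip: exp_add)
  then show "modul (\<eta> + h) g x = 1 * modul \<eta> g x + of_real (norm h) * modul \<eta> (\<lambda>x. of_real (1 / norm h) * modul h g x + of_real (- 1 / norm h) * g x) x"
    using assms by (simp add: modul_def field_simps)
qed

text \<open>Makes the integrals over the cubes meaningful. A change of frequency by h is written as
  |h| times a bounded difference quotient, first in one factor and then in the other, and the
  uniform bound gives a local Lipschitz estimate.\<close>

lemma continuous_R_modul:
  assumes \<theta>: "\<theta> \<in> TS True M A" and \<gamma>: "\<gamma> \<in> TS True M A"
  shows "continuous_on S (\<lambda>\<xi>. R (conv (modul \<xi> \<theta>) (modul \<xi> \<gamma>)))"
proof -
  obtain l C where l: "l > 0" "C > 0" and S1: "\<And>\<phi> \<psi> P D. \<phi> \<in> TS True M A \<Longrightarrow> \<psi> \<in> TS True M A \<Longrightarrow> P > 0 \<Longrightarrow> D > 0 \<Longrightarrow> gs_le M A l (1 / l) P \<phi> \<Longrightarrow>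
      (\<integral>y. cmod (\<psi> y) * wgt A (1 / l) y \<partial>lborel) \<le> D \<Longrightarrow> norm (R (conv \<phi> \<psi>)) \<le> C * P * D"
    using exists_ubd by blast
  let ?q = "\<lambda>h g. (\<lambda>x. of_real (1 / norm h) * modul h g x + of_real (- 1 / norm h) * g x)"
  have qT: "?q h g \<in> TS True M A" if "g \<in> TS True M A" for h :: "real^'n" and g
    using that by (intro TS_lincomb TS_modul)
  define r where "r = domK TYPE('n) * (1 / l)"
  have r: "r > 0" using l domK(1)[of "TYPE('n)"] by (auto simp: r_def)
  have "\<exists>K>0. \<forall>\<psi>\<in>{?q h \<theta> | h. h \<noteq> 0 \<and> 2 * pi * norm h \<le> 1}. gs_le M A (l / 2) (1 / l) K \<psi>"
    using TS_bounded_modul_quotients[OF \<theta>, unfolded TS_bounded_iff] l by simp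
  then obtain K1 where K1: "K1 > 0" "\<And>h. h \<noteq> 0 \<Longrightarrow> 2 * pi * norm h \<le> 1 \<Longrightarrow> gs_le M A (l / 2) (1 / l) K1 (?q h \<theta>)" by blast
  have "\<exists>K>0. \<forall>\<psi>\<in>{?q h \<gamma> | h. h \<noteq> 0 \<and> 2 * pi * norm h \<le> 1}. gs_le M A 1 r K \<psi>"
    using TS_bounded_modul_quotients[OF \<gamma>, unfolded TS_bounded_iff] r by simp
  then obtain K2 where K2: "K2 > 0" "\<And>h. h \<noteq> 0 \<Longrightarrow> 2 * pi * norm h \<le> 1 \<Longrightarrow> gs_le M A 1 r K2 (?q h \<gamma>)" by blast
  have "isCont (\<lambda>\<xi>. R (conv (modul \<xi> \<theta>) (modul \<xi> \<gamma>))) \<eta>" for \<eta>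
    unfolding isCont_iff
  proof -
    let ?g = "\<lambda>\<xi>. R (conv (modul \<xi> \<theta>) (modul \<xi> \<gamma>))"
    define P1 where "P1 = K1 * exp (assoc_fun M (2 * pi * norm \<eta> / (l / 2)))"
    define D1 where "D1 = (\<integral>y. cmod (\<gamma> y) * wgt A (1 / l) y \<partial>lborel) + 1"
    have mT: "modul \<eta> \<theta> \<in> TS True M A" using \<theta> by (rule TS_modul)
    obtain P2 where P2: "P2 > 0" "gs_le M A l (1 / l) P2 (modul \<eta> \<theta>)" using TS_True_gs_le[OF mT] l by (metis zero_less_divide_1_iff)
    define D2 where "D2 = K2 * M 0 * (\<integral>x. wgt A (1 / l) x / wgt A r (x::real^'n) \<partial>lborel) + 1"
    have pos: "P1 > 0" "D1 > 0" "D2 > 0"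
      using K1 K2 by (auto simp: P1_def D1_def D2_def intro!: add_nonneg_pos mult_nonneg_nonneg integral_nonneg_AE)
    have "norm (?g (\<eta> + h) - ?g \<eta>) \<le> (C * P1 * D1 + C * P2 * D2) * norm h" if h: "h \<noteq> 0" "2 * pi * norm h \<le> 1" for h
    proof -
      let ?d\<theta> = "modul \<eta> (?q h \<theta>)" and ?d\<gamma> = "modul \<eta> (?q h \<gamma>)"
      have T: "?d\<theta> \<in> TS True M A" "?d\<gamma> \<in> TS True M A" "modul (\<eta> + h) \<gamma> \<in> TS True M A" "modul \<eta> \<gamma> \<in> TS True M A"
        using \<theta> \<gamma> qT by (auto intro: TS_modul)
      have T2: "conv (modul \<eta> \<theta>) (modul (\<eta> + h) \<gamma>) \<in> TS True M A" "conv ?d\<theta> (modul (\<eta> + h) \<gamma>) \<in> TS True M A"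
        "conv (modul \<eta> \<theta>) (modul \<eta> \<gamma>) \<in> TS True M A" "conv (modul \<eta> \<theta>) ?d\<gamma> \<in> TS True M A"
        using T mT by (auto intro: TS_conv)
      have "conv (modul (\<eta> + h) \<theta>) (modul (\<eta> + h) \<gamma>) = (\<lambda>x. 1 * conv (modul \<eta> \<theta>) (modul (\<eta> + h) \<gamma>) x + of_real (norm h) * conv ?d\<theta> (modul (\<eta> + h) \<gamma>) x)"
        unfolding modul_diff_eq[OF h(1), of \<eta> \<theta>] by (rule conv_lincomb_left[OF mT T(1,3)])
      then have e1: "?g (\<eta> + h) = cs 1 (R (conv (modul \<eta> \<theta>) (modul (\<eta> + h) \<gamma>))) + cs (of_real (norm h)) (R (conv ?d\<theta> (modul (\<eta> + h) \<gamma>)))"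
        by (simp only: R_lincomb[OF TST_T[OF T2(1)] TST_T[OF T2(2)]])
      have "conv (modul \<eta> \<theta>) (modul (\<eta> + h) \<gamma>) = (\<lambda>x. 1 * conv (modul \<eta> \<theta>) (modul \<eta> \<gamma>) x + of_real (norm h) * conv (modul \<eta> \<theta>) ?d\<gamma> x)"
        unfolding modul_diff_eq[OF h(1), of \<eta> \<gamma>] by (rule conv_lincomb_right[OF T(4,2) mT])
      then have e2: "R (conv (modul \<eta> \<theta>) (modul (\<eta> + h) \<gamma>)) = cs 1 (?g \<eta>) + cs (of_real (norm h)) (R (conv (modul \<eta> \<theta>) ?d\<gamma>))"
        by (simp only: R_lincomb[OF TST_T[OF T2(3)] TST_T[OF T2(4)]])
      have cs1: "cs 1 e = e" for e by (rule iota_inj) (simp add: cs)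
      have "?g (\<eta> + h) - ?g \<eta> = cs (of_real (norm h)) (R (conv ?d\<theta> (modul (\<eta> + h) \<gamma>))) + cs (of_real (norm h)) (R (conv (modul \<eta> \<theta>) ?d\<gamma>))"
        unfolding e1 e2 cs1 by simp
      then have "norm (?g (\<eta> + h) - ?g \<eta>) \<le> norm h * norm (R (conv ?d\<theta> (modul (\<eta> + h) \<gamma>))) + norm h * norm (R (conv (modul \<eta> \<theta>) ?d\<gamma>))"
        using norm_triangle_ineq[of "cs (of_real (norm h)) (R (conv ?d\<theta> (modul (\<eta> + h) \<gamma>)))" "cs (of_real (norm h)) (R (conv (modul \<eta> \<theta>) ?d\<gamma>))"]
        by (simp add: norm_cs)
      also have "\<dots> \<le> norm h * (C * P1 * D1) + norm h * (C * P2 * D2)"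
      proof (intro add_mono mult_left_mono)
        show "norm (R (conv ?d\<theta> (modul (\<eta> + h) \<gamma>))) \<le> C * P1 * D1"
        proof (rule S1[OF T(1,3) pos(1,2)])
          show "gs_le M A l (1 / l) P1 ?d\<theta>"
            using gs_le_modul[OF TS_smooth[OF qT[OF \<theta>]] K1(2)[OF h], of \<eta>] l by (simp add: P1_def)
          show "(\<integral>y. cmod (modul (\<eta> + h) \<gamma> y) * wgt A (1 / l) y \<partial>lborel) \<le> D1" by (simp add: D1_def)
        qed
        show "norm (R (conv (modul \<eta> \<theta>) ?d\<gamma>)) \<le> C * P2 * D2"
        proof (rule S1[OF mT T(2) P2(1) pos(3) P2(2)])
          have "(\<integral>y. cmod (?q h \<gamma> y) * wgt A (1 / l) y \<partial>lborel) \<le> (K2 * M 0) * (\<integral>x. wgt A (1 / l) x / wgt A r (x::real^'n) \<partial>lborel)"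
            by (rule wgt_L1(2)[OF _ _ TS_measurable[OF qT[OF \<gamma>]]])
              (use l gs_le_pd_div[OF K2(2)[OF h] TS_smooth[OF qT[OF \<gamma>]], of "[]"] in \<open>auto simp: r_def\<close>)
          then show "(\<integral>y. cmod (?d\<gamma> y) * wgt A (1 / l) y \<partial>lborel) \<le> D2" unfolding cmod_modul D2_def by linarith
        qed
      qed auto
      finally show ?thesis by (simp add: algebra_simps)
    qed
    then have "\<forall>\<^sub>F h in at 0. norm (?g (\<eta> + h) - ?g \<eta>) \<le> (C * P1 * D1 + C * P2 * D2) * norm h"
      unfolding eventually_at by (intro exI[of _ "1 / (2 * pi)"]) (auto simp: dist_norm pos_less_divide_eq mult.commute mult.left_commute less_imp_le)
    moreover have "((\<lambda>h::real^'n. (C * P1 * D1 + C * P2 * D2) * norm h) \<longlongrightarrow> 0) (at 0)"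
      by (rule tendsto_mult_right_zero[OF tendsto_norm_zero[OF tendsto_ident_at]])
    ultimately have "(\<lambda>h. ?g (\<eta> + h) - ?g \<eta>) \<midarrow>0\<rightarrow> 0" by (rule Lim_null_comparison)
    then show "(\<lambda>h. ?g (\<eta> + h)) \<midarrow>0\<rightarrow> ?g \<eta>" by (simp add: LIM_zero_iff)
  qed
  then show ?thesis by (simp add: continuous_at_imp_continuous_on)
qed

end

section \<open>Integration by parts on the cubes\<close>

abbreviation decay :: "'n::finite itself \<Rightarrow> nat \<Rightarrow> real" where
  "decay t m \<equiv> 1 / rad t m ^ (2 * CARD('n))"

text \<open>On the \<open>m\<close>-th cube one integrates by parts \<open>n m\<close> times in the direction of the largest
  coordinate. \<open>l m\<close> is the parameter of the seminorms in which \<open>f\<close> is controlled there and \<open>Z m \<xi>\<close> the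
  resulting growth in the frequency; \<open>key\<close> says that \<open>n m\<close> integrations by parts make up for it.\<close>
locale cube_decomposition = tmib_conv M A beur \<iota> f for M A :: "nat \<Rightarrow> real" and beur and \<iota> :: "'e::banach \<Rightarrow> 'n::finite udist" and f +
  fixes \<theta> \<gamma> :: "'n testfun" and n :: "nat \<Rightarrow> nat" and Q l :: "nat \<Rightarrow> real" and Z :: "nat \<Rightarrow> real^'n \<Rightarrow> real" and \<kappa> lmin :: real
  assumes \<theta>: "\<theta> \<in> TS True M A" and \<gamma>: "\<gamma> \<in> TS True M A" and unit: "conv \<theta> \<gamma> 0 = 1"
    and A1: "\<And>m \<xi> \<gamma>' D. \<gamma>' \<in> TS True M A \<Longrightarrow> D > 0 \<Longrightarrow> (\<integral>y. cmod (\<gamma>' y) * wgt A (1 / l m) y \<partial>lborel) \<le> D \<Longrightarrow>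
       norm (R (conv (modul \<xi> \<theta>) (modul \<xi> \<gamma>'))) \<le> Z m \<xi> * D"
    and A2: "\<And>m \<xi> \<gamma>' D a. a \<in> T \<Longrightarrow> \<gamma>' \<in> TS True M A \<Longrightarrow> D > 0 \<Longrightarrow>
       (\<And>x. cmod (conv a (reflect (modul \<xi> \<gamma>')) x) \<le> D / wgt A (domK TYPE('n) * (2 / l m)) x) \<Longrightarrow>
       cmod (f (conv a (reflect (conv (modul \<xi> \<theta>) (modul \<xi> \<gamma>'))))) \<le> Z m \<xi> * D"
    and Z0: "\<And>m \<xi>. Z m \<xi> \<ge> 0"
    and key: "\<And>m \<xi>. \<xi> \<in> cube m \<Longrightarrow> (1 / \<bar>\<xi> $ dirn m\<bar>) ^ n m * M (n m) * Z m \<xi> \<le> \<kappa> * Q m ^ n m / rad TYPE('n) m ^ (2 * CARD('n))"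
    and n0: "\<And>m. maxc TYPE('n) m \<le> 1 \<Longrightarrow> n m = 0"
    and \<kappa>: "\<kappa> > 0" and Q: "\<And>m. Q m > 0" and lmin: "lmin > 0" "\<And>m. l m \<ge> lmin" and Qbdd: "\<exists>Qmax. \<forall>m. Q m \<le> Qmax"
    and adapt: "if beur then (\<forall>m. Q m = Q 0 \<and> l m = lmin) else (\<forall>L. finite {m. l m < L}) \<and> (\<forall>\<epsilon>>0. finite {m. Q m > \<epsilon>})"
begin

abbreviation G :: "nat \<Rightarrow> nat \<Rightarrow> 'n testfun" where "G m k \<equiv> pd (replicate k (dirn m)) \<gamma>"

text \<open>The integrand in front of the derivative of order n - k of the test function. The sign
  (-1)^n of the integrations by parts splits into this (-1)^k and the (-1)^(n-k) belonging to the
  distributional derivative.\<close>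

definition bb :: "nat \<Rightarrow> nat \<Rightarrow> real^'n \<Rightarrow> 'e" where
  "bb m k \<xi> = cs ((-1) ^ k * of_nat (n m choose k) / (2 * of_real pi * \<i> * of_real (\<xi> $ dirn m)) ^ n m) (R (conv (modul \<xi> \<theta>) (modul \<xi> (G m k))))"

definition p :: "nat \<Rightarrow> nat \<Rightarrow> 'e" where
  "p m k = integral (cube m) (bb m k)"

lemma GT: "G m k \<in> TS True M A"
  using \<gamma> by (rule TS_pd)

text \<open>Where the dominant coordinate may vanish, \<open>n0\<close> prescribes no integration by
  parts, so no division by zero occurs.\<close>

lemma component_nonzero: "(\<xi> :: real^'n) \<in> cube m \<Longrightarrow> n m > 0 \<Longrightarrow> \<xi> $ dirn m \<noteq> 0"
proof -
  assume \<xi>: "(\<xi> :: real^'n) \<in> cube m" and n: "n m > 0"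
  then have "maxc TYPE('n) m > 1" using n0[of m] by linarith
  from cube_component_ge[OF \<xi> this] rad_ge_1[of "TYPE('n)" m] show ?thesis by auto
qed

lemma continuous_bb: "continuous_on (cube m) (bb m k)"
proof -
  have "continuous_on (cube m) (\<lambda>\<xi>::real^'n. (2 * of_real pi * \<i> * complex_of_real (\<xi> $ dirn m)) ^ n m)"
    by (intro continuous_intros)
  moreover have "(2 * of_real pi * \<i> * complex_of_real (\<xi> $ dirn m)) ^ n m \<noteq> 0" if "\<xi> \<in> cube m" for \<xi> :: "real^'n"
    using component_nonzero[OF that] by (cases "n m = 0") auto
  ultimately show ?thesis unfolding bb_def
    by (intro continuous_cs continuous_R_modul \<theta> GT continuous_on_divide continuous_on_const) auto
qed

lemma bb_integrable: "bb m k integrable_on cube m"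
  using continuous_bb unfolding cube_def by (rule integrable_continuous)

lemma iota_p:
  assumes "\<phi> \<in> T"
  shows "\<iota> (p m k) \<phi> = integral (cube m) (\<lambda>\<xi>. \<iota> (bb m k \<xi>) \<phi>)" and "(\<lambda>\<xi>. \<iota> (bb m k \<xi>) \<phi>) integrable_on cube m"
  using integral_linear[OF bb_integrable bounded_linear_iota[OF assms]] integrable_linear[OF bb_integrable bounded_linear_iota[OF assms]]
  by (auto simp: p_def comp_def)

lemma coeff_bound:
  assumes "k \<le> n m"
  shows "cmod ((-1) ^ k * of_nat (n m choose k) / (2 * of_real pi * \<i> * of_real (\<xi> $ dirn m)) ^ n m) \<le> 2 ^ n m * (1 / \<bar>\<xi> $ dirn m\<bar>) ^ n m"
proof -
  have "real (n m choose k) \<le> 2 ^ n m"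
    using binomial_le_pow2[of "n m" k] by (metis of_nat_le_iff of_nat_numeral of_nat_power)
  moreover have "1 / (2 * pi * \<bar>\<xi> $ dirn m\<bar>) ^ n m \<le> (1 / \<bar>\<xi> $ dirn m\<bar>) ^ n m"
  proof (cases "\<xi> $ dirn m = 0")
    case False
    have "\<bar>\<xi> $ dirn m\<bar> \<le> 2 * pi * \<bar>\<xi> $ dirn m\<bar>" using pi_gt3 by (simp add: mult_le_cancel_right1)
    then have "1 / (2 * pi * \<bar>\<xi> $ dirn m\<bar>) \<le> 1 / \<bar>\<xi> $ dirn m\<bar>" using False pi_gt_zero by (intro divide_left_mono) auto
    then have "(1 / (2 * pi * \<bar>\<xi> $ dirn m\<bar>)) ^ n m \<le> (1 / \<bar>\<xi> $ dirn m\<bar>) ^ n m" by (intro power_mono) auto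
    then show ?thesis by (simp add: power_one_over)
  qed (auto simp: power_0_left)
  ultimately have "real (n m choose k) * (1 / (2 * pi * \<bar>\<xi> $ dirn m\<bar>) ^ n m) \<le> 2 ^ n m * (1 / \<bar>\<xi> $ dirn m\<bar>) ^ n m"
    by (intro mult_mono) auto
  then show ?thesis by (simp add: norm_mult norm_divide norm_power)
qed

text \<open>The common mechanism of the two estimates: a bound with \<open>k\<close> derivatives on \<open>\<gamma>\<close> and
  \<open>n - k\<close> derivatives left over is paid for by the division by the \<open>n\<close>-th power of the frequency.\<close>
lemma frequency_gain:
  assumes k: "k \<le> n m" and \<xi>: "\<xi> \<in> cube m" and x: "x \<le> Z m \<xi> * (c * (h ^ k * M k))" and ch: "c \<ge> 0" "h \<ge> 0"
  shows "2 ^ n m * (1 / \<bar>\<xi> $ dirn m\<bar>) ^ n m * x \<le> (\<kappa> * c * M 0) * ((2 * Q m) ^ n m * h ^ k / M (n m - k)) * decay TYPE('n) m"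
proof -
  let ?n = "n m"
  have "2 ^ ?n * (1 / \<bar>\<xi> $ dirn m\<bar>) ^ ?n * x \<le> 2 ^ ?n * (1 / \<bar>\<xi> $ dirn m\<bar>) ^ ?n * (Z m \<xi> * (c * (h ^ k * M k)))"
    using x by (intro mult_left_mono) auto
  also have "\<dots> = ((1 / \<bar>\<xi> $ dirn m\<bar>) ^ ?n * M ?n * Z m \<xi>) * (2 ^ ?n * c * h ^ k * (M k / M ?n))" by simp
  also have "\<dots> \<le> (\<kappa> * Q m ^ ?n / rad TYPE('n) m ^ (2 * CARD('n))) * (2 ^ ?n * c * h ^ k * (M k / M ?n))"
    using key[OF \<xi>] ch by (intro mult_right_mono) auto
  also have "\<dots> \<le> (\<kappa> * Q m ^ ?n / rad TYPE('n) m ^ (2 * CARD('n))) * (2 ^ ?n * c * h ^ k * (M 0 / M (?n - k)))"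
  proof -
    have "M k / M ?n \<le> M 0 / M (?n - k)"
      using M.mult_le[of k "?n - k"] k M.pos[of ?n] M.pos[of "?n - k"] by (simp add: field_simps)
    then show ?thesis using ch \<kappa> Q[of m] rad_ge_1[of "TYPE('n)" m] by (intro mult_left_mono mult_nonneg_nonneg divide_nonneg_nonneg) auto
  qed
  finally show ?thesis by (simp add: power_mult_distrib mult_ac)
qed

text \<open>\<open>\<gamma>\<close> is of Beurling type, so the growth rate \<open>h\<close> in the
  number of derivatives and the weight \<open>s\<close> are both free; the two later uses choose
  them differently.\<close>

lemma G_weighted:
  assumes h: "h > 0" and s: "s > 0"
  obtains c where "c > 0" "\<And>m k. (\<integral>y. cmod (G m k y) * wgt A s y \<partial>lborel) \<le> c * (h ^ k * M k)"
proof -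
  define t where "t = domK TYPE('n) * s"
  have t: "t > 0" using s domK(1)[of "TYPE('n)"] by (simp add: t_def)
  obtain C where C: "C > 0" "gs_le M A h t C \<gamma>" using TS_True_gs_le[OF \<gamma> h t] by blast
  define J where "J = (\<integral>x. wgt A s x / wgt A t (x::real^'n) \<partial>lborel)"
  have J: "J \<ge> 0" unfolding J_def by (intro integral_nonneg_AE) auto
  have "(\<integral>y. cmod (G m k y) * wgt A s y \<partial>lborel) \<le> (C * (J + 1)) * (h ^ k * M k)" for m k
  proof -
    have "(\<integral>y. cmod (G m k y) * wgt A s y \<partial>lborel) \<le> (C * (h ^ k * M k)) * J"
      unfolding J_def
      by (rule wgt_L1(2)[OF s _ TS_measurable[OF GT]])
        (use gs_le_pd_div[OF C(2) TS_smooth[OF \<gamma>], of "replicate k (dirn m)"] in \<open>auto simp: t_def\<close>)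
    also have "\<dots> \<le> (C * (h ^ k * M k)) * (J + 1)" using C h by (intro mult_left_mono) auto
    finally show ?thesis by (simp add: mult_ac)
  qed
  moreover have "C * (J + 1) > 0" using C J by (intro mult_pos_pos) auto
  ultimately show ?thesis using that by blast
qed

text \<open>The k derivatives on \<open>\<gamma>\<close> cost M_k, and dividing by the n-th power of
  the frequency gains 1/M_n; by (M.1) the quotient is at most M_0/M_(n-k). That is the weight
  required of a coefficient of order n - k.\<close>

lemma norm_p:
  assumes h: "h > 0"
  obtains c where "c > 0" "\<And>m k. k \<le> n m \<Longrightarrow> norm (p m k) \<le> c * ((2 * Q m) ^ n m * h ^ k / M (n m - k)) * decay TYPE('n) m"
proof -
  obtain c where c: "c > 0" "\<And>m k. (\<integral>y. cmod (G m k y) * wgt A (1 / lmin) y \<partial>lborel) \<le> c * (h ^ k * M k)"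
    using G_weighted[OF h, of "1 / lmin"] lmin(1) by auto
  have "norm (p m k) \<le> (\<kappa> * c * M 0) * ((2 * Q m) ^ n m * h ^ k / M (n m - k)) * decay TYPE('n) m" if k: "k \<le> n m" for m k
  proof -
    have l: "0 < 1 / l m" "1 / l m \<le> 1 / lmin" using lmin(1) lmin(2)[of m] by (auto intro!: divide_left_mono mult_pos_pos)
    have i1: "integrable lborel (\<lambda>y. cmod (G m k y) * wgt A (1 / l m) y)" by (rule TS_True_wgt_integrable[OF GT l(1)])
    have i2: "integrable lborel (\<lambda>y. cmod (G m k y) * wgt A (1 / lmin) y)" by (rule TS_True_wgt_integrable[OF GT]) (use lmin in simp)
    have "(\<integral>y. cmod (G m k y) * wgt A (1 / l m) y \<partial>lborel) \<le> (\<integral>y. cmod (G m k y) * wgt A (1 / lmin) y \<partial>lborel)"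
      using A.wgt_mono[OF _ l(2)] l(1) by (intro integral_mono_AE[OF i1 i2] AE_I2 mult_left_mono) auto
    then have w: "(\<integral>y. cmod (G m k y) * wgt A (1 / l m) y \<partial>lborel) \<le> c * (h ^ k * M k)" using c(2) by (rule order_trans)
    have D: "c * (h ^ k * M k) > 0" using c h M.pos by simp
    have "norm (bb m k \<xi>) \<le> (\<kappa> * c * M 0) * ((2 * Q m) ^ n m * h ^ k / M (n m - k)) * decay TYPE('n) m" if \<xi>: "\<xi> \<in> cube m" for \<xi>
    proof -
      have "norm (bb m k \<xi>) \<le> (2 ^ n m * (1 / \<bar>\<xi> $ dirn m\<bar>) ^ n m) * norm (R (conv (modul \<xi> \<theta>) (modul \<xi> (G m k))))"
        unfolding bb_def norm_cs using coeff_bound[OF k] by (intro mult_right_mono) auto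
      also have "\<dots> \<le> (\<kappa> * c * M 0) * ((2 * Q m) ^ n m * h ^ k / M (n m - k)) * decay TYPE('n) m"
        by (rule frequency_gain[OF k \<xi> A1[OF GT D w]]) (use c h in auto)
      finally show ?thesis .
    qed
    then have "norm (p m k) \<le> integral (cube m) (\<lambda>_::real^'n. (\<kappa> * c * M 0) * ((2 * Q m) ^ n m * h ^ k / M (n m - k)) * decay TYPE('n) m)"
      unfolding p_def by (intro integral_norm_bound_integral bb_integrable integrable_on_cube_const(1)) auto
    then show ?thesis unfolding integrable_on_cube_const(2) .
  qed
  moreover have "\<kappa> * c * M 0 > 0" using \<kappa> c M.pos by simp
  ultimately show ?thesis using that by blast
qed

lemma iota_R_conv:
  assumes "a \<in> T" "\<gamma>' \<in> TS True M A"
  shows "\<iota> (R (conv (modul \<xi> \<theta>) (modul \<xi> \<gamma>'))) a = f (conv a (reflect (conv (modul \<xi> \<theta>) (modul \<xi> \<gamma>'))))"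
  by (rule iota_R[OF TST_T[OF TS_conv[OF TS_modul[OF \<theta>] TS_modul[OF assms(2)]]] assms(1)])

text \<open>Here the functional \<open>f\<close> itself is used instead of the norm of the space, so that the growth
  in the frequency enters only once.\<close>
lemma pairing_bound_cell:
  assumes \<mu>: "\<mu> > 0" and \<rho>: "\<rho> > 0"
  obtains c where "c > 0" "\<And>m k \<phi> D. k \<le> n m \<Longrightarrow> domK TYPE('n) * (4 / l m) \<le> \<rho> \<Longrightarrow> \<phi> \<in> T \<Longrightarrow> D > 0 \<Longrightarrow> gs_le M A \<mu> \<rho> D \<phi> \<Longrightarrow>
     cmod (\<iota> (p m k) (pd (replicate (n m - k) (dirn m)) \<phi>)) \<le> c * D * (2 * Q m * \<mu>) ^ n m * decay TYPE('n) m"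
proof -
  define s where "s = domK TYPE('n) * (4 / lmin)"
  have K: "domK TYPE('n) \<ge> 1" by (rule domK)
  have s: "s > 0" using lmin(1) K by (simp add: s_def)
  obtain c where c: "c > 0" "\<And>m k. (\<integral>y. cmod (G m k y) * wgt A s y \<partial>lborel) \<le> c * (\<mu> ^ k * M k)"
    using G_weighted[OF \<mu> s] by blast
  have "cmod (\<iota> (p m k) (pd (replicate (n m - k) (dirn m)) \<phi>)) \<le> (\<kappa> * c * M 0) * D * (2 * Q m * \<mu>) ^ n m * decay TYPE('n) m"
    if k: "k \<le> n m" and l\<rho>: "domK TYPE('n) * (4 / l m) \<le> \<rho>" and \<phi>: "\<phi> \<in> T" and D: "D > 0" and g: "gs_le M A \<mu> \<rho> D \<phi>" for m k \<phi> D
  proof -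
    let ?pp = "n m - k"
    let ?a = "pd (replicate ?pp (dirn m)) \<phi>"
    \<comment> \<open>\<open>A2\<close> asks for decay of the convolution with weight
      \<open>t\<close>; since \<open>conv_wgt_bound\<close> halves the dilation, both factors are
      measured with \<open>2 * t\<close>.\<close>
    define t where "t = domK TYPE('n) * (2 / l m)"
    have lm: "l m > 0" using lmin(1) lmin(2)[of m] by linarith
    have t: "t > 0" using lm K by (simp add: t_def)
    have t\<rho>: "2 * t \<le> \<rho>" using l\<rho> by (simp add: t_def mult.commute)
    have ts: "2 * t \<le> s"
    proof -
      have "1 / l m \<le> 1 / lmin" using lmin(1) lmin(2)[of m] by (auto intro!: divide_left_mono mult_pos_pos)
      from mult_left_mono[OF this, of "4 * domK TYPE('n)"] show ?thesis using K by (simp add: t_def s_def mult.commute)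
    qed
    have aT: "?a \<in> T" using \<phi> by (rule TS_pd)
    define Da where "Da = D * (\<mu> ^ ?pp * M ?pp)"
    have Da: "Da > 0" using D \<mu> M.pos by (simp add: Da_def)
    have abd: "cmod (?a x) \<le> Da / wgt A (2 * t) x" for x
    proof -
      have "cmod (?a x) \<le> Da / wgt A \<rho> x"
        using gs_le_pd_div[OF g TS_smooth[OF \<phi>], of "replicate ?pp (dirn m)" x] by (simp add: Da_def)
      also have "\<dots> \<le> Da / wgt A (2 * t) x" using A.wgt_mono[OF _ t\<rho>] t Da by (intro divide_left_mono) auto
      finally show ?thesis .
    qed
    define D' where "D' = (D * (\<mu> ^ ?pp * M ?pp)) * (c * (\<mu> ^ k * M k))"
    have D': "D' > 0" using D \<mu> M.pos c by (simp add: D'_def)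
    have i1: "integrable lborel (\<lambda>y. cmod (G m k y) * wgt A (2 * t) y)" by (rule TS_True_wgt_integrable[OF GT]) (use t in simp)
    have i2: "integrable lborel (\<lambda>y. cmod (G m k y) * wgt A s y)" by (rule TS_True_wgt_integrable[OF GT s])
    have "(\<integral>y. cmod (G m k y) * wgt A (2 * t) y \<partial>lborel) \<le> (\<integral>y. cmod (G m k y) * wgt A s y \<partial>lborel)"
      using A.wgt_mono[OF _ ts] t by (intro integral_mono_AE[OF i1 i2] AE_I2 mult_left_mono) auto
    then have w: "(\<integral>y. cmod (G m k y) * wgt A (2 * t) y \<partial>lborel) \<le> c * (\<mu> ^ k * M k)" using c(2) by (rule order_trans)
    have cb: "cmod (conv ?a (reflect (modul \<xi> (G m k))) x) \<le> D' / wgt A (domK TYPE('n) * (2 / l m)) x" for \<xi> x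
    proof -
      have rT: "reflect (modul \<xi> (G m k)) \<in> TS True M A" using GT by (intro TS_reflect TS_modul)
      have "cmod (conv ?a (reflect (modul \<xi> (G m k))) x) * wgt A t x \<le> Da * (c * (\<mu> ^ k * M k))"
        by (rule conv_wgt_bound[OF TS_measurable[OF aT] abd])
          (use Da t w integrable_reflect_modul_wgt[OF i1] TS_measurable[OF rT] in \<open>auto simp: reflect_modul_integrable_wgt\<close>)
      then show ?thesis unfolding t_def[symmetric] by (subst pos_le_divide_eq) (simp_all add: D'_def Da_def)
    qed
    have "cmod (\<iota> (bb m k \<xi>) ?a) \<le> (\<kappa> * c * M 0) * D * (2 * Q m * \<mu>) ^ n m * decay TYPE('n) m" if \<xi>: "\<xi> \<in> cube m" for \<xi>
    proof -
      have "cmod (\<iota> (bb m k \<xi>) ?a) \<le> (2 ^ n m * (1 / \<bar>\<xi> $ dirn m\<bar>) ^ n m) * cmod (\<iota> (R (conv (modul \<xi> \<theta>) (modul \<xi> (G m k)))) ?a)"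
        unfolding bb_def cs[OF aT] norm_mult using coeff_bound[OF k] by (intro mult_right_mono) auto
      also have "\<dots> \<le> (\<kappa> * (D * (\<mu> ^ ?pp * M ?pp) * c) * M 0) * ((2 * Q m) ^ n m * \<mu> ^ k / M (n m - k)) * decay TYPE('n) m"
      proof (rule frequency_gain[OF k \<xi>])
        show "cmod (\<iota> (R (conv (modul \<xi> \<theta>) (modul \<xi> (G m k)))) ?a) \<le> Z m \<xi> * (D * (\<mu> ^ ?pp * M ?pp) * c * (\<mu> ^ k * M k))"
          using A2[OF aT GT D' cb] iota_R_conv[OF aT GT] by (simp add: D'_def mult_ac)
      qed (use D \<mu> c in auto)
      also have "\<dots> = (\<kappa> * c * M 0) * D * (2 * Q m) ^ n m * (\<mu> ^ ?pp * \<mu> ^ k) * decay TYPE('n) m" by simp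
      also have "\<mu> ^ ?pp * \<mu> ^ k = \<mu> ^ n m" using k by (simp flip: power_add)
      finally show ?thesis by (simp add: power_mult_distrib mult_ac)
    qed
    then have "cmod (\<iota> (p m k) ?a) \<le> integral (cube m) (\<lambda>_::real^'n. (\<kappa> * c * M 0) * D * (2 * Q m * \<mu>) ^ n m * decay TYPE('n) m)"
      unfolding iota_p(1)[OF aT] by (intro integral_norm_bound_integral iota_p(2)[OF aT] integrable_on_cube_const(1)) auto
    then show ?thesis unfolding integrable_on_cube_const(2) .
  qed
  moreover have "\<kappa> * c * M 0 > 0" using \<kappa> c M.pos by simp
  ultimately show ?thesis using that by blast
qed

text \<open>The reconstruction formula with \<open>\<eta> = conv \<theta> \<gamma>\<close>, whose
  value at 0 is 1, cut along the cubes. On each cube the integrand is rewritten by n integrations by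
  parts, the derivatives of \<open>\<eta>\<close> being put on \<open>\<gamma>\<close>.\<close>

lemma cell_sum:
  assumes \<phi>: "\<phi> \<in> T"
  shows "(\<lambda>m. \<Sum>k\<le>n m. (-1) ^ (n m - k) * \<iota> (p m k) (pd (replicate (n m - k) (dirn m)) \<phi>)) sums f \<phi>"
proof -
  define \<eta> where "\<eta> = conv \<theta> \<gamma>"
  have \<eta>: "\<eta> \<in> TS True M A" unfolding \<eta>_def using \<theta> \<gamma> by (rule TS_conv)
  let ?F = "\<lambda>\<xi>. f (conv \<phi> (reflect (modul \<xi> \<eta>)))"
  note rec = reconstruction[OF fUD \<phi> \<eta>]
  have "(\<lambda>m. integral (cube m) ?F) sums (f \<phi>)"
    using sums_cubes[OF rec(1)] rec(2) unit by (simp add: \<eta>_def)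
  moreover have "integral (cube m) ?F = (\<Sum>k\<le>n m. (-1) ^ (n m - k) * \<iota> (p m k) (pd (replicate (n m - k) (dirn m)) \<phi>))" for m
  proof -
    let ?n = "n m"
    have aT: "pd (replicate q (dirn m)) \<phi> \<in> T" for q using \<phi> by (rule TS_pd)
    have "?F \<xi> = (\<Sum>k\<le>?n. (-1) ^ (?n - k) * \<iota> (bb m k \<xi>) (pd (replicate (?n - k) (dirn m)) \<phi>))" if \<xi>: "\<xi> \<in> cube m" for \<xi>
    proof -
      let ?c = "2 * of_real pi * \<i> * of_real (\<xi> $ dirn m) :: complex"
      let ?a = "\<lambda>q k. conv (pd (replicate q (dirn m)) \<phi>) (reflect (modul \<xi> (pd (replicate k (dirn m)) \<eta>)))"
      have c0: "?c ^ ?n \<noteq> 0" using component_nonzero[OF \<xi>] by (cases "?n = 0") auto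
      have faT: "?a q k \<in> T" for q k by (rule TS_conv[OF aT TS_reflect[OF TS_modul[OF TS_pd[OF TST_T[OF \<eta>]]]]])
      have G\<eta>: "modul \<xi> (pd (replicate k (dirn m)) \<eta>) = conv (modul \<xi> \<theta>) (modul \<xi> (G m k))" for k
        unfolding \<eta>_def pd_conv_TS2[OF \<gamma> TS_integrable[OF \<theta>]] by (rule modul_conv)
      have fa: "f (?a q k) = \<iota> (R (conv (modul \<xi> \<theta>) (modul \<xi> (G m k)))) (pd (replicate q (dirn m)) \<phi>)" for q k
        unfolding G\<eta> using iota_R_conv[OF aT GT] by simp
      have a00: "conv \<phi> (reflect (modul \<xi> \<eta>)) \<in> T" using faT[of 0 0] by simp
      have "(\<lambda>x. ?c ^ ?n * ?a 0 0 x) = (\<lambda>x. \<Sum>k\<le>?n. ((-1) ^ ?n * of_nat (?n choose k)) * ?a (?n - k) k x)"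
        using integration_by_parts_modul[OF \<phi> \<eta>, of \<xi> "dirn m" ?n] by (auto simp: sum_distrib_left mult.assoc)
      then have "f (\<lambda>x. ?c ^ ?n * ?a 0 0 x) = f (\<lambda>x. \<Sum>k\<le>?n. ((-1) ^ ?n * of_nat (?n choose k)) * ?a (?n - k) k x)" by simp
      then have "?c ^ ?n * ?F \<xi> = (\<Sum>k\<le>?n. ((-1) ^ ?n * of_nat (?n choose k)) * f (?a (?n - k) k))"
        using UD_cmult[OF fUD a00, of "?c ^ ?n"] UD_sum[OF fUD, of "{..?n}" "\<lambda>k. ?a (?n - k) k" "\<lambda>k. (-1) ^ ?n * of_nat (?n choose k)"] faT by simp
      then have "?F \<xi> = (\<Sum>k\<le>?n. ((-1) ^ ?n * of_nat (?n choose k)) * f (?a (?n - k) k)) / ?c ^ ?n"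
        using c0 by (simp add: eq_divide_eq mult.commute)
      also have "\<dots> = (\<Sum>k\<le>?n. (-1) ^ (?n - k) * \<iota> (bb m k \<xi>) (pd (replicate (?n - k) (dirn m)) \<phi>))"
        unfolding sum_divide_distrib
      proof (rule sum.cong[OF refl])
        fix k assume "k \<in> {..?n}"
        then have "(-1::complex) ^ ?n = (-1) ^ (?n - k) * (-1) ^ k" by (simp flip: power_add)
        then show "(-1) ^ ?n * of_nat (?n choose k) * f (?a (?n - k) k) / ?c ^ ?n = (-1) ^ (?n - k) * \<iota> (bb m k \<xi>) (pd (replicate (?n - k) (dirn m)) \<phi>)"
          unfolding fa bb_def cs[OF aT] by simp
      qed
      finally show ?thesis .
    qed
    then have "integral (cube m) ?F = integral (cube m) (\<lambda>\<xi>. \<Sum>k\<le>?n. (-1) ^ (?n - k) * \<iota> (bb m k \<xi>) (pd (replicate (?n - k) (dirn m)) \<phi>))"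
      by (rule Henstock_Kurzweil_Integration.integral_cong)
    also have "\<dots> = (\<Sum>k\<le>?n. integral (cube m) (\<lambda>\<xi>. (-1) ^ (?n - k) * \<iota> (bb m k \<xi>) (pd (replicate (?n - k) (dirn m)) \<phi>)))"
      by (rule Henstock_Kurzweil_Integration.integral_sum) (auto intro!: integrable_on_mult_right iota_p(2)[OF aT])
    also have "\<dots> = (\<Sum>k\<le>?n. (-1) ^ (?n - k) * \<iota> (p m k) (pd (replicate (?n - k) (dirn m)) \<phi>))"
      by (rule sum.cong[OF refl]) (simp add: integral_mult_right iota_p(1)[OF aT])
    finally show ?thesis .
  qed
  ultimately show ?thesis by simp
qed

end

definition axial :: "'n \<Rightarrow> nat \<Rightarrow> 'n \<Rightarrow> nat" where
  "axial j q = (\<lambda>i. if i = j then q else 0)"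

lemma mlen_axial [simp]: "mlen (axial j q) = q"
  by (simp add: mlen_def axial_def)

lemma mderiv_axial: "smooth \<phi> \<Longrightarrow> mderiv (axial j q) \<phi> = pd (replicate q j) \<phi>"
proof (rule mderiv_eq_pd)
  show "count_list (replicate q j) i = axial j q i" for i by (induction q) (auto simp: axial_def)
qed

section \<open>Coefficients and convergence of the series of derivatives\<close>

context cube_decomposition
begin

text \<open>The contribution of the m-th cube to the coefficient at \<open>\<alpha>\<close>: only
  multiples of the unit vector in direction \<open>dirn m\<close> up to order \<open>n m\<close>
  occur. The zero multi-index lies on every axis and collects from all cubes.\<close>

definition X :: "nat \<Rightarrow> ('n \<Rightarrow> nat) \<Rightarrow> 'e" where
  "X m \<alpha> = (if \<alpha> = axial (dirn m) (mlen \<alpha>) \<and> mlen \<alpha> \<le> n m then p m (n m - mlen \<alpha>) else 0)"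

definition fa :: "('n \<Rightarrow> nat) \<Rightarrow> 'e" where
  "fa \<alpha> = (\<Sum>m. X m \<alpha>)"

lemma decay_pos [simp]: "decay TYPE('n) m > 0"
  using rad_ge_1[of "TYPE('n)" m] by simp

text \<open>With h = 1/(2 Qmax) in \<open>norm_p\<close>, the factor (2Q)^(n-q) h^(n-q) is at most
  1, and (2 Q tau)^q remains. It is at most 1 apart from finitely many cubes, whose contribution is
  put into \<open>B\<close>.\<close>

lemma norm_X:
  assumes \<tau>: "\<tau> > 0" and fin: "finite {m. 2 * Q m * \<tau> > 1}"
  obtains C where "C > 0" "\<And>m \<alpha>. \<tau> ^ mlen \<alpha> * M (mlen \<alpha>) * norm (X m \<alpha>) \<le> C * decay TYPE('n) m"
proof -
  obtain Qmax where Qm: "\<And>m. Q m \<le> Qmax" using Qbdd by blast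
  then have Qmax: "Qmax > 0" using Q[of 0] less_le_trans by blast
  obtain c where c: "c > 0" "\<And>m k. k \<le> n m \<Longrightarrow> norm (p m k) \<le> c * ((2 * Q m) ^ n m * (1 / (2 * Qmax)) ^ k / M (n m - k)) * decay TYPE('n) m"
    using norm_p[of "1 / (2 * Qmax)"] Qmax by auto
  define B where "B = 1 + (\<Sum>m | 2 * Q m * \<tau> > 1. (2 * Q m * \<tau>) ^ n m)"
  have Q\<tau>: "0 \<le> 2 * Q m * \<tau>" for m using Q[of m] \<tau> by simp
  have B1: "B \<ge> 1" unfolding B_def by (simp add: sum_nonneg Q\<tau>)
  have B: "(2 * Q m * \<tau>) ^ q \<le> B" if q: "q \<le> n m" for m q
  proof (cases "2 * Q m * \<tau> > 1")
    case True
    then have "(2 * Q m * \<tau>) ^ q \<le> (2 * Q m * \<tau>) ^ n m" using q by (intro power_increasing) auto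
    also have "\<dots> \<le> (\<Sum>m | 2 * Q m * \<tau> > 1. (2 * Q m * \<tau>) ^ n m)"
      using True by (intro member_le_sum fin) (auto simp: Q\<tau>)
    finally show ?thesis by (simp add: B_def)
  next
    case False
    then have "(2 * Q m * \<tau>) ^ q \<le> 1" by (intro power_le_one Q\<tau>) simp
    then show ?thesis using B1 by simp
  qed
  have key: "\<tau> ^ q * M q * norm (p m (n m - q)) \<le> c * B * decay TYPE('n) m" if q: "q \<le> n m" for m q
  proof -
    let ?k = "n m - q"
    have "\<tau> ^ q * M q * norm (p m ?k) \<le> \<tau> ^ q * M q * (c * ((2 * Q m) ^ n m * (1 / (2 * Qmax)) ^ ?k / M q) * decay TYPE('n) m)"
      using c(2)[of ?k m] q \<tau> M.pos[of q] by (intro mult_left_mono) auto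
    also have "\<dots> = c * (\<tau> ^ q * ((2 * Q m) ^ n m * (1 / (2 * Qmax)) ^ ?k)) * decay TYPE('n) m"
      using M.pos[of q] by simp
    also have "(2 * Q m) ^ n m = (2 * Q m) ^ q * (2 * Q m) ^ ?k" using q by (simp only: flip: power_add) simp
    also have "\<tau> ^ q * ((2 * Q m) ^ q * (2 * Q m) ^ ?k * (1 / (2 * Qmax)) ^ ?k) = (2 * Q m * \<tau>) ^ q * (2 * Q m * (1 / (2 * Qmax))) ^ ?k"
      by (simp only: power_mult_distrib mult_ac)
    also have "c * ((2 * Q m * \<tau>) ^ q * (2 * Q m * (1 / (2 * Qmax))) ^ ?k) * decay TYPE('n) m \<le> c * (B * 1) * decay TYPE('n) m"
    proof (intro mult_right_mono mult_left_mono mult_mono B q power_le_one)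
      show "2 * Q m * (1 / (2 * Qmax)) \<le> 1" using Qm[of m] Qmax by simp
      show "0 \<le> 2 * Q m * (1 / (2 * Qmax))" using Q[of m] Qmax by simp
      then show "0 \<le> (2 * Q m * (1 / (2 * Qmax))) ^ ?k" by (rule zero_le_power)
    qed (use B1 c decay_pos[of m] in \<open>auto simp: less_imp_le\<close>)
    finally show ?thesis by simp
  qed
  have "\<tau> ^ mlen \<alpha> * M (mlen \<alpha>) * norm (X m \<alpha>) \<le> c * B * decay TYPE('n) m" for m \<alpha>
  proof (cases "\<alpha> = axial (dirn m) (mlen \<alpha>) \<and> mlen \<alpha> \<le> n m")
    case True
    then show ?thesis unfolding X_def using key[of "mlen \<alpha>" m] by simp
  next
    case False
    then have "X m \<alpha> = 0" unfolding X_def by (rule if_not_P)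
    moreover have "0 \<le> c * B * decay TYPE('n) m" using c B1 decay_pos[of m] by (intro mult_nonneg_nonneg) auto
    ultimately show ?thesis by simp
  qed
  moreover have "c * B > 0" using c B1 by simp
  ultimately show ?thesis using that by blast
qed

lemma finite_large_Q:
  assumes "\<tau> > 0" "\<not> beur \<or> \<tau> \<le> 1 / (2 * Q 0)"
  shows "finite {m. 2 * Q m * \<tau> > 1}"
proof (cases beur)
  case True
  then have "Q m = Q 0" for m using adapt by simp
  moreover have "2 * Q 0 * \<tau> \<le> 1" using assms True Q[of 0] by (simp add: pos_le_divide_eq mult_ac)
  ultimately have "{m. 2 * Q m * \<tau> > 1} = {}" by (metis (mono_tags, lifting) Collect_empty_eq not_le)
  then show ?thesis by simp
next
  case False
  then have "finite {m. Q m > 1 / (2 * \<tau>)}" using adapt assms by simp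
  moreover have "{m. 2 * Q m * \<tau> > 1} = {m. Q m > 1 / (2 * \<tau>)}" using assms(1) by (auto simp: pos_divide_less_eq mult_ac)
  ultimately show ?thesis by simp
qed

lemma summable_X: "summable (\<lambda>m. norm (X m \<alpha>))"
proof -
  define \<tau> where "\<tau> = 1 / (2 * Q 0)"
  have \<tau>: "\<tau> > 0" using Q[of 0] by (simp add: \<tau>_def)
  have "finite {m. 2 * Q m * \<tau> > 1}" by (rule finite_large_Q[OF \<tau>]) (simp add: \<tau>_def)
  from norm_X[OF \<tau> this]
  obtain C where "C > 0" and C: "\<And>m \<alpha>. \<tau> ^ mlen \<alpha> * M (mlen \<alpha>) * norm (X m \<alpha>) \<le> C * decay TYPE('n) m" by blast
  have "norm (X m \<alpha>) \<le> C / (\<tau> ^ mlen \<alpha> * M (mlen \<alpha>)) * decay TYPE('n) m" for m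
    using C[of \<alpha> m] \<tau> M.pos[of "mlen \<alpha>"] by (simp only: times_divide_eq_left pos_le_divide_eq mult_pos_pos zero_less_power) (simp add: mult_ac)
  then show ?thesis
    by (intro summable_comparison_test[OF _ summable_mult[OF summable_rad[where 'n = 'n], of "C / (\<tau> ^ mlen \<alpha> * M (mlen \<alpha>))"]]) (auto intro!: exI[of _ 0])
qed

text \<open>Here the two quantifiers over the radius arise: in the Beurling case \<open>Q\<close> is
  constant and limits \<open>\<tau>\<close>, in the Roumieu case it tends to 0 and every
  \<open>\<tau>\<close> is allowed.\<close>

lemma fa_bound:
  assumes \<tau>: "\<tau> > 0" "\<not> beur \<or> \<tau> \<le> 1 / (2 * Q 0)"
  shows "\<exists>C. \<forall>\<alpha>. \<tau> ^ mlen \<alpha> * M (mlen \<alpha>) * norm (fa \<alpha>) \<le> C"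
proof -
  obtain C where C: "C > 0" "\<And>m \<alpha>. \<tau> ^ mlen \<alpha> * M (mlen \<alpha>) * norm (X m \<alpha>) \<le> C * decay TYPE('n) m"
    using norm_X[OF \<tau>(1) finite_large_Q[OF \<tau>]] by blast
  have "\<tau> ^ mlen \<alpha> * M (mlen \<alpha>) * norm (fa \<alpha>) \<le> (\<Sum>m. C * decay TYPE('n) m)" for \<alpha>
  proof -
    have "\<tau> ^ mlen \<alpha> * M (mlen \<alpha>) * norm (fa \<alpha>) \<le> \<tau> ^ mlen \<alpha> * M (mlen \<alpha>) * (\<Sum>m. norm (X m \<alpha>))"
      unfolding fa_def using \<tau> M.pos[of "mlen \<alpha>"] by (intro mult_left_mono summable_norm summable_X) auto
    also have "\<dots> = (\<Sum>m. \<tau> ^ mlen \<alpha> * M (mlen \<alpha>) * norm (X m \<alpha>))"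
      by (rule suminf_mult[symmetric, OF summable_X])
    also have "\<dots> \<le> (\<Sum>m. C * decay TYPE('n) m)"
      by (intro suminf_le C(2) summable_mult summable_X summable_rad)
    finally show ?thesis .
  qed
  then show ?thesis by blast
qed

text \<open>Away from a finite set of cubes \<open>pairing_bound_cell\<close> applies with 4 Q mu at
  most 1. A Beurling-bounded set admits the \<open>\<mu>\<close> and \<open>\<rho>\<close> for which
  the exceptional set is empty; a Roumieu-bounded set dictates them, and then \<open>Q\<close>
  tending to 0 and \<open>l\<close> to infinity leave finitely many exceptions, bounded by
  continuity of \<open>\<iota>\<close>.\<close>

lemma pairing_bound:
  assumes B: "TS_bounded beur M A B"
  obtains C where "\<And>m \<phi>. \<phi> \<in> B \<Longrightarrow> (\<Sum>q\<le>n m. cmod (\<iota> (p m (n m - q)) (pd (replicate q (dirn m)) \<phi>))) \<le> C * decay TYPE('n) m"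
proof -
  let ?S = "\<lambda>m \<phi>. \<Sum>q\<le>n m. cmod (\<iota> (p m (n m - q)) (pd (replicate q (dirn m)) \<phi>))"
  have BT: "\<phi> \<in> T" if "\<phi> \<in> B" for \<phi> using B that by (auto simp: TS_bounded_def)
  have K: "domK TYPE('n) \<ge> 1" by (rule domK)
  obtain \<mu> \<rho> D where \<mu>: "\<mu> > 0" and \<rho>: "\<rho> > 0" and D: "D > 0" and g: "\<forall>\<phi>\<in>B. gs_le M A \<mu> \<rho> D \<phi>"
    and fin: "finite ({m. 4 * Q m * \<mu> > 1} \<union> {m. domK TYPE('n) * (4 / l m) > \<rho>})"
  proof (cases beur)
    case True
    define \<mu> \<rho> where "\<mu> = 1 / (4 * Q 0)" and "\<rho> = domK TYPE('n) * (4 / lmin)"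
    have pos: "\<mu> > 0" "\<rho> > 0" using Q[of 0] lmin(1) K by (auto simp: \<mu>_def \<rho>_def)
    have all: "\<forall>m. Q m = Q 0 \<and> l m = lmin" using adapt True by simp
    have "{m. 4 * Q m * \<mu> > 1} \<union> {m. domK TYPE('n) * (4 / l m) > \<rho>} = {}"
      unfolding all[rule_format, THEN conjunct2]
      by (subst all[rule_format, THEN conjunct1]) (use Q[of 0] in \<open>simp add: \<mu>_def \<rho>_def\<close>)
    then have fin: "finite ({m. 4 * Q m * \<mu> > 1} \<union> {m. domK TYPE('n) * (4 / l m) > \<rho>})" by simp
    have "\<exists>C>0. \<forall>\<phi>\<in>B. gs_le M A \<mu> \<rho> C \<phi>" using B[unfolded TS_bounded_iff] True pos by simp
    then obtain C where "C > 0" "\<forall>\<phi>\<in>B. gs_le M A \<mu> \<rho> C \<phi>" by blast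
    from that[OF pos this fin] show ?thesis .
  next
    case False
    obtain \<mu> \<rho> C where g: "\<mu> > 0" "\<rho> > 0" "C > 0" "\<forall>\<phi>\<in>B. gs_le M A \<mu> \<rho> C \<phi>"
      using B[unfolded TS_bounded_iff] False by auto
    have ad: "\<forall>L. finite {m. l m < L}" "\<forall>\<epsilon>>0. finite {m. Q m > \<epsilon>}" using adapt False by auto
    have lpos: "l m > 0" for m using lmin(1) lmin(2)[of m] by linarith
    have "{m. 4 * Q m * \<mu> > 1} = {m. Q m > 1 / (4 * \<mu>)}" using g(1) by (auto simp: pos_divide_less_eq mult_ac)
    moreover have "{m. domK TYPE('n) * (4 / l m) > \<rho>} = {m. l m < domK TYPE('n) * 4 / \<rho>}"
      using g(2) lpos by (auto simp: pos_less_divide_eq mult_ac)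
    ultimately have fin: "finite ({m. 4 * Q m * \<mu> > 1} \<union> {m. domK TYPE('n) * (4 / l m) > \<rho>})"
      using ad g(1) by simp
    from that[OF g fin] show ?thesis .
  qed
  let ?E = "{m. 4 * Q m * \<mu> > 1} \<union> {m. domK TYPE('n) * (4 / l m) > \<rho>}"
  obtain c where c: "c > 0" "\<And>m k \<phi> D. k \<le> n m \<Longrightarrow> domK TYPE('n) * (4 / l m) \<le> \<rho> \<Longrightarrow> \<phi> \<in> T \<Longrightarrow> D > 0 \<Longrightarrow> gs_le M A \<mu> \<rho> D \<phi> \<Longrightarrow>
     cmod (\<iota> (p m k) (pd (replicate (n m - k) (dirn m)) \<phi>)) \<le> c * D * (2 * Q m * \<mu>) ^ n m * decay TYPE('n) m"
    using pairing_bound_cell[OF \<mu> \<rho>] by blast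
  have reg: "?S m \<phi> \<le> c * D * decay TYPE('n) m" if m: "m \<notin> ?E" and \<phi>: "\<phi> \<in> B" for m \<phi>
  proof -
    have Q\<mu>: "0 \<le> 2 * Q m * \<mu>" "4 * Q m * \<mu> \<le> 1" "0 \<le> Q m" "0 \<le> \<mu>" using Q[of m] \<mu> m by auto
    have "?S m \<phi> \<le> (\<Sum>q\<le>n m. c * D * (2 * Q m * \<mu>) ^ n m * decay TYPE('n) m)"
    proof (rule sum_mono)
      fix q assume "q \<in> {..n m}"
      then show "cmod (\<iota> (p m (n m - q)) (pd (replicate q (dirn m)) \<phi>)) \<le> c * D * (2 * Q m * \<mu>) ^ n m * decay TYPE('n) m"
        using c(2)[of "n m - q" m \<phi> D] m BT[OF \<phi>] D g \<phi> by simp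
    qed
    also have "\<dots> = real (n m + 1) * (c * D * (2 * Q m * \<mu>) ^ n m * decay TYPE('n) m)" by simp
    \<comment> \<open>The number n + 1 of terms is estimated by 2^n, which explains 4 in place of 2
      in the smallness condition.\<close>
    also have "\<dots> \<le> 2 ^ n m * (c * D * (2 * Q m * \<mu>) ^ n m * decay TYPE('n) m)"
    proof (rule mult_right_mono)
      have "n m + 1 \<le> 2 ^ n m" using Suc_leI[OF less_exp[of "n m"]] by (simp only: Suc_eq_plus1)
      then show "real (n m + 1) \<le> 2 ^ n m" by (metis of_nat_le_iff of_nat_numeral of_nat_power)
    qed (use c D Q\<mu> decay_pos[of m] in \<open>intro mult_nonneg_nonneg zero_le_power, auto\<close>)
    also have "\<dots> = c * D * (4 * Q m * \<mu>) ^ n m * decay TYPE('n) m"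
    proof -
      have "(4 * Q m * \<mu>) ^ n m = 2 ^ n m * (2 * Q m * \<mu>) ^ n m" by (subst power_mult_distrib[symmetric]) (simp add: mult.assoc)
      then show ?thesis by (simp add: mult_ac)
    qed
    also have "\<dots> \<le> c * D * 1 * decay TYPE('n) m"
      using c D Q\<mu> Q[of m] \<mu> decay_pos[of m] by (intro mult_right_mono mult_left_mono power_le_one) (auto simp: less_imp_le)
    finally show ?thesis by simp
  qed
  have "\<exists>C. C \<ge> 0 \<and> (\<forall>\<phi>\<in>B. ?S m \<phi> \<le> C)" for m
  proof -
    have "\<exists>C. \<forall>\<phi>\<in>B. cmod (\<iota> (p m (n m - q)) (pd (replicate q (dirn m)) \<phi>)) \<le> C" for q
    proof -
      obtain C where "\<forall>e. \<forall>\<psi>\<in>pd (replicate q (dirn m)) ` B. cmod (\<iota> e \<psi>) \<le> C * norm e"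
        using iota_bounded[OF TS_bounded_pd[OF B]] by blast
      then show ?thesis by blast
    qed
    then obtain C where C: "\<And>q \<phi>. \<phi> \<in> B \<Longrightarrow> cmod (\<iota> (p m (n m - q)) (pd (replicate q (dirn m)) \<phi>)) \<le> C q" by metis
    have "?S m \<phi> \<le> \<bar>\<Sum>q\<le>n m. C q\<bar>" if "\<phi> \<in> B" for \<phi>
      using sum_mono[where K = "{..n m}", OF C[OF that]] by (rule order_trans[OF _ abs_ge_self])
    then show ?thesis by (intro exI[of _ "\<bar>\<Sum>q\<le>n m. C q\<bar>"]) auto
  qed
  then have "\<exists>C. \<forall>m. C m \<ge> 0 \<and> (\<forall>\<phi>\<in>B. ?S m \<phi> \<le> C m)" by (intro choice allI)
  then obtain C where C': "\<forall>m. C m \<ge> 0 \<and> (\<forall>\<phi>\<in>B. ?S m \<phi> \<le> C m)" by (elim exE)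
  have C: "C m \<ge> 0" "\<And>\<phi>. \<phi> \<in> B \<Longrightarrow> ?S m \<phi> \<le> C m" for m
    using C'[THEN spec, of m] by (rule conjunct1) (use C'[THEN spec, of m, THEN conjunct2] in \<open>rule bspec\<close>)
  \<comment> \<open>Dividing by the positive \<open>decay\<close> of each exceptional cube lets one
    constant serve all cubes.\<close>
  let ?C = "c * D + (\<Sum>m\<in>?E. C m / decay TYPE('n) m)"
  have nn: "C m / decay TYPE('n) m \<ge> 0" for m using C(1) decay_pos[of m] by (intro divide_nonneg_pos) auto
  have "?S m \<phi> \<le> ?C * decay TYPE('n) m" if \<phi>: "\<phi> \<in> B" for m \<phi>
  proof (cases "m \<in> ?E")
    case True
    have "?S m \<phi> \<le> (C m / decay TYPE('n) m) * decay TYPE('n) m" using C(2)[of \<phi> m] \<phi> decay_pos[of m] rad_ge_1[of "TYPE('n)" m] by simp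
    also have "\<dots> \<le> ?C * decay TYPE('n) m"
    proof (rule mult_right_mono)
      have "C m / decay TYPE('n) m \<le> (\<Sum>m\<in>?E. C m / decay TYPE('n) m)"
        by (rule member_le_sum[OF True nn fin])
      then show "C m / decay TYPE('n) m \<le> ?C" using mult_pos_pos[OF c(1) D] by linarith
    qed (use decay_pos[of m] in simp)
    finally show ?thesis .
  next
    case False
    have "c * D * decay TYPE('n) m \<le> ?C * decay TYPE('n) m"
      using sum_nonneg[of ?E "\<lambda>m. C m / decay TYPE('n) m"] nn decay_pos[of m] by (intro mult_right_mono) auto
    then show ?thesis using reg[OF False \<phi>] by linarith
  qed
  then show ?thesis using that by blast
qed

text \<open>A finite index set containing \<open>F0\<close> exhausts all terms of the cubes m <
  \<open>M0\<close>. The remaining error consists of parts of the later cubes, whose absolute sums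
  are dominated by the tail of a convergent series, uniformly on the bounded set.\<close>

lemma ud_sums_fa: "ud_sums beur M A (\<lambda>\<alpha>. ud_deriv \<alpha> (\<iota> (fa \<alpha>))) f"
  unfolding ud_sums_def
proof (intro allI impI)
  fix B :: "'n testfun set" and \<epsilon> :: real assume B: "TS_bounded beur M A B" and \<epsilon>: "\<epsilon> > 0"
  obtain C where C: "\<And>m \<phi>. \<phi> \<in> B \<Longrightarrow> (\<Sum>q\<le>n m. cmod (\<iota> (p m (n m - q)) (pd (replicate q (dirn m)) \<phi>))) \<le> C * decay TYPE('n) m"
    using pairing_bound[OF B] by blast
  have sC: "summable (\<lambda>m. C * decay TYPE('n) m)" by (intro summable_mult summable_rad)
  obtain M0 where M0: "\<And>N. N \<ge> M0 \<Longrightarrow> norm (\<Sum>i. C * decay TYPE('n) (i + N)) < \<epsilon>"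
    using suminf_exist_split[OF \<epsilon> sC] by blast
  define F0 where "F0 = (\<Union>m<M0. (axial (dirn m) ` {..n m} :: ('n \<Rightarrow> nat) set))"
  have "finite F0" by (simp add: F0_def)
  moreover have "\<forall>\<phi>\<in>B. cmod (f \<phi> - (\<Sum>\<alpha>\<in>F. ud_deriv \<alpha> (\<iota> (fa \<alpha>)) \<phi>)) \<le> \<epsilon>" if F: "finite F" "F0 \<subseteq> F" for F
  proof
    fix \<phi> assume \<phi>B: "\<phi> \<in> B"
    then have \<phi>: "\<phi> \<in> T" using B by (auto simp: TS_bounded_def)
    let ?t = "\<lambda>m q. (-1) ^ q * \<iota> (p m (n m - q)) (pd (replicate q (dirn m)) \<phi>)"
    let ?Y = "\<lambda>m. \<Sum>q | q \<le> n m \<and> axial (dirn m) q \<in> F. ?t m q"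
    have "?Y sums (\<Sum>\<alpha>\<in>F. ud_deriv \<alpha> (\<iota> (fa \<alpha>)) \<phi>)"
    proof -
      \<comment> \<open>The partial sum over \<open>F\<close> is rewritten as a series over the
        cubes, so that it can be subtracted from \<open>cell_sum\<close> cube by cube.\<close>
      have "(\<lambda>m. (-1) ^ mlen \<alpha> * \<iota> (X m \<alpha>) (mderiv \<alpha> \<phi>)) sums ud_deriv \<alpha> (\<iota> (fa \<alpha>)) \<phi>" for \<alpha>
      proof -
        have "(\<lambda>m. X m \<alpha>) sums fa \<alpha>" unfolding fa_def by (rule summable_sums[OF summable_norm_cancel[OF summable_X]])
        from sums_mult[OF bounded_linear.sums[OF bounded_linear_iota[OF mderiv_TS[OF \<phi>]] this]] show ?thesis
          by (simp add: ud_deriv_def)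
      qed
      then have "(\<lambda>m. \<Sum>\<alpha>\<in>F. (-1) ^ mlen \<alpha> * \<iota> (X m \<alpha>) (mderiv \<alpha> \<phi>)) sums (\<Sum>\<alpha>\<in>F. ud_deriv \<alpha> (\<iota> (fa \<alpha>)) \<phi>)"
        by (rule sums_sum)
      moreover have "(\<Sum>\<alpha>\<in>F. (-1) ^ mlen \<alpha> * \<iota> (X m \<alpha>) (mderiv \<alpha> \<phi>)) = ?Y m" for m
      proof -
        have i0: "\<iota> 0 \<psi> = 0" if "\<psi> \<in> T" for \<psi> using bounded_linear_iota[OF that] by (rule linear_simps(3))
        have "(\<Sum>\<alpha>\<in>F. (-1) ^ mlen \<alpha> * \<iota> (X m \<alpha>) (mderiv \<alpha> \<phi>)) = (\<Sum>\<alpha>\<in>axial (dirn m) ` {q. q \<le> n m \<and> axial (dirn m) q \<in> F}. (-1) ^ mlen \<alpha> * \<iota> (X m \<alpha>) (mderiv \<alpha> \<phi>))"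
        proof (rule sum.mono_neutral_right[OF F(1)])
          show "axial (dirn m) ` {q. q \<le> n m \<and> axial (dirn m) q \<in> F} \<subseteq> F" by auto
          show "\<forall>\<alpha>\<in>F - axial (dirn m) ` {q. q \<le> n m \<and> axial (dirn m) q \<in> F}. (-1) ^ mlen \<alpha> * \<iota> (X m \<alpha>) (mderiv \<alpha> \<phi>) = 0"
          proof
            fix \<alpha> assume a: "\<alpha> \<in> F - axial (dirn m) ` {q. q \<le> n m \<and> axial (dirn m) q \<in> F}"
            have "\<not> (\<alpha> = axial (dirn m) (mlen \<alpha>) \<and> mlen \<alpha> \<le> n m)"
            proof
              assume h: "\<alpha> = axial (dirn m) (mlen \<alpha>) \<and> mlen \<alpha> \<le> n m"
              then have "mlen \<alpha> \<in> {q. q \<le> n m \<and> axial (dirn m) q \<in> F}"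
                using a by (intro CollectI conjI) (simp, metis DiffD1)
              then have "axial (dirn m) (mlen \<alpha>) \<in> axial (dirn m) ` {q. q \<le> n m \<and> axial (dirn m) q \<in> F}" by (rule imageI)
              then have "\<alpha> \<in> axial (dirn m) ` {q. q \<le> n m \<and> axial (dirn m) q \<in> F}" by (subst h[THEN conjunct1])
              with a show False by blast
            qed
            then show "(-1) ^ mlen \<alpha> * \<iota> (X m \<alpha>) (mderiv \<alpha> \<phi>) = 0"
              using i0[OF mderiv_TS[OF \<phi>]] unfolding X_def by (subst if_not_P) simp_all
          qed
        qed
        also have "\<dots> = ?Y m"
          using mderiv_axial[OF TS_smooth[OF \<phi>]]
          by (subst sum.reindex) (auto intro!: sum.cong inj_onI simp: X_def dest: arg_cong[of _ _ mlen])
        finally show ?thesis .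
      qed
      ultimately show ?thesis by simp
    qed
    moreover have "(\<lambda>m. \<Sum>q\<le>n m. ?t m q) sums f \<phi>"
    proof -
      have "(\<Sum>k\<le>n m. (-1) ^ (n m - k) * \<iota> (p m k) (pd (replicate (n m - k) (dirn m)) \<phi>)) = (\<Sum>q\<le>n m. ?t m q)" for m
        by (rule sum.reindex_bij_witness[of _ "\<lambda>q. n m - q" "\<lambda>q. n m - q"]) auto
      then show ?thesis using cell_sum[OF \<phi>] by simp
    qed
    ultimately have d: "(\<lambda>m. (\<Sum>q\<le>n m. ?t m q) - ?Y m) sums (f \<phi> - (\<Sum>\<alpha>\<in>F. ud_deriv \<alpha> (\<iota> (fa \<alpha>)) \<phi>))"
      by (intro sums_diff)
    have dY: "(\<Sum>q\<le>n m. ?t m q) - ?Y m = (\<Sum>q | q \<le> n m \<and> axial (dirn m) q \<notin> F. ?t m q)" for m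
    proof -
      have "(\<Sum>q\<le>n m. ?t m q) - ?Y m = sum (?t m) ({..n m} - {q. q \<le> n m \<and> axial (dirn m) q \<in> F})"
        by (subst sum_diff) auto
      also have "{..n m} - {q. q \<le> n m \<and> axial (dirn m) q \<in> F} = {q. q \<le> n m \<and> axial (dirn m) q \<notin> F}" by auto
      finally show ?thesis .
    qed
    have d0: "(\<Sum>q\<le>n m. ?t m q) - ?Y m = 0" if "m < M0" for m
    proof -
      have "{q. q \<le> n m \<and> axial (dirn m) q \<notin> F} = {}" using F(2) that by (auto simp: F0_def)
      then show ?thesis unfolding dY by (simp only: sum.empty)
    qed
    have dn: "norm ((\<Sum>q\<le>n m. ?t m q) - ?Y m) \<le> C * decay TYPE('n) m" for m
    proof -
      have "norm ((\<Sum>q\<le>n m. ?t m q) - ?Y m) \<le> (\<Sum>q | q \<le> n m \<and> axial (dirn m) q \<notin> F. norm (?t m q))"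
        unfolding dY by (rule norm_sum)
      also have "\<dots> \<le> (\<Sum>q\<le>n m. norm (?t m q))" by (rule sum_mono2) auto
      also have "\<dots> \<le> C * decay TYPE('n) m" using C[OF \<phi>B, of m] by (simp add: norm_mult norm_power)
      finally show ?thesis .
    qed
    have "(\<lambda>i. (\<Sum>q\<le>n (i + M0). ?t (i + M0) q) - ?Y (i + M0)) sums (f \<phi> - (\<Sum>\<alpha>\<in>F. ud_deriv \<alpha> (\<iota> (fa \<alpha>)) \<phi>))"
      unfolding sums_iff_shift[of "\<lambda>m. (\<Sum>q\<le>n m. ?t m q) - ?Y m"] using d d0 by simp
    then have eq: "f \<phi> - (\<Sum>\<alpha>\<in>F. ud_deriv \<alpha> (\<iota> (fa \<alpha>)) \<phi>) = (\<Sum>i. (\<Sum>q\<le>n (i + M0). ?t (i + M0) q) - ?Y (i + M0))"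
      by (rule sums_unique)
    have "cmod (f \<phi> - (\<Sum>\<alpha>\<in>F. ud_deriv \<alpha> (\<iota> (fa \<alpha>)) \<phi>)) \<le> (\<Sum>i. C * decay TYPE('n) (i + M0))"
      unfolding eq by (intro norm_suminf_le dn) (use summable_ignore_initial_segment[OF sC, of M0] in simp)
    also have "\<dots> \<le> \<epsilon>" using M0[OF order_refl] by simp
    finally show "cmod (f \<phi> - (\<Sum>\<alpha>\<in>F. ud_deriv \<alpha> (\<iota> (fa \<alpha>)) \<phi>)) \<le> \<epsilon>" .
  qed
  ultimately show "\<forall>\<^sub>F F in finite_subsets_at_top UNIV. \<forall>\<phi>\<in>B. cmod (f \<phi> - (\<Sum>\<alpha>\<in>F. ud_deriv \<alpha> (\<iota> (fa \<alpha>)) \<phi>)) \<le> \<epsilon>"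
    unfolding eventually_finite_subsets_at_top by blast
qed

end

section \<open>Choice of the parameters\<close>

context tmib_conv
begin

definition fbd :: "real \<Rightarrow> bool" where
  "fbd l \<longleftrightarrow> (\<exists>C>0. \<forall>\<phi>\<in>T. \<forall>D. gs_le M A l (1 / l) D \<phi> \<longrightarrow> cmod (f \<phi>) \<le> C * D)"

lemma fbd_mono:
  assumes "fbd l'" "0 < l" "l \<le> l'"
  shows "fbd l"
proof -
  obtain C where C: "C > 0" "\<forall>\<phi>\<in>T. \<forall>D. gs_le M A l' (1 / l') D \<phi> \<longrightarrow> cmod (f \<phi>) \<le> C * D"
    using assms(1) unfolding fbd_def by (elim exE conjE)
  have "1 / l' \<le> 1 / l" using assms by (intro divide_left_mono) auto
  then have g: "gs_le M A l' (1 / l') D \<phi>" if "gs_le M A l (1 / l) D \<phi>" for D \<phi>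
    using assms by (intro gs_le_mono[OF that]) auto
  show ?thesis unfolding fbd_def using C(1) C(2)[rule_format, OF _ g] by blast
qed

text \<open>In the Beurling case both bounds hold for one small \<open>l\<close>, used on every
  cube. In the Roumieu case they hold for all \<open>l\<close>, and a sequence tending to infinity
  eventually reaches the seminorms of any bounded set.\<close>

lemma step_sizes:
  "\<exists>lmin lam. (lmin::real) > 0 \<and> (\<forall>N::nat. lam N \<ge> lmin \<and> ubd (lam N) \<and> fbd (lam N)) \<and>
    (if beur then (\<forall>N. lam N = lmin) else (\<forall>N. lam N = real N + 1))"
proof (cases beur)
  case True
  with uniform_bound have "\<exists>l0>0. \<forall>l>0. l \<le> l0 \<longrightarrow> ubd l" by (simp only: if_True)
  then obtain l1 where l1: "l1 > 0" "\<forall>l>0. l \<le> l1 \<longrightarrow> ubd l" by (elim exE conjE)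
  have "\<exists>l>0. fbd l" unfolding fbd_def using UD_bound[OF fUD] True by (simp only: if_True)
  then obtain l2 where l2: "l2 > 0" "fbd l2" by (elim exE conjE)
  let ?l = "min l1 l2"
  have "ubd ?l" "fbd ?l" "?l > 0" using l1 l2 by (auto intro: fbd_mono[OF l2(2)])
  then show ?thesis using True by (intro exI[of _ ?l] exI[of _ "\<lambda>_. ?l"]) simp
next
  case False
  with uniform_bound have u: "\<forall>l>0. ubd l" by (simp only: if_False)
  have "\<forall>l>0. fbd l" unfolding fbd_def using UD_bound[OF fUD] False by (simp only: if_False)
  with u show ?thesis using False by (intro exI[of _ 1] exI[of _ "\<lambda>N. real N + 1"]) simp
qed

text \<open>In the first bound \<open>modul \<xi> \<theta>\<close> is the factor measured by a
  seminorm. In the second the convolution is regrouped so that all derivatives fall on it as well,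
  and the rest is used only through its decay.\<close>

lemma frequency_bounds:
  assumes l: "l > 0" "ubd l" "fbd l" and \<theta>: "\<theta> \<in> TS True M A"
  obtains CC where "CC > 0"
    "\<And>\<xi> \<gamma>' D. \<gamma>' \<in> TS True M A \<Longrightarrow> D > 0 \<Longrightarrow> (\<integral>y. cmod (\<gamma>' y) * wgt A (1 / l) y \<partial>lborel) \<le> D \<Longrightarrow>
       norm (R (conv (modul \<xi> \<theta>) (modul \<xi> \<gamma>'))) \<le> CC * exp (assoc_fun M (4 * pi * norm \<xi> / l)) * D"
    "\<And>\<xi> \<gamma>' D a. a \<in> T \<Longrightarrow> \<gamma>' \<in> TS True M A \<Longrightarrow> D > 0 \<Longrightarrow>
       (\<And>x. cmod (conv a (reflect (modul \<xi> \<gamma>')) x) \<le> D / wgt A (domK TYPE('n) * (2 / l)) x) \<Longrightarrow>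
       cmod (f (conv a (reflect (conv (modul \<xi> \<theta>) (modul \<xi> \<gamma>'))))) \<le> CC * exp (assoc_fun M (4 * pi * norm \<xi> / l)) * D"
proof -
  let ?E = "\<lambda>\<xi>::real^'n. exp (assoc_fun M (4 * pi * norm \<xi> / l))"
  obtain C1 where C1: "C1 > 0" "\<forall>\<phi>\<in>TS True M A. \<forall>\<psi>\<in>TS True M A. \<forall>P>0. \<forall>D>0. gs_le M A l (1 / l) P \<phi> \<longrightarrow>
      (\<integral>y. cmod (\<psi> y) * wgt A (1 / l) y \<partial>lborel) \<le> D \<longrightarrow> norm (R (conv \<phi> \<psi>)) \<le> C1 * P * D"
    using l(2) unfolding ubd_def by (elim exE conjE)
  obtain C2 where C2: "C2 > 0" "\<forall>\<phi>\<in>T. \<forall>D. gs_le M A l (1 / l) D \<phi> \<longrightarrow> cmod (f \<phi>) \<le> C2 * D"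
    using l(3) unfolding fbd_def by (elim exE conjE)
  \<comment> \<open>A modulation doubles \<open>l\<close> and a convolution halves the dilation of
    the weight, so \<open>\<theta>\<close> is measured with \<open>l / 2\<close> and
    \<open>2 / l\<close>. The halved \<open>l\<close> turns 2 pi |xi| into the 4 pi |xi| of the
    growth factor.\<close>
  have l2: "l / 2 > 0" "2 / l > 0" using l by auto
  obtain P where P: "P > 0" "gs_le M A (l / 2) (2 / l) P \<theta>" using TS_True_gs_le[OF \<theta> l2] by blast
  have m\<theta>: "gs_le M A l (2 * (1 / l)) (P * ?E \<xi>) (modul \<xi> \<theta>)" for \<xi>
    using gs_le_modul[OF TS_smooth[OF \<theta>] P(2) l2(1), of \<xi>] by (simp add: mult_ac)
  have PE: "P * ?E \<xi> > 0" for \<xi> using P by simp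
  have mT: "modul \<xi> g \<in> TS True M A" if "g \<in> TS True M A" for \<xi> and g :: "'n testfun" using that by (rule TS_modul)
  define J where "J = (\<integral>x. wgt A (2 * (1 / l)) x / wgt A (domK TYPE('n) * (2 / l)) (x::real^'n) \<partial>lborel)"
  have J: "J \<ge> 0" unfolding J_def by (intro integral_nonneg_AE) auto
  define CC where "CC = C1 * P + C2 * P * J"
  have CC: "CC > 0" "C1 * P \<le> CC" "C2 * P * J \<le> CC" using C1 C2 P J by (auto simp: CC_def intro!: add_pos_nonneg mult_nonneg_nonneg)
  show ?thesis
  proof (rule that[OF CC(1)])
    fix \<xi> :: "real^'n" and \<gamma>' :: "'n testfun" and D assume h: "\<gamma>' \<in> TS True M A" "(D::real) > 0" "(\<integral>y. cmod (\<gamma>' y) * wgt A (1 / l) y \<partial>lborel) \<le> D"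
    have "gs_le M A l (1 / l) (P * ?E \<xi>) (modul \<xi> \<theta>)" by (rule gs_le_mono[OF m\<theta>]) (use l in \<open>auto simp: divide_right_mono\<close>)
    moreover have "(\<integral>y. cmod (modul \<xi> \<gamma>' y) * wgt A (1 / l) y \<partial>lborel) \<le> D" using h by simp
    ultimately have "norm (R (conv (modul \<xi> \<theta>) (modul \<xi> \<gamma>'))) \<le> C1 * (P * ?E \<xi>) * D"
      by (rule C1(2)[rule_format, OF mT[OF \<theta>] mT[OF h(1)] PE h(2)])
    also have "\<dots> \<le> CC * ?E \<xi> * D"
      using mult_right_mono[OF CC(2), of "?E \<xi> * D"] h(2) by (simp add: mult_ac)
    finally show "norm (R (conv (modul \<xi> \<theta>) (modul \<xi> \<gamma>'))) \<le> CC * ?E \<xi> * D" .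
  next
    fix \<xi> :: "real^'n" and \<gamma>' a :: "'n testfun" and D assume h: "a \<in> T" "\<gamma>' \<in> TS True M A" "(D::real) > 0"
      "\<And>x. cmod (conv a (reflect (modul \<xi> \<gamma>')) x) \<le> D / wgt A (domK TYPE('n) * (2 / l)) x"
    let ?\<theta> = "reflect (modul \<xi> \<theta>)" and ?\<gamma> = "reflect (modul \<xi> \<gamma>')"
    have T: "?\<theta> \<in> T" "?\<gamma> \<in> T" using \<theta> h(2) by (auto intro!: TS_reflect TST_T mT)
    have cT: "conv a ?\<gamma> \<in> T" by (rule TS_conv[OF h(1) T(2)])
    have g: "gs_le M A l (1 / l) ((P * ?E \<xi>) * (D * J)) (conv ?\<theta> (conv a ?\<gamma>))"
    proof (rule gs_le_conv[OF T(1) gs_le_reflect[OF TS_smooth[OF mT[OF \<theta>]] m\<theta>]])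
      show "(\<integral>y. cmod (conv a ?\<gamma> y) * wgt A (2 * (1 / l)) y \<partial>lborel) \<le> D * J"
        unfolding J_def by (rule wgt_L1(2)[OF _ _ TS_measurable[OF cT] h(4)]) (use l in auto)
      show "integrable lborel (\<lambda>y. cmod (conv a ?\<gamma> y) * wgt A (2 * (1 / l)) y)"
        by (rule wgt_L1(1)[OF _ _ TS_measurable[OF cT] h(4)]) (use l in auto)
    qed (use l TS_measurable[OF cT] in auto)
    have "conv a (reflect (conv (modul \<xi> \<theta>) (modul \<xi> \<gamma>'))) = conv ?\<theta> (conv a ?\<gamma>)"
      unfolding reflect_conv conv_assoc[OF h(1) T(2,1), symmetric] conv_commute[of ?\<theta> ?\<gamma>] by (rule conv_commute)
    then have "cmod (f (conv a (reflect (conv (modul \<xi> \<theta>) (modul \<xi> \<gamma>'))))) \<le> C2 * ((P * ?E \<xi>) * (D * J))"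
      using C2(2)[rule_format, OF TS_conv[OF T(1) cT] g] by simp
    also have "\<dots> \<le> CC * ?E \<xi> * D"
      using mult_right_mono[OF CC(3), of "?E \<xi> * D"] h(3) by (simp add: mult_ac)
    finally show "cmod (f (conv a (reflect (conv (modul \<xi> \<theta>) (modul \<xi> \<gamma>'))))) \<le> CC * ?E \<xi> * D" .
  qed
qed

theorem ud_sums_of_inE_conv:
  assumes nt: "\<exists>\<phi>::'n testfun \<in> TS True M A. \<phi> \<noteq> (\<lambda>_. 0)"
  shows "\<exists>fa :: ('n \<Rightarrow> nat) \<Rightarrow> 'e. ud_sums beur M A (\<lambda>\<alpha>. ud_deriv \<alpha> (\<iota> (fa \<alpha>))) f \<and>
            (if beur then (\<exists>l>0. \<exists>C. \<forall>\<alpha>. l ^ mlen \<alpha> * M (mlen \<alpha>) * norm (fa \<alpha>) \<le> C)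
             else (\<forall>l>0. \<exists>C. \<forall>\<alpha>. l ^ mlen \<alpha> * M (mlen \<alpha>) * norm (fa \<alpha>) \<le> C))"
proof -
  obtain \<theta> \<gamma> :: "'n testfun" where \<theta>: "\<theta> \<in> TS True M A" and \<gamma>: "\<gamma> \<in> TS True M A" and unit: "conv \<theta> \<gamma> 0 = 1"
    using exists_factorized_unit[OF nt] by blast
  obtain lam :: "nat \<Rightarrow> real" and lmin where lmin0: "lmin > 0" and lamN: "\<forall>N. lam N \<ge> lmin \<and> ubd (lam N) \<and> fbd (lam N)"
    and lam: "if beur then (\<forall>N. lam N = lmin) else (\<forall>N. lam N = real N + 1)"
    using step_sizes by (elim exE conjE)
  note lmin = lmin0 lamN[THEN spec, THEN conjunct1]
  note lb = lamN[THEN spec, THEN conjunct2, THEN conjunct1] lamN[THEN spec, THEN conjunct2, THEN conjunct2]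
  have lam0: "lam N > 0" for N using lmin(1) lmin(2)[of N] by linarith
  let ?d = "real CARD('n)" and ?w = "assoc_fun M"
  have d1: "?d \<ge> 1" by (simp add: Suc_leI)
  define bds where "bds = (\<lambda>N CC. CC > 0 \<and>
    (\<forall>\<xi> \<gamma>' D. \<gamma>' \<in> TS True M A \<longrightarrow> D > 0 \<longrightarrow> (\<integral>y. cmod (\<gamma>' y) * wgt A (1 / lam N) y \<partial>lborel) \<le> D \<longrightarrow>
       norm (R (conv (modul \<xi> \<theta>) (modul \<xi> \<gamma>'))) \<le> CC * exp (?w (4 * pi * norm \<xi> / lam N)) * D) \<and>
    (\<forall>\<xi> \<gamma>' D a. a \<in> T \<longrightarrow> \<gamma>' \<in> TS True M A \<longrightarrow> D > 0 \<longrightarrow>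
       (\<forall>x. cmod (conv a (reflect (modul \<xi> \<gamma>')) x) \<le> D / wgt A (domK TYPE('n) * (2 / lam N)) x) \<longrightarrow>
       cmod (f (conv a (reflect (conv (modul \<xi> \<theta>) (modul \<xi> \<gamma>'))))) \<le> CC * exp (?w (4 * pi * norm \<xi> / lam N)) * D))"
  have "\<exists>CC. bds N CC" for N
    unfolding bds_def by (rule frequency_bounds[OF lam0 lb \<theta>, of N]) blast
  then obtain CC where CC: "\<And>N. bds N (CC N)" by metis
  have CC0: "CC N > 0" for N using CC[of N] unfolding bds_def by (rule conjunct1)
  \<comment> \<open>2d powers of the radius make the series over the cubes converge; one more is
    spent on the factor \<open>rad\<close> left by \<open>slow_choice\<close>.\<close>
  let ?e = "2 * CARD('n) + 1"
  obtain K Ca where K: "K \<ge> 1" and Ca: "Ca > 0" "\<And>t. t \<ge> 0 \<Longrightarrow> (1 + t) ^ ?e * exp (?w t) \<le> Ca * exp (?w (K * t))"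
    using M.exp_assoc_absorb[of ?e] by blast
  \<comment> \<open>Everything that depends on the step N: the constant of
    \<open>frequency_bounds\<close>, and \<open>lam N ^ ?e\<close>, the price of comparing the
    radius with the argument of \<open>assoc_fun\<close>.\<close>
  define C' where "C' = (\<lambda>N. CC N * (lam N ^ ?e * Ca))"
  obtain \<nu> \<kappa> where \<kappa>: "\<kappa> > 0" and \<nu>: "\<And>m. C' (\<nu> m) \<le> \<kappa> * rad TYPE('n) m" and \<nu>fin: "\<And>L. finite {m. \<nu> m < (L::nat)}"
    using slow_choice[of "rad TYPE('n)" C'] rad_ge_1 finite_rad_le[where 'n = 'n] by metis
  define l where "l = (\<lambda>m. lam (\<nu> m))"
  \<comment> \<open>12 pi d is 4 pi from the modulation times 3d from \<open>cube_norm_le\<close>;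
    \<open>K\<close> is the dilation that absorbs the powers of the radius.\<close>
  define Q where "Q = (\<lambda>m. K * (12 * pi * ?d) / l m)"
  define Z where "Z = (\<lambda>m (\<xi>::real^'n). CC (\<nu> m) * exp (?w (4 * pi * norm \<xi> / l m)))"
  \<comment> \<open>Away from the origin the term of order \<open>n m\<close> comes within a factor
    2 of the supremum at \<open>Q m * rad TYPE('n) m\<close>; near the origin there is no
    integration by parts.\<close>
  define n where "n = (\<lambda>m. if maxc TYPE('n) m \<le> 1 then 0 else
     (SOME p. exp (?w (Q m * rad TYPE('n) m)) \<le> 2 * ((Q m * rad TYPE('n) m) ^ p * M 0 / M p)))"
  define Qmax where "Qmax = K * (12 * pi * ?d) / lmin"
  have l0: "l m > 0" "l m \<ge> lmin" for m using lam0 lmin by (auto simp: l_def)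
  have c0: "K * (12 * pi * ?d) > 0" using K d1 by (intro mult_pos_pos) auto
  have Q0: "Q m > 0" "Q m \<le> Qmax" for m
    using c0 l0[of m] lmin(1) unfolding Q_def Qmax_def by (auto intro!: divide_pos_pos divide_left_mono mult_pos_pos)
  have r1: "rad TYPE('n) m \<ge> 1" for m by (rule rad_ge_1)
  have ZQ: "Z m \<xi> \<le> \<kappa> * exp (?w (Q m * rad TYPE('n) m)) / rad TYPE('n) m ^ (2 * CARD('n))" if \<xi>: "\<xi> \<in> cube m" for m \<xi>
  proof -
    let ?r = "rad TYPE('n) m"
    define t where "t = 12 * pi * ?d * ?r / l m"
    have t: "t \<ge> 0" using r1[of m] l0[of m] by (simp add: t_def)
    have "4 * pi * norm \<xi> \<le> 4 * pi * (3 * ?d * ?r)" using cube_norm_le[OF \<xi>] by (intro mult_left_mono) auto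
    then have "4 * pi * norm \<xi> / l m \<le> t" unfolding t_def using l0[of m] by (intro divide_right_mono) (auto simp: mult_ac)
    then have 1: "exp (?w (4 * pi * norm \<xi> / l m)) \<le> exp (?w t)" using l0[of m] by (auto intro!: M.assoc_mono)
    \<comment> \<open>Powers of the radius become powers of 1 + t, which \<open>Ca\<close> and
      \<open>K\<close> absorb into the associated function.\<close>
    have "?r \<le> l m * (1 + t)"
    proof -
      have "1 * 1 \<le> (12 * pi) * ?d" using pi_gt3 d1 by (intro mult_mono) auto
      then have "1 * ?r \<le> (12 * pi * ?d) * ?r" using r1[of m] by (intro mult_right_mono) auto
      also have "\<dots> = l m * t" using l0[of m] by (simp add: t_def)
      also have "\<dots> \<le> l m * (1 + t)" using l0[of m] by (intro mult_left_mono) auto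
      finally show ?thesis by simp
    qed
    then have "?r ^ ?e \<le> (l m * (1 + t)) ^ ?e" using r1[of m] by (intro power_mono) auto
    then have "?r ^ ?e * exp (?w t) \<le> (l m * (1 + t)) ^ ?e * exp (?w t)" by (intro mult_right_mono) auto
    also have "\<dots> = l m ^ ?e * ((1 + t) ^ ?e * exp (?w t))" by (simp only: power_mult_distrib mult.assoc)
    also have "\<dots> \<le> l m ^ ?e * (Ca * exp (?w (K * t)))" using Ca(2)[OF t] l0[of m] by (intro mult_left_mono) auto
    finally have 2: "?r ^ ?e * exp (?w t) \<le> l m ^ ?e * Ca * exp (?w (K * t))" by (simp only: mult.assoc)
    have Kt: "K * t = Q m * ?r" by (simp add: Q_def t_def)
    have "?r ^ ?e * Z m \<xi> \<le> CC (\<nu> m) * (?r ^ ?e * exp (?w t))"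
      using mult_left_mono[OF 1, of "CC (\<nu> m) * ?r ^ ?e"] CC0[of "\<nu> m"] r1[of m] by (simp add: Z_def mult_ac)
    also have "\<dots> \<le> CC (\<nu> m) * (l m ^ ?e * Ca * exp (?w (K * t)))" using 2 CC0[of "\<nu> m"] by (intro mult_left_mono) auto
    also have "\<dots> = C' (\<nu> m) * exp (?w (Q m * ?r))" unfolding Kt C'_def l_def by (simp only: mult_ac)
    also have "\<dots> \<le> \<kappa> * ?r * exp (?w (Q m * ?r))" using \<nu>[of m] by (intro mult_right_mono) auto
    finally have "?r * (?r ^ (2 * CARD('n)) * Z m \<xi>) \<le> ?r * (\<kappa> * exp (?w (Q m * ?r)))" by (simp add: mult_ac)
    then have "?r ^ (2 * CARD('n)) * Z m \<xi> \<le> \<kappa> * exp (?w (Q m * ?r))" using r1[of m] by (simp add: mult_le_cancel_left_pos)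
    moreover have "?r ^ (2 * CARD('n)) > 0" using r1[of m] by simp
    ultimately show ?thesis by (simp only: pos_le_divide_eq mult.commute)
  qed
  \<comment> \<open>The 2 is the loss in \<open>assoc_attained\<close>; \<open>exp (?w Qmax)\<close>
    covers the cubes near the origin, where the radius is 1 and \<open>n\<close> is 0.\<close>
  define \<kappa>' where "\<kappa>' = M 0 * \<kappa> * (2 + exp (?w Qmax))"
  have M\<kappa>: "M 0 * \<kappa> > 0" using M.pos[of 0] \<kappa> by simp
  have Z0: "Z m \<xi> \<ge> 0" for m \<xi> using CC0[of "\<nu> m"] by (simp add: Z_def)
  have key: "(1 / \<bar>\<xi> $ dirn m\<bar>) ^ n m * M (n m) * Z m \<xi> \<le> \<kappa>' * Q m ^ n m / rad TYPE('n) m ^ (2 * CARD('n))" if \<xi>: "\<xi> \<in> cube m" for m \<xi>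
  proof -
    let ?r = "rad TYPE('n) m" and ?x = "\<bar>\<xi> $ dirn m\<bar>" and ?n = "n m"
    have re: "?r ^ (2 * CARD('n)) > 0" using r1[of m] by simp
    show ?thesis
    proof (cases "maxc TYPE('n) m \<le> 1")
      case True
      then have n: "?n = 0" and r: "?r = 1" by (auto simp: n_def rad_def)
      have "?w (Q m) \<le> ?w Qmax" using Q0[of m] by (intro M.assoc_mono) auto
      then have "M 0 * \<kappa> * exp (?w (Q m)) \<le> \<kappa>'" unfolding \<kappa>'_def using M\<kappa> by (intro mult_left_mono) (auto intro: add_increasing)
      moreover have "M 0 * Z m \<xi> \<le> M 0 * (\<kappa> * exp (?w (Q m)))" using ZQ[OF \<xi>] M.pos[of 0] unfolding r by (intro mult_left_mono) auto
      ultimately show ?thesis unfolding n r by simp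
    next
      case False
      then have x: "?x \<ge> ?r" using cube_component_ge[OF \<xi>] by simp
      have "\<exists>p. exp (?w (Q m * ?r)) \<le> 2 * ((Q m * ?r) ^ p * M 0 / M p)"
        by (rule M.assoc_attained[of "Q m * ?r"]) (use Q0[of m] r1[of m] in auto)
      then have np: "exp (?w (Q m * ?r)) \<le> 2 * ((Q m * ?r) ^ ?n * M 0 / M ?n)"
        unfolding n_def if_not_P[OF False] by (rule someI_ex)
      \<comment> \<open>The powers of the radius cancel against the near-extremal term of the
        associated function, and M_n cancels its denominator; what survives is a multiple of Q^n
        times the summable factor.\<close>
      have "(1 / ?x) ^ ?n * M ?n * Z m \<xi> \<le> (1 / ?r) ^ ?n * M ?n * (\<kappa> * (2 * ((Q m * ?r) ^ ?n * M 0 / M ?n)) / ?r ^ (2 * CARD('n)))"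
      proof (rule mult_mono)
        show "(1 / ?x) ^ ?n * M ?n \<le> (1 / ?r) ^ ?n * M ?n"
          using x r1[of m] M.pos[of ?n] by (intro mult_right_mono power_mono divide_left_mono mult_pos_pos) auto
        show "Z m \<xi> \<le> \<kappa> * (2 * ((Q m * ?r) ^ ?n * M 0 / M ?n)) / ?r ^ (2 * CARD('n))"
          by (rule order_trans[OF ZQ[OF \<xi>]]) (use np \<kappa> re in \<open>intro divide_right_mono mult_left_mono, auto\<close>)
        show "0 \<le> (1 / ?r) ^ ?n * M ?n" using r1[of m] M.pos[of ?n] by simp
      qed (rule Z0)
      also have "\<dots> = M 0 * \<kappa> * 2 * (Q m ^ ?n / ?r ^ (2 * CARD('n)))"
        using r1[of m] M.pos[of ?n] by (simp add: power_mult_distrib power_divide)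
      also have "\<dots> \<le> \<kappa>' * (Q m ^ ?n / ?r ^ (2 * CARD('n)))"
        unfolding \<kappa>'_def using M\<kappa> Q0[of m] re by (intro mult_right_mono mult_left_mono) auto
      finally show ?thesis by simp
    qed
  qed
  have fin_l: "finite {m. l m < L}" if "\<not> beur" for L
  proof (rule finite_subset[OF _ \<nu>fin[of "nat \<lceil>L\<rceil>"]])
    have "l m = real (\<nu> m) + 1" for m using lam that by (simp add: l_def)
    then show "{m. l m < L} \<subseteq> {m. \<nu> m < nat \<lceil>L\<rceil>}" by (auto, linarith)
  qed
  have fin_Q: "finite {m. Q m > \<epsilon>}" if "\<not> beur" "\<epsilon> > 0" for \<epsilon>
  proof (rule finite_subset[OF _ fin_l[OF that(1)]])
    show "{m. Q m > \<epsilon>} \<subseteq> {m. l m < K * (12 * pi * ?d) / \<epsilon>}"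
      using l0(1) that(2) unfolding Q_def by (auto simp only: mem_Collect_eq pos_less_divide_eq subset_iff mult.commute)
  qed
  interpret cd: cube_decomposition M A beur \<iota> f \<theta> \<gamma> n Q l Z \<kappa>' lmin
  proof
    show "if beur then \<forall>m. Q m = Q 0 \<and> l m = lmin else (\<forall>L. finite {m. l m < L}) \<and> (\<forall>\<epsilon>>0. finite {m. \<epsilon> < Q m})"
    proof (cases beur)
      case True
      then have "l m = lmin" for m using lam by (simp add: l_def)
      then show ?thesis using True by (simp add: Q_def)
    next
      case False
      then show ?thesis using fin_l fin_Q by simp
    qed
    show "\<exists>Qmax. \<forall>m. Q m \<le> Qmax" using Q0(2) by blast
    show "\<kappa>' > 0" unfolding \<kappa>'_def by (rule mult_pos_pos[OF M\<kappa>]) (simp add: add_pos_pos)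
    show "norm (R (conv (modul \<xi> \<theta>) (modul \<xi> \<gamma>'))) \<le> Z m \<xi> * D"
      if "\<gamma>' \<in> TS True M A" "D > 0" "(\<integral>y. cmod (\<gamma>' y) * wgt A (1 / l m) y \<partial>lborel) \<le> D" for m \<xi> \<gamma>' D
      using CC[of "\<nu> m", unfolded bds_def, THEN conjunct2, THEN conjunct1, rule_format, OF that[unfolded l_def]] by (simp add: Z_def l_def)
    show "cmod (f (conv a (reflect (conv (modul \<xi> \<theta>) (modul \<xi> \<gamma>'))))) \<le> Z m \<xi> * D"
      if "a \<in> T" "\<gamma>' \<in> TS True M A" "D > 0" "\<And>x. cmod (conv a (reflect (modul \<xi> \<gamma>')) x) \<le> D / wgt A (domK TYPE('n) * (2 / l m)) x" for m \<xi> \<gamma>' D a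
      using CC[of "\<nu> m", unfolded bds_def, THEN conjunct2, THEN conjunct2, rule_format, OF that[unfolded l_def]] by (simp add: Z_def l_def)
    show "n m = 0" if "maxc TYPE('n) m \<le> 1" for m using that by (simp add: n_def)
  qed (fact \<theta> \<gamma> unit Z0 key Q0 lmin l0)+
  have "if beur then (\<exists>l>0. \<exists>C. \<forall>\<alpha>. l ^ mlen \<alpha> * M (mlen \<alpha>) * norm (cd.fa \<alpha>) \<le> C)
             else (\<forall>l>0. \<exists>C. \<forall>\<alpha>. l ^ mlen \<alpha> * M (mlen \<alpha>) * norm (cd.fa \<alpha>) \<le> C)"
  proof (cases beur)
    case True
    have pos: "1 / (2 * Q 0) > 0" using Q0(1)[of 0] by simp
    show ?thesis unfolding if_P[OF True] using pos cd.fa_bound[OF pos disjI2[OF order_refl]] by blast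
  next
    case False
    then show ?thesis unfolding if_not_P[OF False] using cd.fa_bound by blast
  qed
  with cd.ud_sums_fa show ?thesis by blast
qed

end

theorem theorem1p1:
  fixes beur :: bool and M A :: "nat \<Rightarrow> real"
    and \<iota> :: "'e::banach \<Rightarrow> 'n::finite udist" and f :: "'n udist"
  assumes "weight_seq M" "M1 M" "M2' M"
    and "weight_seq A" "M1 A" "M2' A"
    and "\<exists>\<phi>::'n testfun \<in> TS True M A. \<phi> \<noteq> (\<lambda>_. 0)"
    and "TMIB beur M A \<iota>"
    and "cond_G beur M A \<iota>"
    and "f \<in> UD beur M A"
  shows "(\<forall>\<phi>\<in>TS beur M A. \<exists>e. ud_eq beur M A (\<iota> e) (ud_conv f \<phi>)) \<longleftrightarrow>
         (\<exists>fa :: ('n \<Rightarrow> nat) \<Rightarrow> 'e.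
            ud_sums beur M A (\<lambda>\<alpha>. ud_deriv \<alpha> (\<iota> (fa \<alpha>))) f \<and>
            (if beur then (\<exists>l>0. \<exists>C. \<forall>\<alpha>. l ^ mlen \<alpha> * M (mlen \<alpha>) * norm (fa \<alpha>) \<le> C)
             else (\<forall>l>0. \<exists>C. \<forall>\<alpha>. l ^ mlen \<alpha> * M (mlen \<alpha>) * norm (fa \<alpha>) \<le> C)))"
proof -
  interpret tmib M A beur \<iota>
    by unfold_locales (use assms in auto)
  have E: "(\<exists>e. ud_eq beur M A (\<iota> e) u) \<longleftrightarrow> inE u" for u
    by (simp add: inE_def ud_eq_def)
  show ?thesis
    unfolding E
  proof
    assume h: "\<forall>\<phi>\<in>TS beur M A. inE (ud_conv f \<phi>)"
    interpret tmib_conv M A beur \<iota> f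
      by unfold_locales (use assms(10) h in auto)
    show "\<exists>fa :: ('n \<Rightarrow> nat) \<Rightarrow> 'e. ud_sums beur M A (\<lambda>\<alpha>. ud_deriv \<alpha> (\<iota> (fa \<alpha>))) f \<and>
            (if beur then (\<exists>l>0. \<exists>C. \<forall>\<alpha>. l ^ mlen \<alpha> * M (mlen \<alpha>) * norm (fa \<alpha>) \<le> C)
             else (\<forall>l>0. \<exists>C. \<forall>\<alpha>. l ^ mlen \<alpha> * M (mlen \<alpha>) * norm (fa \<alpha>) \<le> C))"
      by (rule ud_sums_of_inE_conv[OF assms(7)])
  qed (use inE_conv_of_ud_sums[OF assms(10)] in blast)
qed

end
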